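(* The global monodromy group $\bar H_{\gamma,\mathbf B}$ of the solution space $\mathrm{Ker}\,\bar R_{(1,0)}(t,\vartheta_t)$ is generated by $$h_\infty=\begin{pmatrix}0&0&\cdots&0&(-1)^{n+1}\\1&0&\cdots&0&-\mathcal A_{\bar\gamma-1}\\0&1&\cdots&0&-\mathcal A_{\bar\gamma-2}\\\vdots&\vdots&\ddots&\vdots&\vdots\\0&0&\cdots&1&-\mathcal A_1\end{pmatrix},\qquad(h_0)^{-1}=\begin{pmatrix}0&0&\cdots&0&-1\\1&0&\cdots&0&-\mathcal B_{\bar\gamma-1}\\0&1&\cdots&0&-\mathcal B_{\bar\gamma-2}\\\vdots&\vdots&\ddots&\vdots&\vdots\\0&0&\cdots&1&-\mathcal B_1\end{pmatrix}.$$ Here $h_0\in GL(\bar\gamma,\mathbb Z)$ (resp. $h_\infty\in GL(\bar\gamma,\mathbb Z)$) corresponds to the monodromy action around a loop turning anticlockwise around $t=0$ (resp. $t=\infty$). The monodromy action around the point $t=1$ is given by $h_1=(h_0h_\infty)^{-1}$.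
   Context: Let $n\ge 1$. Let $\alpha(1),\dots,\alpha(n+2)\in\mathbb Z^n$ with $\alpha(n+1)=0$, such that the convex hull $\Delta$ of $\alpha(1),\dots,\alpha(n+1)$ is an $n$-dimensional simplex and $\alpha(n+2)$ lies in its interior. Put $\gamma=n!\,\mathrm{vol}(\Delta)$ and, for $1\le q\le n+1$, $B_q=n!\,\mathrm{vol}$ of the convex hull of $\{\alpha(i)\}_{i=1}^{n+2}\setminus\{\alpha(q)\}$; these are positive integers with $\sum_{q=1}^{n+1}B_q=\gamma$, $\mathbf B=(B_1,\dots,B_{n+1})$. It is assumed that $\gcd(B_1,\dots,B_{n+1})=1$. Define the multisets $C^+=\{0,\frac1\gamma,\dots,\frac{\gamma-1}\gamma\}$, $C^-(1,0)=\{\frac j{B_q}:1\le q\le n+1,\ 0\le j\le B_q-1\}$ (with multiplicity), $C^0(1,0)=C^+\cap C^-(1,0)$ (multiset intersection), and $\bar\gamma=\sharp|C^+\setminus C^0(1,0)|=\sharp|C^-(1,0)\setminus C^0(1,0)|$. The operator is $$\bar R_{(1,0)}(t,\vartheta_t)=\prod_{\alpha^+\in C^+\setminus C^0(1,0)}(\vartheta_t+\alpha^+)-t\prod_{\alpha^-\in C^-(1,0)\setminus C^0(1,0)}(\vartheta_t+\alpha^-+1),\quad\vartheta_t=t\,\partial_t,$$ with singular points $t=0,1,\infty$. The integers $\mathcal A_i,\mathcal B_i$ are defined by $$\prod_{\alpha^-\in C^-(1,0)\setminus C^0(1,0)}(\mathsf t-e^{2\pi i\alpha^-})=\mathsf t^{\bar\gamma}+\mathcal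 A_1\mathsf t^{\bar\gamma-1}+\dots+\mathcal A_{\bar\gamma},\qquad\prod_{\alpha^+\in C^+\setminus C^0(1,0)}(\mathsf t-e^{2\pi i\alpha^+})=\mathsf t^{\bar\gamma}+\mathcal B_1\mathsf t^{\bar\gamma-1}+\dots+\mathcal B_{\bar\gamma},$$ and one has $\mathcal A_{\bar\gamma}=(-1)^n$, $\mathcal B_{\bar\gamma}=1$. Monodromy matrices are taken with respect to a suitable basis of the solution space. *)

theory Defs
  imports
    "HOL-Complex_Analysis.Complex_Analysis"
    "HOL-Algebra.Generated_Groups"
    "Jordan_Normal_Form.Matrix"
begin

hide_const (open) Matrix.vec Module.smult
no_notation vec_index (infixl \<open>$\<close> 100)

definition normalized_volume :: "(real ^ 'n::finite) set \<Rightarrow> real" where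
  "normalized_volume S = fact CARD('n) * measure lebesgue S"


section \<open>The exponents\<close>

definition C_plus :: "nat \<Rightarrow> real multiset" where
  "C_plus \<gamma> = image_mset (\<lambda>j. real j / real \<gamma>) (mset_set {0..<\<gamma>})"

definition C_minus :: "nat \<Rightarrow> (nat \<Rightarrow> nat) \<Rightarrow> real multiset" where
  "C_minus n B = (\<Sum>q\<in>{1..n+1}. image_mset (\<lambda>j. real j / real (B q)) (mset_set {0..<B q}))"

definition C_zero :: "nat \<Rightarrow> nat \<Rightarrow> (nat \<Rightarrow> nat) \<Rightarrow> real multiset" where
  "C_zero \<gamma> n B = C_plus \<gamma> \<inter># C_minus n B"

definition C_plus_red :: "nat \<Rightarrow> nat \<Rightarrow> (nat \<Rightarrow> nat) \<Rightarrow> real multiset" where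
  "C_plus_red \<gamma> n B = C_plus \<gamma> - C_zero \<gamma> n B"

definition C_minus_red :: "nat \<Rightarrow> nat \<Rightarrow> (nat \<Rightarrow> nat) \<Rightarrow> real multiset" where
  "C_minus_red \<gamma> n B = C_minus n B - C_zero \<gamma> n B"

definition gamma_bar :: "nat \<Rightarrow> nat \<Rightarrow> (nat \<Rightarrow> nat) \<Rightarrow> nat" where
  "gamma_bar \<gamma> n B = size (C_plus_red \<gamma> n B)"


section \<open>The differential operator and its local solutions\<close>

definition theta :: "(complex \<Rightarrow> complex) \<Rightarrow> complex \<Rightarrow> complex" where
  "theta f = (\<lambda>t. t * deriv f t)"

text \<open>Products of the commuting factors \<open>theta + a\<close> are formed as polynomials in one
  indeterminate, in which \<open>theta\<close> is then substituted.\<close>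

definition poly_theta :: "complex poly \<Rightarrow> (complex \<Rightarrow> complex) \<Rightarrow> complex \<Rightarrow> complex" where
  "poly_theta p f = (\<lambda>t. \<Sum>k\<le>degree p. Polynomial.coeff p k * (theta ^^ k) f t)"

definition R_bar ::
  "nat \<Rightarrow> nat \<Rightarrow> (nat \<Rightarrow> nat) \<Rightarrow> (complex \<Rightarrow> complex) \<Rightarrow> complex \<Rightarrow> complex" where
  "R_bar \<gamma> n B f = (\<lambda>t.
     poly_theta (\<Prod>a\<in>#C_plus_red \<gamma> n B. [:complex_of_real a, 1:]) f t
     - t * poly_theta (\<Prod>a\<in>#C_minus_red \<gamma> n B. [:complex_of_real a + 1, 1:]) f t)"

text \<open>Germs at a point \<open>z\<close> are represented by functions on the whole plane, of which only the
  values near \<open>z\<close> matter.\<close>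

definition germ_eq :: "complex \<Rightarrow> (complex \<Rightarrow> complex) \<Rightarrow> (complex \<Rightarrow> complex) \<Rightarrow> bool" where
  "germ_eq z f g \<longleftrightarrow> (\<forall>\<^sub>F w in nhds z. f w = g w)"

definition local_solution ::
  "((complex \<Rightarrow> complex) \<Rightarrow> complex \<Rightarrow> complex) \<Rightarrow> complex \<Rightarrow> (complex \<Rightarrow> complex) \<Rightarrow> bool" where
  "local_solution D z f \<longleftrightarrow> f analytic_on {z} \<and> germ_eq z (D f) (\<lambda>_. 0)"

definition lin_comb ::
  "nat \<Rightarrow> (nat \<Rightarrow> complex) \<Rightarrow> (nat \<Rightarrow> complex \<Rightarrow> complex) \<Rightarrow> complex \<Rightarrow> complex" where
  "lin_comb m c \<Phi> = (\<lambda>w. \<Sum>i<m. c i * \<Phi> i w)"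

text \<open>\<open>\<Phi> 0, \<dots>, \<Phi> (m-1)\<close> is a basis of the space of germs at \<open>z\<close> of solutions of \<open>D f = 0\<close>.\<close>

definition solution_basis ::
  "((complex \<Rightarrow> complex) \<Rightarrow> complex \<Rightarrow> complex) \<Rightarrow> complex \<Rightarrow> nat \<Rightarrow>
   (nat \<Rightarrow> complex \<Rightarrow> complex) \<Rightarrow> bool" where
  "solution_basis D z m \<Phi> \<longleftrightarrow>
     (\<forall>i<m. local_solution D z (\<Phi> i)) \<and>
     (\<forall>c. germ_eq z (lin_comb m c \<Phi>) (\<lambda>_. 0) \<longrightarrow> (\<forall>i<m. c i = 0)) \<and>
     (\<forall>f. local_solution D z f \<longrightarrow> (\<exists>c. germ_eq z f (lin_comb m c \<Phi>)))"


section \<open>Analytic continuation and monodromy\<close>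

text \<open>The germ of \<open>g\<close> at the end point of \<open>p\<close> is the analytic continuation along \<open>p\<close> of the germ
  of \<open>f\<close> at the start point.\<close>

definition continuation_along ::
  "(real \<Rightarrow> complex) \<Rightarrow> (complex \<Rightarrow> complex) \<Rightarrow> (complex \<Rightarrow> complex) \<Rightarrow> bool" where
  "continuation_along p f g \<longleftrightarrow>
     (\<exists>F. (\<forall>s\<in>{0..1}. F s analytic_on {p s}) \<and>
          (\<forall>s\<in>{0..1}. \<forall>\<^sub>F s' in at s within {0..1}. germ_eq (p s') (F s') (F s)) \<and>
          germ_eq (pathstart p) (F 0) f \<and> germ_eq (pathfinish p) (F 1) g)"

text \<open>Column \<open>j\<close> of \<open>M\<close> contains the coordinates of the continuation of \<open>\<Phi> j\<close> along the loop
  \<open>l\<close>; the matrix of \<open>l +++ l'\<close> is therefore the matrix of \<open>l'\<close> times that of \<open>l\<close>.\<close>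

definition is_monodromy_matrix ::
  "nat \<Rightarrow> (nat \<Rightarrow> complex \<Rightarrow> complex) \<Rightarrow> (real \<Rightarrow> complex) \<Rightarrow> complex mat \<Rightarrow> bool" where
  "is_monodromy_matrix m \<Phi> l M \<longleftrightarrow>
     M \<in> carrier_mat m m \<and>
     (\<forall>j<m. continuation_along l (\<Phi> j) (lin_comb m (\<lambda>i. M $$ (i, j)) \<Phi>))"

definition loop_at :: "complex \<Rightarrow> (real \<Rightarrow> complex) \<Rightarrow> bool" where
  "loop_at z l \<longleftrightarrow> path l \<and> path_image l \<subseteq> - {0, 1} \<and> pathstart l = z \<and> pathfinish l = z"

definition monodromy_group ::
  "complex \<Rightarrow> nat \<Rightarrow> (nat \<Rightarrow> complex \<Rightarrow> complex) \<Rightarrow> complex mat set" where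
  "monodromy_group z m \<Phi> = {M. \<exists>l. loop_at z l \<and> is_monodromy_matrix m \<Phi> l M}"

text \<open>Loops based at \<open>1/2\<close> turning once anticlockwise around \<open>0\<close>, \<open>1\<close> and \<open>\<infinity>\<close>. The last one
  runs clockwise along a circle enclosing \<open>0\<close> and \<open>1\<close>, i.e. anticlockwise in the coordinate
  \<open>1/t\<close>. In \<open>- {0, 1}\<close> the concatenation \<open>loop_0 +++ loop_1 +++ loop_inf\<close> is null-homotopic.\<close>

definition loop_0 :: "real \<Rightarrow> complex" where
  "loop_0 = part_circlepath 0 (1/2) 0 (2 * pi)"

definition loop_1 :: "real \<Rightarrow> complex" where
  "loop_1 = part_circlepath 1 (1/2) pi (3 * pi)"

definition loop_inf :: "real \<Rightarrow> complex" where
  "loop_inf = linepath (1/2) (2 * \<i>) +++ part_circlepath 0 2 (pi/2) (pi/2 - 2 * pi)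
     +++ linepath (2 * \<i>) (1/2)"

text \<open>Transport of a loop at the end point of \<open>\<tau>\<close> to its start point.\<close>

definition conj_loop :: "(real \<Rightarrow> complex) \<Rightarrow> (real \<Rightarrow> complex) \<Rightarrow> real \<Rightarrow> complex" where
  "conj_loop \<tau> l = \<tau> +++ l +++ reversepath \<tau>"


section \<open>The matrices\<close>

definition A_coeff :: "nat \<Rightarrow> nat \<Rightarrow> (nat \<Rightarrow> nat) \<Rightarrow> nat \<Rightarrow> complex" where
  "A_coeff \<gamma> n B i = Polynomial.coeff
     (\<Prod>a\<in>#C_minus_red \<gamma> n B. [:- exp (2 * of_real pi * \<i> * of_real a), 1:])
     (gamma_bar \<gamma> n B - i)"

definition B_coeff :: "nat \<Rightarrow> nat \<Rightarrow> (nat \<Rightarrow> nat) \<Rightarrow> nat \<Rightarrow> complex" where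
  "B_coeff \<gamma> n B i = Polynomial.coeff
     (\<Prod>a\<in>#C_plus_red \<gamma> n B. [:- exp (2 * of_real pi * \<i> * of_real a), 1:])
     (gamma_bar \<gamma> n B - i)"

text \<open>Ones below the diagonal, last column \<open>(a, - A (m-1), \<dots>, - A 1)\<close>; rows and columns are
  numbered from 0.\<close>

definition last_column_mat :: "nat \<Rightarrow> complex \<Rightarrow> (nat \<Rightarrow> complex) \<Rightarrow> complex mat" where
  "last_column_mat m a A = mat m m (\<lambda>(i, j).
     if j = m - 1 then (if i = 0 then a else - A (m - i))
     else if i = j + 1 then 1 else 0)"

definition GL :: "nat \<Rightarrow> complex mat monoid" where
  "GL m = units_of (ring_mat TYPE(complex) m ())"

definition GL_int :: "nat \<Rightarrow> complex mat set" where
  "GL_int m = map_mat complex_of_int ` Units (ring_mat TYPE(int) m ())"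

end

theory Submission
  imports Defs "Jordan_Normal_Form.Determinant"
begin

text \<open>The operator is \<open>p(theta) - t q(theta)\<close>, where \<open>p\<close> has the roots \<open>- a\<close> for the \<open>a\<close> in
  \<open>C_plus_red\<close>, and \<open>q\<close> the roots \<open>- a - 1\<close> for the \<open>a\<close> in \<open>C_minus_red\<close>: a hypergeometric
  operator, whose monodromy was determined by Levelt and by Beukers and Heckman. Three facts are
  combined.

  Local theory. The local exponents at \<open>0\<close> are the roots of \<open>p\<close>, those at \<open>\<infinity>\<close> the negatives of the
  roots of \<open>q\<close>. The Frobenius solutions, written as contour integrals over a circle around all
  exponents (\<open>frobenius_solutions\<close>), show that the monodromy matrices at \<open>0\<close> and \<open>\<infinity>\<close> are
  annihilated by \<open>\<Prod>(X - exp (2 \<pi> \<i> \<rho>))\<close>, where \<open>\<rho>\<close> runs over the exponents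
  (\<open>monodromy_0_annihilated\<close>, \<open>monodromy_inf_annihilated\<close>). At \<open>1\<close> there are \<open>m - 1\<close> independent
  holomorphic solutions, hence the monodromy fixes a hyperplane (\<open>monodromy_1_hyperplane\<close>). Local
  solutions, regular or holomorphic at \<open>1\<close>, come from Picard iteration on star-shaped sets
  (\<open>regular_singular_system\<close>).

  Global theory. The plane without \<open>0\<close> and \<open>1\<close> is covered by three charts, the plane slit along
  two of the three intervals into which \<open>0\<close> and \<open>1\<close> divide the real line. Bases of solutions on
  the charts can be chosen so that they agree above the real axis. Below it they differ by
  constant matrices, and these generate the monodromy group (\<open>monodromy_group_generated\<close>). The
  matrices of the three standard loops are read off directly.

  Algebra. Two matrices without common eigenvalue that agree on a hyperplane are simultaneously
  conjugate to the companion matrices of their annihilating polynomials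
  (\<open>simultaneous_companion\<close>). Here the two matrices are the inverse of the monodromy at \<open>0\<close> and
  the monodromy at \<open>\<infinity>\<close>. They have no common eigenvalue because \<open>C_plus_red\<close> and \<open>C_minus_red\<close> are
  disjoint.

  What remains is the arithmetic of the exponents. Subdividing the simplex from the interior point
  shows that the \<open>B q\<close> are positive with sum \<open>\<gamma>\<close> (\<open>exponent_data_of_simplex\<close>). It follows that the
  sums over \<open>C_plus_red\<close> and \<open>C_minus_red\<close> differ by \<open>n / 2\<close>. Therefore twice the exponent at \<open>1\<close>
  is an integer; as \<open>C_plus_red\<close> is moreover invariant under the reflection that sends \<open>x\<close> to
  \<open>1 - x\<close>, the constant terms of the two characteristic polynomials are \<open>1\<close> and \<open>(-1) ^ n\<close>. Both
  polynomials are quotients of products of the polynomials \<open>X ^ N - 1\<close> by the polynomial of the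
  common part, which is integral by inclusion and exclusion (\<open>int_coeffs_UN_fractions\<close>); so both
  are integral.\<close>

section \<open>Regular and regular singular systems on star-shaped domains\<close>

text \<open>Averages along the segment from \<open>a\<close>. Multiplication by \<open>z - a\<close> turns them into the solution
  operator of \<open>(z - a) y' + (N / 2) y = (z - a) g\<close> that vanishes at \<open>a\<close>: the variation of
  constants formula \<open>(z - a) powr (- N / 2) * \<integral> (w - a) powr (N / 2) * g w dw\<close>, after the
  substitution \<open>w = a + s\<^sup>2 (z - a)\<close>, which keeps half-integral exponents polynomial in \<open>s\<close>.\<close>

definition segment_mean :: "nat \<Rightarrow> complex \<Rightarrow> (complex \<Rightarrow> complex) \<Rightarrow> complex \<Rightarrow> complex" where
  "segment_mean N a g z =
     integral {0..1} (\<lambda>s::real. 2 * of_real s ^ (N + 1) * g (a + of_real (s^2) * (z - a)))"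

text \<open>The iteration integrates along segments issuing from \<open>a\<close>.\<close>

definition star_at :: "complex \<Rightarrow> complex set \<Rightarrow> bool" where
  "star_at a D \<longleftrightarrow> a \<in> D \<and> (\<forall>z\<in>D. \<forall>s\<in>{0..1}. a + of_real s * (z - a) \<in> D)"

lemma star_atD: "star_at a D \<Longrightarrow> z \<in> D \<Longrightarrow> 0 \<le> s \<Longrightarrow> s \<le> 1 \<Longrightarrow> a + of_real s * (z - a) \<in> D"
  by (auto simp: star_at_def)

lemma star_at_sq: "star_at a D \<Longrightarrow> z \<in> D \<Longrightarrow> s \<in> {0..1} \<Longrightarrow> a + (of_real s)\<^sup>2 * (z - a) \<in> D"
  using star_atD[of a D z "s^2"] by (simp add: power_le_one)

lemma segment_mean_integrable:
  fixes g :: "complex \<Rightarrow> complex"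
  assumes "star_at a D" "continuous_on D g" "z \<in> D"
  shows "(\<lambda>s::real. 2 * of_real s ^ (N + 1) * g (a + of_real (s^2) * (z - a))) integrable_on {0..1}"
  by (intro integrable_continuous_interval continuous_intros continuous_on_compose2[OF assms(2)])
     (use star_at_sq[OF assms(1) assms(3)] in auto)

lemma has_field_derivative_segment_mean:
  assumes "open D" "star_at a D" "g holomorphic_on D" "z \<in> D"
  shows "(segment_mean N a g has_field_derivative
      integral {0..1} (\<lambda>s::real. 2 * of_real s ^ (N + 3) * deriv g (a + of_real (s^2) * (z - a)))) (at z)"
proof -
  obtain e where e: "e > 0" "ball z e \<subseteq> D" using assms(1,4) openE by blast
  have g': "continuous_on D (deriv g)" using assms(1,3) by (simp add: holomorphic_deriv holomorphic_on_imp_continuous_on)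
  have gc: "continuous_on D g" using assms(3) holomorphic_on_imp_continuous_on by blast
  have st: "a + (of_real s)\<^sup>2 * (w - a) \<in> D" if "w \<in> ball z e" "s \<in> {0..1}" for w s
    using star_at_sq[OF assms(2)] that e by blast
  have "((\<lambda>w. integral (cbox 0 1) (\<lambda>s::real. 2 * of_real s ^ (N + 1) * g (a + of_real (s^2) * (w - a))))
      has_field_derivative
      integral (cbox 0 1) (\<lambda>s::real. 2 * of_real s ^ (N + 3) * deriv g (a + of_real (s^2) * (z - a)))) (at z within ball z e)"
  proof (rule leibniz_rule_field_derivative)
    fix w :: complex and s :: real assume w: "w \<in> ball z e" and s: "s \<in> cbox 0 1"
    have d: "(g has_field_derivative deriv g (a + (of_real s)\<^sup>2 * (w - a))) (at (a + (of_real s)\<^sup>2 * (w - a)))"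
      using st[OF w] s assms(1,3) by (auto intro: holomorphic_derivI)
    show "((\<lambda>w. 2 * of_real s ^ (N + 1) * g (a + of_real (s^2) * (w - a))) has_field_derivative
       2 * of_real s ^ (N + 3) * deriv g (a + of_real (s^2) * (w - a))) (at w within ball z e)"
    proof -
      have "((\<lambda>w. a + of_real (s^2) * (w - a)) has_field_derivative of_real (s^2)) (at w)"
        by (auto intro!: derivative_eq_intros)
      then have "((\<lambda>w. g (a + of_real (s^2) * (w - a))) has_field_derivative
          deriv g (a + of_real (s^2) * (w - a)) * of_real (s^2)) (at w)"
        by (intro DERIV_chain2[where f=g]) (use d in auto)
      from DERIV_cmult[OF this, of "2 * of_real s ^ (N + 1)"] show ?thesis
        by (simp add: has_field_derivative_at_within power_add power2_eq_square numeral_3_eq_3 mult_ac)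
    qed
  next
    fix w assume "w \<in> ball z e"
    then show "(\<lambda>s::real. 2 * of_real s ^ (N + 1) * g (a + of_real (s^2) * (w - a))) integrable_on cbox 0 1"
      using segment_mean_integrable[OF assms(2) gc] e by auto
  next
    show "continuous_on (ball z e \<times> cbox 0 1)
     (\<lambda>(w, s::real). 2 * of_real s ^ (N + 3) * deriv g (a + of_real (s^2) * (w - a)))"
    proof -
      have "continuous_on (ball z e \<times> {0..1}) (\<lambda>x. deriv g (a + of_real ((snd x)^2) * (fst x - a)))"
        by (rule continuous_on_compose2[OF g', of _ "\<lambda>x. a + of_real ((snd x)^2) * (fst x - a)"])
           (use st in \<open>auto intro!: continuous_intros\<close>)
      moreover have "continuous_on (ball z e \<times> {0..1}) (\<lambda>x. 2 * complex_of_real (snd x) ^ (N + 3))"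
        by (intro continuous_intros)
      ultimately show ?thesis
        unfolding case_prod_unfold cbox_interval by (rule continuous_on_mult[rotated])
    qed
  qed (use e in auto)
  moreover have "at z within ball z e = at z" using e(1) by (intro at_within_open) auto
  moreover have "segment_mean N a g =
      (\<lambda>w. integral (cbox 0 1) (\<lambda>s::real. 2 * of_real s ^ (N + 1) * g (a + of_real (s^2) * (w - a))))"
    by (rule ext) (simp only: segment_mean_def box_real)
  ultimately show ?thesis by (simp only: box_real)
qed

text \<open>Integration of \<open>d/ds (s ^ (N + 2) * g (a + s\<^sup>2 (z - a)))\<close> over \<open>{0..1}\<close>: the boundary term
  is \<open>g z\<close>, and the two terms of the integrand are a multiple of the mean and \<open>z - a\<close> times its
  derivative.\<close>

lemma segment_mean_ode:
  assumes "open D" "star_at a D" "g holomorphic_on D" "z \<in> D"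
  shows "segment_mean N a g z + (z - a) * deriv (segment_mean N a g) z
       + of_nat N / 2 * segment_mean N a g z = g z"
proof -
  let ?w = "\<lambda>s::real. a + of_real (s^2) * (z - a)"
  have gc: "continuous_on D g" using assms(3) holomorphic_on_imp_continuous_on by blast
  have g': "deriv g holomorphic_on D" "continuous_on D (deriv g)"
    using assms(1,3) by (simp_all add: holomorphic_deriv holomorphic_on_imp_continuous_on)
  have i1: "(\<lambda>s::real. 2 * of_real s ^ (N + 1) * g (?w s)) integrable_on {0..1}"
    by (rule segment_mean_integrable[OF assms(2) gc assms(4)])
  have i2: "(\<lambda>s::real. 2 * of_real s ^ (N + 3) * deriv g (?w s)) integrable_on {0..1}"
    using segment_mean_integrable[OF assms(2) g'(2) assms(4), of "N+2"] by (simp add: numeral_3_eq_3)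
  let ?F = "\<lambda>s::real. of_real s ^ (N + 2) * g (?w s)"
  have "((\<lambda>s::real. of_nat (N + 2) * of_real s ^ (N + 1) * g (?w s)
        + of_real s ^ (N + 2) * (deriv g (?w s) * (2 * of_real s * (z - a)))) has_integral (?F 1 - ?F 0)) {0..1}"
  proof (rule fundamental_theorem_of_calculus)
    fix s :: real assume s: "s \<in> {0..1}"
    have d: "(g has_field_derivative deriv g (?w s)) (at (?w s))"
      using star_at_sq[OF assms(2,4) s] assms(1,3) by (auto intro: holomorphic_derivI)
    have "((\<lambda>u. a + u^2 * (z - a)) has_field_derivative (2 * of_real s * (z - a))) (at (of_real s :: complex))"
      by (auto intro!: derivative_eq_intros)
    then have "((\<lambda>u. g (a + u^2 * (z - a))) has_field_derivative (deriv g (?w s) * (2 * of_real s * (z - a)))) (at (of_real s))"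
      by (intro DERIV_chain2[where f=g]) (use d in auto)
    moreover have "((\<lambda>u::complex. u ^ (N + 2)) has_field_derivative of_nat (N + 2) * of_real s ^ (N + 1)) (at (of_real s))"
      using DERIV_power[OF DERIV_ident, of "N + 2" "of_real s :: complex" UNIV] by (simp add: mult_ac)
    ultimately have "((\<lambda>u. u ^ (N + 2) * g (a + u^2 * (z - a))) has_field_derivative
        (of_nat (N + 2) * of_real s ^ (N + 1) * g (?w s)
        + of_real s ^ (N + 2) * (deriv g (?w s) * (2 * of_real s * (z - a))))) (at (of_real s))"
      by (rule DERIV_cong[OF DERIV_mult[rotated]]) (simp add: mult_ac add_ac)
    then show "((\<lambda>s::real. of_real s ^ (N + 2) * g (?w s)) has_vector_derivative
        (of_nat (N + 2) * of_real s ^ (N + 1) * g (?w s)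
        + of_real s ^ (N + 2) * (deriv g (?w s) * (2 * of_real s * (z - a))))) (at s within {0..1})"
      using has_vector_derivative_real_field[of "\<lambda>u. u ^ (N + 2) * g (a + u^2 * (z - a))" _ s "{0..1}"]
      by (simp add: o_def)
  qed simp
  then have "integral {0..1} (\<lambda>s::real. of_nat (N + 2) * of_real s ^ (N + 1) * g (?w s)
        + of_real s ^ (N + 2) * (deriv g (?w s) * (2 * of_real s * (z - a)))) = g z"
    by (auto dest: integral_unique)
  also have "(\<lambda>s::real. of_nat (N + 2) * of_real s ^ (N + 1) * g (?w s)
        + of_real s ^ (N + 2) * (deriv g (?w s) * (2 * of_real s * (z - a))))
     = (\<lambda>s::real. (of_nat (N + 2) / 2) * (2 * of_real s ^ (N + 1) * g (?w s))
          + (z - a) * (2 * of_real s ^ (N + 3) * deriv g (?w s)))"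
    by (auto simp: field_simps power_add numeral_3_eq_3 power2_eq_square)
  also have "integral {0..1} \<dots> = (of_nat (N + 2) / 2) * segment_mean N a g z
      + (z - a) * deriv (segment_mean N a g) z"
    unfolding segment_mean_def[of N a g z]
      DERIV_imp_deriv[OF has_field_derivative_segment_mean[OF assms]]
    by (rule integral_unique, intro has_integral_add has_integral_mult_right integrable_integral i1 i2)
  finally show ?thesis by (simp add: field_simps)
qed

text \<open>The estimate that makes the Picard iteration converge on the whole star and not only near
  \<open>a\<close>: each integration gains a factor \<open>1 / (n + 1)\<close>, so factorials appear in the denominators.\<close>

lemma norm_segment_mean_le:
  assumes "star_at a S" "continuous_on S g" "z \<in> S"
    and M: "\<And>w. w \<in> S \<Longrightarrow> norm (g w) \<le> M * norm (w - a) ^ n"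
  shows "norm (segment_mean N a g z) \<le> M * norm (z - a) ^ n / (n + 1)"
proof -
  have M0: "0 \<le> M * norm (z - a) ^ n" using M[OF assms(3)] norm_ge_zero order_trans by blast
  have "((\<lambda>s::real. s ^ (2*n+1)) has_integral (1 / (2 * (real n + 1)))) {0..1}"
  proof -
    have "((\<lambda>s::real. s ^ (2*n+1)) has_integral (1 ^ (2*n+2) / real (2*n+2) - 0 ^ (2*n+2) / real (2*n+2))) {0..1}"
    proof (rule fundamental_theorem_of_calculus)
      fix s :: real
      have "((\<lambda>s. s ^ (2*n+2) / real (2*n+2)) has_field_derivative (real (2*n+2) * s ^ (2*n+1) / real (2*n+2))) (at s within {0..1})"
        using DERIV_cdivide[OF DERIV_pow[of "2*n+2" s "{0..1}"], of "real (2*n+2)"] by simp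
      moreover have "real (2*n+2) * s ^ (2*n+1) / real (2*n+2) = s ^ (2*n+1)"
        by (rule nonzero_mult_div_cancel_left) linarith
      ultimately show "((\<lambda>s. s ^ (2*n+2) / real (2*n+2)) has_vector_derivative s ^ (2*n+1)) (at s within {0..1})"
        by (simp only: has_real_derivative_iff_has_vector_derivative)
    qed simp
    moreover have "1 ^ (2*n+2) / real (2*n+2) - 0 ^ (2*n+2) / real (2*n+2) = 1 / (2 * (real n + 1))"
      by (simp add: field_simps)
    ultimately show ?thesis by (simp only:)
  qed
  from has_integral_mult_left[OF this, of "2 * (M * norm (z - a) ^ n)"]
  have hi: "((\<lambda>s::real. 2 * s ^ (2*n+1) * (M * norm (z - a) ^ n)) has_integral
     (M * norm (z - a) ^ n / (n + 1))) {0..1}"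
    by (rule back_subst[of "\<lambda>F. (fst F has_integral snd F) {0..1}", unfolded fst_conv snd_conv, of "(_, _)" "(_, _)", unfolded fst_conv snd_conv])
       (simp add: field_simps)
  have "norm (segment_mean N a g z) \<le> integral {0..1} (\<lambda>s::real. 2 * s ^ (2*n+1) * (M * norm (z - a) ^ n))"
    unfolding segment_mean_def
  proof (rule integral_norm_bound_integral)
    show "(\<lambda>s::real. 2 * of_real s ^ (N + 1) * g (a + of_real (s^2) * (z - a))) integrable_on {0..1}"
      by (rule segment_mean_integrable[OF assms(1-3)])
    show "(\<lambda>s::real. 2 * s ^ (2*n+1) * (M * norm (z - a) ^ n)) integrable_on {0..1}"
      using hi by blast
    fix s :: real assume s: "s \<in> {0..1}"
    have "norm (g (a + of_real (s^2) * (z - a))) \<le> M * norm (of_real (s^2) * (z - a)) ^ n"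
      using M[OF star_at_sq[OF assms(1,3) s]] by simp
    also have "\<dots> = s ^ (2*n) * (M * norm (z - a) ^ n)"
      using s by (simp add: norm_mult power_mult_distrib norm_power power_mult)
    finally have 1: "norm (g (a + of_real (s^2) * (z - a))) \<le> s ^ (2*n) * (M * norm (z - a) ^ n)" .
    have 2: "s ^ (N + 1) \<le> s" using s power_decreasing[of 1 "N+1" s] by simp
    have "norm (2 * of_real s ^ (N + 1) * g (a + of_real (s^2) * (z - a)))
       = (2 * s ^ (N+1)) * norm (g (a + of_real (s^2) * (z - a)))"
      using s by (simp add: norm_mult norm_power)
    also have "\<dots> \<le> (2 * s) * (s ^ (2*n) * (M * norm (z - a) ^ n))"
      by (rule mult_mono) (use 1 2 s M0 in auto)
    finally show "norm (2 * of_real s ^ (N + 1) * g (a + of_real (s^2) * (z - a)))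
      \<le> 2 * s ^ (2*n+1) * (M * norm (z - a) ^ n)" by (simp add: algebra_simps)
  qed
  also have "\<dots> = M * norm (z - a) ^ n / (n + 1)" using hi by (rule integral_unique)
  finally show ?thesis .
qed

lemma segment_mean_diff:
  assumes "star_at a S" "continuous_on S g" "continuous_on S h" "z \<in> S"
  shows "segment_mean N a (\<lambda>w. g w - h w) z = segment_mean N a g z - segment_mean N a h z"
  unfolding segment_mean_def
  by (subst integral_diff[symmetric])
     (use segment_mean_integrable[OF assms(1,2,4)] segment_mean_integrable[OF assms(1,3,4)] in
       \<open>auto simp: algebra_simps\<close>)

text \<open>The cone from \<open>a\<close> over a small closed disc is compact and still star-shaped; uniform
  convergence on such sets gives a holomorphic limit.\<close>

lemma star_at_compact_neighbourhood:
  assumes "open D" "star_at a D" "z \<in> D"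
  obtains S e where "compact S" "star_at a S" "S \<subseteq> D" "e > 0" "cball z e \<subseteq> S"
proof -
  obtain e where e: "e > 0" "cball z e \<subseteq> D" using assms(1,3) open_contains_cball by blast
  define S where "S = (\<lambda>(s::real, w). a + of_real s * (w - a)) ` ({0..1} \<times> cball z e)"
  have "compact S" unfolding S_def case_prod_unfold
    by (intro compact_continuous_image continuous_intros compact_Times) auto
  moreover have "S \<subseteq> D" unfolding S_def using e star_atD[OF assms(2)] by auto
  moreover have "w \<in> S" if "w \<in> cball z e" for w
    unfolding S_def using that by (intro image_eqI[where x="(1, w)"]) auto
  moreover have "star_at a S" unfolding star_at_def
  proof (intro conjI ballI)
    show "a \<in> S" unfolding S_def using e by (intro image_eqI[where x="(0, z)"]) auto
    fix w and s :: real assume "w \<in> S" and s: "s \<in> {0..1}"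
    then obtain r v where r: "r \<in> {0..1}" "v \<in> cball z e" "w = a + of_real r * (v - a)"
      unfolding S_def by auto
    have "s * r \<in> {0..1}" using s r(1) by (auto simp: mult_le_one)
    then show "a + of_real s * (w - a) \<in> S" unfolding S_def
      using r by (intro image_eqI[where x="(s * r, v)"]) auto
  qed
  ultimately show ?thesis using that e(1) by blast
qed

lemma uniform_limit_sum:
  fixes f :: "'i \<Rightarrow> 'n \<Rightarrow> 'x \<Rightarrow> complex"
  assumes "\<And>i. i \<in> I \<Longrightarrow> uniform_limit S (f i) (g i) F"
  shows "uniform_limit S (\<lambda>n x. \<Sum>i\<in>I. f i n x) (\<lambda>x. \<Sum>i\<in>I. g i x) F"
  using assms by (induction I rule: infinite_finite_induct) (auto intro!: uniform_limit_intros)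

text \<open>The integrated form of the system with poles at \<open>a\<close>, as a fixed point iteration.\<close>

fun picard :: "nat \<Rightarrow> complex \<Rightarrow> (nat \<Rightarrow> nat \<Rightarrow> complex \<Rightarrow> complex) \<Rightarrow> (nat \<Rightarrow> nat) \<Rightarrow> (nat \<Rightarrow> complex) \<Rightarrow>
    nat \<Rightarrow> nat \<Rightarrow> complex \<Rightarrow> complex" where
  "picard m a A N c 0 i z = c i"
| "picard m a A N c (Suc n) i z =
     c i + (z - a) * segment_mean (N i) a (\<lambda>w. \<Sum>j<m. A i j w * picard m a A N c n j w) z"

lemma holomorphic_segment_mean:
  "open D \<Longrightarrow> star_at a D \<Longrightarrow> g holomorphic_on D \<Longrightarrow> segment_mean N a g holomorphic_on D"
  by (meson has_field_derivative_segment_mean holomorphic_on_open)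

lemma picard_holomorphic:
  assumes "open D" "star_at a D" "\<And>i j. i < m \<Longrightarrow> j < m \<Longrightarrow> A i j holomorphic_on D" "i < m"
  shows "picard m a A N c n i holomorphic_on D"
  using assms(4)
proof (induction n arbitrary: i)
  case 0 then show ?case by (simp add: picard.simps(1)[abs_def])
next
  case (Suc n)
  have "(\<lambda>w. \<Sum>j<m. A i j w * picard m a A N c n j w) holomorphic_on D"
  proof (intro holomorphic_on_sum holomorphic_on_mult)
    fix j assume "j \<in> {..<m}"
    then show "A i j holomorphic_on D" "picard m a A N c n j holomorphic_on D"
      using assms(3) Suc by auto
  qed
  from holomorphic_segment_mean[OF assms(1,2) this] show ?case unfolding picard.simps(2)[abs_def]
    by (intro holomorphic_on_add holomorphic_on_mult holomorphic_on_diff holomorphic_on_ident holomorphic_on_const)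
qed

text \<open>A linear system whose row \<open>i\<close> has at \<open>a\<close> either no singularity (\<open>N i = 0\<close>) or a simple pole
  with residue \<open>- N i / 2\<close> on the diagonal. As no residue is a positive integer, there is no
  resonance. In a row with a pole it is \<open>u i - c i\<close> that enters the singular term; the choice
  \<open>c i = 0\<close> gives the homogeneous system. Half-integral residues are those that occur at the point
  \<open>1\<close> of the hypergeometric equation.\<close>

theorem regular_singular_system:
  fixes A :: "nat \<Rightarrow> nat \<Rightarrow> complex \<Rightarrow> complex"
  assumes D: "open D" "star_at a D"
    and A: "\<And>i j. i < m \<Longrightarrow> j < m \<Longrightarrow> A i j holomorphic_on D"
  shows "\<exists>u. (\<forall>i<m. u i holomorphic_on D) \<and> (\<forall>i<m. u i a = c i) \<and>
    (\<forall>i<m. \<forall>z\<in>D. N i = 0 \<longrightarrow> deriv (u i) z = (\<Sum>j<m. A i j z * u j z)) \<and>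
    (\<forall>i<m. \<forall>z\<in>D. (z - a) * deriv (u i) z + of_nat (N i) / 2 * (u i z - c i)
        = (z - a) * (\<Sum>j<m. A i j z * u j z))"
proof -
  define y where "y = picard m a A N c"
  define d where "d n i z = y (Suc n) i z - y n i z" for n i z
  define u where "u i z = c i + (\<Sum>n. d n i z)" for i z
  have yhol: "y n i holomorphic_on D" if "i < m" for n i
    unfolding y_def by (rule picard_holomorphic[OF D A that])
  have ycont: "continuous_on S (y n i)" if "S \<subseteq> D" "i < m" for S n i
    using that yhol holomorphic_on_imp_continuous_on continuous_on_subset by blast
  have Acont: "continuous_on S (A i j)" if "S \<subseteq> D" "i < m" "j < m" for S i j
    using that A holomorphic_on_imp_continuous_on continuous_on_subset by blast
  have ysum: "y n i z = c i + (\<Sum>k<n. d k i z)" for n i z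
    by (induction n) (auto simp: d_def y_def)
  have dSuc: "d (Suc n) i z = (z - a) * segment_mean (N i) a (\<lambda>w. \<Sum>j<m. A i j w * d n j w) z"
    if "S \<subseteq> D" "star_at a S" "z \<in> S" "i < m" for S n i z
  proof -
    have "continuous_on S (\<lambda>w. \<Sum>j<m. A i j w * y n j w)" for n
      by (intro continuous_intros Acont ycont) (use that in auto)
    then have "segment_mean (N i) a (\<lambda>w. (\<Sum>j<m. A i j w * y (Suc n) j w) - (\<Sum>j<m. A i j w * y n j w)) z
      = segment_mean (N i) a (\<lambda>w. (\<Sum>j<m. A i j w * y (Suc n) j w)) z - segment_mean (N i) a (\<lambda>w. (\<Sum>j<m. A i j w * y n j w)) z"
      using that by (intro segment_mean_diff) auto
    moreover have "(\<lambda>w. \<Sum>j<m. A i j w * (y (Suc n) j w - y n j w))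
      = (\<lambda>w. (\<Sum>j<m. A i j w * y (Suc n) j w) - (\<Sum>j<m. A i j w * y n j w))"
      by (simp add: right_diff_distrib sum_subtractf)
    moreover have yS: "y (Suc k) i z = c i + (z - a) * segment_mean (N i) a (\<lambda>w. \<Sum>j<m. A i j w * y k j w) z" for k
      by (simp add: y_def)
    ultimately show ?thesis unfolding d_def yS by (simp only: right_diff_distrib) simp
  qed
  have conv: "\<exists>M. summable M \<and> (\<forall>n. \<forall>i<m. \<forall>z\<in>S. norm (d n i z) \<le> M n)"
    if S: "S \<subseteq> D" "star_at a S" "compact S" for S
  proof -
    have "\<exists>b. \<forall>i<m. \<forall>j<m. \<forall>w\<in>S. norm (A i j w) \<le> b"
    proof -
      have "\<exists>b. \<forall>w\<in>S. norm (A i j w) \<le> b" if "i < m" "j < m" for i j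
        using compact_imp_bounded[OF compact_continuous_image[OF Acont[OF S(1) that] S(3)]]
        by (auto simp: bounded_iff)
      then obtain b where b: "\<And>i j w. i < m \<Longrightarrow> j < m \<Longrightarrow> w \<in> S \<Longrightarrow> norm (A i j w) \<le> b i j" by metis
      have "b i j \<le> (\<Sum>i<m. \<Sum>j<m. \<bar>b i j\<bar>)" if "i < m" "j < m" for i j
      proof -
        have "\<bar>b i j\<bar> \<le> (\<Sum>j<m. \<bar>b i j\<bar>)" using that by (intro member_le_sum) auto
        also have "\<dots> \<le> (\<Sum>i<m. \<Sum>j<m. \<bar>b i j\<bar>)"
          using that by (intro member_le_sum[where f="\<lambda>i. \<Sum>j<m. \<bar>b i j\<bar>"]) (auto intro: sum_nonneg)
        finally show ?thesis by simp
      qed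
      then show ?thesis using b by (intro exI[of _ "\<Sum>i<m. \<Sum>j<m. \<bar>b i j\<bar>"]) (meson order_trans)
    qed
    then obtain b where b: "\<And>i j w. i < m \<Longrightarrow> j < m \<Longrightarrow> w \<in> S \<Longrightarrow> norm (A i j w) \<le> b" by blast
    define L where "L = m * \<bar>b\<bar>"
    define C where "C = (\<Sum>j<m. norm (c j))"
    have C: "norm (c i) \<le> C" if "i < m" for i unfolding C_def using that by (intro member_le_sum) auto
    obtain R where R: "\<And>w. w \<in> S \<Longrightarrow> norm (w - a) \<le> R"
    proof -
      have "bounded ((\<lambda>w. w - a) ` S)"
        by (intro compact_imp_bounded compact_continuous_image continuous_intros S)
      then show ?thesis using that by (auto simp: bounded_iff)
    qed
    have L0: "L \<ge> 0" and C0: "C \<ge> 0" unfolding L_def C_def by (auto intro: sum_nonneg)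
    have R0: "R \<ge> 0" using R[of a] S(2) by (auto simp: star_at_def)
    have rowbd: "norm (\<Sum>j<m. A i j w * v j) \<le> L * K" if "i < m" "w \<in> S" "\<And>j. j < m \<Longrightarrow> norm (v j) \<le> K" for i w v K
    proof -
      have "norm (\<Sum>j<m. A i j w * v j) \<le> (\<Sum>j<m. \<bar>b\<bar> * K)"
      proof (rule sum_norm_le)
        fix j assume "j \<in> {..<m}"
        then show "norm (A i j w * v j) \<le> \<bar>b\<bar> * K"
          unfolding norm_mult using b[of i j w] that by (intro mult_mono) auto
      qed
      then show ?thesis by (simp add: L_def)
    qed
    have bd: "norm (d n i z) \<le> C * L ^ Suc n * norm (z - a) ^ Suc n / fact (Suc n)" if "i < m" "z \<in> S" for n i z
      using that
    proof (induction n arbitrary: i z)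
      case 0
      have c0: "continuous_on S (\<lambda>w. \<Sum>j<m. A i j w * c j)"
        by (intro continuous_on_sum continuous_on_mult continuous_on_const Acont S 0) auto
      have "norm (segment_mean (N i) a (\<lambda>w. \<Sum>j<m. A i j w * c j) z) \<le> (L * C) * norm (z - a) ^ 0 / (real 0 + 1)"
        using norm_segment_mean_le[OF S(2) c0 0(2), of "L * C" 0 "N i"] rowbd[OF 0(1), of _ c C] C
        by auto
      then have "norm (z - a) * norm (segment_mean (N i) a (\<lambda>w. \<Sum>j<m. A i j w * c j) z) \<le> norm (z - a) * (L * C)"
        by (intro mult_left_mono) auto
      then show ?case by (simp add: d_def y_def norm_mult mult_ac)
    next
      case (Suc n)
      have dc: "continuous_on S (\<lambda>w. \<Sum>j<m. A i j w * d n j w)"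
        unfolding d_def by (intro continuous_intros Acont ycont S Suc) auto
      have "norm (segment_mean (N i) a (\<lambda>w. \<Sum>j<m. A i j w * d n j w) z)
        \<le> (L * (C * L ^ Suc n / fact (Suc n))) * norm (z - a) ^ Suc n / (Suc n + 1)"
      proof (rule norm_segment_mean_le[OF S(2) dc Suc.prems(2)])
        fix w assume "w \<in> S"
        then show "norm (\<Sum>j<m. A i j w * d n j w) \<le> L * (C * L ^ Suc n / fact (Suc n)) * norm (w - a) ^ Suc n"
          using rowbd[OF Suc.prems(1), of w "\<lambda>j. d n j w" "C * L ^ Suc n * norm (w - a) ^ Suc n / fact (Suc n)"] Suc.IH[of _ w]
          by (simp del: power_Suc fact_Suc)
      qed
      then have "norm (z - a) * norm (segment_mean (N i) a (\<lambda>w. \<Sum>j<m. A i j w * d n j w) z)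
        \<le> norm (z - a) * ((L * (C * L ^ Suc n / fact (Suc n))) * norm (z - a) ^ Suc n / (Suc n + 1))"
        by (intro mult_left_mono) auto
      also have "\<dots> = C * L ^ Suc (Suc n) * norm (z - a) ^ Suc (Suc n) / fact (Suc (Suc n))"
        by (simp add: divide_simps) (simp add: algebra_simps)?
      finally show ?case using dSuc[OF S(1,2) Suc.prems(2,1)] by (simp add: norm_mult)
    qed
    define M where "M n = C * ((L * R) ^ Suc n / fact (Suc n))" for n
    have "summable (\<lambda>n. (L * R) ^ n / fact n)"
      using summable_exp[of "L * R"] by (simp add: divide_inverse mult.commute)
    then have "summable (\<lambda>n. (L * R) ^ Suc n / fact (Suc n))"
      by (subst summable_Suc_iff)
    then have "summable M" unfolding M_def by (rule summable_mult)
    moreover have "norm (d n i z) \<le> M n" if "i < m" "z \<in> S" for n i z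
    proof -
      have "C * L ^ Suc n * norm (z - a) ^ Suc n / fact (Suc n) \<le> C * L ^ Suc n * R ^ Suc n / fact (Suc n)"
        by (intro divide_right_mono mult_left_mono power_mono R that) (use L0 C0 in auto)
      then show ?thesis using bd[OF that, of n] by (simp add: M_def power_mult_distrib mult.assoc del: power_Suc fact_Suc)
    qed
    ultimately show ?thesis by blast
  qed
  have ulim: "uniform_limit S (\<lambda>n. y n i) (u i) sequentially"
    if S: "S \<subseteq> D" "star_at a S" "compact S" and i: "i < m" for S i
  proof -
    obtain M where "summable M" "\<And>n z. z \<in> S \<Longrightarrow> norm (d n i z) \<le> M n" using conv[OF S] i by blast
    then have "uniform_limit S (\<lambda>n z. \<Sum>k<n. d k i z) (\<lambda>z. \<Sum>k. d k i z) sequentially"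
      by (intro Weierstrass_m_test) auto
    then have "uniform_limit S (\<lambda>n z. c i + (\<Sum>k<n. d k i z)) (\<lambda>z. c i + (\<Sum>k. d k i z)) sequentially"
      by (intro uniform_limit_intros)
    then show ?thesis by (simp add: u_def[abs_def] ysum[abs_def])
  qed
  have uhol: "u i holomorphic_on D" if i: "i < m" for i
  proof (rule holomorphic_uniform_sequence[OF D(1) yhol[OF i]])
    fix z assume "z \<in> D"
    then obtain S e where "compact S" "star_at a S" "S \<subseteq> D" "e > 0" "cball z e \<subseteq> S"
      using star_at_compact_neighbourhood[OF D] by blast
    then show "\<exists>d>0. cball z d \<subseteq> D \<and> uniform_limit (cball z d) (\<lambda>n. y n i) (u i) sequentially"
      using ulim[of S i] i uniform_limit_on_subset by blast
  qed
  have ghol: "(\<lambda>w. \<Sum>j<m. A i j w * u j w) holomorphic_on D" if "i < m" for i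
    by (intro holomorphic_intros A uhol that) auto
  have fix_eq: "u i z = c i + (z - a) * segment_mean (N i) a (\<lambda>w. \<Sum>j<m. A i j w * u j w) z"
    if i: "i < m" and z: "z \<in> D" for i z
  proof -
    obtain S e where S: "compact S" "star_at a S" "S \<subseteq> D" "e > 0" "cball z e \<subseteq> S"
      using star_at_compact_neighbourhood[OF D z] by blast
    have zS: "z \<in> S" using S by auto
    define G where "G w = (\<Sum>j<m. A i j w * u j w)" for w
    define Gn where "Gn n w = (\<Sum>j<m. A i j w * y n j w)" for n w
    have Gc: "continuous_on S G" unfolding G_def using ghol[OF i] S(3)
      using continuous_on_subset holomorphic_on_imp_continuous_on by blast
    have Gnc: "continuous_on S (Gn n)" for n unfolding Gn_def
      by (intro continuous_intros Acont ycont S i) auto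
    have bA: "bounded (A i j ` S)" if "j < m" for j
      using compact_continuous_image[OF Acont[OF S(3) i that] S(1)] compact_imp_bounded by blast
    have bu: "bounded (u j ` S)" if "j < m" for j
      using compact_continuous_image[OF continuous_on_subset[OF holomorphic_on_imp_continuous_on[OF uhol[OF that]] S(3)] S(1)]
        compact_imp_bounded by blast
    have uG: "uniform_limit S Gn G sequentially"
      unfolding G_def[abs_def] Gn_def[abs_def]
      by (intro uniform_limit_sum bounded_bilinear.bounded_uniform_limit[OF bounded_bilinear_mult]
           uniform_limit_const ulim S bA bu) auto
    have "(\<lambda>n. segment_mean (N i) a (Gn n) z) \<longlonglongrightarrow> segment_mean (N i) a G z"
    proof (rule LIMSEQ_I)
      fix r :: real assume "r > 0"
      then obtain n0 where n0: "\<And>n w. n \<ge> n0 \<Longrightarrow> w \<in> S \<Longrightarrow> dist (Gn n w) (G w) < r / 2"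
        using uG unfolding uniform_limit_iff eventually_sequentially by (meson half_gt_zero)
      have "norm (segment_mean (N i) a (Gn n) z - segment_mean (N i) a G z) < r" if "n \<ge> n0" for n
      proof -
        have "norm (segment_mean (N i) a (\<lambda>w. Gn n w - G w) z) \<le> (r / 2) * norm (z - a) ^ 0 / (real 0 + 1)"
          using norm_segment_mean_le[OF S(2) _ zS, of "\<lambda>w. Gn n w - G w" "r / 2" 0 "N i"] n0[OF that] Gc Gnc
          by (auto intro!: continuous_intros simp: dist_norm less_imp_le)
        then show ?thesis using segment_mean_diff[OF S(2) Gnc Gc zS] \<open>r > 0\<close> by simp
      qed
      then show "\<exists>no. \<forall>n\<ge>no. norm (segment_mean (N i) a (Gn n) z - segment_mean (N i) a G z) < r" by blast
    qed
    then have "(\<lambda>n. c i + (z - a) * segment_mean (N i) a (Gn n) z) \<longlonglongrightarrow> c i + (z - a) * segment_mean (N i) a G z"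
      by (intro tendsto_intros)
    then have "(\<lambda>n. y (Suc n) i z) \<longlonglongrightarrow> c i + (z - a) * segment_mean (N i) a G z"
      by (simp add: y_def Gn_def[abs_def])
    moreover have "(\<lambda>n. y (Suc n) i z) \<longlonglongrightarrow> u i z"
      using tendsto_uniform_limitI[OF ulim[OF S(3,2,1) i] zS] LIMSEQ_Suc by blast
    ultimately show ?thesis using LIMSEQ_unique unfolding G_def by blast
  qed
  have der: "deriv (u i) z = (\<Sum>j<m. A i j z * u j z)
       - of_nat (N i) / 2 * segment_mean (N i) a (\<lambda>w. \<Sum>j<m. A i j w * u j w) z"
    if i: "i < m" and z: "z \<in> D" for i z
  proof -
    let ?G = "segment_mean (N i) a (\<lambda>w. \<Sum>j<m. A i j w * u j w)"
    have "(?G has_field_derivative deriv ?G z) (at z)"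
      using holomorphic_derivI[OF holomorphic_segment_mean[OF D ghol[OF i]] D(1) z] .
    then have "((\<lambda>z. c i + (z - a) * ?G z) has_field_derivative (?G z + (z - a) * deriv ?G z)) (at z)"
      by (auto intro!: derivative_eq_intros)
    then have "(u i has_field_derivative (?G z + (z - a) * deriv ?G z)) (at z)"
      by (rule DERIV_cong_ev[THEN iffD1, rotated -1])
         (use fix_eq[OF i] D(1) z in \<open>auto simp: eventually_nhds\<close>)
    then have "deriv (u i) z = ?G z + (z - a) * deriv ?G z" by (rule DERIV_imp_deriv)
    then show ?thesis using segment_mean_ode[OF D ghol[OF i] z, of "N i"] by (simp only: eq_diff_eq)
  qed
  have "(z - a) * deriv (u i) z + of_nat (N i) / 2 * (u i z - c i) = (z - a) * (\<Sum>j<m. A i j z * u j z)"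
    if i: "i < m" and z: "z \<in> D" for i z
  proof -
    have "u i z - c i = (z - a) * segment_mean (N i) a (\<lambda>w. \<Sum>j<m. A i j w * u j w) z"
      using fix_eq[OF i z] by simp
    then show ?thesis unfolding der[OF i z] by (simp only: right_diff_distrib) simp
  qed
  moreover have "u i a = c i" if "i < m" for i
    using fix_eq[OF that, of a] D by (simp add: star_at_def)
  ultimately show ?thesis using uhol der by (intro exI[of _ u]) auto
qed

section \<open>Linear systems\<close>

no_notation vec_index (infixl \<open>$\<close> 100)

lemma mult_mat_vec_index_sum:
  assumes "A \<in> carrier_mat n m" "v \<in> carrier_vec m" "i < n"
  shows "vec_index (A *\<^sub>v v) i = (\<Sum>j<m. A $$ (i, j) * vec_index v j)"
  using assms by (simp add: scalar_prod_def atLeast0LessThan)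

lemma solve_linear_system:
  fixes M :: "nat \<Rightarrow> nat \<Rightarrow> complex"
  assumes inj: "\<And>c. (\<And>k. k < m \<Longrightarrow> (\<Sum>i<m. M k i * c i) = 0) \<Longrightarrow> \<forall>i<m. c i = 0"
  obtains c where "\<And>k. k < m \<Longrightarrow> (\<Sum>i<m. M k i * c i) = v k"
proof -
  define A where "A = mat m m (\<lambda>(k, i). M k i)"
  have A: "A \<in> carrier_mat m m" by (simp add: A_def)
  have "det A \<noteq> 0"
  proof
    assume "det A = 0"
    then obtain w where w: "w \<in> carrier_vec m" "w \<noteq> 0\<^sub>v m" "A *\<^sub>v w = 0\<^sub>v m"
      using det_0_iff_vec_prod_zero_field[OF A] by blast
    have "(\<Sum>i<m. M k i * vec_index w i) = 0" if "k < m" for k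
      using mult_mat_vec_index_sum[OF A w(1) that] that unfolding w(3) by (simp add: A_def)
    then have "\<forall>i<m. vec_index w i = 0" by (rule inj)
    then show False using w(1,2) by (auto intro!: eq_vecI)
  qed
  then obtain B where B: "B \<in> carrier_mat m m" "A * B = 1\<^sub>m m"
    using det_non_zero_imp_unit[OF A, where b="()"] by (auto simp: Units_def ring_mat_def)
  define x where "x = B *\<^sub>v Matrix.vec m v"
  have x: "x \<in> carrier_vec m" using B by (simp add: x_def)
  have "A *\<^sub>v x = Matrix.vec m v"
    unfolding x_def using A B by (simp add: assoc_mult_mat_vec[symmetric, of A m m B m])
  then have "(\<Sum>i<m. M k i * vec_index x i) = v k" if "k < m" for k
    using mult_mat_vec_index_sum[OF A x that] that by (simp add: A_def)
  then show ?thesis by (rule that)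
qed

lemma underdetermined_system:
  fixes M :: "nat \<Rightarrow> nat \<Rightarrow> complex"
  assumes "r < m"
  obtains c where "\<exists>i<m. c i \<noteq> 0" "\<And>k. k < r \<Longrightarrow> (\<Sum>i<m. M k i * c i) = 0"
proof -
  define A where "A = mat m m (\<lambda>(k, i). if k < r then M k i else 0)"
  have A: "A \<in> carrier_mat m m" by (simp add: A_def)
  have row: "row A r = 0\<^sub>v m" using assms by (auto simp: A_def intro!: eq_vecI)
  have "det A = 0"
  proof (rule ccontr)
    assume "det A \<noteq> 0"
    then obtain B where B: "B \<in> carrier_mat m m" "A * B = 1\<^sub>m m"
      using det_non_zero_imp_unit[OF A, where b="()"] by (auto simp: Units_def ring_mat_def)
    have "(A * B) $$ (r, r) = 0" using A B(1) assms by (simp add: row)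
    then show False using B assms by simp
  qed
  then obtain w where w: "w \<in> carrier_vec m" "w \<noteq> 0\<^sub>v m" "A *\<^sub>v w = 0\<^sub>v m"
    using det_0_iff_vec_prod_zero_field[OF A] by blast
  have "(\<Sum>i<m. M k i * vec_index w i) = 0" if "k < r" for k
    using mult_mat_vec_index_sum[OF A w(1), of k] that assms unfolding w(3) by (simp add: A_def)
  moreover have "\<exists>i<m. vec_index w i \<noteq> 0" using w(1,2) by (auto intro!: eq_vecI)
  ultimately show ?thesis by (rule that[rotated])
qed

section \<open>The hypergeometric equation\<close>

text \<open>The operator \<open>p(theta) - t q(theta)\<close>; for monic \<open>p\<close>, \<open>q\<close> of equal degree its finite singular
  points are \<open>0\<close> and \<open>1\<close>.\<close>

definition hyp_op :: "complex poly \<Rightarrow> complex poly \<Rightarrow> (complex \<Rightarrow> complex) \<Rightarrow> complex \<Rightarrow> complex" where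
  "hyp_op p q f = (\<lambda>t. poly_theta p f t - t * poly_theta q f t)"

lemma theta_Suc: "(theta ^^ Suc k) f z = z * deriv ((theta ^^ k) f) z"
  by (simp add: theta_def)

lemma theta_cong:
  assumes "open S" "\<And>z. z \<in> S \<Longrightarrow> f z = g z" "z \<in> S"
  shows "(theta ^^ k) f z = (theta ^^ k) g z"
  using assms(3)
proof (induction k arbitrary: z)
  case 0 then show ?case using assms by simp
next
  case (Suc k)
  have "deriv ((theta ^^ k) f) z = deriv ((theta ^^ k) g) z"
    by (rule deriv_cong_ev) (use Suc assms(1) in \<open>auto simp: eventually_nhds\<close>)
  then show ?case by (simp only: theta_Suc)
qed

lemma holomorphic_theta:
  assumes "open S" "f holomorphic_on S"
  shows "(theta ^^ k) f holomorphic_on S"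
  using assms by (induction k) (auto simp: theta_def[abs_def] intro!: holomorphic_intros holomorphic_deriv)

lemma theta_sum:
  assumes "open S" "\<And>i. i \<in> I \<Longrightarrow> f i holomorphic_on S" "z \<in> S"
  shows "(theta ^^ k) (\<lambda>w. \<Sum>i\<in>I. c i * f i w) z = (\<Sum>i\<in>I. c i * (theta ^^ k) (f i) z)"
  using assms(3)
proof (induction k arbitrary: z)
  case 0 then show ?case by simp
next
  case (Suc k)
  have "deriv ((theta ^^ k) (\<lambda>w. \<Sum>i\<in>I. c i * f i w)) z = deriv (\<lambda>z. \<Sum>i\<in>I. c i * (theta ^^ k) (f i) z) z"
    by (rule deriv_cong_ev) (use Suc assms(1) in \<open>auto simp: eventually_nhds\<close>)
  also have "\<dots> = (\<Sum>i\<in>I. c i * deriv ((theta ^^ k) (f i)) z)"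
  proof (rule DERIV_imp_deriv, rule DERIV_sum)
    fix i assume "i \<in> I"
    then have "((theta ^^ k) (f i) has_field_derivative deriv ((theta ^^ k) (f i)) z) (at z)"
      using holomorphic_derivI[OF holomorphic_theta[OF assms(1,2)] assms(1) Suc.prems] by blast
    then show "((\<lambda>z. c i * (theta ^^ k) (f i) z) has_field_derivative c i * deriv ((theta ^^ k) (f i)) z) (at z)"
      by (rule DERIV_cmult)
  qed
  finally show ?case by (simp only: theta_Suc sum_distrib_left mult.left_commute)
qed

lemma poly_theta_cong:
  assumes "open S" "\<And>z. z \<in> S \<Longrightarrow> f z = g z" "z \<in> S"
  shows "poly_theta p f z = poly_theta p g z"
  unfolding poly_theta_def using theta_cong[OF assms] by simp

lemma hyp_op_cong:
  assumes "open S" "\<And>z. z \<in> S \<Longrightarrow> f z = g z" "z \<in> S"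
  shows "hyp_op p q f z = hyp_op p q g z"
  unfolding hyp_op_def using poly_theta_cong[OF assms] by simp

lemma poly_theta_sum:
  assumes "open S" "\<And>i. i \<in> I \<Longrightarrow> f i holomorphic_on S" "z \<in> S"
  shows "poly_theta p (\<lambda>w. \<Sum>i\<in>I. c i * f i w) z = (\<Sum>i\<in>I. c i * poly_theta p (f i) z)"
proof -
  have "(theta ^^ k) (\<lambda>w. \<Sum>i\<in>I. c i * f i w) z = (\<Sum>i\<in>I. c i * (theta ^^ k) (f i) z)" for k
    by (rule theta_sum[OF assms])
  then show ?thesis
    unfolding poly_theta_def sum_distrib_left by (subst sum.swap) (simp add: sum_distrib_left mult_ac)
qed

lemma hyp_op_sum:
  assumes "open S" "\<And>i. i \<in> I \<Longrightarrow> f i holomorphic_on S" "z \<in> S"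
  shows "hyp_op p q (\<lambda>w. \<Sum>i\<in>I. c i * f i w) z = (\<Sum>i\<in>I. c i * hyp_op p q (f i) z)"
proof -
  have "poly_theta r (\<lambda>w. \<Sum>i\<in>I. c i * f i w) z = (\<Sum>i\<in>I. c i * poly_theta r (f i) z)" for r
    by (rule poly_theta_sum[OF assms])
  then show ?thesis
    unfolding hyp_op_def by (simp add: right_diff_distrib sum_subtractf sum_distrib_left mult_ac)
qed

lemma poly_theta_bound:
  assumes "degree p \<le> N"
  shows "poly_theta p f t = (\<Sum>k\<le>N. Polynomial.coeff p k * (theta ^^ k) f t)"
  unfolding poly_theta_def
  by (rule sum.mono_neutral_left) (use assms in \<open>auto simp: coeff_eq_0\<close>)

lemma holomorphic_poly_theta:
  "open S \<Longrightarrow> f holomorphic_on S \<Longrightarrow> poly_theta p f holomorphic_on S"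
  unfolding poly_theta_def[abs_def] by (intro holomorphic_intros holomorphic_theta)

lemma theta_poly_theta:
  assumes "open S" "f holomorphic_on S" "z \<in> S"
  shows "theta (poly_theta p f) z = poly_theta (pCons 0 p) f z"
proof -
  have "theta (poly_theta p f) z = (theta ^^ 1) (\<lambda>t. \<Sum>k\<le>degree p. Polynomial.coeff p k * (theta ^^ k) f t) z"
    by (simp add: poly_theta_def[abs_def])
  also have "\<dots> = (\<Sum>k\<le>degree p. Polynomial.coeff p k * (theta ^^ 1) ((theta ^^ k) f) z)"
    by (rule theta_sum[OF assms(1) _ assms(3)]) (rule holomorphic_theta[OF assms(1,2)])
  also have "\<dots> = (\<Sum>k\<le>degree p. Polynomial.coeff (pCons 0 p) (Suc k) * (theta ^^ Suc k) f z)"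
    by simp
  also have "\<dots> = (\<Sum>k\<le>Suc (degree p). Polynomial.coeff (pCons 0 p) k * (theta ^^ k) f z)"
    by (subst sum.atMost_Suc_shift) simp
  also have "\<dots> = poly_theta (pCons 0 p) f z"
    by (rule poly_theta_bound[symmetric]) (rule degree_pCons_le)
  finally show ?thesis .
qed

lemma poly_theta_add: "poly_theta (p + q) f z = poly_theta p f z + poly_theta q f z"
proof -
  let ?N = "max (degree p) (degree q)"
  show ?thesis
    using poly_theta_bound[of p ?N f z] poly_theta_bound[of q ?N f z] poly_theta_bound[of "p + q" ?N f z]
    by (simp add: degree_add_le_max distrib_right sum.distrib)
qed

text \<open>In the coordinate \<open>log t\<close> the operator \<open>theta\<close> is the derivative.\<close>

lemma theta_exp:
  assumes "open S" "f holomorphic_on S" "open U" "\<And>x. x \<in> U \<Longrightarrow> exp x \<in> S \<and> f (exp x) = F x" "x \<in> U"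
  shows "(theta ^^ k) f (exp x) = (deriv ^^ k) F x"
  using assms(5)
proof (induction k arbitrary: x)
  case 0 then show ?case using assms by simp
next
  case (Suc k)
  have "((theta ^^ k) f has_field_derivative deriv ((theta ^^ k) f) (exp x)) (at (exp x))"
    using holomorphic_derivI[OF holomorphic_theta[OF assms(1,2)] assms(1)] assms(4) Suc.prems by blast
  then have "((\<lambda>x. (theta ^^ k) f (exp x)) has_field_derivative deriv ((theta ^^ k) f) (exp x) * exp x) (at x)"
    by (rule DERIV_chain2[OF _ DERIV_exp])
  then have "deriv (\<lambda>x. (theta ^^ k) f (exp x)) x = (theta ^^ Suc k) f (exp x)"
    by (auto dest: DERIV_imp_deriv simp: theta_def)
  moreover have "deriv (\<lambda>x. (theta ^^ k) f (exp x)) x = deriv ((deriv ^^ k) F) x"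
    by (rule deriv_cong_ev) (use Suc assms(3) in \<open>auto simp: eventually_nhds\<close>)
  ultimately show ?case by simp
qed

text \<open>Away from \<open>0\<close> the vanishing of all \<open>theta ^^ k\<close> is the vanishing of all derivatives in the
  coordinate \<open>log t\<close>, so the identity theorem applies.\<close>

lemma eq_0_if_theta_eq_0:
  assumes "open S" "connected S" "f holomorphic_on S" "a \<in> S" "a \<noteq> 0" "\<And>k. (theta ^^ k) f a = 0" "z \<in> S"
  shows "f z = 0"
proof -
  define U where "U = exp -` S"
  have U: "open U" unfolding U_def by (intro open_vimage assms continuous_on_exp continuous_on_id)
  obtain x where x: "a = exp x" using assms(5) by (metis exp_Ln)
  have xU: "x \<in> U" using assms x by (simp add: U_def)
  then obtain e where e: "e > 0" "ball x e \<subseteq> U" using U openE by blast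
  have hol: "(\<lambda>x. f (exp x)) holomorphic_on U" unfolding U_def
    by (rule holomorphic_on_compose_gen[OF _ assms(3), unfolded o_def]) (auto intro: holomorphic_intros)
  have 1: "f (exp y) = 0" if "y \<in> ball x e" for y
  proof (rule holomorphic_fun_eq_0_on_connected[of "\<lambda>x. f (exp x)" "ball x e" x y])
    show "(deriv ^^ n) (\<lambda>x. f (exp x)) x = 0" for n
      using theta_exp[OF assms(1,3) U _ xU, of "\<lambda>x. f (exp x)" n] assms(6) x by (auto simp: U_def)
  qed (use e that hol holomorphic_on_subset in auto)
  have op: "open (exp ` ball x e)"
  proof (rule open_mapping_thm[of exp UNIV])
    show "\<not> exp constant_on (UNIV :: complex set)"
    proof
      assume "exp constant_on (UNIV :: complex set)"
      then have "exp (0::complex) = exp (of_real pi * \<i>)" by (metis UNIV_I constant_on_def)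
      then show False by simp
    qed
  qed (auto intro: holomorphic_intros)
  show ?thesis
  proof (rule analytic_continuation_open[of "exp ` ball x e \<inter> S" S f "\<lambda>_. 0" z])
    show "open (exp ` ball x e \<inter> S)" using op assms by blast
    show "exp ` ball x e \<inter> S \<noteq> {}" using x assms e by force
    fix w assume "w \<in> exp ` ball x e \<inter> S" then show "f w = 0" using 1 by auto
  qed (use assms in auto)
qed

locale hypergeometric =
  fixes p q :: "complex poly" and m :: nat
  assumes m_pos: "m > 0" and deg: "degree p = m" "degree q = m"
    and monic: "Polynomial.coeff p m = 1" "Polynomial.coeff q m = 1"
begin

definition sol :: "complex set \<Rightarrow> (complex \<Rightarrow> complex) \<Rightarrow> bool" where
  "sol D f \<longleftrightarrow> f holomorphic_on D \<and> (\<forall>t\<in>D. hyp_op p q f t = 0)"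

lemma sol_subset: "sol D f \<Longrightarrow> S \<subseteq> D \<Longrightarrow> sol S f"
  by (auto simp: sol_def intro: holomorphic_on_subset)

lemma sol_cong:
  assumes "open D" "\<And>z. z \<in> D \<Longrightarrow> f z = g z" "sol D f"
  shows "sol D g"
  using assms hyp_op_cong[of D f g _ p q] holomorphic_cong[of D D f g] by (auto simp: sol_def)

lemma sol_lin_comb: "open D \<Longrightarrow> (\<And>i. i < m \<Longrightarrow> sol D (\<Phi> i)) \<Longrightarrow> sol D (lin_comb m c \<Phi>)"
proof -
  assume D: "open D" and \<Phi>: "\<And>i. i < m \<Longrightarrow> sol D (\<Phi> i)"
  have "hyp_op p q (\<lambda>w. \<Sum>i<m. c i * \<Phi> i w) z = (\<Sum>i<m. c i * hyp_op p q (\<Phi> i) z)" if "z \<in> D" for z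
    by (rule hyp_op_sum[OF D _ that]) (use \<Phi> in \<open>auto simp: sol_def\<close>)
  then show ?thesis using \<Phi> unfolding sol_def lin_comb_def[abs_def]
    by (auto intro!: holomorphic_intros)
qed

lemma sol_diff: "open D \<Longrightarrow> sol D f \<Longrightarrow> sol D g \<Longrightarrow> sol D (\<lambda>z. f z - g z)"
proof -
  assume D: "open D" and fg: "sol D f" "sol D g"
  define h where "h i = (if i = (0::nat) then f else g)" for i
  have "hyp_op p q (\<lambda>w. \<Sum>i\<in>{0,1}. (if i = 0 then 1 else -1) * h i w) z = 0" if "z \<in> D" for z
    by (subst hyp_op_sum[OF D _ that]) (use fg that in \<open>auto simp: sol_def h_def\<close>)
  then have "\<forall>z\<in>D. hyp_op p q (\<lambda>w. f w - g w) z = 0" by (simp add: h_def)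
  then show ?thesis using fg by (auto simp: sol_def intro: holomorphic_intros)
qed

text \<open>Applying \<open>theta\<close> repeatedly to the equation determines all \<open>theta ^^ k\<close> of a solution from
  the first \<open>m\<close>, because the leading coefficient \<open>1 - t\<close> does not vanish.\<close>

lemma sol_unique:
  assumes D: "open D" "connected D" "0 \<notin> D" "1 \<notin> D" and f: "sol D f" and a: "a \<in> D"
    and init: "\<And>k. k < m \<Longrightarrow> (theta ^^ k) f a = 0" and z: "z \<in> D"
  shows "f z = 0"
proof -
  have hol: "f holomorphic_on D" using f by (simp add: sol_def)
  \<comment> \<open>After \<open>j\<close> applications of \<open>theta\<close> the equation still has the form \<open>P(theta) f = t Q(theta) f\<close>
    with monic \<open>P\<close>, \<open>Q\<close>, because \<open>theta (t g) = t (g + theta g)\<close>.\<close>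
  have shifted: "\<exists>P Q. degree P \<le> m + j \<and> degree Q \<le> m + j \<and> Polynomial.coeff P (m + j) = 1 \<and>
      Polynomial.coeff Q (m + j) = 1 \<and> (\<forall>t\<in>D. poly_theta P f t - t * poly_theta Q f t = 0)" for j
  proof (induction j)
    case 0
    show ?case using f deg monic by (intro exI[of _ p] exI[of _ q]) (auto simp: sol_def hyp_op_def)
  next
    case (Suc j)
    then obtain P Q where PQ: "degree P \<le> m + j" "degree Q \<le> m + j" "Polynomial.coeff P (m + j) = 1"
      "Polynomial.coeff Q (m + j) = 1" "\<And>t. t \<in> D \<Longrightarrow> poly_theta P f t - t * poly_theta Q f t = 0" by blast
    have "poly_theta (pCons 0 P) f t - t * poly_theta (Q + pCons 0 Q) f t = 0" if t: "t \<in> D" for t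
    proof -
      have hP: "(poly_theta P f has_field_derivative deriv (poly_theta P f) t) (at t)"
        and hQ: "(poly_theta Q f has_field_derivative deriv (poly_theta Q f) t) (at t)"
        using holomorphic_derivI[OF holomorphic_poly_theta[OF D(1) hol] D(1) t] by blast+
      have "((\<lambda>t. poly_theta P f t - t * poly_theta Q f t) has_field_derivative
          (deriv (poly_theta P f) t - (poly_theta Q f t + t * deriv (poly_theta Q f) t))) (at t)"
        by (auto intro!: derivative_eq_intros hP hQ)
      moreover have "deriv (\<lambda>t. poly_theta P f t - t * poly_theta Q f t) t = deriv (\<lambda>t. 0) t"
        by (rule deriv_cong_ev) (use PQ(5) D(1) t in \<open>auto simp: eventually_nhds\<close>)
      ultimately have "deriv (poly_theta P f) t - (poly_theta Q f t + t * deriv (poly_theta Q f) t) = 0"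
        by (auto dest: DERIV_imp_deriv)
      then have "t * deriv (poly_theta P f) t - t * (poly_theta Q f t + t * deriv (poly_theta Q f) t) = 0"
        by (simp add: right_diff_distrib[symmetric])
      then show ?thesis
        unfolding poly_theta_add theta_poly_theta[OF D(1) hol t, symmetric] theta_def .
    qed
    moreover have "degree (pCons 0 P) \<le> m + Suc j" "degree (Q + pCons 0 Q) \<le> m + Suc j"
      using PQ(1,2) degree_pCons_le[of 0 P] degree_pCons_le[of 0 Q] by (auto intro!: degree_add_le)
    moreover have "Polynomial.coeff (pCons 0 P) (m + Suc j) = 1" "Polynomial.coeff (Q + pCons 0 Q) (m + Suc j) = 1"
      using PQ by (auto simp: coeff_eq_0)
    ultimately show ?case by blast
  qed
  have "(theta ^^ k) f a = 0" for k
  proof (induction k rule: less_induct)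
    case (less k)
    show ?case
    proof (cases "k < m")
      case False
      then obtain j where j: "k = m + j" by (metis le_add_diff_inverse not_less)
      obtain P Q where PQ: "degree P \<le> m + j" "degree Q \<le> m + j" "Polynomial.coeff P (m + j) = 1"
        "Polynomial.coeff Q (m + j) = 1" "\<And>t. t \<in> D \<Longrightarrow> poly_theta P f t - t * poly_theta Q f t = 0"
        using shifted by blast
      have "poly_theta R f a = Polynomial.coeff R (m + j) * (theta ^^ k) f a" if "degree R \<le> m + j" for R
      proof -
        have "poly_theta R f a = (\<Sum>i\<le>k. Polynomial.coeff R i * (theta ^^ i) f a)"
          using poly_theta_bound[OF that] j by simp
        also have "\<dots> = (\<Sum>i\<in>{k}. Polynomial.coeff R i * (theta ^^ i) f a)"
          by (rule sum.mono_neutral_right) (use less in auto)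
        finally show ?thesis using j by simp
      qed
      then have "(1 - a) * (theta ^^ k) f a = 0"
        using PQ(5)[OF a] PQ by (simp add: algebra_simps)
      then show ?thesis using D a by auto
    qed (simp add: init)
  qed
  then show ?thesis using eq_0_if_theta_eq_0[OF D(1,2) hol a] D a z by metis
qed

text \<open>The local exponents at \<open>1\<close> are \<open>0, \<dots>, m - 2\<close> and \<open>m - 1 - \<kappa>\<close>.\<close>

definition \<kappa> :: complex where "\<kappa> = Polynomial.coeff q (m - 1) - Polynomial.coeff p (m - 1)"

text \<open>In place of \<open>(theta ^^ (m-1)) f\<close> the system below has the unknown \<open>(p - q)(theta) f\<close>; its
  last equation then has the simple pole at \<open>1\<close> in diagonal form. The unknowns are \<open>u\<close>, and
  \<open>jet u k\<close> is \<open>(theta ^^ k) f\<close> expressed by them.\<close>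

definition jet_coeff :: "nat \<Rightarrow> nat \<Rightarrow> complex" where
  "jet_coeff k j = (if k < m - 1 then (if j = k then 1 else 0)
     else if j < m - 1 then (Polynomial.coeff p j - Polynomial.coeff q j) / \<kappa> else - 1 / \<kappa>)"

definition jet :: "(nat \<Rightarrow> complex \<Rightarrow> complex) \<Rightarrow> nat \<Rightarrow> complex \<Rightarrow> complex" where
  "jet u k t = (\<Sum>j<m. jet_coeff k j * u j t)"

definition last_coeff :: "nat \<Rightarrow> complex" where
  "last_coeff j = (\<Sum>k<m-1. (Polynomial.coeff p k - Polynomial.coeff q k) * jet_coeff (Suc k) j)
     + \<kappa> * (\<Sum>k<m. Polynomial.coeff p k * jet_coeff k j)"

lemma jet_less: "k < m - 1 \<Longrightarrow> jet u k t = u k t"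
  by (simp add: jet_def jet_coeff_def if_distrib[of "\<lambda>x. x * _"] cong: if_cong)

lemma sum_mult_swap: "(\<Sum>j\<in>J. (\<Sum>k\<in>K. a k * E k j) * U j) = (\<Sum>k\<in>K. a k * (\<Sum>j\<in>J. E k j * U j))"
  for a :: "nat \<Rightarrow> complex"
  unfolding sum_distrib_left sum_distrib_right mult.assoc by (rule sum.swap)

lemma sum_split_last: "(\<Sum>k<m. F k) = (\<Sum>k<m-1. F k) + F (m - 1)" for F :: "nat \<Rightarrow> complex"
  using m_pos by (cases m) auto

lemma jet_last:
  "jet u (m - 1) t = ((\<Sum>j<m-1. (Polynomial.coeff p j - Polynomial.coeff q j) * u j t) - u (m - 1) t) / \<kappa>"
proof -
  have 1: "jet u (m - 1) t = (\<Sum>j<m-1. (Polynomial.coeff p j - Polynomial.coeff q j) / \<kappa> * u j t)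
     + (- 1 / \<kappa>) * u (m - 1) t"
    by (simp add: jet_def sum_split_last jet_coeff_def)
  have 2: "(\<Sum>j<m-1. (Polynomial.coeff p j - Polynomial.coeff q j) / \<kappa> * u j t)
     = (\<Sum>j<m-1. (Polynomial.coeff p j - Polynomial.coeff q j) * u j t) / \<kappa>"
    by (simp add: sum_divide_distrib)
  show ?thesis unfolding 1 2 by (simp add: diff_divide_distrib)
qed

lemma last_unknown:
  assumes "\<kappa> \<noteq> 0"
  shows "u (m - 1) t = (\<Sum>k<m. (Polynomial.coeff p k - Polynomial.coeff q k) * jet u k t)"
proof -
  have "(\<Sum>k<m. (Polynomial.coeff p k - Polynomial.coeff q k) * jet u k t)
     = (\<Sum>k<m-1. (Polynomial.coeff p k - Polynomial.coeff q k) * u k t) - \<kappa> * jet u (m - 1) t"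
    by (simp add: sum_split_last jet_less \<kappa>_def algebra_simps)
  then show ?thesis unfolding jet_last using assms by simp
qed

text \<open>Unfolding \<open>u (m - 1) = (p - q)(theta) f\<close> turns the last equation of the system into
  \<open>p(theta) f = t q(theta) f\<close>, multiplied by \<open>\<kappa>\<close>.\<close>

lemma sol_of_system:
  assumes D: "open D" "0 \<notin> D" and \<kappa>: "\<kappa> \<noteq> 0"
    and u: "\<And>i. i < m \<Longrightarrow> u i holomorphic_on D"
    and eq: "\<And>i t. i < m - 1 \<Longrightarrow> t \<in> D \<Longrightarrow> t * deriv (u i) t = jet u (Suc i) t"
    and last_eq: "\<And>t. t \<in> D \<Longrightarrow> (t - 1) * (t * deriv (u (m - 1)) t) + t * \<kappa> * u (m - 1) t
        = (t - 1) * (\<Sum>j<m. last_coeff j * u j t)"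
  shows "jet u 0 holomorphic_on D" "sol (D - {1}) (jet u 0)"
    "\<And>k t. k < m \<Longrightarrow> t \<in> D \<Longrightarrow> (theta ^^ k) (jet u 0) t = jet u k t"
proof -
  have jhol: "jet u k holomorphic_on D" for k
    unfolding jet_def[abs_def] by (intro holomorphic_on_sum holomorphic_on_mult holomorphic_on_const u) auto
  show "jet u 0 holomorphic_on D" by (rule jhol)
  have theta_jet: "theta (jet u k) t = (\<Sum>j<m. jet_coeff k j * (t * deriv (u j) t))" if "t \<in> D" for k t
    using theta_sum[OF D(1), of "{..<m}" u t 1 "jet_coeff k"] u that
    by (simp add: jet_def[abs_def] theta_def)
  have theta_jet_less: "theta (jet u k) t = jet u (Suc k) t" if "k < m - 1" "t \<in> D" for k t
    unfolding theta_jet[OF that(2)] using that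
    by (simp add: jet_coeff_def if_distrib[of "\<lambda>x. x * _"] eq cong: if_cong)
  show th: "(theta ^^ k) (jet u 0) t = jet u k t" if "k < m" "t \<in> D" for k t
    using that
  proof (induction k arbitrary: t)
    case (Suc k)
    have "deriv ((theta ^^ k) (jet u 0)) t = deriv (jet u k) t"
      by (rule deriv_cong_ev) (use Suc D(1) in \<open>auto simp: eventually_nhds\<close>)
    then have "(theta ^^ Suc k) (jet u 0) t = theta (jet u k) t" by (simp add: theta_def)
    then show ?case using theta_jet_less[of k t] Suc by simp
  qed simp
  have th_m: "(theta ^^ m) (jet u 0) t = theta (jet u (m - 1)) t" if "t \<in> D" for t
  proof -
    have "deriv ((theta ^^ (m - 1)) (jet u 0)) t = deriv (jet u (m - 1)) t"
      by (rule deriv_cong_ev) (use that th m_pos D(1) in \<open>auto simp: eventually_nhds\<close>)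
    then have "(theta ^^ Suc (m - 1)) (jet u 0) t = theta (jet u (m - 1)) t" by (simp add: theta_def)
    then show ?thesis using m_pos by simp
  qed
  have "hyp_op p q (jet u 0) t = 0" if t: "t \<in> D" "t \<noteq> 1" for t
  proof -
    define X where "X = theta (jet u (m - 1)) t"
    define Sp where "Sp = (\<Sum>k<m. Polynomial.coeff p k * jet u k t)"
    define Sq where "Sq = (\<Sum>k<m. Polynomial.coeff q k * jet u k t)"
    define w where "w = u (m - 1) t"
    define W where "W = t * deriv (u (m - 1)) t"
    define Y where "Y = (\<Sum>k<m-1. (Polynomial.coeff p k - Polynomial.coeff q k) * jet u (Suc k) t)"
    have pt: "poly_theta r (jet u 0) t = (\<Sum>k<m. Polynomial.coeff r k * jet u k t) + X"
      if "degree r = m" "Polynomial.coeff r m = 1" for r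
      unfolding poly_theta_def that(1) lessThan_Suc_atMost[symmetric] sum.lessThan_Suc
      using that th t th_m X_def by simp
    have L: "(\<Sum>j<m. last_coeff j * u j t) = Y + \<kappa> * Sp"
      unfolding last_coeff_def Y_def Sp_def jet_def distrib_right sum.distrib mult.assoc[of \<kappa>]
        sum_distrib_left[of \<kappa>, symmetric] sum_mult_swap ..
    have w: "w = Sp - Sq"
      unfolding w_def Sp_def Sq_def last_unknown[OF \<kappa>] by (simp add: left_diff_distrib sum_subtractf)
    have "X = (\<Sum>j<m. jet_coeff (m - 1) j * (t * deriv (u j) t))"
      unfolding X_def by (rule theta_jet[OF t(1)])
    also have "\<dots> = (\<Sum>j<m-1. (Polynomial.coeff p j - Polynomial.coeff q j) / \<kappa> * jet u (Suc j) t) + (- 1 / \<kappa>) * W"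
      using t(1) by (simp add: sum_split_last jet_coeff_def W_def eq)
    also have "(\<Sum>j<m-1. (Polynomial.coeff p j - Polynomial.coeff q j) / \<kappa> * jet u (Suc j) t) = Y / \<kappa>"
      by (simp add: Y_def sum_divide_distrib)
    also have "Y / \<kappa> + (- 1 / \<kappa>) * W = (Y - W) / \<kappa>" by (simp add: diff_divide_distrib)
    finally have X: "\<kappa> * X = Y - W" using \<kappa> by simp
    have "(t - 1) * W + t * \<kappa> * w = (t - 1) * (Y + \<kappa> * Sp)"
      using last_eq[OF t(1)] unfolding L W_def w_def .
    then have "(t - 1) * (Y - W) = \<kappa> * (t * w - (t - 1) * Sp)" by (simp add: algebra_simps)
    then have "\<kappa> * ((t - 1) * X) = \<kappa> * (t * w - (t - 1) * Sp)" using X by (metis mult.left_commute)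
    then have "(t - 1) * X = t * w - (t - 1) * Sp" using \<kappa> by simp
    moreover have "hyp_op p q (jet u 0) t = (Sp + X) - t * (Sq + X)"
      unfolding hyp_op_def using pt deg monic Sp_def Sq_def by simp
    ultimately show ?thesis unfolding w by (simp add: algebra_simps)
  qed
  then show "sol (D - {1}) (jet u 0)" using jhol[of 0] holomorphic_on_subset by (auto simp: sol_def)
qed

lemma sol_exists_centre:
  assumes D: "open D" "star_at a D" "0 \<notin> D" "1 \<notin> D" and \<kappa>: "\<kappa> \<noteq> 0"
  obtains f where "sol D f" "\<And>k. k < m \<Longrightarrow> (theta ^^ k) f a = c k"
proof -
  define A where "A i j t = (if i < m - 1 then jet_coeff (Suc i) j else last_coeff j) / t
     - (if i = m - 1 \<and> j = m - 1 then \<kappa> / (t - 1) else 0)" for i j t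
  \<comment> \<open>The initial values of the unknowns that correspond to the values \<open>c\<close> of \<open>(theta ^^ k) f\<close>.\<close>
  define c' where "c' i = (if i < m - 1 then c i
     else (\<Sum>k<m. (Polynomial.coeff p k - Polynomial.coeff q k) * c k))" for i
  have nz: "t \<noteq> 0 \<and> t \<noteq> 1" if "t \<in> D" for t using that D by auto
  have Ahol: "A i j holomorphic_on D" if "i < m" "j < m" for i j
    unfolding A_def[abs_def]
    by (cases "i = m - 1 \<and> j = m - 1"; cases "i < m - 1") (use nz in \<open>auto intro!: holomorphic_intros\<close>)
  obtain u where u': "\<forall>i<m. u i holomorphic_on D" "\<forall>i<m. u i a = c' i"
    "\<forall>i<m. \<forall>z\<in>D. deriv (u i) z = (\<Sum>j<m. A i j z * u j z)"
    using regular_singular_system[where m=m and A=A and c=c' and N="\<lambda>_. 0", OF D(1,2) Ahol] by blast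
  have u: "\<And>i. i < m \<Longrightarrow> u i holomorphic_on D" "\<And>i. i < m \<Longrightarrow> u i a = c' i"
    "\<And>i z. i < m \<Longrightarrow> z \<in> D \<Longrightarrow> deriv (u i) z = (\<Sum>j<m. A i j z * u j z)"
    using u' by auto
  have eq: "t * deriv (u i) t = jet u (Suc i) t" if "i < m - 1" "t \<in> D" for i t
    using u(3)[of i t] that nz[of t] by (simp add: A_def jet_def sum_distrib_left)
  have last_eq: "(t - 1) * (t * deriv (u (m - 1)) t) + t * \<kappa> * u (m - 1) t
        = (t - 1) * (\<Sum>j<m. last_coeff j * u j t)" if t: "t \<in> D" for t
  proof -
    have m1: "m - 1 < m" using m_pos by simp
    have "deriv (u (m - 1)) t = (\<Sum>j<m. last_coeff j / t * u j t - (if j = m - 1 then \<kappa> / (t - 1) * u j t else 0))"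
      unfolding u(3)[OF m1 t]
      by (rule sum.cong) (auto simp: A_def left_diff_distrib)
    also have "\<dots> = (\<Sum>j<m. last_coeff j * u j t) / t - \<kappa> / (t - 1) * u (m - 1) t"
      using m_pos by (simp add: sum_subtractf sum_divide_distrib)
    finally show ?thesis using nz[OF t] by (simp add: divide_simps) (simp add: algebra_simps)
  qed
  have D1: "D - {1} = D" using D by auto
  note s = sol_of_system[OF D(1,3) \<kappa> u(1) eq last_eq, unfolded D1]
  have "jet u k a = c k" if "k < m" for k
  proof (cases "k < m - 1")
    case True then show ?thesis using jet_less u(2)[of k] that by (simp add: c'_def)
  next
    case False
    then have k: "k = m - 1" using that by simp
    have "u (m - 1) a = (\<Sum>k<m. (Polynomial.coeff p k - Polynomial.coeff q k) * c k)"
      using u(2)[of "m - 1"] m_pos by (simp add: c'_def)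
    also have "\<dots> = (\<Sum>k<m-1. (Polynomial.coeff p k - Polynomial.coeff q k) * c k) - \<kappa> * c (m - 1)"
      by (simp add: sum_split_last \<kappa>_def algebra_simps)
    finally show ?thesis unfolding k jet_last using u(2) \<kappa> by (simp add: c'_def)
  qed
  then show ?thesis using that[OF s(2)] s(3) D by (simp add: star_at_def)
qed

text \<open>The system in the unknowns above has its only pole at \<open>1\<close> in the last row, with residue
  \<open>- \<kappa>\<close>. As \<open>2 * \<kappa>\<close> is a positive integer, there are \<open>m - 1\<close> independent solutions that are
  holomorphic at \<open>1\<close>.\<close>

lemma sol_exists_at_1:
  assumes N: "2 * \<kappa> = of_nat N" "N > 0"
  obtains f where "f holomorphic_on ball 1 1" "sol (ball 1 1 - {1}) f"
    "\<And>k. k < m - 1 \<Longrightarrow> (theta ^^ k) f 1 = c k"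
proof -
  let ?D = "ball (1::complex) 1"
  define A where "A i j t = (if i < m - 1 then jet_coeff (Suc i) j else last_coeff j) / t" for i j and t :: complex
  \<comment> \<open>The row with the pole gets the initial value \<open>0\<close>: then \<open>\<kappa> (u - c')\<close> in the conclusion of
    \<open>regular_singular_system\<close> is \<open>\<kappa> u\<close>.\<close>
  define c' where "c' i = (if i < m - 1 then c i else 0)" for i
  have D: "open ?D" "0 \<notin> ?D" by auto
  have st: "star_at 1 ?D"
  proof -
    have "norm (complex_of_real s * (z - 1)) < 1" if "norm (z - 1) < 1" "s \<in> {0..1}" for s z
      using that mult_left_le_one_le[of "norm (z - 1)" s] by (auto simp: norm_mult)
    then show ?thesis by (auto simp: star_at_def dist_norm norm_minus_commute)
  qed
  have \<kappa>: "\<kappa> \<noteq> 0" using N by auto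
  have nz: "t \<noteq> 0" if "t \<in> ?D" for t using that by auto
  have Ahol: "A i j holomorphic_on ?D" if "i < m" "j < m" for i j
    unfolding A_def[abs_def] by (intro holomorphic_intros) (use nz in auto)
  obtain u where u': "\<forall>i<m. u i holomorphic_on ?D" "\<forall>i<m. u i 1 = c' i"
    "\<forall>i<m. \<forall>z\<in>?D. (if i < m - 1 then 0 else N) = 0 \<longrightarrow> deriv (u i) z = (\<Sum>j<m. A i j z * u j z)"
    "\<forall>i<m. \<forall>z\<in>?D. (z - 1) * deriv (u i) z + of_nat (if i < m - 1 then 0 else N) / 2 * (u i z - c' i)
        = (z - 1) * (\<Sum>j<m. A i j z * u j z)"
    using regular_singular_system[where m=m and A=A and c=c' and N="\<lambda>i. if i < m - 1 then 0 else N", OF D(1) st Ahol]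
    by blast
  have u: "\<And>i. i < m \<Longrightarrow> u i holomorphic_on ?D" "\<And>i. i < m \<Longrightarrow> u i 1 = c' i"
    "\<And>i z. i < m - 1 \<Longrightarrow> z \<in> ?D \<Longrightarrow> deriv (u i) z = (\<Sum>j<m. A i j z * u j z)"
    "\<And>z. z \<in> ?D \<Longrightarrow> (z - 1) * deriv (u (m - 1)) z
        + of_nat N / 2 * (u (m - 1) z - c' (m - 1)) = (z - 1) * (\<Sum>j<m. A (m - 1) j z * u j z)"
    subgoal using u'(1) by blast
    subgoal using u'(2) by blast
    subgoal for i z using u'(3) by simp
    subgoal for z using u'(4)[rule_format, of "m - 1" z] m_pos by simp
    done
  have eq: "t * deriv (u i) t = jet u (Suc i) t" if "i < m - 1" "t \<in> ?D" for i t
    using u(3)[of i t] that nz[of t] by (simp add: A_def jet_def sum_distrib_left)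
  have last_eq: "(t - 1) * (t * deriv (u (m - 1)) t) + t * \<kappa> * u (m - 1) t
        = (t - 1) * (\<Sum>j<m. last_coeff j * u j t)" if t: "t \<in> ?D" for t
  proof -
    have "of_nat N / 2 = \<kappa>" using N by (simp add: field_simps)
    then have "(t - 1) * deriv (u (m - 1)) t + \<kappa> * u (m - 1) t = (t - 1) * (\<Sum>j<m. A (m - 1) j t * u j t)"
      using u(4)[OF t] by (simp add: c'_def)
    then have "t * ((t - 1) * deriv (u (m - 1)) t + \<kappa> * u (m - 1) t) = (t - 1) * (\<Sum>j<m. t * (A (m - 1) j t * u j t))"
      by (simp add: sum_distrib_left mult_ac)
    moreover have "t * (A (m - 1) j t * u j t) = last_coeff j * u j t" for j
      using nz[OF t] by (simp add: A_def)
    ultimately show ?thesis by (simp only: distrib_left mult_ac)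
  qed
  note s = sol_of_system[OF D \<kappa> u(1) eq last_eq]
  have "(theta ^^ k) (jet u 0) 1 = c k" if "k < m - 1" for k
    using s(3)[of k 1] jet_less[OF that] u(2)[of k] that by (simp add: c'_def)
  then show ?thesis using that[OF s(1,2)] by blast
qed

end

section \<open>Fundamental systems\<close>

lemma theta_zero: "(theta ^^ k) (\<lambda>_. 0) z = 0"
proof -
  have "(theta ^^ k) (\<lambda>_. 0) = (\<lambda>_. 0)" by (induction k) (auto simp: theta_def)
  then show ?thesis by simp
qed

lemma theta_lin_comb:
  assumes "open S" "\<And>i. i < m \<Longrightarrow> \<Phi> i holomorphic_on S" "z \<in> S"
  shows "(theta ^^ k) (lin_comb m c \<Phi>) z = (\<Sum>i<m. (theta ^^ k) (\<Phi> i) z * c i)"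
proof -
  have "(theta ^^ k) (\<lambda>w. \<Sum>i<m. c i * \<Phi> i w) z = (\<Sum>i<m. c i * (theta ^^ k) (\<Phi> i) z)"
    by (rule theta_sum) (use assms in auto)
  then show ?thesis by (simp add: lin_comb_def mult.commute)
qed

lemma germ_eq_refl [simp]: "germ_eq z f f"
  by (simp add: germ_eq_def)

lemma germ_eq_sym: "germ_eq z f g \<Longrightarrow> germ_eq z g f"
  unfolding germ_eq_def by (elim eventually_mono) simp

lemma germ_eq_trans: "germ_eq z f g \<Longrightarrow> germ_eq z g h \<Longrightarrow> germ_eq z f h"
  unfolding germ_eq_def by (rule eventually_elim2[where P="\<lambda>w. f w = g w" and Q="\<lambda>w. g w = h w"]) auto

lemma germ_eq_open: "open S \<Longrightarrow> z \<in> S \<Longrightarrow> (\<And>w. w \<in> S \<Longrightarrow> f w = g w) \<Longrightarrow> germ_eq z f g"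
  unfolding germ_eq_def eventually_nhds by blast

lemma germ_eq_ball: "germ_eq z f g \<longleftrightarrow> (\<exists>e>0. \<forall>w\<in>ball z e. f w = g w)"
  unfolding germ_eq_def eventually_nhds_metric by (auto simp: dist_commute)

lemma germ_eq_lin_comb:
  assumes "\<And>i. i < m \<Longrightarrow> germ_eq z (f i) (g i)"
  shows "germ_eq z (lin_comb m c f) (lin_comb m c g)"
proof -
  have "\<forall>\<^sub>F w in nhds z. \<forall>i\<in>{..<m}. f i w = g i w"
    using assms by (intro eventually_ball_finite) (auto simp: germ_eq_def)
  then show ?thesis unfolding germ_eq_def by (elim eventually_mono) (simp add: lin_comb_def)
qed

context hypergeometric
begin

text \<open>On such a set a solution is determined by the values of \<open>(theta ^^ k) f\<close>, \<open>k < m\<close>, at a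
  point.\<close>

definition region :: "complex set \<Rightarrow> bool" where
  "region D \<longleftrightarrow> open D \<and> connected D \<and> 0 \<notin> D \<and> 1 \<notin> D"

definition fundamental :: "complex set \<Rightarrow> (nat \<Rightarrow> complex \<Rightarrow> complex) \<Rightarrow> bool" where
  "fundamental D \<Phi> \<longleftrightarrow> (\<forall>i<m. sol D (\<Phi> i)) \<and> (\<forall>c. (\<forall>z\<in>D. lin_comb m c \<Phi> z = 0) \<longrightarrow> (\<forall>i<m. c i = 0))"

lemma sol_holomorphic: "sol D f \<Longrightarrow> f holomorphic_on D"
  by (simp add: sol_def)

lemma sol_eq:
  assumes "region D" "sol D f" "sol D g" "a \<in> D" "\<And>k. k < m \<Longrightarrow> (theta ^^ k) f a = (theta ^^ k) g a" "z \<in> D"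
  shows "f z = g z"
proof -
  have D: "open D" using assms by (simp add: region_def)
  define h where "h i = (if i = (0::nat) then f else g)" for i
  have "(theta ^^ k) (\<lambda>w. f w - g w) a = 0" if "k < m" for k
  proof -
    have "(theta ^^ k) (\<lambda>w. \<Sum>i\<in>{0,1}. (if i = 0 then 1 else -1) * h i w) a
      = (\<Sum>i\<in>{0,1}. (if i = 0 then 1 else -1) * (theta ^^ k) (h i) a)"
      by (rule theta_sum[OF D _ assms(4)]) (use assms in \<open>auto simp: h_def sol_def\<close>)
    then show ?thesis using assms(5)[OF that] by (simp add: h_def)
  qed
  then have "f z - g z = 0"
    using sol_unique[OF _ _ _ _ sol_diff[OF D assms(2,3)] assms(4) _ assms(6)] assms(1)
    by (simp add: region_def)
  then show ?thesis by simp
qed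

text \<open>The map from initial values at the centre of the star to those at \<open>b\<close> is injective by
  uniqueness, hence surjective.\<close>

lemma sol_exists:
  assumes D: "region D" "star_at a D" and \<kappa>: "\<kappa> \<noteq> 0" and b: "b \<in> D"
  shows "\<exists>f. sol D f \<and> (\<forall>k<m. (theta ^^ k) f b = v k)"
proof -
  have op: "open D" and nz: "0 \<notin> D" "1 \<notin> D" using D by (auto simp: region_def)
  have aD: "a \<in> D" using D(2) by (simp add: star_at_def)
  have "\<exists>f. sol D f \<and> (\<forall>k<m. (theta ^^ k) f a = (if k = i then 1 else 0))" for i :: nat
    by (rule sol_exists_centre[OF op D(2) nz \<kappa>, of "\<lambda>k. if k = i then 1 else 0"]) blast
  then obtain \<phi> where \<phi>: "\<And>i. sol D (\<phi> i)" "\<And>i k. k < m \<Longrightarrow> (theta ^^ k) (\<phi> i) a = (if k = i then 1 else 0)"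
    by metis
  have th: "(theta ^^ k) (lin_comb m c \<phi>) z = (\<Sum>i<m. (theta ^^ k) (\<phi> i) z * c i)" if "z \<in> D" for k z c
    by (rule theta_lin_comb[OF op _ that]) (use \<phi> sol_holomorphic in blast)
  have inj: "\<forall>i<m. c i = 0" if 0: "\<And>k. k < m \<Longrightarrow> (\<Sum>i<m. (theta ^^ k) (\<phi> i) b * c i) = 0" for c
  proof (intro allI impI)
    fix i assume i: "i < m"
    have con: "connected D" using D(1) by (simp add: region_def)
    have sl: "sol D (lin_comb m c \<phi>)" by (rule sol_lin_comb[OF op \<phi>(1)])
    have "lin_comb m c \<phi> z = 0" if "z \<in> D" for z
    proof (rule sol_unique[OF op con nz sl b _ that])
      fix k assume "k < m"
      then show "(theta ^^ k) (lin_comb m c \<phi>) b = 0" unfolding th[OF b] by (rule 0)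
    qed
    then have "(theta ^^ i) (lin_comb m c \<phi>) a = 0"
      using theta_cong[OF op, of "lin_comb m c \<phi>" "\<lambda>_. 0" a i] aD theta_zero by simp
    then show "c i = 0" using th[OF aD, of i c] \<phi>(2)[OF i] i by (simp add: if_distrib[of "\<lambda>x. x * _"] cong: if_cong)
  qed
  obtain c where "\<And>k. k < m \<Longrightarrow> (\<Sum>i<m. (theta ^^ k) (\<phi> i) b * c i) = v k"
    using solve_linear_system[of m "\<lambda>k i. (theta ^^ k) (\<phi> i) b" v] inj by blast
  then have "\<forall>k<m. (theta ^^ k) (lin_comb m c \<phi>) b = v k" using th[OF b] by simp
  moreover have "sol D (lin_comb m c \<phi>)" by (rule sol_lin_comb[OF op \<phi>(1)])
  ultimately show ?thesis by blast
qed

lemma fundamental_exists: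
  assumes D: "region D" "star_at a D" and \<kappa>: "\<kappa> \<noteq> 0" and b: "b \<in> D"
  obtains \<Phi> where "fundamental D \<Phi>" "\<And>i k. i < m \<Longrightarrow> k < m \<Longrightarrow> (theta ^^ k) (\<Phi> i) b = (if k = i then 1 else 0)"
proof -
  have op: "open D" using D by (auto simp: region_def)
  have "\<exists>f. sol D f \<and> (\<forall>k<m. (theta ^^ k) f b = (if k = i then 1 else 0))" for i :: nat
    by (rule sol_exists[OF D \<kappa> b])
  then obtain \<phi> where \<phi>: "\<And>i. sol D (\<phi> i)" "\<And>i k. k < m \<Longrightarrow> (theta ^^ k) (\<phi> i) b = (if k = i then 1 else 0)"
    by metis
  have "c i = 0" if z: "\<forall>z\<in>D. lin_comb m c \<phi> z = 0" and i: "i < m" for c i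
  proof -
    have "(theta ^^ i) (lin_comb m c \<phi>) b = 0"
      using theta_cong[OF op, of "lin_comb m c \<phi>" "\<lambda>_. 0" b i] b z theta_zero by simp
    moreover have "(theta ^^ i) (lin_comb m c \<phi>) b = (\<Sum>j<m. (theta ^^ i) (\<phi> j) b * c j)"
      by (rule theta_lin_comb[OF op _ b]) (use \<phi> sol_holomorphic in blast)
    ultimately show ?thesis using \<phi>(2)[OF i] i by (simp add: if_distrib[of "\<lambda>x. x * _"] cong: if_cong)
  qed
  then have "fundamental D \<phi>" using \<phi>(1) by (auto simp: fundamental_def)
  then show ?thesis using \<phi>(2) by (intro that) auto
qed

lemma fundamental_inj:
  assumes D: "region D" and \<Phi>: "fundamental D \<Phi>" and b: "b \<in> D"
    and 0: "\<And>k. k < m \<Longrightarrow> (\<Sum>i<m. (theta ^^ k) (\<Phi> i) b * c i) = 0"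
  shows "\<forall>i<m. c i = 0"
proof -
  have op: "open D" using D by (auto simp: region_def)
  have "(theta ^^ k) (lin_comb m c \<Phi>) b = (\<Sum>i<m. (theta ^^ k) (\<Phi> i) b * c i)" for k
    by (rule theta_lin_comb[OF op _ b]) (use \<Phi> in \<open>auto simp: fundamental_def sol_def\<close>)
  moreover have "sol D (lin_comb m c \<Phi>)" using \<Phi> by (intro sol_lin_comb op) (auto simp: fundamental_def)
  ultimately have "\<forall>z\<in>D. lin_comb m c \<Phi> z = 0"
    using sol_unique[of D "lin_comb m c \<Phi>" b] D b 0 by (auto simp: region_def)
  then show ?thesis using \<Phi> by (auto simp: fundamental_def)
qed

text \<open>A solution on a smaller region is a combination of the given system because its initial
  values at one point are; the map from coefficients to initial values is injective, hence onto.\<close>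

lemma fundamental_spans:
  assumes D: "region D" and \<Phi>: "fundamental D \<Phi>" and S: "region S" "S \<subseteq> D" and f: "sol S f"
  shows "\<exists>c. \<forall>z\<in>S. f z = lin_comb m c \<Phi> z"
proof (cases "S = {}")
  case False
  then obtain b where b: "b \<in> S" by blast
  have op: "open S" using S by (auto simp: region_def)
  obtain c where c: "\<And>k. k < m \<Longrightarrow> (\<Sum>i<m. (theta ^^ k) (\<Phi> i) b * c i) = (theta ^^ k) f b"
    using solve_linear_system[of m "\<lambda>k i. (theta ^^ k) (\<Phi> i) b" "\<lambda>k. (theta ^^ k) f b"]
      fundamental_inj[OF D \<Phi>] b S(2) by blast
  have sols: "\<And>i. i < m \<Longrightarrow> sol S (\<Phi> i)" using \<Phi> sol_subset[OF _ S(2)] by (auto simp: fundamental_def)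
  have "(theta ^^ k) (lin_comb m c \<Phi>) b = (\<Sum>i<m. (theta ^^ k) (\<Phi> i) b * c i)" for k
    by (rule theta_lin_comb[OF op _ b]) (use sols sol_holomorphic in blast)
  then have "(theta ^^ k) f b = (theta ^^ k) (lin_comb m c \<Phi>) b" if "k < m" for k
    using c[OF that] by simp
  note th = this
  have sl: "sol S (lin_comb m c \<Phi>)" by (rule sol_lin_comb[OF op sols])
  have "f z = lin_comb m c \<Phi> z" if "z \<in> S" for z
    by (rule sol_eq[OF S(1) f sl b th that])
  then show ?thesis by blast
qed auto

text \<open>Independence survives restriction to open subsets, by the identity theorem.\<close>

lemma fundamental_independent_on:
  assumes D: "region D" and \<Phi>: "fundamental D \<Phi>" and S: "open S" "S \<subseteq> D" "S \<noteq> {}"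
    and 0: "\<And>z. z \<in> S \<Longrightarrow> lin_comb m c \<Phi> z = 0"
  shows "\<forall>i<m. c i = 0"
proof -
  obtain b where b: "b \<in> S" using S by blast
  have "(\<Sum>i<m. (theta ^^ k) (\<Phi> i) b * c i) = 0" for k
  proof -
    have "(theta ^^ k) (lin_comb m c \<Phi>) b = (\<Sum>i<m. (theta ^^ k) (\<Phi> i) b * c i)"
      by (rule theta_lin_comb[OF S(1) _ b])
         (use \<Phi> S(2) in \<open>auto simp: fundamental_def sol_def intro: holomorphic_on_subset\<close>)
    then show ?thesis using theta_cong[OF S(1), of "lin_comb m c \<Phi>" "\<lambda>_. 0" b k] 0 b theta_zero by simp
  qed
  then show ?thesis using fundamental_inj[OF D \<Phi>, of b] b S by blast
qed

lemma local_solution_iff: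
  "local_solution (hyp_op p q) z f \<longleftrightarrow> (\<exists>e>0. sol (ball z e) f)"
proof
  assume "local_solution (hyp_op p q) z f"
  then obtain S e where S: "open S" "z \<in> S" "f holomorphic_on S" and e: "e > 0" "\<forall>w\<in>ball z e. hyp_op p q f w = 0"
    unfolding local_solution_def germ_eq_ball analytic_at by blast
  obtain e' where "e' > 0" "ball z e' \<subseteq> S" using S openE by blast
  moreover have "f holomorphic_on ball z (min e e')"
    by (rule holomorphic_on_subset[OF S(3)]) (use calculation in \<open>auto simp: subset_iff\<close>)
  ultimately show "\<exists>e>0. sol (ball z e) f" using e
    by (intro exI[of _ "min e e'"]) (auto simp: sol_def)
next
  assume "\<exists>e>0. sol (ball z e) f"
  then show "local_solution (hyp_op p q) z f"
    unfolding local_solution_def germ_eq_ball analytic_at sol_def using centre_in_ball open_ball by blast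
qed

lemma sol_imp_local_solution: "open D \<Longrightarrow> z \<in> D \<Longrightarrow> sol D f \<Longrightarrow> local_solution (hyp_op p q) z f"
  unfolding local_solution_iff by (metis openE sol_subset)

lemma local_solution_cong:
  "local_solution (hyp_op p q) z f \<Longrightarrow> germ_eq z f g \<Longrightarrow> local_solution (hyp_op p q) z g"
proof -
  assume "local_solution (hyp_op p q) z f" "germ_eq z f g"
  then obtain d e where "d > 0" "sol (ball z d) f" "e > 0" "\<forall>w\<in>ball z e. f w = g w"
    unfolding local_solution_iff germ_eq_ball by blast
  then have "sol (ball z (min d e)) g"
    by (intro sol_cong[of _ f g]) (auto intro: sol_subset)
  then show ?thesis unfolding local_solution_iff using \<open>d > 0\<close> \<open>e > 0\<close> by (metis min_less_iff_conj)
qed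

lemma small_ball_region:
  assumes "region D" "z \<in> D"
  obtains e where "e > 0" "ball z e \<subseteq> D" "\<And>d. d \<le> e \<Longrightarrow> region (ball z d)"
proof -
  obtain e where "e > 0" "ball z e \<subseteq> D" using assms openE unfolding region_def by blast
  moreover have "region (ball z d)" if "d \<le> e" for d
    using order.trans[OF subset_ball[OF that, of z] \<open>ball z e \<subseteq> D\<close>] assms(1) unfolding region_def
    by (simp only: open_ball connected_ball) blast
  ultimately show ?thesis by (rule that)
qed

lemma local_solution_lin_comb:
  assumes D: "region D" "z \<in> D" and \<Phi>: "fundamental D \<Phi>"
  shows "local_solution (hyp_op p q) z f \<longleftrightarrow> (\<exists>c. germ_eq z f (lin_comb m c \<Phi>))"
proof
  assume "local_solution (hyp_op p q) z f"
  then obtain d where d: "d > 0" "sol (ball z d) f" unfolding local_solution_iff by blast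
  obtain e where e: "e > 0" "ball z e \<subseteq> D" "\<And>d. d \<le> e \<Longrightarrow> region (ball z d)"
    using small_ball_region[OF D] by blast
  have "\<exists>c. \<forall>w\<in>ball z (min d e). f w = lin_comb m c \<Phi> w"
    by (rule fundamental_spans[OF D(1) \<Phi>]) (use d e in \<open>auto intro: sol_subset\<close>)
  then show "\<exists>c. germ_eq z f (lin_comb m c \<Phi>)" using d e unfolding germ_eq_ball by (metis min_less_iff_conj)
next
  assume "\<exists>c. germ_eq z f (lin_comb m c \<Phi>)"
  then obtain c where c: "germ_eq z f (lin_comb m c \<Phi>)" by blast
  have "sol D (lin_comb m c \<Phi>)" using D \<Phi> by (intro sol_lin_comb) (auto simp: fundamental_def region_def)
  then show "local_solution (hyp_op p q) z f"
    using local_solution_cong[OF sol_imp_local_solution germ_eq_sym[OF c]] D by (auto simp: region_def)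
qed

lemma fundamental_solution_basis:
  assumes D: "region D" "z \<in> D" and \<Phi>: "fundamental D \<Phi>"
  shows "solution_basis (hyp_op p q) z m \<Phi>"
  unfolding solution_basis_def
proof (intro conjI allI impI)
  fix i assume "i < m"
  then show "local_solution (hyp_op p q) z (\<Phi> i)"
    using \<Phi> D sol_imp_local_solution[of D z] by (auto simp: fundamental_def region_def)
next
  fix c i assume g: "germ_eq z (lin_comb m c \<Phi>) (\<lambda>_. 0)" and i: "i < m"
  obtain e where e: "e > 0" "\<forall>w\<in>ball z e. lin_comb m c \<Phi> w = 0" using g unfolding germ_eq_ball by blast
  have "open D" using D by (simp add: region_def)
  moreover have "z \<in> ball z e \<inter> D" using e D by simp
  then have "ball z e \<inter> D \<noteq> {}" by blast
  ultimately have "\<forall>i<m. c i = 0"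
    by (intro fundamental_independent_on[OF D(1) \<Phi>, of "ball z e \<inter> D" c]) (use e in auto)
  then show "c i = 0" using i by blast
next
  fix f assume "local_solution (hyp_op p q) z f"
  then show "\<exists>c. germ_eq z f (lin_comb m c \<Phi>)" using local_solution_lin_comb[OF D \<Phi>] by blast
qed

end

section \<open>Analytic continuation\<close>

text \<open>A continuation along the restriction of \<open>p\<close> to an interval, as a family of germs.\<close>

definition germ_family :: "(real \<Rightarrow> complex) \<Rightarrow> real \<Rightarrow> real \<Rightarrow> (real \<Rightarrow> complex \<Rightarrow> complex) \<Rightarrow> bool" where
  "germ_family p a b F \<longleftrightarrow> (\<forall>s\<in>{a..b}. F s analytic_on {p s}) \<and>
     (\<forall>s\<in>{a..b}. \<exists>d>0. \<forall>s'\<in>{a..b}. dist s' s < d \<longrightarrow> germ_eq (p s') (F s') (F s))"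

lemma continuation_along_germ_family:
  "continuation_along p f g \<longleftrightarrow> (\<exists>F. germ_family p 0 1 F \<and> germ_eq (p 0) (F 0) f \<and> germ_eq (p 1) (F 1) g)"
proof -
  have "(\<forall>\<^sub>F s' in at s within {0..1}. germ_eq (p s') (F s') (F s)) \<longleftrightarrow>
     (\<exists>d>0. \<forall>s'\<in>{0..1}. dist s' s < d \<longrightarrow> germ_eq (p s') (F s') (F s))" for F s
    unfolding eventually_at by (metis germ_eq_refl)
  then show ?thesis unfolding continuation_along_def germ_family_def pathstart_def pathfinish_def
    by (intro ex_cong1) auto
qed

lemma germ_family_const: "(\<And>s. a \<le> s \<Longrightarrow> s \<le> b \<Longrightarrow> f analytic_on {p s}) \<Longrightarrow> germ_family p a b (\<lambda>_. f)"
  unfolding germ_family_def by (auto intro: exI[of _ 1])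

lemma germ_family_reparam:
  assumes F: "germ_family p a b F" and \<phi>: "continuous_on {a'..b'} \<phi>" "\<And>s. s \<in> {a'..b'} \<Longrightarrow> \<phi> s \<in> {a..b}"
    and p': "\<And>s. s \<in> {a'..b'} \<Longrightarrow> p' s = p (\<phi> s)"
  shows "germ_family p' a' b' (\<lambda>s. F (\<phi> s))"
  unfolding germ_family_def
proof (intro conjI ballI)
  fix s assume s: "s \<in> {a'..b'}"
  show "F (\<phi> s) analytic_on {p' s}" using F \<phi>(2)[OF s] p'[OF s] by (auto simp: germ_family_def)
  obtain d where d: "d > 0" "\<And>s'. s' \<in> {a..b} \<Longrightarrow> dist s' (\<phi> s) < d \<Longrightarrow> germ_eq (p s') (F s') (F (\<phi> s))"
    using F \<phi>(2)[OF s] unfolding germ_family_def by blast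
  obtain e where "e > 0" "\<And>s'. s' \<in> {a'..b'} \<Longrightarrow> dist s' s < e \<Longrightarrow> dist (\<phi> s') (\<phi> s) < d"
    using \<phi>(1) s d(1) unfolding continuous_on_iff by blast
  then show "\<exists>d>0. \<forall>s'\<in>{a'..b'}. dist s' s < d \<longrightarrow> germ_eq (p' s') (F (\<phi> s')) (F (\<phi> s))"
    using d(2) \<phi>(2) p' by (metis (no_types, lifting))
qed

lemma germ_eq_eventually_along:
  assumes "continuous_on {a..b} p" "s \<in> {a..b}" "germ_eq (p s) f g"
  obtains d where "d > 0" "\<And>s'. s' \<in> {a..b} \<Longrightarrow> dist s' s < d \<Longrightarrow> germ_eq (p s') f g"
proof -
  obtain e where e: "e > 0" "\<forall>w\<in>ball (p s) e. f w = g w" using assms(3) unfolding germ_eq_ball by blast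
  obtain d where "d > 0" "\<And>s'. s' \<in> {a..b} \<Longrightarrow> dist s' s < d \<Longrightarrow> dist (p s') (p s) < e"
    using assms(1,2) e(1) unfolding continuous_on_iff by blast
  moreover have "germ_eq (p s') f g" if "dist (p s') (p s) < e" for s'
    using germ_eq_open[of "ball (p s) e" "p s'" f g] e that by (simp add: dist_commute)
  ultimately show ?thesis using that by blast
qed

lemma germ_family_join:
  assumes p: "continuous_on {a..c} p" and ab: "a \<le> b" "b \<le> c"
    and F: "germ_family p a b F" "germ_family p b c G" and eq: "germ_eq (p b) (F b) (G b)"
  shows "germ_family p a c (\<lambda>s. if s \<le> b then F s else G s)"
  unfolding germ_family_def
proof (intro conjI ballI)
  fix s assume s: "s \<in> {a..c}"
  show "(if s \<le> b then F s else G s) analytic_on {p s}" using F s by (auto simp: germ_family_def)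
  consider "s < b" | "s = b" | "s > b" by linarith
  then show "\<exists>d>0. \<forall>s'\<in>{a..c}. dist s' s < d \<longrightarrow>
      germ_eq (p s') (if s' \<le> b then F s' else G s') (if s \<le> b then F s else G s)"
  proof cases
    case 1
    obtain d where d: "d > 0" "\<And>s'. s' \<in> {a..b} \<Longrightarrow> dist s' s < d \<Longrightarrow> germ_eq (p s') (F s') (F s)"
      using F(1) s 1 unfolding germ_family_def by (metis atLeastAtMost_iff less_imp_le)
    then show ?thesis using 1 s by (intro exI[of _ "min d (b - s)"]) (auto simp: dist_real_def)
  next
    case 3
    obtain d where d: "d > 0" "\<And>s'. s' \<in> {b..c} \<Longrightarrow> dist s' s < d \<Longrightarrow> germ_eq (p s') (G s') (G s)"
      using F(2) s 3 unfolding germ_family_def by (metis atLeastAtMost_iff less_imp_le)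
    then show ?thesis using 3 s by (intro exI[of _ "min d (s - b)"]) (auto simp: dist_real_def)
  next
    case 2
    obtain d1 where d1: "d1 > 0" "\<And>s'. s' \<in> {a..b} \<Longrightarrow> dist s' b < d1 \<Longrightarrow> germ_eq (p s') (F s') (F b)"
      using F(1) ab unfolding germ_family_def by (metis atLeastAtMost_iff order_refl)
    obtain d2 where d2: "d2 > 0" "\<And>s'. s' \<in> {b..c} \<Longrightarrow> dist s' b < d2 \<Longrightarrow> germ_eq (p s') (G s') (G b)"
      using F(2) ab unfolding germ_family_def by (metis atLeastAtMost_iff order_refl)
    obtain d3 where d3: "d3 > 0" "\<And>s'. s' \<in> {a..c} \<Longrightarrow> dist s' b < d3 \<Longrightarrow> germ_eq (p s') (G b) (F b)"
      using germ_eq_eventually_along[OF p _ germ_eq_sym[OF eq]] ab by (metis atLeastAtMost_iff)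
    have "germ_eq (p s') (if s' \<le> b then F s' else G s') (F b)"
      if "s' \<in> {a..c}" "dist s' b < min d1 (min d2 d3)" for s'
      using that d1(2)[of s'] germ_eq_trans[OF d2(2)[of s'] d3(2)[of s']] by auto
    then show ?thesis using d1 d2 d3 2 by (intro exI[of _ "min d1 (min d2 d3)"]) auto
  qed
qed

lemma germ_family_analytic: "germ_family p a b F \<Longrightarrow> s \<in> {a..b} \<Longrightarrow> F s analytic_on {p s}"
  by (auto simp: germ_family_def)

text \<open>Connectedness of \<open>{0..1}\<close> in the form used for germs along a path: a property that spreads
  locally, in both directions, spreads from \<open>0\<close> to \<open>1\<close>.\<close>

lemma path_property_induct:
  fixes Q :: "real \<Rightarrow> bool"
  assumes "Q 0" and loc: "\<And>s. s \<in> {0..1} \<Longrightarrow>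
    \<exists>d>0. \<forall>s'\<in>{0..1}. \<forall>s''\<in>{0..1}. dist s' s < d \<longrightarrow> dist s'' s < d \<longrightarrow> Q s' \<longrightarrow> Q s''"
  shows "Q 1"
proof -
  have "0 \<le> (0::real) \<and> (1::real) \<le> 1 \<longrightarrow> Q 0 \<longrightarrow> Q 1"
  proof (rule Bolzano[where P="\<lambda>a b. 0 \<le> a \<and> b \<le> 1 \<longrightarrow> Q a \<longrightarrow> Q b" and a=0 and b=1])
    fix s :: real assume s: "0 \<le> s" "s \<le> 1"
    obtain d where d: "d > 0" "\<And>s' s''. s' \<in> {0..1} \<Longrightarrow> s'' \<in> {0..1} \<Longrightarrow> dist s' s < d \<Longrightarrow> dist s'' s < d \<Longrightarrow> Q s' \<Longrightarrow> Q s''"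
      using loc[of s] s by auto
    have "Q a \<Longrightarrow> Q b" if "a \<le> s" "s \<le> b" "b - a < d" "0 \<le> a" "b \<le> 1" for a b
      by (rule d(2)[of a b]) (use that in \<open>auto simp: dist_real_def\<close>)
    then show "\<exists>d>0. \<forall>a b. a \<le> s \<and> s \<le> b \<and> b - a < d \<longrightarrow> 0 \<le> a \<and> b \<le> 1 \<longrightarrow> Q a \<longrightarrow> Q b"
      using d(1) by blast
  qed auto
  then show ?thesis using assms(1) by simp
qed

text \<open>By the identity theorem, near a parameter \<open>s\<close> one coincidence of germs forces all others.\<close>

lemma germ_eq_propagate:
  assumes p: "continuous_on {0..1} p" and s: "s \<in> {0..1}" and fg: "f analytic_on {p s}" "g analytic_on {p s}"
  obtains d where "d > 0" "\<And>s' s''. s' \<in> {0..1} \<Longrightarrow> s'' \<in> {0..1} \<Longrightarrow> dist s' s < d \<Longrightarrow> dist s'' s < d \<Longrightarrow>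
     germ_eq (p s') f g \<Longrightarrow> germ_eq (p s'') f g"
proof -
  obtain e1 e2 where "e1 > 0" "f holomorphic_on ball (p s) e1" "e2 > 0" "g holomorphic_on ball (p s) e2"
    using fg unfolding analytic_on_def by auto
  then obtain e where e: "e > 0" "f holomorphic_on ball (p s) e" "g holomorphic_on ball (p s) e"
    by (metis holomorphic_on_subset min.cobounded1 min.cobounded2 min_less_iff_conj subset_ball)
  obtain d where d: "d > 0" "\<And>s'. s' \<in> {0..1} \<Longrightarrow> dist s' s < d \<Longrightarrow> p s' \<in> ball (p s) e"
    using p s e(1) unfolding continuous_on_iff mem_ball by (metis dist_commute)
  show ?thesis
  proof (rule that[OF d(1)])
    fix s' s'' assume s': "s' \<in> {0..1}" "s'' \<in> {0..1}" "dist s' s < d" "dist s'' s < d" "germ_eq (p s') f g"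
    then obtain r where r: "r > 0" "\<forall>w\<in>ball (p s') r. f w = g w" unfolding germ_eq_ball by blast
    have in_ball: "p s' \<in> ball (p s) e" "p s'' \<in> ball (p s) e" using d(2) s' by auto
    have "p s' \<in> ball (p s') r \<inter> ball (p s) e" using r in_ball by simp
    then have ne: "ball (p s') r \<inter> ball (p s) e \<noteq> {}" by blast
    have "f w = g w" if "w \<in> ball (p s) e" for w
      by (rule analytic_continuation_open[of "ball (p s') r \<inter> ball (p s) e" "ball (p s) e" f g w])
         (use r e ne that in auto)
    then show "germ_eq (p s'') f g" using germ_eq_open[of "ball (p s) e" "p s''" f g] in_ball by blast
  qed
qed

lemma germ_family_local:
  assumes "germ_family p 0 1 F" "s \<in> {0..1}"
  obtains d where "d > 0" "\<And>s'. s' \<in> {0..1} \<Longrightarrow> dist s' s < d \<Longrightarrow> germ_eq (p s') (F s') (F s)"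
  using assms unfolding germ_family_def by blast

lemma germ_family_unique:
  assumes p: "path p" and F: "germ_family p 0 1 F" "germ_family p 0 1 G" and 0: "germ_eq (p 0) (F 0) (G 0)"
  shows "germ_eq (p 1) (F 1) (G 1)"
proof (rule path_property_induct[of "\<lambda>s. germ_eq (p s) (F s) (G s)"])
  fix s :: real assume s: "s \<in> {0..1}"
  have pc: "continuous_on {0..1} p" using p by (simp add: path_def)
  obtain d1 where d1: "d1 > 0" "\<And>s'. s' \<in> {0..1} \<Longrightarrow> dist s' s < d1 \<Longrightarrow> germ_eq (p s') (F s') (F s)"
    by (rule germ_family_local[OF F(1) s]) blast
  obtain d2 where d2: "d2 > 0" "\<And>s'. s' \<in> {0..1} \<Longrightarrow> dist s' s < d2 \<Longrightarrow> germ_eq (p s') (G s') (G s)"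
    by (rule germ_family_local[OF F(2) s]) blast
  obtain d3 where d3: "d3 > 0" "\<And>s' s''. s' \<in> {0..1} \<Longrightarrow> s'' \<in> {0..1} \<Longrightarrow> dist s' s < d3 \<Longrightarrow> dist s'' s < d3 \<Longrightarrow>
     germ_eq (p s') (F s) (G s) \<Longrightarrow> germ_eq (p s'') (F s) (G s)"
    using germ_eq_propagate[OF pc s germ_family_analytic[OF F(1) s] germ_family_analytic[OF F(2) s]] by blast
  have "germ_eq (p s'') (F s'') (G s'')"
    if "s' \<in> {0..1}" "s'' \<in> {0..1}" "dist s' s < min d1 (min d2 d3)" "dist s'' s < min d1 (min d2 d3)"
      "germ_eq (p s') (F s') (G s')" for s' s''
  proof -
    have "germ_eq (p s') (F s) (G s)"
    proof -
      have "germ_eq (p s') (F s) (F s')" "germ_eq (p s') (G s') (G s)"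
        using germ_eq_sym[OF d1(2)[of s']] d2(2)[of s'] that by auto
      from germ_eq_trans[OF this(1) germ_eq_trans[OF that(5) this(2)]] show ?thesis .
    qed
    with that have mid: "germ_eq (p s'') (F s) (G s)" by (intro d3(2)[of s' s'']) auto
    have "germ_eq (p s'') (F s'') (F s)" "germ_eq (p s'') (G s) (G s'')"
      using germ_eq_sym[OF d2(2)[of s'']] d1(2)[of s''] that by auto
    from germ_eq_trans[OF this(1) germ_eq_trans[OF mid this(2)]] show ?thesis .
  qed
  moreover have "0 < min d1 (min d2 d3)" using d1(1) d2(1) d3(1) by simp
  ultimately show "\<exists>d>0. \<forall>s'\<in>{0..1}. \<forall>s''\<in>{0..1}. dist s' s < d \<longrightarrow> dist s'' s < d \<longrightarrow>
      germ_eq (p s') (F s') (G s') \<longrightarrow> germ_eq (p s'') (F s'') (G s'')"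
    by blast
qed (rule 0)

lemma continuation_along_unique:
  assumes "path p" "continuation_along p f g" "continuation_along p f' g'" "germ_eq (pathstart p) f f'"
  shows "germ_eq (pathfinish p) g g'"
proof -
  obtain F where F: "germ_family p 0 1 F" "germ_eq (p 0) (F 0) f" "germ_eq (p 1) (F 1) g"
    using assms(2) unfolding continuation_along_germ_family by blast
  obtain G where G: "germ_family p 0 1 G" "germ_eq (p 0) (G 0) f'" "germ_eq (p 1) (G 1) g'"
    using assms(3) unfolding continuation_along_germ_family by blast
  have "germ_eq (p 0) (F 0) (G 0)"
    using germ_eq_trans[OF F(2) germ_eq_trans[OF _ germ_eq_sym[OF G(2)]]] assms(4) by (simp add: pathstart_def)
  from germ_family_unique[OF assms(1) F(1) G(1) this] show ?thesis
    using germ_eq_trans[OF germ_eq_sym[OF F(3)] germ_eq_trans[OF _ G(3)]] by (simp add: pathfinish_def)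
qed

lemma continuation_along_cong:
  "continuation_along p f g \<Longrightarrow> germ_eq (pathstart p) f f' \<Longrightarrow> germ_eq (pathfinish p) g g' \<Longrightarrow> continuation_along p f' g'"
  unfolding continuation_along_def by (metis germ_eq_trans)

lemma continuation_along_join:
  assumes "path p" "path q" "pathfinish p = pathstart q" "continuation_along p f g" "continuation_along q g h"
  shows "continuation_along (p +++ q) f h"
proof -
  obtain F where F: "germ_family p 0 1 F" "germ_eq (p 0) (F 0) f" "germ_eq (p 1) (F 1) g"
    using assms(4) unfolding continuation_along_germ_family by blast
  obtain G where G: "germ_family q 0 1 G" "germ_eq (q 0) (G 0) g" "germ_eq (q 1) (G 1) h"
    using assms(5) unfolding continuation_along_germ_family by blast
  have mid: "p 1 = q 0" using assms(3) by (simp add: pathstart_def pathfinish_def)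
  have "path (p +++ q)" using assms by simp
  then have c: "continuous_on {0..1} (p +++ q)" by (simp add: path_def)
  have 1: "germ_family (p +++ q) 0 (1/2) (\<lambda>s. F (2 * s))"
    by (rule germ_family_reparam[OF F(1)]) (auto simp: joinpaths_def intro!: continuous_intros)
  have 2: "germ_family (p +++ q) (1/2) 1 (\<lambda>s. G (2 * s - 1))"
  proof (rule germ_family_reparam[OF G(1)])
    fix s :: real assume "s \<in> {1/2..1}"
    moreover have "(p +++ q) (1/2) = q (2 * (1/2) - 1)" using mid by (simp add: joinpaths_def)
    ultimately show "(p +++ q) s = q (2 * s - 1)"
      by (cases "s = 1/2") (simp only:, simp add: joinpaths_def)
  qed (auto intro!: continuous_intros)
  have "germ_family (p +++ q) 0 1 (\<lambda>s. if s \<le> 1/2 then F (2 * s) else G (2 * s - 1))"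
    by (rule germ_family_join[OF c _ _ 1 2])
       (use germ_eq_trans[OF F(3)[unfolded mid] germ_eq_sym[OF G(2)]] mid in \<open>auto simp: joinpaths_def\<close>)
  then show ?thesis unfolding continuation_along_germ_family
    by (intro exI[of _ "\<lambda>s. if s \<le> 1/2 then F (2 * s) else G (2 * s - 1)"] conjI)
       (use F G in \<open>auto simp: joinpaths_def\<close>)
qed

lemma continuation_along_reverse:
  assumes "continuation_along p f g"
  shows "continuation_along (reversepath p) g f"
proof -
  obtain F where F: "germ_family p 0 1 F" "germ_eq (p 0) (F 0) f" "germ_eq (p 1) (F 1) g"
    using assms unfolding continuation_along_germ_family by blast
  have "germ_family (reversepath p) 0 1 (\<lambda>s. F (1 - s))"
    by (rule germ_family_reparam[OF F(1)]) (auto simp: reversepath_def intro!: continuous_intros)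
  then show ?thesis unfolding continuation_along_germ_family
    by (intro exI[of _ "\<lambda>s. F (1 - s)"] conjI) (use F in \<open>auto simp: reversepath_def\<close>)
qed

lemma continuation_along_lin_comb:
  assumes "path l" "\<And>j. j < m \<Longrightarrow> continuation_along l (f j) (g j)"
  shows "continuation_along l (lin_comb m c f) (lin_comb m c g)"
proof -
  have "\<exists>F. germ_family l 0 1 F \<and> germ_eq (l 0) (F 0) (f j) \<and> germ_eq (l 1) (F 1) (g j)" if "j < m" for j
    using assms(2)[OF that] unfolding continuation_along_germ_family .
  then obtain F where F: "\<And>j. j < m \<Longrightarrow> germ_family l 0 1 (F j)" "\<And>j. j < m \<Longrightarrow> germ_eq (l 0) (F j 0) (f j)"
    "\<And>j. j < m \<Longrightarrow> germ_eq (l 1) (F j 1) (g j)" by metis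
  have "germ_family l 0 1 (\<lambda>s. lin_comb m c (\<lambda>j. F j s))"
    unfolding germ_family_def
  proof (intro conjI ballI)
    fix s :: real assume s: "s \<in> {0..1}"
    show "lin_comb m c (\<lambda>j. F j s) analytic_on {l s}"
      unfolding lin_comb_def by (intro analytic_intros) (use F(1) s germ_family_analytic in blast)
    have "\<exists>d>0. \<forall>s'\<in>{0..1}. dist s' s < d \<longrightarrow> germ_eq (l s') (F j s') (F j s)" if "j < m" for j
      using F(1)[OF that] s unfolding germ_family_def by blast
    then obtain d where d: "\<And>j. j < m \<Longrightarrow> d j > 0"
      "\<And>j s'. j < m \<Longrightarrow> s' \<in> {0..1} \<Longrightarrow> dist s' s < d j \<Longrightarrow> germ_eq (l s') (F j s') (F j s)" by metis
    have "\<exists>e>0. \<forall>j<m. e \<le> d j"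
      using d(1) by (intro exI[of _ "Min (insert 1 (d ` {..<m}))"]) auto
    then obtain e where e: "e > 0" "\<And>j. j < m \<Longrightarrow> e \<le> d j" by blast
    have "germ_eq (l s') (lin_comb m c (\<lambda>j. F j s')) (lin_comb m c (\<lambda>j. F j s))"
      if "s' \<in> {0..1}" "dist s' s < e" for s'
      by (rule germ_eq_lin_comb) (use d(2) e(2) that in \<open>meson order.strict_trans2\<close>)
    then show "\<exists>d>0. \<forall>s'\<in>{0..1}. dist s' s < d \<longrightarrow>
        germ_eq (l s') (lin_comb m c (\<lambda>j. F j s')) (lin_comb m c (\<lambda>j. F j s))" using e(1) by blast
  qed
  moreover have "germ_eq (l 0) (lin_comb m c (\<lambda>j. F j 0)) (lin_comb m c f)"
    "germ_eq (l 1) (lin_comb m c (\<lambda>j. F j 1)) (lin_comb m c g)"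
    by (rule germ_eq_lin_comb, use F in blast)+
  ultimately show ?thesis unfolding continuation_along_germ_family by blast
qed

section \<open>Frobenius series as contour integrals\<close>

text \<open>With \<open>x = log t\<close> the equation reads \<open>P(d/dx) u = exp x * Q(d/dx) u\<close>. Its Frobenius solutions
  at \<open>x = -\<infinity>\<close> are the series \<open>\<Sum>k. c k z * exp ((z + k) x)\<close> at the exponents \<open>z = \<rho> i\<close>, together
  with derivatives in \<open>z\<close> when exponents coincide. Integrating the series with a free exponent
  \<open>z\<close>, divided by \<open>P z\<close>, over a circle around the exponents yields all of them at once, without
  logarithms and without distinguishing multiplicities.\<close>

definition diff_op :: "complex poly \<Rightarrow> (complex \<Rightarrow> complex) \<Rightarrow> complex \<Rightarrow> complex" where
  "diff_op p f x = (\<Sum>k\<le>degree p. Polynomial.coeff p k * (deriv ^^ k) f x)"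

text \<open>All exponents lie in a disc of radius \<open>1/2\<close>, so no two of them differ by a nonzero integer.\<close>

locale frobenius =
  fixes m :: nat and \<rho> :: "nat \<Rightarrow> complex" and Q :: "complex poly" and z0 :: complex
  assumes near: "\<And>i. i < m \<Longrightarrow> cmod (\<rho> i - z0) < 1/2" and degQ: "degree Q \<le> m"
begin

definition P :: "complex poly" where "P = (\<Prod>i<m. [:- \<rho> i, 1:])"

lemma poly_P: "poly P z = (\<Prod>i<m. z - \<rho> i)"
  by (simp add: P_def poly_prod)

text \<open>The margin by which the exponents stay inside the disc; it allows the contour to be moved
  slightly outwards.\<close>

definition \<delta> :: real where "\<delta> = 1/2 - Max (insert 0 ((\<lambda>i. cmod (\<rho> i - z0)) ` {..<m}))"

lemma \<delta>: "0 < \<delta>" "\<delta> \<le> 1/2" "i < m \<Longrightarrow> cmod (\<rho> i - z0) \<le> 1/2 - \<delta>"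
proof -
  let ?A = "insert 0 ((\<lambda>i. cmod (\<rho> i - z0)) ` {..<m})"
  have "Max ?A < 1/2" using near by (subst Max_less_iff) auto
  moreover have "0 \<le> Max ?A" by (intro Max_ge) auto
  moreover have "cmod (\<rho> i - z0) \<le> Max ?A" if "i < m" using that by (intro Max_ge) auto
  ultimately show "0 < \<delta>" "\<delta> \<le> 1/2" "i < m \<Longrightarrow> cmod (\<rho> i - z0) \<le> 1/2 - \<delta>" by (auto simp: \<delta>_def)
qed

lemma dist_exponent:
  assumes "i < m"
  shows "cmod (z + of_nat n - \<rho> i) \<ge> n - cmod (z - z0) - (1/2 - \<delta>)"
proof -
  have "of_nat n = (z + of_nat n - \<rho> i) - (z - z0) + (\<rho> i - z0)" by simp
  then have "real n = cmod ((z + of_nat n - \<rho> i) - (z - z0) + (\<rho> i - z0))" by (metis norm_of_nat)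
  also have "\<dots> \<le> cmod (z + of_nat n - \<rho> i) + cmod (z - z0) + cmod (\<rho> i - z0)"
    by (meson add_right_mono norm_triangle_ineq norm_triangle_ineq4 order_trans)
  finally show ?thesis using \<delta>(3)[OF assms] by linarith
qed

lemma P_nonzero: "cmod (z - z0) < 1/2 + \<delta> \<Longrightarrow> poly P (z + of_nat (Suc n)) \<noteq> 0"
proof -
  assume z: "cmod (z - z0) < 1/2 + \<delta>"
  have "z + of_nat (Suc n) - \<rho> i \<noteq> 0" if "i < m" for i
  proof -
    have "real (Suc n) - cmod (z - z0) - (1/2 - \<delta>) > 0" using z by simp
    then show ?thesis using dist_exponent[OF that, of "Suc n" z] by auto
  qed
  then show ?thesis by (simp add: poly_P del: of_nat_Suc)
qed

lemma P_circle: "cmod (z - z0) = 1/2 \<Longrightarrow> poly P z \<noteq> 0"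
  by (auto simp: poly_P dest: near)

definition C :: real where
  "C = (\<Sum>k\<le>degree Q. cmod (Polynomial.coeff Q k) * (cmod z0 + 1) ^ k) / \<delta> ^ m"

lemma C_nonneg: "C \<ge> 0"
  unfolding C_def using \<delta>(1) by (intro divide_nonneg_nonneg sum_nonneg) auto

text \<open>Because \<open>deg Q \<le> deg P\<close>, the coefficient ratios stay bounded, uniformly on the circle and in
  \<open>n\<close>.\<close>

lemma norm_ratio_le:
  assumes z: "cmod (z - z0) = 1/2"
  shows "cmod (poly Q (z + of_nat n) / poly P (z + of_nat (Suc n))) \<le> C"
proof -
  have "(\<delta> * real (Suc n)) ^ m = (\<Prod>i<m. \<delta> * real (Suc n))" by simp
  also have "\<dots> \<le> (\<Prod>i<m. cmod (z + of_nat (Suc n) - \<rho> i))"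
  proof (rule prod_mono)
    fix i assume i: "i \<in> {..<m}"
    have "\<delta> * real (Suc n) \<le> real n + \<delta>"
      using \<delta>(1,2) mult_right_mono[of \<delta> 1 "real n"] by (simp add: algebra_simps)
    also have "\<dots> = real (Suc n) - cmod (z - z0) - (1/2 - \<delta>)" using z by simp
    also have "\<dots> \<le> cmod (z + of_nat (Suc n) - \<rho> i)" using dist_exponent[of i "Suc n" z] i by simp
    finally show "0 \<le> \<delta> * real (Suc n) \<and> \<delta> * real (Suc n) \<le> cmod (z + of_nat (Suc n) - \<rho> i)"
      using \<delta>(1) by simp
  qed
  finally have lower: "(\<delta> * real (Suc n)) ^ m \<le> cmod (poly P (z + of_nat (Suc n)))"
    by (simp add: poly_P prod_norm del: of_nat_Suc)
  have zn: "cmod (z + of_nat n) \<le> (cmod z0 + 1) * real (Suc n)"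
  proof -
    have "z + of_nat n = z0 + (z - z0) + of_nat n" by simp
    then have "cmod (z + of_nat n) \<le> cmod z0 + cmod (z - z0) + real n"
      by (metis (no_types, lifting) add_mono norm_of_nat norm_triangle_le order_refl norm_triangle_ineq)
    also have "\<dots> \<le> (cmod z0 + 1) * real (Suc n)" 
    proof -
      have "(cmod z0 + 1) * real (Suc n) = cmod z0 + 1 + real n * cmod z0 + real n" by (simp add: algebra_simps)
      moreover have "real n * cmod z0 \<ge> 0" by simp
      ultimately show ?thesis using z by linarith
    qed
    finally show ?thesis .
  qed
  have "cmod (poly Q (z + of_nat n)) \<le> (\<Sum>k\<le>degree Q. cmod (Polynomial.coeff Q k) * ((cmod z0 + 1) ^ k * real (Suc n) ^ m))"
    unfolding poly_altdef
  proof (rule sum_norm_le)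
    fix k assume k: "k \<in> {..degree Q}"
    have "cmod (z + of_nat n) ^ k \<le> ((cmod z0 + 1) * real (Suc n)) ^ k" by (rule power_mono[OF zn]) simp
    also have "\<dots> = (cmod z0 + 1) ^ k * real (Suc n) ^ k" by (rule power_mult_distrib)
    also have "\<dots> \<le> (cmod z0 + 1) ^ k * real (Suc n) ^ m"
      using k degQ by (intro mult_left_mono power_increasing) auto
    finally show "cmod (Polynomial.coeff Q k * (z + of_nat n) ^ k)
      \<le> cmod (Polynomial.coeff Q k) * ((cmod z0 + 1) ^ k * real (Suc n) ^ m)"
      by (simp add: norm_mult norm_power mult_left_mono)
  qed
  also have "\<dots> = C * (\<delta> * real (Suc n)) ^ m"
    using \<delta>(1) by (simp add: C_def power_mult_distrib sum_distrib_left sum_distrib_right sum_divide_distrib mult_ac)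
  also have "\<dots> \<le> C * cmod (poly P (z + of_nat (Suc n)))" by (rule mult_left_mono[OF lower C_nonneg])
  finally show ?thesis
    using P_nonzero[of z n] z \<delta>(1) by (simp add: norm_divide divide_le_eq del: of_nat_Suc)
qed

text \<open>The solution of \<open>c (k + 1) * P (z + k + 1) = c k * Q (z + k)\<close> with \<open>c 0 = 1\<close>.\<close>

definition series_coeff :: "nat \<Rightarrow> complex \<Rightarrow> complex" where
  "series_coeff k z = (\<Prod>i<k. poly Q (z + of_nat i) / poly P (z + of_nat (Suc i)))"

lemma series_coeff_0 [simp]: "series_coeff 0 z = 1"
  by (simp add: series_coeff_def)

lemma series_coeff_Suc: "cmod (z - z0) < 1/2 + \<delta> \<Longrightarrow> series_coeff (Suc k) z * poly P (z + of_nat (Suc k)) = series_coeff k z * poly Q (z + of_nat k)"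
  using P_nonzero[of z k] by (simp add: series_coeff_def del: of_nat_Suc)

lemma norm_series_coeff_le: "cmod (z - z0) = 1/2 \<Longrightarrow> cmod (series_coeff k z) \<le> C ^ k"
proof (induction k)
  case (Suc k)
  have "cmod (series_coeff (Suc k) z) = cmod (series_coeff k z) * cmod (poly Q (z + of_nat k) / poly P (z + of_nat (Suc k)))"
    unfolding series_coeff_def prod.lessThan_Suc by (rule norm_mult)
  also have "\<dots> \<le> C ^ k * C" by (intro mult_mono Suc norm_ratio_le) (use C_nonneg in auto)
  finally show ?case by (simp add: mult.commute)
qed simp

lemma holomorphic_series_coeff: "series_coeff k holomorphic_on ball z0 (1/2 + \<delta>)"
  unfolding series_coeff_def[abs_def]
proof (intro holomorphic_on_prod holomorphic_on_divide)
  fix i z assume "z \<in> ball z0 (1/2 + \<delta>)"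
  then show "poly P (z + of_nat (Suc i)) \<noteq> 0" by (intro P_nonzero) (simp add: dist_norm norm_minus_commute)
qed (intro holomorphic_intros)+

text \<open>The weight \<open>h\<close> is an entire function that selects a solution, and \<open>g\<close> is a polynomial:
  inserting \<open>g (z + k)\<close> amounts to applying \<open>g(d/dx)\<close> to the series.\<close>

definition integrand :: "(complex \<Rightarrow> complex) \<Rightarrow> complex poly \<Rightarrow> nat \<Rightarrow> complex \<Rightarrow> complex \<Rightarrow> complex" where
  "integrand h g k x z = h z * series_coeff k z / poly P z * poly g (z + of_nat k) * exp ((z + of_nat k) * x)"

definition T :: "(complex \<Rightarrow> complex) \<Rightarrow> complex poly \<Rightarrow> nat \<Rightarrow> complex \<Rightarrow> complex" where
  "T h g k x = contour_integral (circlepath z0 (1/2)) (integrand h g k x)"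

definition F :: "(complex \<Rightarrow> complex) \<Rightarrow> complex poly \<Rightarrow> complex \<Rightarrow> complex" where
  "F h g x = (\<Sum>k. T h g k x)"

lemma circle_subset: "sphere z0 (1/2) \<subseteq> ball z0 (1/2 + \<delta>)"
  using \<delta>(1) by (auto simp: dist_norm)

lemma continuous_weight:
  assumes "h holomorphic_on UNIV"
  shows "continuous_on (sphere z0 (1/2)) (\<lambda>z. h z * series_coeff k z / poly P z * poly g (z + of_nat k))"
proof -
  have "continuous_on (sphere z0 (1/2)) h" "continuous_on (sphere z0 (1/2)) (series_coeff k)"
    using assms holomorphic_series_coeff[of k] circle_subset
    by (meson continuous_on_subset holomorphic_on_imp_continuous_on subset_UNIV)+
  then show ?thesis
    by (intro continuous_intros) (use P_circle in \<open>auto simp: dist_norm norm_minus_commute\<close>)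
qed

lemma has_contour_integral_T:
  assumes "h holomorphic_on UNIV"
  shows "(integrand h g k x has_contour_integral T h g k x) (circlepath z0 (1/2))"
proof -
  have "continuous_on (sphere z0 (1/2)) (integrand h g k x)"
    unfolding integrand_def by (intro continuous_on_mult continuous_weight assms continuous_intros)
  then show ?thesis unfolding T_def
    by (intro has_contour_integral_integral contour_integrable_continuous_circlepath) simp
qed

text \<open>Growth of \<open>g (z + k)\<close> in \<open>k\<close> is absorbed in the exponential \<open>exp k\<close>, whence the factor
  \<open>exp 1\<close> in the ratio of the majorizing geometric series.\<close>

lemma poly_exp_bound: "cmod (poly g z) \<le> (\<Sum>i\<le>degree g. cmod (Polynomial.coeff g i) * fact i) * exp (cmod z)"
  unfolding poly_altdef sum_distrib_right
proof (rule sum_norm_le)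
  fix i
  have "cmod z ^ i / fact i \<le> exp (cmod z)"
  proof -
    have "(\<Sum>k\<in>{i}. cmod z ^ k /\<^sub>R fact k) \<le> (\<Sum>k. cmod z ^ k /\<^sub>R fact k)"
      by (rule sum_le_suminf[OF summable_exp_generic]) auto
    then show ?thesis by (simp add: exp_def divide_inverse mult.commute)
  qed
  then have "cmod z ^ i \<le> fact i * exp (cmod z)" by (simp add: divide_le_eq mult.commute)
  then have "cmod (Polynomial.coeff g i) * cmod z ^ i \<le> cmod (Polynomial.coeff g i) * (fact i * exp (cmod z))"
    by (rule mult_left_mono) simp
  then show "cmod (Polynomial.coeff g i * z ^ i) \<le> cmod (Polynomial.coeff g i) * fact i * exp (cmod z)"
    by (simp add: norm_mult norm_power mult_ac)
qed

lemma norm_T_le: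
  assumes h: "h holomorphic_on UNIV"
  obtains K where "K \<ge> 0" "\<And>k x E. (\<And>z. cmod (z - z0) = 1/2 \<Longrightarrow> cmod (exp (z * x)) \<le> E) \<Longrightarrow>
     cmod (T h g k x) \<le> K * (C * exp 1 * exp (Re x)) ^ k * E"
proof -
  have "continuous_on (sphere z0 (1/2)) (\<lambda>z. h z / poly P z)"
    using continuous_weight[OF h, of 0 1] by simp
  then have "bounded ((\<lambda>z. h z / poly P z) ` sphere z0 (1/2))"
    by (intro compact_imp_bounded compact_continuous_image) auto
  then obtain K1 where K1': "\<forall>y\<in>(\<lambda>z. h z / poly P z) ` sphere z0 (1/2). cmod y \<le> K1"
    unfolding bounded_iff by blast
  have K1: "cmod (h z / poly P z) \<le> K1" if "cmod (z - z0) = 1/2" for z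
    using K1' that by (auto simp: dist_norm norm_minus_commute)
  define G where "G = (\<Sum>i\<le>degree g. cmod (Polynomial.coeff g i) * fact i)"
  have G0: "G \<ge> 0" unfolding G_def by (intro sum_nonneg) auto
  have "cmod ((z0 + 1/2) - z0) = 1/2" by (simp add: norm_divide)
  from K1[OF this] have K10: "K1 \<ge> 0" using norm_ge_zero order_trans by blast
  define R where "R = cmod z0 + 1/2"
  show ?thesis
  proof (rule that[of "K1 * G * exp R * pi"])
    show "0 \<le> K1 * G * exp R * pi" using K10 G0 by simp
    fix k x E assume E: "\<And>z. cmod (z - z0) = 1/2 \<Longrightarrow> cmod (exp (z * x)) \<le> E"
    have "cmod ((z0 + 1/2) - z0) = 1/2" by (simp add: norm_divide)
    from E[OF this] have E0: "E \<ge> 0" using norm_ge_zero order_trans by blast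
    let ?B = "K1 * G * exp R * (C * exp 1 * exp (Re x)) ^ k * E"
    have "cmod (T h g k x) \<le> ?B * (2 * pi * (1/2))"
    proof (rule has_contour_integral_bound_circlepath[OF has_contour_integral_T[OF h]])
      show "0 \<le> ?B" using K10 G0 E0 C_nonneg by simp
      fix z assume z: "cmod (z - z0) = 1/2"
      have zR: "cmod (z + of_nat k) \<le> R + real k"
      proof -
        have "z + of_nat k = z0 + (z - z0) + of_nat k" by simp
        then have "cmod (z + of_nat k) \<le> cmod z0 + cmod (z - z0) + real k"
          by (metis (no_types, lifting) add_mono norm_of_nat norm_triangle_le order_refl norm_triangle_ineq)
        then show ?thesis using z by (simp add: R_def)
      qed
      have "cmod (poly g (z + of_nat k)) \<le> G * exp (cmod (z + of_nat k))"
        unfolding G_def by (rule poly_exp_bound)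
      also have "\<dots> \<le> G * exp (R + real k)" using zR G0 by (intro mult_left_mono) auto
      finally have 1: "cmod (poly g (z + of_nat k)) \<le> G * exp (R + real k)" .
      have "cmod (exp ((z + of_nat k) * x)) = cmod (exp (z * x)) * exp (Re x) ^ k"
        by (simp add: distrib_right exp_add norm_mult norm_exp_eq_Re norm_power exp_of_nat_mult)
      also have "\<dots> \<le> E * exp (Re x) ^ k" by (rule mult_right_mono[OF E[OF z]]) simp
      finally have 2: "cmod (exp ((z + of_nat k) * x)) \<le> E * exp (Re x) ^ k" .
      have "cmod (integrand h g k x z) = cmod (h z / poly P z) * cmod (series_coeff k z) *
          cmod (poly g (z + of_nat k)) * cmod (exp ((z + of_nat k) * x))"
        by (simp add: integrand_def norm_mult norm_divide)
      also have "\<dots> \<le> K1 * C ^ k * (G * exp (R + real k)) * (E * exp (Re x) ^ k)"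
        by (intro mult_mono K1 norm_series_coeff_le z 1 2) (use K10 C_nonneg G0 E0 in auto)
      also have "\<dots> = ?B" by (simp add: exp_add power_mult_distrib exp_of_nat_mult[of k 1, simplified] mult_ac)
      finally show "cmod (integrand h g k x z) \<le> ?B" .
    qed simp
    then show "cmod (T h g k x) \<le> K1 * G * exp R * pi * (C * exp 1 * exp (Re x)) ^ k * E"
      by (simp add: mult_ac)
  qed
qed

text \<open>On \<open>Re x < - X\<close> the ratio of the majorizing geometric series is at most \<open>1/2\<close>.\<close>

definition X :: real where "X = ln (2 * (C * exp 1) + 1)"

definition H :: "complex set" where "H = {x. Re x < - X}"

lemma ratio_H: "x \<in> H \<Longrightarrow> C * exp 1 * exp (Re x) \<le> 1/2"
proof -
  assume "x \<in> H"
  have c: "C * exp 1 \<ge> 0" using C_nonneg by simp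
  have "exp (Re x) \<le> exp (- X)" using \<open>x \<in> H\<close> by (simp add: H_def)
  also have "\<dots> = 1 / (2 * (C * exp 1) + 1)" using c by (simp add: X_def exp_minus inverse_eq_divide)
  finally have "C * exp 1 * exp (Re x) \<le> C * exp 1 * (1 / (2 * (C * exp 1) + 1))"
    using c by (rule mult_left_mono)
  also have "\<dots> \<le> 1/2" using c by (simp add: divide_simps)
  finally show ?thesis .
qed

lemma open_H: "open H"
  unfolding H_def by (rule open_halfspace_Re_lt)

lemma T_majorant:
  assumes h: "h holomorphic_on UNIV" and S: "S \<subseteq> H" "bounded S"
  obtains M where "summable M" "\<And>k x. x \<in> S \<Longrightarrow> cmod (T h g k x) \<le> M k"
proof -
  obtain r where r: "\<And>x. x \<in> S \<Longrightarrow> cmod x \<le> r" using S(2) unfolding bounded_iff by blast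
  obtain K where K: "K \<ge> 0" "\<And>k x E. (\<And>z. cmod (z - z0) = 1/2 \<Longrightarrow> cmod (exp (z * x)) \<le> E) \<Longrightarrow>
     cmod (T h g k x) \<le> K * (C * exp 1 * exp (Re x)) ^ k * E" using norm_T_le[OF h] by blast
  define E where "E = exp ((cmod z0 + 1/2) * r)"
  have "cmod (T h g k x) \<le> K * (1/2) ^ k * E" if x: "x \<in> S" for k x
  proof -
    have "cmod (exp (z * x)) \<le> E" if z: "cmod (z - z0) = 1/2" for z
    proof -
      have "cmod z \<le> cmod z0 + 1/2" using norm_triangle_ineq[of z0 "z - z0"] z by simp
      then have "cmod z * cmod x \<le> (cmod z0 + 1/2) * r" using r[OF x] by (intro mult_mono) auto
      then have "Re (z * x) \<le> (cmod z0 + 1/2) * r"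
        using complex_Re_le_cmod[of "z * x"] norm_mult[of z x] by linarith
      then show ?thesis by (simp add: E_def norm_exp_eq_Re del: times_complex.sel)
    qed
    then have "cmod (T h g k x) \<le> K * (C * exp 1 * exp (Re x)) ^ k * E" by (rule K(2))
    also have "\<dots> \<le> K * (1/2) ^ k * E"
      using ratio_H[of x] S(1) x K(1) C_nonneg
      by (intro mult_right_mono mult_left_mono power_mono) (auto simp: E_def)
    finally show ?thesis .
  qed
  moreover have "summable (\<lambda>k. K * (1/2) ^ k * E)"
    by (intro summable_mult summable_mult2 summable_geometric) simp
  ultimately show ?thesis using that by blast
qed

lemma T_summable: "h holomorphic_on UNIV \<Longrightarrow> x \<in> H \<Longrightarrow> summable (\<lambda>k. T h g k x)"
proof -
  assume "h holomorphic_on UNIV" "x \<in> H"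
  then obtain M where M: "summable M" "\<And>k y. y \<in> {x} \<Longrightarrow> cmod (T h g k y) \<le> M k"
    using T_majorant[of h "{x}" g] by blast
  show ?thesis by (rule summable_comparison_test'[OF M(1), of 0]) (use M(2) in simp)
qed

lemma DERIV_T:
  assumes h: "h holomorphic_on UNIV"
  shows "(T h g k has_field_derivative T h (pCons 0 g) k x) (at x)"
proof -
  define \<gamma> where "\<gamma> s = circlepath z0 (1/2) s" for s
  define \<gamma>' where "\<gamma>' s = vector_derivative (circlepath z0 (1/2)) (at s)" for s
  define w where "w z = h z * series_coeff k z / poly P z * poly g (z + of_nat k)" for z
  have g1: "continuous_on {0..1} \<gamma>" unfolding \<gamma>_def
    using path_circlepath[of z0 "1/2"] by (simp add: path_def)
  have g2: "continuous_on {0..1} \<gamma>'"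
    unfolding \<gamma>'_def vector_derivative_circlepath by (intro continuous_intros)
  have sph: "\<gamma> s \<in> sphere z0 (1/2)" if "s \<in> {0..1}" for s
    using path_image_circlepath_nonneg[of "1/2" z0] that unfolding \<gamma>_def path_image_def by auto
  have wc: "continuous_on {0..1} (\<lambda>s. w (\<gamma> s))"
  proof -
    have "continuous_on (sphere z0 (1/2)) w" unfolding w_def by (rule continuous_weight[OF h])
    then have "continuous_on (\<gamma> ` {0..1}) w" by (rule continuous_on_subset) (rule image_subsetI, rule sph)
    from continuous_on_compose[OF g1 this] show ?thesis by (simp only: o_def)
  qed
  have Teq: "T h g k = (\<lambda>x. integral (cbox 0 1) (\<lambda>s. w (\<gamma> s) * exp ((\<gamma> s + of_nat k) * x) * \<gamma>' s))"
    unfolding T_def contour_integral_integral integrand_def w_def \<gamma>_def \<gamma>'_def box_real ..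
  have T'eq: "T h (pCons 0 g) k x = integral (cbox 0 1)
      (\<lambda>s. w (\<gamma> s) * (exp ((\<gamma> s + of_nat k) * x) * (\<gamma> s + of_nat k)) * \<gamma>' s)"
    by (simp add: T_def contour_integral_integral integrand_def w_def \<gamma>_def \<gamma>'_def mult_ac)
  have "((\<lambda>x. integral (cbox 0 1) (\<lambda>s. w (\<gamma> s) * exp ((\<gamma> s + of_nat k) * x) * \<gamma>' s)) has_field_derivative
     integral (cbox 0 1) (\<lambda>s. w (\<gamma> s) * (exp ((\<gamma> s + of_nat k) * x) * (\<gamma> s + of_nat k)) * \<gamma>' s)) (at x within UNIV)"
  proof (rule leibniz_rule_field_derivative)
    fix y :: complex and s :: real
    show "((\<lambda>x. w (\<gamma> s) * exp ((\<gamma> s + of_nat k) * x) * \<gamma>' s) has_field_derivative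
        w (\<gamma> s) * (exp ((\<gamma> s + of_nat k) * y) * (\<gamma> s + of_nat k)) * \<gamma>' s) (at y within UNIV)"
      by (auto intro!: derivative_eq_intros)
    show "(\<lambda>s. w (\<gamma> s) * exp ((\<gamma> s + of_nat k) * y) * \<gamma>' s) integrable_on cbox 0 1"
      unfolding box_real by (intro integrable_continuous_interval continuous_intros wc g1 g2)
  next
    have c1: "continuous_on (UNIV \<times> cbox 0 1) (\<lambda>y. w (\<gamma> (snd y)))" for w' :: "complex set"
      by (rule continuous_on_compose2[OF wc]) (auto intro!: continuous_intros)
    have c2: "continuous_on (UNIV \<times> cbox 0 1) (\<lambda>y. \<gamma> (snd y))"
      by (rule continuous_on_compose2[OF g1]) (auto intro!: continuous_intros)
    have c3: "continuous_on (UNIV \<times> cbox 0 1) (\<lambda>y. \<gamma>' (snd y))"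
      by (rule continuous_on_compose2[OF g2]) (auto intro!: continuous_intros)
    have c4: "continuous_on (UNIV \<times> cbox 0 (1::real)) (\<lambda>y::complex \<times> real. fst y)" by (intro continuous_intros)
    show "continuous_on (UNIV \<times> cbox 0 1)
        (\<lambda>(y, s). w (\<gamma> s) * (exp ((\<gamma> s + of_nat k) * y) * (\<gamma> s + of_nat k)) * \<gamma>' s)"
      unfolding case_prod_unfold
      by (intro continuous_on_mult continuous_on_add continuous_on_exp c1 c2 c3 c4 continuous_on_const)
  qed auto
  then show ?thesis unfolding Teq T'eq by simp
qed

lemma DERIV_F:
  assumes h: "h holomorphic_on UNIV" and x: "x \<in> H"
  shows "(F h g has_field_derivative F h (pCons 0 g) x) (at x)"
proof -
  obtain e where e: "e > 0" "ball x e \<subseteq> H" using openE[OF open_H x] .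
  obtain M where M: "summable M" "\<And>k y. y \<in> ball x e \<Longrightarrow> cmod (T h (pCons 0 g) k y) \<le> M k"
    using T_majorant[OF h e(2) bounded_ball, of "pCons 0 g"] by blast
  have "((\<lambda>x. \<Sum>k. T h g k x) has_field_derivative (\<Sum>k. T h (pCons 0 g) k x)) (at x)"
  proof (rule has_field_derivative_series'(2))
    show "uniformly_convergent_on (ball x e) (\<lambda>n y. \<Sum>i<n. T h (pCons 0 g) i y)"
      by (rule Weierstrass_m_test'[OF _ M(1)]) (rule M(2))
    show "summable (\<lambda>n. T h g n x)" by (rule T_summable[OF h x])
    show "x \<in> ball x e" "x \<in> interior (ball x e)" using e(1) by auto
    show "(T h g k has_field_derivative T h (pCons 0 g) k y) (at y within ball x e)" for k y
      by (rule has_field_derivative_at_within[OF DERIV_T[OF h]])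
  qed (rule convex_ball)
  then show ?thesis by (simp add: F_def[abs_def])
qed

lemma deriv_F:
  assumes h: "h holomorphic_on UNIV" and x: "x \<in> H"
  shows "(deriv ^^ n) (F h g) x = F h (monom 1 n * g) x"
  using x
proof (induction n arbitrary: x)
  case 0 then show ?case by (simp add: monom_0 one_pCons[symmetric])
next
  case (Suc n)
  have "deriv ((deriv ^^ n) (F h g)) x = deriv (F h (monom 1 n * g)) x"
    by (rule deriv_cong_ev) (use Suc open_H in \<open>auto simp: eventually_nhds\<close>)
  also have "\<dots> = F h (pCons 0 (monom 1 n * g)) x"
    by (rule DERIV_imp_deriv[OF DERIV_F[OF h Suc.prems]])
  also have "pCons 0 (monom 1 n * g) = monom 1 (Suc n) * g" by (simp add: monom_Suc)
  finally show ?case by simp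
qed

lemma integrand_linear:
  "integrand h (\<Sum>i\<in>I. Polynomial.smult (c i) (g i)) k x z = (\<Sum>i\<in>I. c i * integrand h (g i) k x z)"
  by (simp add: integrand_def poly_sum sum_distrib_left sum_distrib_right sum_divide_distrib mult_ac)

lemma F_linear:
  assumes h: "h holomorphic_on UNIV" and x: "x \<in> H" and I: "finite I"
  shows "F h (\<Sum>i\<in>I. Polynomial.smult (c i) (g i)) x = (\<Sum>i\<in>I. c i * F h (g i) x)"
proof -
  have "T h (\<Sum>i\<in>I. Polynomial.smult (c i) (g i)) k x = (\<Sum>i\<in>I. c i * T h (g i) k x)" for k
    unfolding T_def integrand_linear[abs_def]
    by (rule contour_integral_unique, intro has_contour_integral_sum has_contour_integral_lmul I)
       (use has_contour_integral_T[OF h] in \<open>simp add: T_def\<close>)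
  moreover have "(\<lambda>k. \<Sum>i\<in>I. c i * T h (g i) k x) sums (\<Sum>i\<in>I. c i * F h (g i) x)"
    unfolding F_def by (intro sums_sum sums_mult summable_sums T_summable h x)
  ultimately show ?thesis unfolding F_def by (simp add: sums_iff)
qed

lemma F_linear_h:
  assumes h: "\<And>i. i \<in> I \<Longrightarrow> h i holomorphic_on UNIV" and x: "x \<in> H" and I: "finite I"
  shows "F (\<lambda>z. \<Sum>i\<in>I. c i * h i z) g x = (\<Sum>i\<in>I. c i * F (h i) g x)"
proof -
  have lin: "integrand (\<lambda>z. \<Sum>i\<in>I. c i * h i z) g k x = (\<lambda>z. \<Sum>i\<in>I. c i * integrand (h i) g k x z)" for k
    by (rule ext) (simp add: integrand_def sum_distrib_left sum_distrib_right sum_divide_distrib mult_ac)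
  have "T (\<lambda>z. \<Sum>i\<in>I. c i * h i z) g k x = (\<Sum>i\<in>I. c i * T (h i) g k x)" for k
    unfolding T_def lin
    by (rule contour_integral_unique, intro has_contour_integral_sum has_contour_integral_lmul I)
       (use has_contour_integral_T[OF h] in \<open>simp add: T_def\<close>)
  moreover have "(\<lambda>k. \<Sum>i\<in>I. c i * T (h i) g k x) sums (\<Sum>i\<in>I. c i * F (h i) g x)"
    unfolding F_def by (intro sums_sum sums_mult summable_sums T_summable h x)
  ultimately show ?thesis unfolding F_def by (simp add: sums_iff)
qed

lemma diff_op_F:
  assumes h: "h holomorphic_on UNIV" and x: "x \<in> H"
  shows "diff_op p (F h g) x = F h (p * g) x"
proof -
  have "p * g = (\<Sum>k\<le>degree p. Polynomial.smult (Polynomial.coeff p k) (monom 1 k)) * g"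
    by (simp add: smult_monom poly_as_sum_of_monoms)
  also have "\<dots> = (\<Sum>k\<le>degree p. Polynomial.smult (Polynomial.coeff p k) (monom 1 k * g))"
    by (simp add: sum_distrib_right)
  finally show ?thesis unfolding diff_op_def deriv_F[OF assms]
    by (simp only: F_linear[OF assms finite_atMost])
qed

text \<open>The term \<open>k + 1\<close> of \<open>P(d/dx)\<close> applied to the series is \<open>exp x\<close> times the term \<open>k\<close> of
  \<open>Q(d/dx)\<close> applied to it; in the term \<open>0\<close> the denominator cancels and the integral vanishes.\<close>

lemma F_equation:
  assumes h: "h holomorphic_on UNIV" and x: "x \<in> H"
  shows "F h P x = exp x * F h Q x"
proof -
  have 0: "T h P 0 x = 0"
  proof -
    have "T h P 0 x = contour_integral (circlepath z0 (1/2)) (\<lambda>z. h z * exp (z * x))"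
      unfolding T_def
      by (rule contour_integral_cong) (use P_circle in \<open>auto simp: integrand_def dist_norm norm_minus_commute\<close>)
    also have "((\<lambda>z. h z * exp (z * x)) has_contour_integral 0) (circlepath z0 (1/2))"
      by (rule Cauchy_theorem_convex_simple[of _ UNIV]) (auto intro!: holomorphic_intros h)
    then have "contour_integral (circlepath z0 (1/2)) (\<lambda>z. h z * exp (z * x)) = 0"
      by (rule contour_integral_unique)
    finally show ?thesis .
  qed
  have S: "T h P (Suc k) x = exp x * T h Q k x" for k
  proof -
    have "T h P (Suc k) x = contour_integral (circlepath z0 (1/2)) (\<lambda>z. exp x * integrand h Q k x z)"
      unfolding T_def
    proof (rule contour_integral_cong)
      fix z assume "z \<in> path_image (circlepath z0 (1/2))"
      then have z: "cmod (z - z0) = 1/2" by (auto simp: dist_norm norm_minus_commute)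
      have e: "exp ((z + of_nat (Suc k)) * x) = exp x * exp ((z + of_nat k) * x)"
        by (simp add: exp_add[symmetric] algebra_simps)
      have "series_coeff (Suc k) z * poly P (z + of_nat (Suc k)) = series_coeff k z * poly Q (z + of_nat k)"
        by (rule series_coeff_Suc) (use z \<delta> in simp)
      then have "h z / poly P z * (series_coeff (Suc k) z * poly P (z + of_nat (Suc k))) * exp ((z + of_nat (Suc k)) * x)
        = h z / poly P z * (series_coeff k z * poly Q (z + of_nat k)) * (exp x * exp ((z + of_nat k) * x))"
        unfolding e by (simp only:)
      then show "integrand h P (Suc k) x z = exp x * integrand h Q k x z"
        by (simp add: integrand_def mult_ac del: of_nat_Suc)
    qed simp
    also have "\<dots> = exp x * T h Q k x"
      by (rule contour_integral_unique, intro has_contour_integral_lmul has_contour_integral_T h)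
    finally show ?thesis .
  qed
  have "F h P x = (\<Sum>k. T h P (Suc k) x) + T h P 0 x"
    using suminf_split_head[OF T_summable[OF h x], of P] by (simp add: F_def)
  also have "\<dots> = exp x * F h Q x"
    unfolding 0 S F_def by (simp add: suminf_mult[OF T_summable[OF h x]])
  finally show ?thesis .
qed

text \<open>The step from \<open>x\<close> to \<open>x + 2 \<pi> \<i>\<close> multiplies the integrand by \<open>exp (2 \<pi> \<i> z)\<close>, in every term
  \<open>k\<close> alike. With these weights the solutions therefore form a flag on which the local monodromy
  is triangular; the weight number \<open>m\<close> cancels all poles, so that the flag ends after \<open>m\<close> steps.\<close>

definition periodic_weight :: "nat \<Rightarrow> complex \<Rightarrow> complex" where
  "periodic_weight j z = (\<Prod>i<j. exp (2 * of_real pi * \<i> * z) - exp (2 * of_real pi * \<i> * \<rho> i))"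

lemma periodic_weight_holomorphic: "periodic_weight j holomorphic_on UNIV"
  unfolding periodic_weight_def[abs_def] by (intro holomorphic_intros)

lemma F_shift:
  assumes x: "x \<in> H"
  shows "F (periodic_weight j) g (x + 2 * of_real pi * \<i>)
     = F (periodic_weight (Suc j)) g x + exp (2 * of_real pi * \<i> * \<rho> j) * F (periodic_weight j) g x"
proof -
  define c where "c i = (if i = (0::nat) then 1 else exp (2 * of_real pi * \<i> * \<rho> j))" for i
  define f where "f i = (if i = (0::nat) then periodic_weight (Suc j) else periodic_weight j)" for i
  have "integrand (periodic_weight j) g k (x + 2 * of_real pi * \<i>) = integrand (\<lambda>z. \<Sum>i\<in>{0,1}. c i * f i z) g k x" for k
  proof
    fix z
    have "exp ((z + of_nat k) * (x + 2 * of_real pi * \<i>))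
       = exp ((z + of_nat k) * x) * exp (2 * of_real pi * \<i> * z) * exp (of_nat k * (2 * of_real pi * \<i>))"
    proof -
      have "(z + of_nat k) * (x + 2 * of_real pi * \<i>)
         = (z + of_nat k) * x + 2 * of_real pi * \<i> * z + of_nat k * (2 * of_real pi * \<i>)"
        by (simp add: algebra_simps)
      then show ?thesis by (simp only: exp_add)
    qed
    also have "exp (of_nat k * (2 * of_real pi * \<i>)) = 1"
      by (simp only: exp_of_nat_mult) simp
    finally have e: "exp ((z + of_nat k) * (x + 2 * of_real pi * \<i>))
       = exp ((z + of_nat k) * x) * exp (2 * of_real pi * \<i> * z) * 1" .
    show "integrand (periodic_weight j) g k (x + 2 * of_real pi * \<i>) z = integrand (\<lambda>z. \<Sum>i\<in>{0,1}. c i * f i z) g k x z"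
      unfolding integrand_def e by (simp add: c_def f_def periodic_weight_def algebra_simps add_divide_distrib diff_divide_distrib)
  qed
  then have "F (periodic_weight j) g (x + 2 * of_real pi * \<i>) = F (\<lambda>z. \<Sum>i\<in>{0,1}. c i * f i z) g x"
    by (simp add: F_def T_def)
  also have "\<dots> = (\<Sum>i\<in>{0,1}. c i * F (f i) g x)"
    by (rule F_linear_h[OF _ x]) (auto simp: f_def periodic_weight_holomorphic)
  finally show ?thesis by (simp add: c_def f_def)
qed

text \<open>The entire function \<open>(exp (2 \<pi> \<i> z) - exp (2 \<pi> \<i> a)) / (z - a)\<close>. It has no zero at distance
  less than \<open>1\<close> from \<open>a\<close>, in particular not at another exponent.\<close>

definition exp_quotient :: "complex \<Rightarrow> complex \<Rightarrow> complex" where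
  "exp_quotient a z = (if z = a then 2 * of_real pi * \<i> * exp (2 * of_real pi * \<i> * a)
     else (exp (2 * of_real pi * \<i> * z) - exp (2 * of_real pi * \<i> * a)) / (z - a))"

lemma exp_quotient_holomorphic: "exp_quotient a holomorphic_on UNIV"
proof -
  have d: "deriv (\<lambda>z. exp (2 * of_real pi * \<i> * z)) a = 2 * of_real pi * \<i> * exp (2 * of_real pi * \<i> * a)"
    by (rule DERIV_imp_deriv) (auto intro!: derivative_eq_intros)
  show ?thesis unfolding exp_quotient_def[abs_def]
    by (rule pole_lemma[of "\<lambda>z. exp (2 * of_real pi * \<i> * z)" UNIV a, unfolded d])
       (auto intro!: holomorphic_intros)
qed

lemma exp_quotient: "exp (2 * of_real pi * \<i> * z) - exp (2 * of_real pi * \<i> * a) = exp_quotient a z * (z - a)"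
  by (simp add: exp_quotient_def)

lemma exp_quotient_nonzero:
  assumes "cmod (z - a) < 1"
  shows "exp_quotient a z \<noteq> 0"
proof (cases "z = a")
  case False
  have "exp (2 * of_real pi * \<i> * z) \<noteq> exp (2 * of_real pi * \<i> * a)"
  proof
    assume "exp (2 * of_real pi * \<i> * z) = exp (2 * of_real pi * \<i> * a)"
    then obtain n :: int where "2 * of_real pi * \<i> * z = 2 * of_real pi * \<i> * a + of_int (2 * n) * pi * \<i>"
      unfolding exp_eq by blast
    then have "2 * of_real pi * \<i> * (z - a) = 2 * of_real pi * \<i> * of_int n" by (simp add: algebra_simps)
    then have n: "z - a = of_int n" by simp
    then have "\<bar>real_of_int n\<bar> < 1" using assms by (metis norm_of_int)
    then have "n = 0" by linarith
    then show False using n False by simp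
  qed
  then show ?thesis using False by (simp add: exp_quotient_def)
qed (simp add: exp_quotient_def)

lemma F_periodic_weight_m: "F (periodic_weight m) g x = 0"
proof -
  have "T (periodic_weight m) g k x = 0" for k
  proof -
    have "T (periodic_weight m) g k x = contour_integral (circlepath z0 (1/2))
       (\<lambda>z. (\<Prod>i<m. exp_quotient (\<rho> i) z) * series_coeff k z * poly g (z + of_nat k) * exp ((z + of_nat k) * x))"
      unfolding T_def
    proof (rule contour_integral_cong)
      fix z assume "z \<in> path_image (circlepath z0 (1/2))"
      then have "poly P z \<noteq> 0" by (intro P_circle) (auto simp: dist_norm norm_minus_commute)
      moreover have "periodic_weight m z = (\<Prod>i<m. exp_quotient (\<rho> i) z) * poly P z"
        unfolding periodic_weight_def exp_quotient poly_P by (rule prod.distrib)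
      ultimately show "integrand (periodic_weight m) g k x z =
        (\<Prod>i<m. exp_quotient (\<rho> i) z) * series_coeff k z * poly g (z + of_nat k) * exp ((z + of_nat k) * x)"
        by (simp add: integrand_def)
    qed simp
    also have "\<dots> = 0"
    proof (rule contour_integral_unique, rule Cauchy_theorem_disc_simple)
      show "(\<lambda>z. (\<Prod>i<m. exp_quotient (\<rho> i) z) * series_coeff k z * poly g (z + of_nat k) * exp ((z + of_nat k) * x))
         holomorphic_on ball z0 (1/2 + \<delta>)"
        by (intro holomorphic_on_mult holomorphic_on_prod holomorphic_series_coeff
             holomorphic_on_subset[OF exp_quotient_holomorphic subset_UNIV] holomorphic_intros)
      show "path_image (circlepath z0 (1/2)) \<subseteq> ball z0 (1/2 + \<delta>)" using circle_subset by simp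
    qed auto
    finally show ?thesis .
  qed
  then show ?thesis by (simp add: F_def)
qed

text \<open>Applying the operator with roots \<open>\<rho> i\<close>, \<open>i > j\<close>, isolates a single exponential \<open>exp (\<rho> j x)\<close>
  with nonzero coefficient in the term \<open>0\<close>; the other terms are smaller as \<open>x\<close> tends to \<open>-\<infinity>\<close>.\<close>

lemma F_independent:
  assumes 0: "\<And>x. x \<in> H \<Longrightarrow> (\<Sum>j<m. d j * F (periodic_weight j) 1 x) = 0"
  shows "\<forall>j<m. d j = 0"
proof (rule ccontr)
  assume "\<not> (\<forall>j<m. d j = 0)"
  then obtain j where j: "j < m" "d j \<noteq> 0" "\<And>i. i < j \<Longrightarrow> d i = 0"
    using exists_least_iff[of "\<lambda>j. j < m \<and> d j \<noteq> 0"] by (metis less_trans)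
  define h where "h z = (\<Sum>i<m. d i * periodic_weight i z)" for z
  have hol: "h holomorphic_on UNIV" unfolding h_def[abs_def] by (intro holomorphic_intros periodic_weight_holomorphic)
  \<comment> \<open>The weight \<open>h\<close> vanishes at \<open>\<rho> i\<close> for \<open>i < j\<close> and \<open>g\<close> for \<open>i > j\<close>; of the poles of \<open>1 / P\<close> in
    the term \<open>0\<close> only \<open>\<rho> j\<close> is left.\<close>
  define g where "g = (\<Prod>i\<in>{Suc j..<m}. [:- \<rho> i, 1:])"
  have F0: "F h 1 x = 0" if "x \<in> H" for x
    using F_linear_h[where I="{..<m}" and h=periodic_weight and c=d and g=1, OF periodic_weight_holomorphic that] 0[OF that]
    by (simp add: h_def[abs_def])
  have Fg: "F h g x = 0" if x: "x \<in> H" for x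
  proof -
    have "(deriv ^^ k) (F h 1) x = 0" for k
    proof -
      have "(deriv ^^ k) (F h 1) x = (deriv ^^ k) (\<lambda>_. 0) x"
        by (rule higher_deriv_cong_ev) (use F0 open_H x in \<open>auto simp: eventually_nhds\<close>)
      then show ?thesis by simp
    qed
    then have "diff_op g (F h 1) x = 0" by (simp add: diff_op_def)
    then show ?thesis using diff_op_F[OF hol x, of g 1] by simp
  qed
  define \<phi> where "\<phi> z = (\<Prod>i<j. exp_quotient (\<rho> i) z) * (\<Sum>i\<in>{j..<m}. d i * (\<Prod>l\<in>{j..<i}. exp (2 * of_real pi * \<i> * z) - exp (2 * of_real pi * \<i> * \<rho> l)))" for z
  have \<phi>hol: "\<phi> holomorphic_on UNIV" unfolding \<phi>_def[abs_def]
    by (intro holomorphic_on_mult holomorphic_on_prod exp_quotient_holomorphic holomorphic_on_sum holomorphic_intros)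
  have h\<phi>: "h z = \<phi> z * (\<Prod>i<j. z - \<rho> i)" for z
  proof -
    have split: "periodic_weight i z = periodic_weight j z * (\<Prod>l\<in>{j..<i}. exp (2 * of_real pi * \<i> * z) - exp (2 * of_real pi * \<i> * \<rho> l))" if "j \<le> i" for i
      by (simp add: periodic_weight_def lessThan_atLeast0 prod.atLeastLessThan_concat that)
    have "h z = (\<Sum>i\<in>{j..<m}. d i * periodic_weight i z)"
      unfolding h_def by (rule sum.mono_neutral_right) (use j in \<open>auto simp: not_le\<close>)
    also have "\<dots> = periodic_weight j z * (\<Sum>i\<in>{j..<m}. d i * (\<Prod>l\<in>{j..<i}. exp (2 * of_real pi * \<i> * z) - exp (2 * of_real pi * \<i> * \<rho> l)))"
      unfolding sum_distrib_left
    proof (rule sum.cong[OF refl])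
      fix i assume "i \<in> {j..<m}"
      then have "j \<le> i" by simp
      from split[OF this] show "d i * periodic_weight i z = periodic_weight j z * (d i * (\<Prod>l\<in>{j..<i}. exp (2 * of_real pi * \<i> * z) - exp (2 * of_real pi * \<i> * \<rho> l)))"
        by (simp only: mult.left_commute)
    qed
    also have "periodic_weight j z = (\<Prod>i<j. exp_quotient (\<rho> i) z) * (\<Prod>i<j. z - \<rho> i)"
      unfolding periodic_weight_def exp_quotient by (rule prod.distrib)
    finally show ?thesis by (simp add: \<phi>_def mult_ac)
  qed
  have \<phi>j: "\<phi> (\<rho> j) \<noteq> 0"
  proof -
    have "(\<Sum>i\<in>{j..<m}. d i * (\<Prod>l\<in>{j..<i}. exp (2 * of_real pi * \<i> * \<rho> j) - exp (2 * of_real pi * \<i> * \<rho> l)))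
      = (\<Sum>i\<in>{j}. d i * (\<Prod>l\<in>{j..<i}. exp (2 * of_real pi * \<i> * \<rho> j) - exp (2 * of_real pi * \<i> * \<rho> l)))"
      by (rule sum.mono_neutral_right) (use j(1) in \<open>auto intro!: prod_zero bexI[of _ j]\<close>)
    moreover have "exp_quotient (\<rho> i) (\<rho> j) \<noteq> 0" if "i < j" for i
    proof (rule exp_quotient_nonzero)
      have "cmod (\<rho> j - \<rho> i) \<le> cmod (\<rho> j - z0) + cmod (\<rho> i - z0)"
        using norm_triangle_ineq4[of "\<rho> j - z0" "\<rho> i - z0"] by simp
      then show "cmod (\<rho> j - \<rho> i) < 1" using near[of i] near[of j] that j(1) by simp
    qed
    ultimately show ?thesis using j(2) by (simp add: \<phi>_def)
  qed
  have T0: "T h g 0 x = 2 * of_real pi * \<i> * (\<phi> (\<rho> j) * exp (\<rho> j * x))" for x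
  proof -
    have "T h g 0 x = contour_integral (circlepath z0 (1/2)) (\<lambda>z. (\<phi> z * exp (z * x)) / (z - \<rho> j))"
      unfolding T_def
    proof (rule contour_integral_cong)
      fix z assume "z \<in> path_image (circlepath z0 (1/2))"
      then have nz: "poly P z \<noteq> 0" by (intro P_circle) (auto simp: dist_norm norm_minus_commute)
      have "poly P z = (\<Prod>i<j. z - \<rho> i) * ((z - \<rho> j) * poly g z)"
      proof -
        have "poly P z = (\<Prod>i\<in>{0..<j}. z - \<rho> i) * (\<Prod>i\<in>{j..<m}. z - \<rho> i)"
          unfolding poly_P lessThan_atLeast0 using prod.atLeastLessThan_concat[of 0 j m] j(1)
          by (metis le0 less_imp_le)
        also have "(\<Prod>i\<in>{j..<m}. z - \<rho> i) = (z - \<rho> j) * (\<Prod>i\<in>{Suc j..<m}. z - \<rho> i)"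
          using j(1) by (rule prod.atLeast_Suc_lessThan)
        finally show ?thesis by (simp add: g_def poly_prod lessThan_atLeast0)
      qed
      then show "integrand h g 0 x z = \<phi> z * exp (z * x) / (z - \<rho> j)"
        using nz by (simp add: integrand_def h\<phi>)
    qed simp
    also have "\<dots> = 2 * of_real pi * \<i> * (\<phi> (\<rho> j) * exp (\<rho> j * x))"
      by (rule contour_integral_unique, rule Cauchy_integral_circlepath)
         (use near[OF j(1)] in \<open>auto intro!: holomorphic_on_imp_continuous_on holomorphic_intros
           intro: holomorphic_on_subset[OF \<phi>hol]\<close>)
    finally show ?thesis .
  qed
  obtain K where K: "K \<ge> 0" "\<And>k x E. (\<And>z. cmod (z - z0) = 1/2 \<Longrightarrow> cmod (exp (z * x)) \<le> E) \<Longrightarrow>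
     cmod (T h g k x) \<le> K * (C * exp 1 * exp (Re x)) ^ k * E" using norm_T_le[OF hol] by blast
  \<comment> \<open>On the circle \<open>Re z \<ge> b\<close>, so the terms \<open>k \<ge> 1\<close> are of size \<open>exp ((b + 1) x)\<close>, which is
    negligible against \<open>exp (Re (\<rho> j) x)\<close> as \<open>x\<close> tends to \<open>-\<infinity>\<close>.\<close>
  define b where "b = Re z0 - 1/2"
  have bound: "cmod (T h g 0 (of_real x)) \<le> 2 * (K * (C * exp 1)) * exp ((b + 1) * x)"
    if x: "of_real x \<in> H" "x \<le> 0" for x :: real
  proof -
    let ?q = "C * exp 1 * exp x"
    have q: "0 \<le> ?q" "?q \<le> 1/2" using ratio_H[OF x(1)] C_nonneg by auto
    have "cmod (exp (z * of_real x)) \<le> exp (b * x)" if "cmod (z - z0) = 1/2" for z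
    proof -
      have "Re z \<ge> b" using abs_Re_le_cmod[of "z - z0"] that by (simp add: b_def abs_if split: if_splits)
      then have "Re z * x \<le> b * x" using x(2) by (rule mult_right_mono_neg)
      then show ?thesis by (simp add: norm_exp_eq_Re)
    qed
    then have Tk: "cmod (T h g k (of_real x)) \<le> K * ?q ^ k * exp (b * x)" for k
      using K(2)[of "of_real x" "exp (b * x)" k] by simp
    have sum: "summable (\<lambda>k. T h g (Suc k) (of_real x))"
      using T_summable[OF hol x(1), of g] by (simp only: summable_Suc_iff[of "\<lambda>k. T h g k (of_real x)"])
    have "0 = F h g (of_real x)" using Fg[OF x(1)] by simp
    also have "\<dots> = T h g 0 (of_real x) + (\<Sum>k. T h g (Suc k) (of_real x))"
      unfolding F_def using suminf_split_head[OF T_summable[OF hol x(1)], of g] by simp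
    finally have "T h g 0 (of_real x) = - (\<Sum>k. T h g (Suc k) (of_real x))" by (simp add: eq_neg_iff_add_eq_0)
    then have "cmod (T h g 0 (of_real x)) = cmod (\<Sum>k. T h g (Suc k) (of_real x))" by simp
    also have "\<dots> \<le> (\<Sum>k. K * ?q * exp (b * x) * (1/2) ^ k)"
    proof (rule norm_suminf_le)
      show "summable (\<lambda>k. K * ?q * exp (b * x) * (1/2) ^ k)" by (intro summable_mult summable_geometric) simp
      fix k
      have "cmod (T h g (Suc k) (of_real x)) \<le> K * (?q * ?q ^ k) * exp (b * x)" using Tk[of "Suc k"] by simp
      also have "\<dots> \<le> K * (?q * (1/2) ^ k) * exp (b * x)"
        using q K(1) by (intro mult_right_mono mult_left_mono power_mono) auto
      finally show "cmod (T h g (Suc k) (of_real x)) \<le> K * ?q * exp (b * x) * (1/2) ^ k" by (simp add: mult_ac)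
    qed
    also have "\<dots> = 2 * (K * ?q * exp (b * x))"
      by (subst suminf_mult) (auto simp: suminf_geometric)
    also have "\<dots> = 2 * (K * (C * exp 1)) * exp ((b + 1) * x)"
      by (simp add: distrib_right exp_add)
    finally show ?thesis .
  qed
  define \<epsilon> where "\<epsilon> = b + 1 - Re (\<rho> j)"
  have \<epsilon>: "\<epsilon> > 0"
    using abs_Re_le_cmod[of "\<rho> j - z0"] near[OF j(1)] by (simp add: \<epsilon>_def b_def)
  define A where "A = 2 * pi * cmod (\<phi> (\<rho> j))"
  have A: "A > 0" using \<phi>j by (simp add: A_def)
  have "A \<le> 2 * (K * (C * exp 1)) * exp (\<epsilon> * x)" if x: "of_real x \<in> H" "x \<le> 0" for x :: real
  proof -
    have "A * exp (Re (\<rho> j) * x) \<le> 2 * (K * (C * exp 1)) * exp ((b + 1) * x)"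
      using bound[OF x] unfolding T0 by (simp add: norm_mult norm_exp_eq_Re A_def)
    also have "exp ((b + 1) * x) = exp (\<epsilon> * x) * exp (Re (\<rho> j) * x)"
      by (simp add: \<epsilon>_def exp_add[symmetric] algebra_simps)
    finally show ?thesis by (simp add: mult.assoc[symmetric])
  qed
  moreover have "((\<lambda>x. 2 * (K * (C * exp 1)) * exp (\<epsilon> * x)) \<longlongrightarrow> 2 * (K * (C * exp 1)) * 0) at_bot"
  proof (intro tendsto_intros)
    have "filterlim (\<lambda>x. \<epsilon> * x) at_bot at_bot"
      using \<epsilon> by (intro filterlim_tendsto_pos_mult_at_bot[OF tendsto_const]) (auto simp: filterlim_ident)
    then show "((\<lambda>x. exp (\<epsilon> * x)) \<longlongrightarrow> 0) at_bot" by (rule filterlim_compose[OF exp_at_bot])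
  qed
  then have "\<forall>\<^sub>F x in at_bot. 2 * (K * (C * exp 1)) * exp (\<epsilon> * x) < A"
    using A by (intro order_tendstoD(2)) simp
  then obtain N where N: "\<And>x. x \<le> N \<Longrightarrow> 2 * (K * (C * exp 1)) * exp (\<epsilon> * x) < A"
    unfolding eventually_at_bot_linorder by blast
  define x where "x = min (min N 0) (- X - 1)"
  have "of_real x \<in> H" "x \<le> 0" "x \<le> N" by (auto simp: x_def H_def)
  ultimately show False using N[of x] by fastforce
qed

text \<open>As \<open>u m = 0\<close>, going once around \<open>0\<close> is given in the basis \<open>u 0, \<dots>, u (m - 1)\<close> by a
  bidiagonal matrix with diagonal entries \<open>exp (2 \<pi> \<i> \<rho> j)\<close>.\<close>

theorem frobenius_solutions:
  "\<exists>u. (\<forall>j. u j holomorphic_on H) \<and>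
     (\<forall>j. \<forall>x\<in>H. diff_op P (u j) x = exp x * diff_op Q (u j) x) \<and>
     (\<forall>j. \<forall>x\<in>H. u j (x + 2 * of_real pi * \<i>) = exp (2 * of_real pi * \<i> * \<rho> j) * u j x + u (Suc j) x) \<and>
     (\<forall>x. u m x = 0) \<and> (\<forall>d. (\<forall>x\<in>H. (\<Sum>j<m. d j * u j x) = 0) \<longrightarrow> (\<forall>j<m. d j = 0))"
proof (intro exI[of _ "\<lambda>j. F (periodic_weight j) 1"] conjI allI ballI impI)
  show "F (periodic_weight j) 1 holomorphic_on H" for j
    using DERIV_F[OF periodic_weight_holomorphic] open_H by (meson holomorphic_on_open)
  show "diff_op P (F (periodic_weight j) 1) x = exp x * diff_op Q (F (periodic_weight j) 1) x" if "x \<in> H" for j x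
    using diff_op_F[OF periodic_weight_holomorphic that, of _ j 1] F_equation[OF periodic_weight_holomorphic that] by simp
  show "F (periodic_weight j) 1 (x + 2 * of_real pi * \<i>) = exp (2 * of_real pi * \<i> * \<rho> j) * F (periodic_weight j) 1 x + F (periodic_weight (Suc j)) 1 x"
    if "x \<in> H" for j x using F_shift[OF that] by simp
  show "F (periodic_weight m) 1 x = 0" for x by (rule F_periodic_weight_m)
  show "d j = 0" if "\<forall>x\<in>H. (\<Sum>j<m. d j * F (periodic_weight j) 1 x) = 0" "j < m" for d j
    using F_independent that by blast
qed

end

section \<open>Pairs of matrices differing by rank one\<close>

text \<open>Vectors of length \<open>m\<close> are functions on \<open>nat\<close> that vanish from \<open>m\<close> on. This makes
  \<open>mat_apply m A ^^ k\<close> meaningful and keeps sums over coordinates plain.\<close>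

definition mat_apply :: "nat \<Rightarrow> complex mat \<Rightarrow> (nat \<Rightarrow> complex) \<Rightarrow> nat \<Rightarrow> complex" where
  "mat_apply m A x = (\<lambda>i. if i < m then \<Sum>j<m. A $$ (i, j) * x j else 0)"

definition poly_mat_apply :: "nat \<Rightarrow> complex mat \<Rightarrow> complex poly \<Rightarrow> (nat \<Rightarrow> complex) \<Rightarrow> nat \<Rightarrow> complex" where
  "poly_mat_apply m A r x = (\<lambda>i. \<Sum>k\<le>degree r. Polynomial.coeff r k * (mat_apply m A ^^ k) x i)"

lemma mat_apply_sum: "mat_apply m A (\<lambda>i. \<Sum>k\<in>K. c k * x k i) i = (\<Sum>k\<in>K. c k * mat_apply m A (x k) i)"
  unfolding mat_apply_def by (simp add: sum_distrib_left mult_ac sum.swap[of _ K])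

lemma mat_apply_0: "mat_apply m A (\<lambda>_. 0) = (\<lambda>_. 0)"
  by (auto simp: mat_apply_def)

lemma mat_apply_mult:
  assumes "A \<in> carrier_mat m m" "B \<in> carrier_mat m m"
  shows "mat_apply m (A * B) x = mat_apply m A (mat_apply m B x)"
proof
  fix i
  have "(\<Sum>j<m. (\<Sum>k<m. A $$ (i, k) * B $$ (k, j)) * x j) = (\<Sum>k<m. A $$ (i, k) * (\<Sum>j<m. B $$ (k, j) * x j))"
    unfolding sum_distrib_left sum_distrib_right mult.assoc by (rule sum.swap)
  then show "mat_apply m (A * B) x i = mat_apply m A (mat_apply m B x) i"
    using assms by (auto simp: mat_apply_def scalar_prod_def atLeast0LessThan)
qed

lemma mat_apply_one: "(\<And>i. i \<ge> m \<Longrightarrow> x i = 0) \<Longrightarrow> mat_apply m (1\<^sub>m m) x = x"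
  by (auto simp: mat_apply_def if_distrib[of "\<lambda>c. c * _"] not_less cong: if_cong)

lemma mat_apply_support: "i \<ge> m \<Longrightarrow> mat_apply m A x i = 0"
  by (simp add: mat_apply_def)

lemma funpow_mat_apply_support: "(\<And>i. i \<ge> m \<Longrightarrow> x i = 0) \<Longrightarrow> i \<ge> m \<Longrightarrow> (mat_apply m A ^^ k) x i = 0"
  by (cases k) (auto simp: mat_apply_support)

lemma funpow_mat_apply_0: "(mat_apply m A ^^ k) (\<lambda>_. 0) = (\<lambda>_. 0)"
  by (induction k) (auto simp: mat_apply_0)

lemma funpow_mat_apply_sum: "(mat_apply m A ^^ k) (\<lambda>i. \<Sum>l\<in>L. c l * x l i) i = (\<Sum>l\<in>L. c l * (mat_apply m A ^^ k) (x l) i)"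
proof (induction k arbitrary: i)
  case (Suc k)
  then have "(mat_apply m A ^^ k) (\<lambda>i. \<Sum>l\<in>L. c l * x l i) = (\<lambda>i. \<Sum>l\<in>L. c l * (mat_apply m A ^^ k) (x l) i)" by blast
  then show ?case by (simp add: mat_apply_sum)
qed simp

lemma poly_mat_apply_bound: "degree r \<le> N \<Longrightarrow> poly_mat_apply m A r x i = (\<Sum>k\<le>N. Polynomial.coeff r k * (mat_apply m A ^^ k) x i)"
  unfolding poly_mat_apply_def by (rule sum.mono_neutral_left) (auto simp: coeff_eq_0)

lemma poly_mat_apply_0: "poly_mat_apply m A r (\<lambda>_. 0) = (\<lambda>_. 0)"
  by (auto simp: poly_mat_apply_def funpow_mat_apply_0)

lemma poly_mat_apply_sum: "poly_mat_apply m A r (\<lambda>i. \<Sum>l\<in>L. c l * x l i) i = (\<Sum>l\<in>L. c l * poly_mat_apply m A r (x l) i)"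
  unfolding poly_mat_apply_def funpow_mat_apply_sum sum_distrib_left by (subst sum.swap) (simp add: mult_ac)

lemma poly_mat_apply_smult: "poly_mat_apply m A (Polynomial.smult c r) x i = c * poly_mat_apply m A r x i"
  using poly_mat_apply_bound[OF degree_smult_le[of c r], of m A x i] by (simp add: poly_mat_apply_def sum_distrib_left mult_ac)

lemma poly_mat_apply_linear_factor:
  "poly_mat_apply m A ([:- \<mu>, 1:] * r) x i = mat_apply m A (poly_mat_apply m A r x) i - \<mu> * poly_mat_apply m A r x i"
proof -
  let ?N = "degree r"
  have "degree ([:- \<mu>, 1:] * r) \<le> degree [:- \<mu>, 1:] + degree r" by (rule degree_mult_le)
  then have d: "degree ([:- \<mu>, 1:] * r) \<le> Suc ?N" by simp
  have "poly_mat_apply m A ([:- \<mu>, 1:] * r) x i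
    = (\<Sum>k\<le>Suc ?N. (Polynomial.coeff (pCons 0 r) k - \<mu> * Polynomial.coeff r k) * (mat_apply m A ^^ k) x i)"
    unfolding poly_mat_apply_bound[OF d] by simp
  also have "\<dots> = (\<Sum>k\<le>Suc ?N. Polynomial.coeff (pCons 0 r) k * (mat_apply m A ^^ k) x i)
      - \<mu> * (\<Sum>k\<le>Suc ?N. Polynomial.coeff r k * (mat_apply m A ^^ k) x i)"
    by (simp only: left_diff_distrib sum_subtractf sum_distrib_left mult.assoc)
  also have "(\<Sum>k\<le>Suc ?N. Polynomial.coeff r k * (mat_apply m A ^^ k) x i) = poly_mat_apply m A r x i"
    by (rule poly_mat_apply_bound[symmetric]) simp
  also have "(\<Sum>k\<le>Suc ?N. Polynomial.coeff (pCons 0 r) k * (mat_apply m A ^^ k) x i)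
     = (\<Sum>k\<le>?N. Polynomial.coeff r k * mat_apply m A ((mat_apply m A ^^ k) x) i)"
    by (subst sum.atMost_Suc_shift) simp
  also have "\<dots> = mat_apply m A (poly_mat_apply m A r x) i" unfolding poly_mat_apply_def mat_apply_sum ..
  finally show ?thesis .
qed

lemma poly_mat_apply_commute: "mat_apply m A (poly_mat_apply m A r x) = poly_mat_apply m A r (mat_apply m A x)"
proof
  fix i show "mat_apply m A (poly_mat_apply m A r x) i = poly_mat_apply m A r (mat_apply m A x) i"
    unfolding poly_mat_apply_def mat_apply_sum by (simp add: funpow_swap1)
qed

lemma poly_mat_apply_linear_factor':
  "poly_mat_apply m A ([:- \<mu>, 1:] * r) x = poly_mat_apply m A r (\<lambda>i. mat_apply m A x i - \<mu> * x i)"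
proof
  fix i
  define y where "y l = (if l = (0::nat) then mat_apply m A x else x)" for l
  define c where "c l = (if l = (0::nat) then 1 else - \<mu>)" for l
  have "poly_mat_apply m A r (\<lambda>i. \<Sum>l\<in>{0,1}. c l * y l i) i = (\<Sum>l\<in>{0,1}. c l * poly_mat_apply m A r (y l) i)"
    by (rule poly_mat_apply_sum)
  then show "poly_mat_apply m A ([:- \<mu>, 1:] * r) x i = poly_mat_apply m A r (\<lambda>i. mat_apply m A x i - \<mu> * x i) i"
    unfolding poly_mat_apply_linear_factor poly_mat_apply_commute by (simp add: y_def c_def)
qed

lemma poly_mat_apply_eigenvector:
  assumes "mat_apply m A x = (\<lambda>i. \<mu> * x i)"
  shows "poly_mat_apply m A r x i = poly r \<mu> * x i"
proof -
  have "(mat_apply m A ^^ k) x = (\<lambda>i. \<mu> ^ k * x i)" for k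
  proof (induction k)
    case (Suc k)
    have "mat_apply m A (\<lambda>i. \<Sum>l\<in>{0::nat}. \<mu> ^ k * x i) i = (\<Sum>l\<in>{0::nat}. \<mu> ^ k * mat_apply m A x i)" for i
      by (rule mat_apply_sum)
    then show ?case using Suc assms by (auto simp: mult_ac)
  qed simp
  then show ?thesis by (simp add: poly_mat_apply_def poly_altdef sum_distrib_right mult.assoc)
qed

text \<open>The factors of the characteristic polynomial of a triangular matrix successively kill the
  members of the flag.\<close>

lemma poly_mat_apply_flag_zero:
  assumes "\<And>j. j < m \<Longrightarrow> mat_apply m A (c j) = (\<lambda>i. \<mu> j * c j i + c (Suc j) i)" and "c m = (\<lambda>_. 0)"
    and span: "\<And>i. i < m \<Longrightarrow> x i = (\<Sum>j<m. d j * c j i)" and supp: "\<And>i. i \<ge> m \<Longrightarrow> x i = 0"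
    and suppc: "\<And>j i. i \<ge> m \<Longrightarrow> c j i = 0"
  shows "poly_mat_apply m A (\<Prod>j<m. [:- \<mu> j, 1:]) x = (\<lambda>_. 0)"
proof -
  have up: "poly_mat_apply m A (\<Prod>i\<in>{j..<m}. [:- \<mu> i, 1:]) (c j) = (\<lambda>_. 0)" if "j \<le> m" for j
    using that
  proof (induction "m - j" arbitrary: j)
    case 0 then show ?case using assms(2) poly_mat_apply_0 by simp
  next
    case (Suc k)
    then have j: "j < m" by simp
    have "(\<lambda>i. mat_apply m A (c j) i - \<mu> j * c j i) = c (Suc j)" using assms(1)[OF j] by simp
    moreover have "(\<Prod>i\<in>{j..<m}. [:- \<mu> i, 1:]) = [:- \<mu> j, 1:] * (\<Prod>i\<in>{Suc j..<m}. [:- \<mu> i, 1:])"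
      by (rule prod.atLeast_Suc_lessThan[OF j])
    ultimately show ?case
      using Suc.hyps(1)[of "Suc j"] Suc.hyps(2) j by (simp only: poly_mat_apply_linear_factor')
  qed
  have down: "poly_mat_apply m A (\<Prod>i\<in>{j-k..<m}. [:- \<mu> i, 1:]) (c j) = (\<lambda>_. 0)" if "j < m" "k \<le> j" for j k
    using that(2)
  proof (induction k)
    case 0 then show ?case using up[of j] that by simp
  next
    case (Suc k)
    have "j - Suc k < m" "Suc (j - Suc k) = j - k" using Suc that by auto
    then have e: "(\<Prod>i\<in>{j - Suc k..<m}. [:- \<mu> i, 1:]) = [:- \<mu> (j - Suc k), 1:] * (\<Prod>i\<in>{j-k..<m}. [:- \<mu> i, 1:])"
      using prod.atLeast_Suc_lessThan[of "j - Suc k" m] by (simp del: mult_pCons_left)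
    have "poly_mat_apply m A (\<Prod>i\<in>{j-k..<m}. [:- \<mu> i, 1:]) (c j) = (\<lambda>_. 0)" using Suc by simp
    then show ?case unfolding e by (intro ext) (simp only: poly_mat_apply_linear_factor mat_apply_0, simp)
  qed
  have each: "poly_mat_apply m A (\<Prod>i<m. [:- \<mu> i, 1:]) (c j) = (\<lambda>_. 0)" if "j < m" for j
    using down[OF that, of j] by (simp add: lessThan_atLeast0)
  have "x = (\<lambda>i. \<Sum>j<m. d j * c j i)" using span supp suppc by (auto simp: fun_eq_iff) (metis (no_types, lifting) linorder_not_less mult_zero_right sum.neutral)
  then have "poly_mat_apply m A (\<Prod>i<m. [:- \<mu> i, 1:]) x = (\<lambda>i. \<Sum>j<m. d j * poly_mat_apply m A (\<Prod>i<m. [:- \<mu> i, 1:]) (c j) i)"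
    using poly_mat_apply_sum[where L="{..<m}" and c=d and x=c] by blast
  then show ?thesis using each by simp
qed

text \<open>The reciprocal polynomial annihilates the inverse matrix.\<close>

lemma poly_mat_apply_inverse_zero:
  assumes AB: "A \<in> carrier_mat m m" "B \<in> carrier_mat m m" "B * A = 1\<^sub>m m"
    and nz: "\<And>j. j < m \<Longrightarrow> \<mu> j \<noteq> 0" and supp: "\<And>i. i \<ge> m \<Longrightarrow> x i = 0"
    and 0: "poly_mat_apply m A (\<Prod>j<m. [:- \<mu> j, 1:]) x = (\<lambda>_. 0)"
  shows "poly_mat_apply m B (\<Prod>j<m. [:- inverse (\<mu> j), 1:]) x = (\<lambda>_. 0)"
proof
  fix i
  let ?r = "\<Prod>j<m. [:- \<mu> j, 1:]"
  have deg: "degree ?r = m" by (subst degree_prod_eq_sum_degree) auto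
  have BA: "(mat_apply m B ^^ n) ((mat_apply m A ^^ k) x) = (mat_apply m B ^^ (n - k)) x" if "k \<le> n" for n k
    using that
  proof (induction k arbitrary: n)
    case (Suc k)
    then obtain n' where n: "n = Suc n'" "k \<le> n'" by (cases n) auto
    have "mat_apply m B (mat_apply m A ((mat_apply m A ^^ k) x)) = (mat_apply m A ^^ k) x"
      unfolding mat_apply_mult[OF AB(2,1), symmetric] AB(3) by (rule mat_apply_one, rule funpow_mat_apply_support[OF supp])
    then have "mat_apply m B ((mat_apply m A ^^ Suc k) x) = (mat_apply m A ^^ k) x" by simp
    moreover have "(mat_apply m B ^^ n) z = (mat_apply m B ^^ n') (mat_apply m B z)" for z
      unfolding n funpow_Suc_right by simp
    ultimately have "(mat_apply m B ^^ n) ((mat_apply m A ^^ Suc k) x) = (mat_apply m B ^^ n') ((mat_apply m A ^^ k) x)"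
      by (simp only:)
    then show ?case using Suc.IH[of n'] n by simp
  qed simp
  have "0 = (mat_apply m B ^^ m) (poly_mat_apply m A ?r x) i" unfolding 0 funpow_mat_apply_0 ..
  also have "\<dots> = (\<Sum>k\<le>m. Polynomial.coeff ?r k * (mat_apply m B ^^ (m - k)) x i)"
    unfolding poly_mat_apply_def deg funpow_mat_apply_sum by (intro sum.cong refl) (simp add: BA)
  also have "\<dots> = (\<Sum>k\<le>m. Polynomial.coeff ?r (m - k) * (mat_apply m B ^^ k) x i)"
    by (rule sum.reindex_bij_witness[of _ "\<lambda>k. m - k" "\<lambda>k. m - k"]) auto
  also have "\<dots> = (\<Sum>k\<le>m. Polynomial.coeff (reflect_poly ?r) k * (mat_apply m B ^^ k) x i)"
    by (intro sum.cong refl) (simp add: coeff_reflect_poly deg)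
  also have "\<dots> = poly_mat_apply m B (reflect_poly ?r) x i"
    by (rule poly_mat_apply_bound[symmetric]) (use degree_reflect_poly_le[of ?r] deg in simp)
  also have "reflect_poly ?r = Polynomial.smult (\<Prod>j<m. - \<mu> j) (\<Prod>j<m. [:- inverse (\<mu> j), 1:])"
  proof -
    have "reflect_poly [:- \<mu> j, 1:] = Polynomial.smult (- \<mu> j) [:- inverse (\<mu> j), 1:]" if "j < m" for j
      using nz[OF that] by (simp add: reflect_poly_pCons)
    then show ?thesis unfolding reflect_poly_prod prod_smult[symmetric] by (intro prod.cong) auto
  qed
  finally have "(\<Prod>j<m. - \<mu> j) * poly_mat_apply m B (\<Prod>j<m. [:- inverse (\<mu> j), 1:]) x i = 0"
    by (simp add: poly_mat_apply_smult)
  then show "poly_mat_apply m B (\<Prod>j<m. [:- inverse (\<mu> j), 1:]) x i = 0" using nz by simp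
qed

definition companion :: "nat \<Rightarrow> complex poly \<Rightarrow> complex mat" where
  "companion m r = mat m m (\<lambda>(i, j). if j = m - 1 then - Polynomial.coeff r i else if i = j + 1 then 1 else 0)"

text \<open>Levelt's theorem. There is \<open>v \<noteq> 0\<close> such that \<open>A^k v\<close> lies in the hyperplane for all
  \<open>k < m - 1\<close>; hence \<open>A^k v = B^k v\<close> for \<open>k < m\<close>. These \<open>m\<close> vectors are independent, and in the
  basis that they form both matrices are companion matrices. Indeed, if \<open>s(A) v = 0\<close> with \<open>s\<close> of
  minimal degree, and \<open>s \<mu> = 0\<close>, then \<open>(s / (X - \<mu>))(A) v\<close> is an eigenvector of \<open>A\<close> for \<open>\<mu>\<close> inside
  the hyperplane, thus one of \<open>B\<close> too, and \<open>\<mu>\<close> is a common root of the two annihilating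
  polynomials.\<close>

theorem simultaneous_companion:
  assumes m: "m > 0" and A: "A \<in> carrier_mat m m" and B: "B \<in> carrier_mat m m"
    and rA: "degree rA = m" "Polynomial.coeff rA m = 1" "\<And>x. (\<And>i. i \<ge> m \<Longrightarrow> x i = 0) \<Longrightarrow> poly_mat_apply m A rA x = (\<lambda>_. 0)"
    and rB: "degree rB = m" "Polynomial.coeff rB m = 1" "\<And>x. (\<And>i. i \<ge> m \<Longrightarrow> x i = 0) \<Longrightarrow> poly_mat_apply m B rB x = (\<lambda>_. 0)"
    and no_common: "\<And>z. poly rA z = 0 \<Longrightarrow> poly rB z \<noteq> 0"
    and agree: "\<And>x. (\<Sum>i<m. l i * x i) = 0 \<Longrightarrow> mat_apply m A x = mat_apply m B x"
  obtains V W where "V \<in> carrier_mat m m" "W \<in> carrier_mat m m" "V * W = 1\<^sub>m m" "W * V = 1\<^sub>m m"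
    "A * V = V * companion m rA" "B * V = V * companion m rB"
proof -
  \<comment> \<open>The linear form \<open>l \<circ> A^k\<close>.\<close>
  define la where "la k = rec_nat l (\<lambda>_ f i. if i < m then \<Sum>j<m. f j * A $$ (j, i) else 0) k" for k :: nat
  have la: "(\<Sum>i<m. la k i * x i) = (\<Sum>i<m. l i * (mat_apply m A ^^ k) x i)" for k x
  proof (induction k arbitrary: x)
    case (Suc k)
    have "(\<Sum>i<m. la (Suc k) i * x i) = (\<Sum>i<m. (\<Sum>j<m. la k j * A $$ (j, i)) * x i)"
      by (simp add: la_def)
    also have "\<dots> = (\<Sum>j<m. la k j * (\<Sum>i<m. A $$ (j, i) * x i))"
      unfolding sum_distrib_left sum_distrib_right mult.assoc by (rule sum.swap)
    also have "\<dots> = (\<Sum>j<m. la k j * mat_apply m A x j)" by (simp add: mat_apply_def)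
    also have "\<dots> = (\<Sum>i<m. l i * (mat_apply m A ^^ Suc k) x i)"
      unfolding Suc funpow_Suc_right o_def ..
    finally show ?case .
  qed (simp add: la_def)
  obtain v0 where v0: "\<exists>i<m. v0 i \<noteq> 0" "\<And>k. k < m - 1 \<Longrightarrow> (\<Sum>i<m. la k i * v0 i) = 0"
    using underdetermined_system[of "m - 1" m la] m by auto
  define v where "v i = (if i < m then v0 i else 0)" for i
  have v: "\<exists>i<m. v i \<noteq> 0" "\<And>k. k < m - 1 \<Longrightarrow> (\<Sum>i<m. la k i * v i) = 0" "\<And>i. i \<ge> m \<Longrightarrow> v i = 0"
    using v0 by (auto simp: v_def)
  define w where "w k = (mat_apply m A ^^ k) v" for k
  have wS: "w (Suc k) = mat_apply m A (w k)" for k by (simp add: w_def)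
  have wsupp: "i \<ge> m \<Longrightarrow> w k i = 0" for k i unfolding w_def using funpow_mat_apply_support[OF v(3)] .
  have wl: "(\<Sum>i<m. l i * w k i) = 0" if "k < m - 1" for k
    using v(2)[OF that] la[of k v] by (simp add: w_def)
  have AB: "mat_apply m B (w k) = w (Suc k)" if "k < m - 1" for k using agree[OF wl[OF that]] wS by simp
  have wB: "(mat_apply m B ^^ k) v = w k" if "k < m" for k
    using that by (induction k) (auto simp: w_def[of 0] AB)
  have pevA: "poly_mat_apply m A r v i = (\<Sum>k\<le>degree r. Polynomial.coeff r k * w k i)" for r i
    by (simp add: poly_mat_apply_def w_def)
  have indep: "r = 0" if r: "degree r < m" "poly_mat_apply m A r v = (\<lambda>_. 0)" for r
  proof (rule ccontr)
    assume "r \<noteq> 0"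
    define Z where "Z d \<longleftrightarrow> (\<exists>r. r \<noteq> 0 \<and> degree r = d \<and> d < m \<and> poly_mat_apply m A r v = (\<lambda>_. 0))" for d
    have "Z (degree r)" using r \<open>r \<noteq> 0\<close> by (auto simp: Z_def)
    then obtain d where d: "Z d" "\<And>e. e < d \<Longrightarrow> \<not> Z e" using exists_least_iff[of Z] by blast
    then obtain s where s: "s \<noteq> 0" "degree s = d" "d < m" "poly_mat_apply m A s v = (\<lambda>_. 0)" by (auto simp: Z_def)
    have "d \<noteq> 0"
    proof
      assume d0: "d = 0"
      then obtain a where "s = [:a:]" using s(2) degree_eq_zeroE by blast
      then have "a * v i = 0" for i using s(4) by (auto simp add: poly_mat_apply_def fun_eq_iff)
      then show False using v(1) s(1) \<open>s = [:a:]\<close> by auto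
    qed
    then have "\<exists>i\<in>{1..degree s}. Polynomial.coeff s i \<noteq> 0"
      using s(1,2) by (intro bexI[of _ "degree s"]) auto
    then obtain \<mu> where "poly s \<mu> = 0"
      using fundamental_theorem_of_algebra[of "Polynomial.coeff s" "degree s"] by (auto simp: poly_altdef)
    then obtain s' where s': "s = [:- \<mu>, 1:] * s'" unfolding poly_eq_0_iff_dvd dvd_def by blast
    then have s'nz: "s' \<noteq> 0" using s(1) by auto
    then have deg: "degree s = Suc (degree s')" unfolding s' by (subst degree_mult_eq) auto
    define y where "y = poly_mat_apply m A s' v"
    have "\<not> Z (degree s')" using d(2) deg s(2) by simp
    then have y: "y \<noteq> (\<lambda>_. 0)" using s'nz deg s(2,3) by (auto simp: Z_def y_def)
    have Ay: "mat_apply m A y = (\<lambda>i. \<mu> * y i)"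
      using s(4) unfolding s' y_def by (auto simp: fun_eq_iff poly_mat_apply_linear_factor simp del: mult_pCons_left)
    have "(\<Sum>i<m. l i * y i) = (\<Sum>k\<le>degree s'. Polynomial.coeff s' k * (\<Sum>i<m. l i * w k i))"
      unfolding y_def pevA sum_distrib_left by (subst sum.swap) (simp add: mult_ac)
    also have "\<dots> = 0" using wl deg s(2,3) by (intro sum.neutral) auto
    finally have By: "mat_apply m B y = (\<lambda>i. \<mu> * y i)" using agree Ay by simp
    have ysupp: "y i = 0" if "i \<ge> m" for i using wsupp[OF that] by (simp add: y_def pevA)
    obtain i where i: "y i \<noteq> 0" using y by auto
    have "poly rA \<mu> * y i = 0" using poly_mat_apply_eigenvector[OF Ay, of rA i] rA(3)[OF ysupp] by simp
    moreover have "poly rB \<mu> * y i = 0" using poly_mat_apply_eigenvector[OF By, of rB i] rB(3)[OF ysupp] by simp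
    ultimately show False using no_common i by auto
  qed
  define V where "V = mat m m (\<lambda>(i, j). w j i)"
  have V: "V \<in> carrier_mat m m" by (simp add: V_def)
  have "det V \<noteq> 0"
  proof
    assume "det V = 0"
    then obtain c where c: "c \<in> carrier_vec m" "c \<noteq> 0\<^sub>v m" "V *\<^sub>v c = 0\<^sub>v m"
      using det_0_iff_vec_prod_zero_field[OF V] by blast
    have cw: "(\<Sum>j<m. vec_index c j * w j i) = 0" for i
    proof (cases "i < m")
      case True
      then have "vec_index (V *\<^sub>v c) i = (\<Sum>j<m. V $$ (i, j) * vec_index c j)"
        by (rule mult_mat_vec_index_sum[OF V c(1)])
      then show ?thesis using True unfolding c(3) by (simp add: V_def mult.commute)
    qed (simp add: wsupp)
    define r where "r = (\<Sum>j<m. monom (vec_index c j) j)"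
    have rc: "Polynomial.coeff r k = (if k < m then vec_index c k else 0)" for k
      by (simp add: r_def coeff_sum)
    have "degree r \<le> m - 1" by (rule degree_le) (use m in \<open>auto simp: rc\<close>)
    have "poly_mat_apply m A r v i = 0" for i
    proof -
      have "poly_mat_apply m A r v i = (\<Sum>k\<le>m - 1. Polynomial.coeff r k * w k i)"
        using poly_mat_apply_bound[OF \<open>degree r \<le> m - 1\<close>] by (simp add: w_def)
      also have "{..m - 1} = {..<m}" using m by auto
      finally show ?thesis using cw by (simp add: rc)
    qed
    then have "r = 0" using indep[of r] \<open>degree r \<le> m - 1\<close> m by (auto simp: fun_eq_iff)
    then have "vec_index c k = 0" if "k < m" for k using rc[of k] that by simp
    then show False using c(1,2) by (auto intro!: eq_vecI)
  qed
  then have "V \<in> Units (ring_mat TYPE(complex) m ())" by (rule det_non_zero_imp_unit[OF V])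
  then obtain W where W: "W \<in> carrier_mat m m" "V * W = 1\<^sub>m m" "W * V = 1\<^sub>m m"
    by (auto simp: Units_def ring_mat_def)
  have comp: "M * V = V * companion m r"
    if M: "M \<in> carrier_mat m m" and Mw: "\<And>k. k < m \<Longrightarrow> (mat_apply m M ^^ k) v = w k"
      and r: "degree r = m" "Polynomial.coeff r m = 1" "poly_mat_apply m M r v = (\<lambda>_. 0)" for M r
  proof (rule eq_matI)
    fix i j assume "i < dim_row (V * companion m r)" "j < dim_col (V * companion m r)"
    then have ij: "i < m" "j < m" by (auto simp: V_def companion_def)
    have "(M * V) $$ (i, j) = (\<Sum>k<m. M $$ (i, k) * w j k)"
      using ij M by (simp add: V_def scalar_prod_def atLeast0LessThan)
    also have "\<dots> = mat_apply m M ((mat_apply m M ^^ j) v) i" using ij Mw[of j] by (simp add: mat_apply_def)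
    also have "\<dots> = (mat_apply m M ^^ Suc j) v i" by simp
    finally have lhs: "(M * V) $$ (i, j) = (mat_apply m M ^^ Suc j) v i" .
    have rhs: "(V * companion m r) $$ (i, j) = (\<Sum>k<m. w k i * companion m r $$ (k, j))"
      using ij by (simp add: V_def companion_def scalar_prod_def atLeast0LessThan)
    show "(M * V) $$ (i, j) = (V * companion m r) $$ (i, j)"
    proof (cases "j = m - 1")
      case True
      have "0 = (\<Sum>k\<le>m. Polynomial.coeff r k * (mat_apply m M ^^ k) v i)"
        using r(3) unfolding poly_mat_apply_def r(1) by (simp add: fun_eq_iff)
      also have "\<dots> = (\<Sum>k<m. Polynomial.coeff r k * w k i) + (mat_apply m M ^^ m) v i"
        unfolding lessThan_Suc_atMost[symmetric] sum.lessThan_Suc using Mw r(2) by simp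
      finally have "(mat_apply m M ^^ m) v i = - (\<Sum>k<m. Polynomial.coeff r k * w k i)" by (simp add: eq_neg_iff_add_eq_0 add.commute)
      also have "\<dots> = (\<Sum>k<m. w k i * companion m r $$ (k, j))"
        unfolding sum_negf[symmetric] using True m by (intro sum.cong) (auto simp: companion_def)
      finally show ?thesis using lhs rhs True m by simp
    next
      case False
      then have "Suc j < m" using ij by simp
      have "(\<Sum>k<m. w k i * companion m r $$ (k, j)) = (\<Sum>k<m. if k = Suc j then w k i else 0)"
        using False ij by (intro sum.cong) (auto simp: companion_def)
      then show ?thesis using lhs rhs Mw[OF \<open>Suc j < m\<close>] \<open>Suc j < m\<close> by simp
    qed
  qed (use that V in \<open>auto simp: companion_def\<close>)
  show ?thesis
    by (rule that[OF V W comp[OF A _ rA(1,2)] comp[OF B wB rB(1,2)]])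
       (use rA(3)[OF v(3)] rB(3)[OF v(3)] in \<open>simp_all add: w_def\<close>)
qed

section \<open>Continuation through three charts\<close>

text \<open>The plane minus two of the three intervals \<open>(-\<infinity>, 0)\<close>, \<open>(0, 1)\<close>, \<open>(1, \<infinity>)\<close> and the points \<open>0\<close>,
  \<open>1\<close>; chart \<open>0\<close> keeps \<open>(0, 1)\<close>, chart \<open>1\<close> keeps \<open>(-\<infinity>, 0)\<close>, and chart \<open>2\<close> keeps \<open>(1, \<infinity>)\<close>. The
  charts are star-shaped, and two of them meet in the union of the upper and the lower half-plane.\<close>

definition chart :: "nat \<Rightarrow> complex set" where
  "chart k = {z. Im z \<noteq> 0 \<or> (if k = 0 then 0 < Re z \<and> Re z < 1 else if k = 1 then Re z < 0 else 1 < Re z)}"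

definition centre :: "nat \<Rightarrow> complex" where
  "centre k = (if k = 0 then 1/2 else if k = 1 then -1 else 3/2)"

lemma open_chart: "open (chart k)"
proof -
  have "chart k = {z. Im z < 0} \<union> {z. Im z > 0} \<union>
    (if k = 0 then {z. 0 < Re z} \<inter> {z. Re z < 1} else if k = 1 then {z. Re z < 0} else {z. 1 < Re z})"
    by (auto simp: chart_def)
  moreover have "open ({z. Im z < 0} \<union> {z. Im z > 0} \<union>
    (if k = 0 then {z. 0 < Re z} \<inter> {z. Re z < 1} else if k = 1 then {z. Re z < 0} else {z. 1 < Re z}))"
    by (simp add: open_Un open_Int open_halfspace_Im_lt open_halfspace_Im_gt open_halfspace_Re_lt open_halfspace_Re_gt)
  ultimately show ?thesis by simp
qed

lemma star_at_chart: "star_at (centre k) (chart k)"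
  unfolding star_at_def
proof (intro conjI ballI)
  show "centre k \<in> chart k" by (auto simp: centre_def chart_def)
  fix z and s :: real assume z: "z \<in> chart k" and s: "s \<in> {0..1}"
  define a where "a = Re (centre k)"
  have im: "Im (centre k) = 0" by (simp add: centre_def)
  let ?w = "centre k + of_real s * (z - centre k)"
  have w: "Re ?w = (1 - s) * a + s * Re z" "Im ?w = s * Im z"
    by (simp_all add: a_def im algebra_simps)
  show "?w \<in> chart k"
  proof (cases "Im ?w = 0")
    case True
    then consider "s = 0" | "Im z = 0" using w by auto
    then show ?thesis
    proof cases
      case 1 then show ?thesis by (auto simp: centre_def chart_def)
    next
      case 2
      have cv: "convex ({0<..<1} :: real set)" "convex ({..<0} :: real set)" "convex ({1<..} :: real set)" by auto
      have "s \<ge> 0" "1 - s \<ge> 0" "(1 - s) + s = 1" using s by auto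
      note cvs = this
      have "(1 - s) *\<^sub>R a + s *\<^sub>R Re z \<in> (if k = 0 then {0<..<1} else if k = 1 then {..<0} else {1<..})"
        using convexD[OF cv(1) _ _ cvs(2,1,3), of a "Re z"] convexD[OF cv(2) _ _ cvs(2,1,3), of a "Re z"]
          convexD[OF cv(3) _ _ cvs(2,1,3), of a "Re z"] z 2
        by (auto simp: a_def centre_def chart_def split: if_splits)
      then show ?thesis unfolding chart_def mem_Collect_eq w by (auto split: if_splits)
    qed
  qed (auto simp: chart_def)
qed

lemma connected_chart: "connected (chart k)"
proof (rule starlike_imp_connected)
  have "closed_segment (centre k) z \<subseteq> chart k" if "z \<in> chart k" for z
  proof
    fix w assume "w \<in> closed_segment (centre k) z"
    then obtain u where "0 \<le> u" "u \<le> 1" "w = (1 - u) *\<^sub>R centre k + u *\<^sub>R z" by (auto simp: closed_segment_def)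
    then have "w = centre k + of_real u * (z - centre k)" by (simp add: scaleR_conv_of_real algebra_simps)
    then show "w \<in> chart k" using star_atD[OF star_at_chart that] \<open>0 \<le> u\<close> \<open>u \<le> 1\<close> by blast
  qed
  moreover have "centre k \<in> chart k" using star_at_chart by (simp add: star_at_def)
  ultimately show "starlike (chart k)" unfolding starlike_def by blast
qed

lemma chart_cover: "z \<noteq> 0 \<Longrightarrow> z \<noteq> 1 \<Longrightarrow> \<exists>k<3. z \<in> chart k"
proof -
  assume z: "z \<noteq> 0" "z \<noteq> 1"
  then consider "Im z \<noteq> 0" | "Re z < 0" | "0 < Re z" "Re z < 1" | "Re z > 1"
    by (metis complex_eqI linorder_neqE_linordered_idom one_complex.sel zero_complex.sel)
  then have "z \<in> chart 0 \<or> z \<in> chart 1 \<or> z \<in> chart 2"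
    by cases (simp_all add: chart_def)
  then show ?thesis by (elim disjE) (rule exI, rule conjI[rotated], assumption, simp)+
qed

lemma (in hypergeometric) region_chart: "region (chart k)"
  unfolding region_def using open_chart connected_chart by (auto simp: chart_def)

text \<open>The columns of \<open>M\<close> are the coordinates of the new basis in the old one.\<close>

definition basis_change :: "nat \<Rightarrow> complex mat \<Rightarrow> (nat \<Rightarrow> complex \<Rightarrow> complex) \<Rightarrow> nat \<Rightarrow> complex \<Rightarrow> complex" where
  "basis_change m M \<Phi> j = lin_comb m (\<lambda>i. M $$ (i, j)) \<Phi>"

lemma basis_change_mult:
  assumes "A \<in> carrier_mat m m" "B \<in> carrier_mat m m" "j < m"
  shows "basis_change m (A * B) \<Phi> j = basis_change m B (basis_change m A \<Phi>) j"
proof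
  fix z
  have "basis_change m (A * B) \<Phi> j z = (\<Sum>i<m. (\<Sum>k<m. A $$ (i, k) * B $$ (k, j)) * \<Phi> i z)"
    using assms by (simp add: basis_change_def lin_comb_def scalar_prod_def atLeast0LessThan)
  also have "\<dots> = (\<Sum>i<m. \<Sum>k<m. B $$ (k, j) * (A $$ (i, k) * \<Phi> i z))"
    by (simp add: sum_distrib_left sum_distrib_right mult_ac)
  also have "\<dots> = (\<Sum>k<m. \<Sum>i<m. B $$ (k, j) * (A $$ (i, k) * \<Phi> i z))" by (rule sum.swap)
  finally show "basis_change m (A * B) \<Phi> j z = basis_change m B (basis_change m A \<Phi>) j z"
    by (simp add: basis_change_def lin_comb_def sum_distrib_left)
qed

lemma basis_change_one: "j < m \<Longrightarrow> basis_change m (1\<^sub>m m) \<Phi> j = \<Phi> j"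
  by (rule ext) (simp add: basis_change_def lin_comb_def if_distrib[of "\<lambda>x. x * _"] cong: if_cong)

lemma lin_comb_basis_change: "lin_comb m c (basis_change m A \<Phi>) = lin_comb m (mat_apply m A c) \<Phi>"
proof
  fix z
  have "lin_comb m c (basis_change m A \<Phi>) z = (\<Sum>j<m. \<Sum>i<m. A $$ (i, j) * c j * \<Phi> i z)"
    by (simp add: basis_change_def lin_comb_def sum_distrib_left mult_ac)
  also have "\<dots> = (\<Sum>i<m. \<Sum>j<m. A $$ (i, j) * c j * \<Phi> i z)" by (rule sum.swap)
  finally show "lin_comb m c (basis_change m A \<Phi>) z = lin_comb m (mat_apply m A c) \<Phi> z"
    by (simp add: lin_comb_def mat_apply_def sum_distrib_right)
qed

lemma germ_eq_basis_change: "(\<And>i. i < m \<Longrightarrow> germ_eq z (f i) (g i)) \<Longrightarrow> germ_eq z (basis_change m A f j) (basis_change m A g j)"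
  unfolding basis_change_def by (rule germ_eq_lin_comb)

lemma is_monodromy_matrix_basis_change:
  "is_monodromy_matrix m \<Phi> l M \<longleftrightarrow> M \<in> carrier_mat m m \<and> (\<forall>j<m. continuation_along l (\<Phi> j) (basis_change m M \<Phi> j))"
  by (simp add: is_monodromy_matrix_def basis_change_def)

lemma continuation_along_basis_change:
  "path l \<Longrightarrow> (\<And>j. j < m \<Longrightarrow> continuation_along l (f j) (g j)) \<Longrightarrow> continuation_along l (basis_change m A f j) (basis_change m A g j)"
  unfolding basis_change_def by (rule continuation_along_lin_comb)

lemma continuation_three_pieces:
  assumes p: "path p" and ab: "0 \<le> a" "a \<le> b" "b \<le> 1"
    and f: "\<And>s. 0 \<le> s \<Longrightarrow> s \<le> a \<Longrightarrow> f analytic_on {p s}"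
    and g: "\<And>s. a \<le> s \<Longrightarrow> s \<le> b \<Longrightarrow> g analytic_on {p s}"
    and h: "\<And>s. b \<le> s \<Longrightarrow> s \<le> 1 \<Longrightarrow> h analytic_on {p s}"
    and eq: "germ_eq (p a) f g" "germ_eq (p b) g h"
  shows "continuation_along p f h"
proof -
  have c: "continuous_on {0..1} p" using p by (simp add: path_def)
  have 1: "germ_family p a 1 (\<lambda>s. if s \<le> b then g else h)"
    by (rule germ_family_join[OF continuous_on_subset[OF c]]) (use ab g h eq in \<open>auto intro: germ_family_const\<close>)
  have 2: "germ_family p 0 1 (\<lambda>s. if s \<le> a then f else if s \<le> b then g else h)"
    by (rule germ_family_join[OF c _ _ germ_family_const 1]) (use ab f eq in auto)
  have "germ_eq (p 1) (if 1 \<le> a then f else if 1 \<le> b then g else h) h"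
  proof (cases "b = 1")
    case True
    then show ?thesis using eq germ_eq_trans[of "p 1" f g h] ab by (cases "a = 1") auto
  qed (use ab in auto)
  then show ?thesis unfolding continuation_along_germ_family using 2 ab
    by (intro exI[of _ "\<lambda>s. if s \<le> a then f else if s \<le> b then g else h"]) auto
qed

lemma continuation_const:
  "(\<And>s. 0 \<le> s \<Longrightarrow> s \<le> 1 \<Longrightarrow> f analytic_on {p s}) \<Longrightarrow> continuation_along p f f"
  unfolding continuation_along_germ_family by (intro exI[of _ "\<lambda>_. f"]) (auto intro: germ_family_const)

text \<open>Bases of solutions on the charts that agree on the upper half-plane; \<open>T k\<close> compares them on
  the lower half-plane. All monodromy is expressed by these matrices: a loop that passes from
  chart \<open>0\<close> to chart \<open>k\<close> above the real axis and back below it has matrix \<open>T k\<close>.\<close>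

locale charts = hypergeometric +
  fixes \<Phi> :: "nat \<Rightarrow> nat \<Rightarrow> complex \<Rightarrow> complex" and T Ti :: "nat \<Rightarrow> complex mat"
  assumes fundamental_chart: "\<And>k. fundamental (chart k) (\<Phi> k)"
    and upper: "\<And>k j z. j < m \<Longrightarrow> Im z > 0 \<Longrightarrow> \<Phi> k j z = \<Phi> 0 j z"
    and lower: "\<And>k j z. j < m \<Longrightarrow> Im z < 0 \<Longrightarrow> \<Phi> k j z = basis_change m (T k) (\<Phi> 0) j z"
    and T: "\<And>k. T k \<in> carrier_mat m m" "\<And>k. Ti k \<in> carrier_mat m m"
    and T_inv: "\<And>k. T k * Ti k = 1\<^sub>m m" "\<And>k. Ti k * T k = 1\<^sub>m m"
begin

lemma sol_\<Phi>: "j < m \<Longrightarrow> sol (chart k) (\<Phi> k j)"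
  using fundamental_chart[of k] unfolding fundamental_def by blast

lemma sol_basis_change: "sol (chart k) (basis_change m A (\<Phi> k) j)"
  unfolding basis_change_def by (rule sol_lin_comb[OF open_chart]) (rule sol_\<Phi>)

lemma sol_analytic: "sol D f \<Longrightarrow> open D \<Longrightarrow> z \<in> D \<Longrightarrow> f analytic_on {z}"
  unfolding sol_def analytic_at by blast

lemma germ_upper:
  assumes "Im z > 0" "j < m"
  shows "germ_eq z (\<Phi> k j) (\<Phi> k' j)"
proof (rule germ_eq_open[of "{z. Im z > 0}"])
  fix w assume "w \<in> {z. Im z > 0}"
  then have "Im w > 0" by simp
  from upper[OF assms(2) this, of k] upper[OF assms(2) this, of k'] show "\<Phi> k j w = \<Phi> k' j w" by (rule trans[OF _ sym])
qed (use assms in \<open>auto simp: open_halfspace_Im_gt\<close>)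

lemma germ_lower_0:
  assumes "Im z < 0" "j < m"
  shows "germ_eq z (\<Phi> k j) (basis_change m (T k) (\<Phi> 0) j)"
  using lower[OF assms(2)] assms(1) by (intro germ_eq_open[of "{z. Im z < 0}"]) (auto simp: open_halfspace_Im_lt)

lemma germ_lower_inv:
  assumes "Im z < 0" "j < m"
  shows "germ_eq z (\<Phi> 0 j) (basis_change m (Ti k) (\<Phi> k) j)"
proof -
  have g: "germ_eq z (basis_change m (Ti k) (\<Phi> k) j) (basis_change m (Ti k) (basis_change m (T k) (\<Phi> 0)) j)"
    by (rule germ_eq_basis_change) (rule germ_lower_0[OF assms(1)])
  have e: "basis_change m (Ti k) (basis_change m (T k) (\<Phi> 0)) j = \<Phi> 0 j"
    unfolding basis_change_mult[OF T(1) T(2) assms(2), symmetric] T_inv(1) by (rule basis_change_one[OF assms(2)])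
  show ?thesis using germ_eq_sym[OF g] unfolding e .
qed

lemma germ_lower:
  assumes "Im z < 0" "j < m"
  shows "germ_eq z (\<Phi> k j) (basis_change m (Ti k' * T k) (\<Phi> k') j)"
proof -
  have "germ_eq z (basis_change m (T k) (\<Phi> 0) j) (basis_change m (T k) (basis_change m (Ti k') (\<Phi> k')) j)"
    by (rule germ_eq_basis_change) (rule germ_lower_inv[OF assms(1)])
  with germ_lower_0[OF assms] show ?thesis
    unfolding basis_change_mult[OF T(2) T(1) assms(2)] by (rule germ_eq_trans)
qed

text \<open>Every chart carries a full set of solutions, so a germ of a solution can be continued as
  long as the path stays in one chart; Bolzano's principle joins the pieces.\<close>

lemma continuation_exists:
  assumes l: "path l" "path_image l \<subseteq> - {0, 1}" and f: "local_solution (hyp_op p q) (pathstart l) f"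
  obtains g where "continuation_along l f g" "local_solution (hyp_op p q) (pathfinish l) g"
proof -
  let ?ls = "\<lambda>z. local_solution (hyp_op p q) z"
  have c: "continuous_on {0..1} l" using l by (simp add: path_def)
  have "0 \<le> (0::real) \<and> (1::real) \<le> 1 \<longrightarrow>
    (\<forall>f. ?ls (l 0) f \<longrightarrow> (\<exists>F. germ_family l 0 1 F \<and> germ_eq (l 0) (F 0) f \<and> ?ls (l 1) (F 1)))"
  proof (rule Bolzano[where P="\<lambda>a b. 0 \<le> a \<and> b \<le> 1 \<longrightarrow>
    (\<forall>f. ?ls (l a) f \<longrightarrow> (\<exists>F. germ_family l a b F \<and> germ_eq (l a) (F a) f \<and> ?ls (l b) (F b)))" and a=0 and b=1])
    fix a b c' :: real
    assume ab: "0 \<le> a \<and> b \<le> 1 \<longrightarrow> (\<forall>f. ?ls (l a) f \<longrightarrow> (\<exists>F. germ_family l a b F \<and> germ_eq (l a) (F a) f \<and> ?ls (l b) (F b)))"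
      and bc: "0 \<le> b \<and> c' \<le> 1 \<longrightarrow> (\<forall>f. ?ls (l b) f \<longrightarrow> (\<exists>F. germ_family l b c' F \<and> germ_eq (l b) (F b) f \<and> ?ls (l c') (F c')))"
      and le: "a \<le> b" "b \<le> c'"
    show "0 \<le> a \<and> c' \<le> 1 \<longrightarrow> (\<forall>f. ?ls (l a) f \<longrightarrow> (\<exists>F. germ_family l a c' F \<and> germ_eq (l a) (F a) f \<and> ?ls (l c') (F c')))"
    proof (intro impI allI)
      fix f assume ac: "0 \<le> a \<and> c' \<le> 1" and f: "?ls (l a) f"
      obtain F where F: "germ_family l a b F" "germ_eq (l a) (F a) f" "?ls (l b) (F b)" using ab ac f le by auto
      obtain G where G: "germ_family l b c' G" "germ_eq (l b) (G b) (F b)" "?ls (l c') (G c')" using bc ac F(3) le by auto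
      let ?H = "\<lambda>s. if s \<le> b then F s else G s"
      have "germ_family l a c' ?H"
        by (rule germ_family_join[OF continuous_on_subset[OF c] le F(1) G(1) germ_eq_sym[OF G(2)]]) (use ac le in auto)
      moreover have "?ls (l c') (?H c')"
        using G F(3) le by (cases "c' = b") auto
      ultimately show "\<exists>F. germ_family l a c' F \<and> germ_eq (l a) (F a) f \<and> ?ls (l c') (F c')"
        using F(2) le by (intro exI[of _ ?H]) auto
    qed
  next
    fix s :: real assume s: "0 \<le> s" "s \<le> 1"
    have "l s \<in> path_image l" using s by (auto simp: path_image_def)
    then obtain k where k: "l s \<in> chart k" using chart_cover[of "l s"] l(2) by blast
    obtain e where e: "e > 0" "ball (l s) e \<subseteq> chart k" using openE[OF open_chart k] .
    obtain d where d: "d > 0" "\<And>s'. s' \<in> {0..1} \<Longrightarrow> dist s' s < d \<Longrightarrow> dist (l s') (l s) < e"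
      using c s e(1) unfolding continuous_on_iff by (metis atLeastAtMost_iff)
    have near: "l s' \<in> chart k" if "s' \<in> {0..1}" "dist s' s < d" for s'
      using d(2)[OF that] e(2) by (auto simp: dist_commute)
    show "\<exists>d>0. \<forall>a b. a \<le> s \<and> s \<le> b \<and> b - a < d \<longrightarrow> 0 \<le> a \<and> b \<le> 1 \<longrightarrow>
       (\<forall>f. ?ls (l a) f \<longrightarrow> (\<exists>F. germ_family l a b F \<and> germ_eq (l a) (F a) f \<and> ?ls (l b) (F b)))"
    proof (intro exI[of _ d] conjI allI impI d(1))
      fix a b f assume ab: "a \<le> s \<and> s \<le> b \<and> b - a < d" "0 \<le> a \<and> b \<le> 1" and f: "?ls (l a) f"
      have ch: "l s' \<in> chart k" if "a \<le> s'" "s' \<le> b" for s'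
        using near[of s'] ab that by (auto simp: dist_real_def)
      obtain cc where cc: "germ_eq (l a) f (lin_comb m cc (\<Phi> k))"
        using local_solution_lin_comb[OF region_chart ch fundamental_chart, of a f] f ab by auto
      have sl: "sol (chart k) (lin_comb m cc (\<Phi> k))" by (intro sol_lin_comb open_chart sol_\<Phi>)
      show "\<exists>F. germ_family l a b F \<and> germ_eq (l a) (F a) f \<and> ?ls (l b) (F b)"
        using germ_eq_sym[OF cc] sol_imp_local_solution[OF open_chart ch sl, of b] ab
        by (intro exI[of _ "\<lambda>_. lin_comb m cc (\<Phi> k)"] conjI germ_family_const sol_analytic[OF sl open_chart] ch) auto
    qed
  qed auto
  then obtain F where "germ_family l 0 1 F" "germ_eq (l 0) (F 0) f" "?ls (l 1) (F 1)"
    using f unfolding pathstart_def by auto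
  note F = this
  have "continuation_along l f (F 1)"
    unfolding continuation_along_germ_family using F by (intro exI[of _ F]) auto
  then show ?thesis using that[of "F 1"] F(3) by (simp add: pathfinish_def)
qed

text \<open>Along a path the coordinates with respect to the basis of the current chart change only when
  the chart changes, and then by a matrix \<open>Ti k' * T k\<close> or not at all. This replaces a computation
  of the fundamental group of the twice punctured plane.\<close>

lemma monodromy_in_group:
  assumes G: "\<And>A B. A \<in> G \<Longrightarrow> B \<in> G \<Longrightarrow> A * B \<in> G" "G \<subseteq> carrier_mat m m" "1\<^sub>m m \<in> G"
      "\<And>k k'. k < 3 \<Longrightarrow> k' < 3 \<Longrightarrow> Ti k' * T k \<in> G"
    and l: "loop_at (1/2) l" and M: "is_monodromy_matrix m (\<Phi> 0) l M"
  shows "M \<in> G"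
proof -
  have lp: "path l" "path_image l \<subseteq> - {0, 1}" "l 0 = 1/2" "l 1 = 1/2"
    using l by (auto simp: loop_at_def pathstart_def pathfinish_def)
  have c: "continuous_on {0..1} l" using lp by (simp add: path_def)
  have "\<exists>F. germ_family l 0 1 F \<and> germ_eq (l 0) (F 0) (\<Phi> 0 j) \<and> germ_eq (l 1) (F 1) (basis_change m M (\<Phi> 0) j)" if "j < m" for j
    using M that unfolding is_monodromy_matrix_basis_change continuation_along_germ_family by blast
  then obtain F where F: "\<And>j. j < m \<Longrightarrow> germ_family l 0 1 (F j)" "\<And>j. j < m \<Longrightarrow> germ_eq (l 0) (F j 0) (\<Phi> 0 j)"
    "\<And>j. j < m \<Longrightarrow> germ_eq (l 1) (F j 1) (basis_change m M (\<Phi> 0) j)" by metis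
  have transition: "\<exists>S\<in>G. \<forall>j<m. germ_eq z (\<Phi> k j) (basis_change m S (\<Phi> k') j)"
    if z: "z \<in> chart k" "z \<in> chart k'" "k < 3" "k' < 3" for z k k'
  proof -
    consider "k = k'" | "Im z > 0" | "Im z < 0"
      using z by (fastforce simp: chart_def split: if_splits)
    then show ?thesis
    proof cases
      case 1 then show ?thesis using G(3) by (intro bexI[of _ "1\<^sub>m m"]) (auto simp: basis_change_one)
    next
      case 2
      then have "\<forall>j<m. germ_eq z (\<Phi> k j) (basis_change m (1\<^sub>m m) (\<Phi> k') j)" using germ_upper by (simp add: basis_change_one)
      then show ?thesis using G(3) by blast
    next
      case 3 then show ?thesis using germ_lower G(4)[OF z(3,4)] by blast
    qed
  qed
  \<comment> \<open>At parameter \<open>s\<close> the continued germs have, in every chart through \<open>l s\<close>, coordinates in \<open>G\<close>.\<close>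
  define Q where "Q s \<longleftrightarrow> (\<forall>k<3. l s \<in> chart k \<longrightarrow> (\<exists>C\<in>G. \<forall>j<m. germ_eq (l s) (F j s) (basis_change m C (\<Phi> k) j)))" for s
  have Q_if: "Q s" if k: "k < 3" "l s \<in> chart k" "C \<in> G" and g: "\<And>j. j < m \<Longrightarrow> germ_eq (l s) (F j s) (basis_change m C (\<Phi> k) j)" for s k C
    unfolding Q_def
  proof (intro allI impI)
    fix k' assume k': "k' < (3::nat)" "l s \<in> chart k'"
    obtain S where S: "S \<in> G" "\<forall>j<m. germ_eq (l s) (\<Phi> k j) (basis_change m S (\<Phi> k') j)"
      using transition[OF k(2) k'(2) k(1) k'(1)] by blast
    have "germ_eq (l s) (F j s) (basis_change m (S * C) (\<Phi> k') j)" if "j < m" for j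
    proof -
      have "germ_eq (l s) (basis_change m C (\<Phi> k) j) (basis_change m C (basis_change m S (\<Phi> k')) j)"
        by (rule germ_eq_basis_change) (use S in blast)
      moreover have "basis_change m C (basis_change m S (\<Phi> k')) j = basis_change m (S * C) (\<Phi> k') j"
        by (rule basis_change_mult[symmetric]) (use S \<open>C \<in> G\<close> G(2) that in auto)
      ultimately show ?thesis using germ_eq_trans[OF g[OF that]] by simp
    qed
    then show "\<exists>C\<in>G. \<forall>j<m. germ_eq (l s) (F j s) (basis_change m C (\<Phi> k') j)"
      using G(1)[OF S(1) k(3)] by blast
  qed
  have "Q 1"
  proof (rule path_property_induct[of Q])
    have "l 0 \<in> chart 0" unfolding lp(3) by (simp add: chart_def)
    then show "Q 0" by (rule Q_if[of 0 0 "1\<^sub>m m", rotated]) (use G F(2) basis_change_one in auto)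
    fix s :: real assume s: "s \<in> {0..1}"
    have "l s \<in> path_image l" using s by (auto simp: path_image_def)
    then obtain k where k: "k < 3" "l s \<in> chart k" using chart_cover[of "l s"] lp(2) by blast
    have "\<exists>d>0. \<forall>s'\<in>{0..1}. dist s' s < d \<longrightarrow> l s' \<in> chart k"
    proof -
      obtain e where e: "e > 0" "ball (l s) e \<subseteq> chart k" using openE[OF open_chart k(2)] .
      obtain d where d: "d > 0" "\<And>s'. s' \<in> {0..1} \<Longrightarrow> dist s' s < d \<Longrightarrow> dist (l s') (l s) < e"
        using c s e(1) unfolding continuous_on_iff by blast
      have "l s' \<in> chart k" if "s' \<in> {0..1}" "dist s' s < d" for s'
        using d(2)[OF that] e(2) by (auto simp: dist_commute)
      then show ?thesis using d(1) by blast
    qed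
    then obtain d0 where d0: "d0 > 0" "\<And>s'. s' \<in> {0..1} \<Longrightarrow> dist s' s < d0 \<Longrightarrow> l s' \<in> chart k" by blast
    have "\<exists>d>0. \<forall>s'\<in>{0..1}. \<forall>s''\<in>{0..1}. dist s' s < d \<longrightarrow> dist s'' s < d \<longrightarrow>
       (\<forall>C. germ_eq (l s') (F j s') (basis_change m C (\<Phi> k) j) \<longrightarrow> germ_eq (l s'') (F j s'') (basis_change m C (\<Phi> k) j))" if j: "j < m" for j
    proof -
      obtain d1 where d1: "d1 > 0" "\<And>s'. s' \<in> {0..1} \<Longrightarrow> dist s' s < d1 \<Longrightarrow> germ_eq (l s') (F j s') (F j s)"
        by (rule germ_family_local[OF F(1)[OF j] s]) blast
      obtain e where e: "e > 0" "ball (l s) e \<subseteq> chart k" "F j s holomorphic_on ball (l s) e"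
      proof -
        obtain e1 where "e1 > 0" "F j s holomorphic_on ball (l s) e1"
          using germ_family_analytic[OF F(1)[OF j] s] unfolding analytic_on_def by auto
        moreover obtain e2 where "e2 > 0" "ball (l s) e2 \<subseteq> chart k" using openE[OF open_chart k(2)] .
        ultimately show ?thesis
          by (intro that[of "min e1 e2"]) (auto intro: holomorphic_on_subset)
      qed
      obtain d2 where d2: "d2 > 0" "\<And>s'. s' \<in> {0..1} \<Longrightarrow> dist s' s < d2 \<Longrightarrow> dist (l s') (l s) < e"
        using c s e(1) unfolding continuous_on_iff by blast
      have "germ_eq (l s'') (F j s'') (basis_change m C (\<Phi> k) j)"
        if s': "s' \<in> {0..1}" "s'' \<in> {0..1}" "dist s' s < min d1 d2" "dist s'' s < min d1 d2"
          and g: "germ_eq (l s') (F j s') (basis_change m C (\<Phi> k) j)" for s' s'' C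
      proof -
        have "germ_eq (l s') (F j s) (basis_change m C (\<Phi> k) j)"
          using germ_eq_trans[OF germ_eq_sym[OF d1(2)[of s']] g] s' by simp
        then obtain r where r: "r > 0" "\<forall>w\<in>ball (l s') r. F j s w = basis_change m C (\<Phi> k) j w" unfolding germ_eq_ball by blast
        have in_ball: "l s' \<in> ball (l s) e" "l s'' \<in> ball (l s) e" using d2(2) s' by (auto simp: dist_commute)
        have "l s' \<in> ball (l s') r \<inter> ball (l s) e" using r in_ball by simp
        then have ne: "ball (l s') r \<inter> ball (l s) e \<noteq> {}" by blast
        have "basis_change m C (\<Phi> k) j holomorphic_on ball (l s) e"
          using sol_basis_change[of k C j] e(2) unfolding sol_def by (blast intro: holomorphic_on_subset)
        then have "F j s w = basis_change m C (\<Phi> k) j w" if "w \<in> ball (l s) e" for w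
          using e(3) r(2) ne that
          by (intro analytic_continuation_open[of "ball (l s') r \<inter> ball (l s) e" "ball (l s) e" "F j s" "basis_change m C (\<Phi> k) j" w]) auto
        then have "germ_eq (l s'') (F j s) (basis_change m C (\<Phi> k) j)"
          using germ_eq_open[of "ball (l s) e" "l s''"] in_ball by blast
        with d1(2)[of s''] s' show ?thesis by (meson germ_eq_trans min_less_iff_conj)
      qed
      moreover have "min d1 d2 > 0" using d1 d2 by simp
      ultimately show ?thesis by blast
    qed
    then obtain dd where dd: "\<And>j. j < m \<Longrightarrow> dd j > 0"
      "\<And>j s' s'' C. j < m \<Longrightarrow> s' \<in> {0..1} \<Longrightarrow> s'' \<in> {0..1} \<Longrightarrow> dist s' s < dd j \<Longrightarrow> dist s'' s < dd j \<Longrightarrow>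
        germ_eq (l s') (F j s') (basis_change m C (\<Phi> k) j) \<Longrightarrow> germ_eq (l s'') (F j s'') (basis_change m C (\<Phi> k) j)" by metis
    define d where "d = Min (insert d0 (dd ` {..<m}))"
    have d: "d > 0" "d \<le> d0" "\<And>j. j < m \<Longrightarrow> d \<le> dd j" unfolding d_def using d0(1) dd(1) by auto
    have "Q s''" if s': "s' \<in> {0..1}" "s'' \<in> {0..1}" "dist s' s < d" "dist s'' s < d" and Qs: "Q s'" for s' s''
    proof -
      have l': "l s' \<in> chart k" "l s'' \<in> chart k" using d0(2) s' d(2) by auto
      obtain C where C: "C \<in> G" "\<And>j. j < m \<Longrightarrow> germ_eq (l s') (F j s') (basis_change m C (\<Phi> k) j)"
        using Qs k(1) l'(1) unfolding Q_def by blast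
      show ?thesis
      proof (rule Q_if[OF k(1) l'(2) C(1)])
        fix j assume j: "j < m"
        show "germ_eq (l s'') (F j s'') (basis_change m C (\<Phi> k) j)"
          by (rule dd(2)[OF j s'(1,2) _ _ C(2)[OF j]]) (use s' d(3)[OF j] in auto)
      qed
    qed
    then show "\<exists>d>0. \<forall>s'\<in>{0..1}. \<forall>s''\<in>{0..1}. dist s' s < d \<longrightarrow> dist s'' s < d \<longrightarrow> Q s' \<longrightarrow> Q s''"
      using d(1) by blast
  qed
  moreover have l1: "l 1 \<in> chart 0" unfolding lp(4) by (simp add: chart_def)
  ultimately obtain C where C: "C \<in> G" "\<And>j. j < m \<Longrightarrow> germ_eq (1/2) (F j 1) (basis_change m C (\<Phi> 0) j)"
    unfolding Q_def lp(4) by (metis zero_less_numeral)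
  have "M $$ (i, j) = C $$ (i, j)" if ij: "i < m" "j < m" for i j
  proof -
    have "germ_eq (1/2) (basis_change m M (\<Phi> 0) j) (basis_change m C (\<Phi> 0) j)"
      using germ_eq_trans[OF germ_eq_sym[OF F(3)[OF ij(2)]] C(2)[OF ij(2), folded lp(4)]] lp(4) by simp
    then have "germ_eq (1/2) (lin_comb m (\<lambda>i. M $$ (i, j) - C $$ (i, j)) (\<Phi> 0)) (\<lambda>_. 0)"
      unfolding germ_eq_def basis_change_def lin_comb_def
      by (elim eventually_mono) (simp add: left_diff_distrib sum_subtractf)
    moreover have "solution_basis (hyp_op p q) (1/2) m (\<Phi> 0)"
      using fundamental_solution_basis[OF region_chart l1 fundamental_chart] unfolding lp(4) .
    ultimately have "\<forall>i<m. M $$ (i, j) - C $$ (i, j) = 0"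
      unfolding solution_basis_def by blast
    then show ?thesis using ij(1) by simp
  qed
  then have "M = C" using M C(1) G(2) unfolding is_monodromy_matrix_def by (intro eq_matI) auto
  then show ?thesis using C(1) by simp
qed

text \<open>On each arc of the three standard loops one chart suffices.\<close>

lemma chart_polar:
  "0 < r \<Longrightarrow> r < 1 \<Longrightarrow> cos x \<ge> 0 \<Longrightarrow> of_real r * exp (\<i> * of_real x) \<in> chart 0"
  "0 < r \<Longrightarrow> cos x \<le> 0 \<Longrightarrow> of_real r * exp (\<i> * of_real x) \<in> chart 1"
  "1 < r \<Longrightarrow> cos x \<ge> 0 \<Longrightarrow> of_real r * exp (\<i> * of_real x) \<in> chart 2"
proof -
  have re: "Re (of_real r * exp (\<i> * of_real x)) = r * cos x" and im: "Im (of_real r * exp (\<i> * of_real x)) = r * sin x"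
    by (simp_all add: Re_exp Im_exp)
  have c: "cos x = 1 \<or> cos x = -1" if "sin x = 0" using that sin_zero_abs_cos_one[of x] by (auto simp: abs_if split: if_splits)
  show "of_real r * exp (\<i> * of_real x) \<in> chart 0" if "0 < r" "r < 1" "cos x \<ge> 0"
    unfolding chart_def mem_Collect_eq re im using that c by auto
  show "of_real r * exp (\<i> * of_real x) \<in> chart 1" if "0 < r" "cos x \<le> 0"
    unfolding chart_def mem_Collect_eq re im using that c by auto
  show "of_real r * exp (\<i> * of_real x) \<in> chart 2" if "1 < r" "cos x \<ge> 0"
    unfolding chart_def mem_Collect_eq re im using that c by auto
qed

lemma cos_quarters:
  "0 \<le> s \<Longrightarrow> s \<le> 1/4 \<Longrightarrow> cos (2 * pi * s) \<ge> 0"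
  "1/4 \<le> s \<Longrightarrow> s \<le> 3/4 \<Longrightarrow> cos (2 * pi * s) \<le> 0"
  "3/4 \<le> s \<Longrightarrow> s \<le> 1 \<Longrightarrow> cos (2 * pi * s) \<ge> 0"
proof -
  have m: "2 * pi * a \<le> 2 * pi * b" if "a \<le> b" for a b :: real using that by simp
  show "cos (2 * pi * s) \<ge> 0" if "0 \<le> s" "s \<le> 1/4"
    by (rule cos_ge_zero) (use m[OF that(1)] m[OF that(2)] pi_gt_zero in linarith)+
  have "cos (2 * pi * s - pi) \<ge> 0" if "1/4 \<le> s" "s \<le> 3/4"
    by (rule cos_ge_zero) (use m[OF that(1)] m[OF that(2)] pi_gt_zero in linarith)+
  then show "cos (2 * pi * s) \<le> 0" if "1/4 \<le> s" "s \<le> 3/4" using that by (simp add: cos_diff)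
  have "cos (2 * pi * s - 2 * pi) \<ge> 0" if "3/4 \<le> s" "s \<le> 1"
    by (rule cos_ge_zero) (use m[OF that(1)] m[OF that(2)] pi_gt_zero in linarith)+
  then show "cos (2 * pi * s) \<ge> 0" if "3/4 \<le> s" "s \<le> 1" using that by (simp add: cos_diff)
qed

lemma cos_3_half_pi: "cos (3 * pi / 2) = 0" "sin (3 * pi / 2) = - 1"
  using cos_3over2_pi sin_3over2_pi by (simp_all add: mult.commute)

lemma loop_at_0: "loop_at (1/2) loop_0"
proof -
  have "path_image loop_0 \<subseteq> sphere 0 (1/2)"
    unfolding loop_0_def by (rule path_image_part_circlepath_subset') simp
  then show ?thesis
    unfolding loop_at_def loop_0_def by (auto simp: exp_eq_1)
qed

lemma loop_at_1: "loop_at (1/2) loop_1"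
proof -
  have "path_image loop_1 \<subseteq> sphere 1 (1/2)"
    unfolding loop_1_def by (rule path_image_part_circlepath_subset') simp
  moreover have "exp (\<i> * (of_real pi * 3)) = (-1 :: complex)"
  proof -
    have "exp (of_nat 3 * (of_real pi * \<i>)) = exp (of_real pi * \<i>) ^ 3" by (rule exp_of_nat_mult)
    then show ?thesis by (simp add: mult_ac)
  qed
  ultimately show ?thesis
    unfolding loop_at_def loop_1_def by (auto simp: mult_ac)
qed

lemma line_chart: "s \<in> {0..1} \<Longrightarrow> linepath (1/2) (2 * \<i>) s \<in> chart 0" "s \<in> {0..1} \<Longrightarrow> linepath (2 * \<i>) (1/2) s \<in> chart 0"
  by (auto simp: linepath_def chart_def)

lemma loop_inf_circle: "part_circlepath 0 2 (pi/2) (pi/2 - 2 * pi) s = of_real 2 * exp (\<i> * of_real (pi/2 - 2 * pi * s))"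
proof -
  have "linepath (pi/2) (pi/2 - 2 * pi) s = pi/2 - 2 * pi * s" by (simp add: linepath_def field_simps)
  then show ?thesis unfolding part_circlepath_def by simp
qed

lemma loop_inf_circle_points:
  "part_circlepath 0 2 (pi/2) (pi/2 - 2 * pi) 0 = 2 * \<i>" "part_circlepath 0 2 (pi/2) (pi/2 - 2 * pi) (1/2) = - 2 * \<i>"
  "part_circlepath 0 2 (pi/2) (pi/2 - 2 * pi) 1 = 2 * \<i>"
  unfolding loop_inf_circle cis_conv_exp[symmetric] by (simp_all add: complex_eq_iff cos_3_half_pi)

lemma loop_at_inf: "loop_at (1/2) loop_inf"
proof -
  define c where "c = part_circlepath 0 2 (pi/2) (pi/2 - 2 * pi)"
  have "path c" "path_image c \<subseteq> sphere 0 2"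
    unfolding c_def by (simp, rule path_image_part_circlepath_subset', simp)
  moreover have "path_image (linepath (1/2) (2 * \<i>)) \<subseteq> chart 0" "path_image (linepath (2 * \<i>) (1/2)) \<subseteq> chart 0"
    using line_chart unfolding path_image_def by blast+
  moreover have "0 \<notin> chart 0" "1 \<notin> chart 0" "(0::complex) \<notin> sphere 0 2" "(1::complex) \<notin> sphere 0 2" by (auto simp: chart_def)
  moreover have "pathstart c = 2 * \<i>" "pathfinish c = 2 * \<i>"
    unfolding pathstart_def pathfinish_def c_def by (rule loop_inf_circle_points)+
  ultimately show ?thesis
    unfolding loop_at_def loop_inf_def c_def[symmetric] by (auto simp: path_image_join)
qed

lemma monodromy_loop_0: "is_monodromy_matrix m (\<Phi> 0) loop_0 (T 1)"
  unfolding is_monodromy_matrix_basis_change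
proof (intro conjI allI impI T(1))
  fix j assume j: "j < m"
  have pt: "loop_0 s = of_real (1/2) * exp (\<i> * of_real (2 * pi * s))" for s
    by (simp add: loop_0_def part_circlepath_def linepath_def mult_ac)
  have q: "loop_0 (1/4) = \<i> / 2" "loop_0 (3/4) = - \<i> / 2"
    unfolding pt by (simp_all add: exp_Euler complex_eq_iff Re_exp Im_exp cos_3_half_pi flip: of_real_mult)
  show "continuation_along loop_0 (\<Phi> 0 j) (basis_change m (T 1) (\<Phi> 0) j)"
  proof (rule continuation_three_pieces[where a="1/4" and b="3/4" and g="\<Phi> 1 j"])
    show "path loop_0" using loop_at_0 by (simp add: loop_at_def)
    show "\<Phi> 0 j analytic_on {loop_0 s}" if "0 \<le> s" "s \<le> 1/4" for s
      by (rule sol_analytic[OF sol_\<Phi>[OF j] open_chart]) (unfold pt, rule chart_polar(1), use cos_quarters(1)[OF that] in auto)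
    show "\<Phi> 1 j analytic_on {loop_0 s}" if "1/4 \<le> s" "s \<le> 3/4" for s
      by (rule sol_analytic[OF sol_\<Phi>[OF j] open_chart]) (unfold pt, rule chart_polar(2), use cos_quarters(2)[OF that] in auto)
    show "basis_change m (T 1) (\<Phi> 0) j analytic_on {loop_0 s}" if "3/4 \<le> s" "s \<le> 1" for s
      by (rule sol_analytic[OF sol_basis_change open_chart]) (unfold pt, rule chart_polar(1), use cos_quarters(3)[OF that] in auto)
    show "germ_eq (loop_0 (1/4)) (\<Phi> 0 j) (\<Phi> 1 j)" unfolding q by (rule germ_upper) (use j in auto)
    show "germ_eq (loop_0 (3/4)) (\<Phi> 1 j) (basis_change m (T 1) (\<Phi> 0) j)" unfolding q by (rule germ_lower_0) (use j in auto)
  qed auto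
qed

lemma monodromy_loop_1: "is_monodromy_matrix m (\<Phi> 0) loop_1 (Ti 2)"
  unfolding is_monodromy_matrix_basis_change
proof (intro conjI allI impI T(2))
  fix j assume j: "j < m"
  have pt: "loop_1 s = 1 - of_real (1/2) * exp (\<i> * of_real (2 * pi * s))" for s
  proof -
    have "loop_1 s = 1 + 1/2 * exp (of_real pi * \<i> + \<i> * of_real (2 * pi * s))"
      by (simp add: loop_1_def part_circlepath_def linepath_def algebra_simps)
    then show ?thesis by (simp only: exp_add exp_pi_i) simp
  qed
  have q: "loop_1 (1/4) = 1 - \<i> / 2" "loop_1 (3/4) = 1 + \<i> / 2"
    unfolding pt by (simp_all add: exp_Euler complex_eq_iff Re_exp Im_exp cos_3_half_pi flip: of_real_mult)
  have refl0: "1 - w \<in> chart 0" if "w \<in> chart 0" for w using that by (auto simp: chart_def)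
  have refl2: "1 - w \<in> chart 2" if "w \<in> chart 1" for w using that by (auto simp: chart_def)
  show "continuation_along loop_1 (\<Phi> 0 j) (basis_change m (Ti 2) (\<Phi> 0) j)"
  proof (rule continuation_three_pieces[where a="1/4" and b="3/4" and g="basis_change m (Ti 2) (\<Phi> 2) j"])
    show "path loop_1" using loop_at_1 by (simp add: loop_at_def)
    show "\<Phi> 0 j analytic_on {loop_1 s}" if "0 \<le> s" "s \<le> 1/4" for s
      by (rule sol_analytic[OF sol_\<Phi>[OF j] open_chart]) (unfold pt, rule refl0, rule chart_polar(1), use cos_quarters(1)[OF that] in auto)
    show "basis_change m (Ti 2) (\<Phi> 2) j analytic_on {loop_1 s}" if "1/4 \<le> s" "s \<le> 3/4" for s
      by (rule sol_analytic[OF sol_basis_change open_chart]) (unfold pt, rule refl2, rule chart_polar(2), use cos_quarters(2)[OF that] in auto)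
    show "basis_change m (Ti 2) (\<Phi> 0) j analytic_on {loop_1 s}" if "3/4 \<le> s" "s \<le> 1" for s
      by (rule sol_analytic[OF sol_basis_change open_chart]) (unfold pt, rule refl0, rule chart_polar(1), use cos_quarters(3)[OF that] in auto)
    show "germ_eq (loop_1 (1/4)) (\<Phi> 0 j) (basis_change m (Ti 2) (\<Phi> 2) j)" unfolding q by (rule germ_lower_inv) (use j in auto)
    show "germ_eq (loop_1 (3/4)) (basis_change m (Ti 2) (\<Phi> 2) j) (basis_change m (Ti 2) (\<Phi> 0) j)"
      unfolding q by (rule germ_eq_basis_change, rule germ_upper) auto
  qed auto
qed

lemma monodromy_loop_inf: "is_monodromy_matrix m (\<Phi> 0) loop_inf (Ti 1 * T 2)"
  unfolding is_monodromy_matrix_basis_change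
proof (intro conjI allI impI)
  show "Ti 1 * T 2 \<in> carrier_mat m m" by (rule mult_carrier_mat[OF T(2) T(1)])
  fix j assume j: "j < m"
  let ?c = "part_circlepath 0 2 (pi/2) (pi/2 - 2 * pi)"
  let ?h = "basis_change m (Ti 1 * T 2)"
  have e: "cos (pi/2 - 2 * pi * s) = sin (2 * pi * s)" for s by (simp add: cos_diff)
  note q = loop_inf_circle_points
  have "continuation_along ?c (\<Phi> 2 j) (?h (\<Phi> 1) j)"
  proof (rule continuation_three_pieces[where a="1/2" and b=1 and g="?h (\<Phi> 1) j"])
    show "\<Phi> 2 j analytic_on {?c s}" if "0 \<le> s" "s \<le> 1/2" for s
    proof (rule sol_analytic[OF sol_\<Phi>[OF j] open_chart], unfold loop_inf_circle, rule chart_polar(3))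
      show "cos (pi/2 - 2 * pi * s) \<ge> 0" unfolding e
        by (rule sin_ge_zero) (use that mult_left_mono[of s "1/2" "2 * pi"] in auto)
    qed simp
    show "?h (\<Phi> 1) j analytic_on {?c s}" if "1/2 \<le> s" "s \<le> 1" for s
    proof (rule sol_analytic[OF sol_basis_change open_chart], unfold loop_inf_circle, rule chart_polar(2))
      have "sin (2 * pi * s - pi) \<ge> 0"
        by (rule sin_ge_zero) (use that mult_left_mono[of s 1 "2 * pi"] mult_left_mono[of "1/2" s "2 * pi"] in auto)
      then show "cos (pi/2 - 2 * pi * s) \<le> 0" unfolding e by (simp add: sin_diff)
    qed simp
    then show "?h (\<Phi> 1) j analytic_on {?c s}" if "1 \<le> s" "s \<le> 1" for s using that by simp
    show "germ_eq (?c (1/2)) (\<Phi> 2 j) (?h (\<Phi> 1) j)" unfolding q by (rule germ_lower) (use j in auto)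
  qed auto
  moreover have "germ_eq (pathstart ?c) (\<Phi> 2 j) (\<Phi> 0 j)" "germ_eq (pathfinish ?c) (?h (\<Phi> 1) j) (?h (\<Phi> 0) j)"
    unfolding pathstart_def pathfinish_def q by (rule germ_upper, simp, rule j) (rule germ_eq_basis_change, rule germ_upper, simp)
  ultimately have circle: "continuation_along ?c (\<Phi> 0 j) (?h (\<Phi> 0) j)" by (rule continuation_along_cong)
  have line1: "continuation_along (linepath (1/2) (2 * \<i>)) (\<Phi> 0 j) (\<Phi> 0 j)"
    by (rule continuation_const, rule sol_analytic[OF sol_\<Phi>[OF j] open_chart], rule line_chart) simp
  have line2: "continuation_along (linepath (2 * \<i>) (1/2)) (?h (\<Phi> 0) j) (?h (\<Phi> 0) j)"
    by (rule continuation_const, rule sol_analytic[OF sol_basis_change open_chart], rule line_chart) simp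
  have ends: "pathstart ?c = 2 * \<i>" "pathfinish ?c = 2 * \<i>"
    unfolding pathstart_def pathfinish_def by (rule q)+
  have "continuation_along (?c +++ linepath (2 * \<i>) (1/2)) (\<Phi> 0 j) (?h (\<Phi> 0) j)"
    by (rule continuation_along_join[OF _ _ _ circle line2]) (simp, simp, unfold ends, simp)
  then show "continuation_along loop_inf (\<Phi> 0 j) (?h (\<Phi> 0) j)"
    unfolding loop_inf_def
    by (intro continuation_along_join[OF _ _ _ line1] path_join_imp) (unfold pathstart_join ends, simp_all)
qed

end

section \<open>Local monodromy at 0 and infinity\<close>

lemma germ_eq_at: "germ_eq z f g \<Longrightarrow> f z = g z"
  unfolding germ_eq_def by (rule eventually_nhds_x_imp_x)

text \<open>The two branches of the logarithm on the charts near \<open>0\<close> and \<open>\<infinity>\<close>: branch \<open>0\<close> is cut along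
  the negative axis, branch \<open>1\<close> along the positive one. They agree on the upper half-plane, as the
  bases of the charts do.\<close>

definition log_branch :: "nat \<Rightarrow> complex \<Rightarrow> complex" where
  "log_branch k t = (if k = 0 then Ln t else Ln (- t) + \<i> * of_real pi)"

text \<open>For \<open>\<sigma> = 1\<close> the image of the strip under \<open>exp\<close> is a slit punctured disc around \<open>0\<close>, for
  \<open>\<sigma> = -1\<close> a slit neighbourhood of \<open>\<infinity>\<close>.\<close>

definition strip :: "complex \<Rightarrow> real \<Rightarrow> nat \<Rightarrow> complex set" where
  "strip \<sigma> X k = {x. Re (\<sigma> * x) < - X \<and> (if k = 0 then - pi else 0) < Im x \<and> Im x < (if k = 0 then pi else 2 * pi)}"

definition punctured :: "complex \<Rightarrow> real \<Rightarrow> nat \<Rightarrow> complex set" where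
  "punctured \<sigma> X k = exp ` strip \<sigma> X k"

lemma log_branch_exp: "x \<in> strip \<sigma> X k \<Longrightarrow> log_branch k (exp x) = x"
proof (cases "k = 0")
  case True
  assume "x \<in> strip \<sigma> X k" then show ?thesis using True by (simp add: log_branch_def strip_def)
next
  case False
  assume x: "x \<in> strip \<sigma> X k"
  have "- exp x = exp (x - \<i> * of_real pi)" by (simp add: exp_diff mult.commute)
  then have "Ln (- exp x) = x - \<i> * of_real pi"
    using x False by (simp add: strip_def)
  then show ?thesis using False by (simp add: log_branch_def)
qed

lemma exp_log_branch: "t \<noteq> 0 \<Longrightarrow> exp (log_branch k t) = t"
  by (simp add: log_branch_def exp_add mult.commute[of \<i>])

lemma convex_strip: "convex (strip \<sigma> X k)" and open_strip: "open (strip \<sigma> X k)"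
proof -
  have "strip \<sigma> X k = {x. inner (cnj \<sigma>) x < - X} \<inter> {x. (if k = 0 then - pi else 0) < Im x}
      \<inter> {x. Im x < (if k = 0 then pi else 2 * pi)}"
    by (auto simp: strip_def inner_complex_def)
  then show "convex (strip \<sigma> X k)" "open (strip \<sigma> X k)"
    by (simp_all add: convex_Int convex_halfspace_lt convex_halfspace_Im_gt convex_halfspace_Im_lt
        open_Int open_halfspace_lt open_halfspace_Im_gt open_halfspace_Im_lt)
qed

lemma log_branch_half_planes: "Im t \<noteq> 0 \<Longrightarrow> (if Im t > 0 then log_branch 1 t = log_branch 0 t else log_branch 1 t = log_branch 0 t + 2 * of_real pi * \<i>)"
proof -
  assume t: "Im t \<noteq> 0"
  then have "t \<noteq> 0" by auto
  then have "Ln (- t) = (if Im t \<le> 0 \<and> \<not> (Re t < 0 \<and> Im t = 0) then Ln t + \<i> * of_real pi else Ln t - \<i> * of_real pi)"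
    by (rule Ln_minus)
  then show ?thesis using t by (auto simp: log_branch_def)
qed

context hypergeometric
begin

lemma mem_punctured: "t \<in> punctured \<sigma> X k \<longleftrightarrow> t \<noteq> 0 \<and> log_branch k t \<in> strip \<sigma> X k"
  unfolding punctured_def using log_branch_exp exp_log_branch by (metis (no_types, lifting) exp_not_eq_zero image_iff)

lemma region_punctured:
  assumes "\<sigma> = 1 \<or> \<sigma> = -1" "X \<ge> 0"
  shows "region (punctured \<sigma> X k)"
proof -
  have "open (punctured \<sigma> X k)"
    unfolding punctured_def
  proof (rule open_mapping_thm3)
    show "inj_on exp (strip \<sigma> X k)" by (metis inj_onI log_branch_exp)
  qed (auto intro: holomorphic_intros open_strip)
  moreover have "connected (punctured \<sigma> X k)"
    unfolding punctured_def
    by (intro connected_continuous_image continuous_on_exp continuous_on_id convex_connected convex_strip)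
  moreover have "1 \<noteq> exp x" if "x \<in> strip \<sigma> X k" for x
  proof
    assume "1 = exp x"
    then have "1 = exp (Re x)" by (metis norm_exp_eq_Re norm_one)
    then show False using that assms by (auto simp: strip_def)
  qed
  ultimately show ?thesis by (auto simp: region_def punctured_def)
qed

lemma Im_exp_strip_0:
  assumes x: "x \<in> strip \<sigma> X k" and "Im (exp x) = 0"
  shows "if k = 0 then Re (exp x) > 0 else Re (exp x) < 0"
proof (cases "k = 0")
  case True
  have s: "sin (Im x) = 0" using assms by (simp add: Im_exp)
  have "\<bar>Im x\<bar> < pi" using x True by (auto simp: strip_def)
  then have "Im x = 0" using s by (metis abs_le_iff sin_eq_0_pi less_imp_le abs_less_iff minus_less_iff)
  then show ?thesis using True by (simp add: Re_exp)
next
  case False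
  have "sin (Im x - pi) = 0" using assms by (simp add: Im_exp sin_diff)
  moreover have "\<bar>Im x - pi\<bar> < pi" using x False by (auto simp: strip_def)
  ultimately have "Im x - pi = 0" by (metis sin_eq_0_pi abs_less_iff minus_less_iff)
  then have "Im x = pi" by simp
  then show ?thesis using False by (simp add: Re_exp)
qed

lemma punctured_subset_chart:
  assumes X: "X \<ge> 0"
  shows "punctured 1 X 0 \<subseteq> chart 0" "punctured \<sigma> X 1 \<subseteq> chart 1" "punctured (-1) X 0 \<subseteq> chart 2"
proof -
  have n: "Re (exp x) < 1" if "Re x < 0" for x
    using complex_Re_le_cmod[of "exp x"] that by (simp add: norm_exp_eq_Re) (meson exp_less_one_iff le_less_trans)
  have n': "Re (exp x) > 1" if "Re x > 0" "Im (exp x) = 0" "Re (exp x) > 0" for x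
  proof -
    have "cmod (exp x) = \<bar>Re (exp x)\<bar>" by (rule cmod_eq_Re[OF that(2)])
    then have "exp (Re x) = Re (exp x)" using that(3) unfolding norm_exp_eq_Re by linarith
    moreover have "exp (Re x) > 1" using that(1) by simp
    ultimately show ?thesis by linarith
  qed
  show "punctured 1 X 0 \<subseteq> chart 0"
    using Im_exp_strip_0[of _ 1 X 0] n X by (fastforce simp: punctured_def chart_def strip_def)
  show "punctured \<sigma> X 1 \<subseteq> chart 1"
    using Im_exp_strip_0[of _ \<sigma> X 1] by (fastforce simp: punctured_def chart_def)
  show "punctured (-1) X 0 \<subseteq> chart 2"
    using Im_exp_strip_0[of _ "-1" X 0] n' X by (fastforce simp: punctured_def chart_def strip_def)
qed

lemma coeff_pcompose_scale: "Polynomial.coeff (pcompose r [:0, \<sigma>:]) k = \<sigma> ^ k * Polynomial.coeff r k" for \<sigma> :: complex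
proof (induction r arbitrary: k)
  case (pCons a r)
  then show ?case by (cases k) (auto simp: pcompose_pCons)
qed simp

lemma poly_theta_exp:
  assumes u: "u holomorphic_on H" "open H" and \<sigma>: "\<sigma> \<noteq> 0"
    and H: "\<And>x. x \<in> strip \<sigma> X k \<Longrightarrow> \<sigma> * x \<in> H" and x: "x \<in> strip \<sigma> X k"
    and hol: "(\<lambda>t. u (\<sigma> * log_branch k t)) holomorphic_on punctured \<sigma> X k" and op: "open (punctured \<sigma> X k)"
  shows "poly_theta r (\<lambda>t. u (\<sigma> * log_branch k t)) (exp x) = diff_op (pcompose r [:0, \<sigma>:]) u (\<sigma> * x)"
proof -
  have "(theta ^^ n) (\<lambda>t. u (\<sigma> * log_branch k t)) (exp x) = \<sigma> ^ n * (deriv ^^ n) u (\<sigma> * x)" for n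
  proof -
    have "(theta ^^ n) (\<lambda>t. u (\<sigma> * log_branch k t)) (exp x) = (deriv ^^ n) (\<lambda>x. u (\<sigma> * x)) x"
      by (rule theta_exp[OF op hol open_strip _ x]) (auto simp: punctured_def log_branch_exp)
    also have "\<dots> = \<sigma> ^ n * (deriv ^^ n) u (\<sigma> * x)"
      by (rule higher_deriv_compose_linear[OF u(1) open_strip u(2) x H])
    finally show ?thesis .
  qed
  moreover have "degree (pcompose r [:0, \<sigma>:]) = degree r" using \<sigma> by (simp add: degree_pcompose)
  ultimately show ?thesis
    unfolding poly_theta_def diff_op_def by (simp add: coeff_pcompose_scale mult_ac)
qed

text \<open>A solution in the logarithmic coordinate \<open>x\<close> near \<open>Re x = -\<infinity>\<close> gives one near \<open>0\<close>
  (\<open>x = log t\<close>) or near \<open>\<infinity>\<close> (\<open>x = - log t\<close>).\<close>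

lemma sol_punctured:
  assumes u: "u holomorphic_on {x. Re x < - X}"
    and eq: "\<And>x. Re x < - X \<Longrightarrow> diff_op P u x = exp x * diff_op Q u x"
    and PQ: "\<sigma> = 1 \<and> P = Polynomial.smult \<epsilon> (pcompose p [:0, \<sigma>:]) \<and> Q = Polynomial.smult \<epsilon> (pcompose q [:0, \<sigma>:])
      \<or> \<sigma> = -1 \<and> P = Polynomial.smult \<epsilon> (pcompose q [:0, \<sigma>:]) \<and> Q = Polynomial.smult \<epsilon> (pcompose p [:0, \<sigma>:])"
    and \<epsilon>: "\<epsilon> \<noteq> 0" and X': "X \<le> X'" "0 \<le> X'"
  shows "sol (punctured \<sigma> X' k) (\<lambda>t. u (\<sigma> * log_branch k t))"
proof -
  let ?H = "{x. Re x < - X}"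
  have \<sigma>: "\<sigma> = 1 \<or> \<sigma> = -1" using PQ by blast
  then have \<sigma>0: "\<sigma> \<noteq> 0" by auto
  have op: "open ?H" by (rule open_halfspace_Re_lt)
  have D: "open (punctured \<sigma> X' k)" using region_punctured[OF \<sigma> X'(2)] by (simp add: region_def)
  have H: "\<sigma> * x \<in> ?H" if "x \<in> strip \<sigma> X' k" for x using that X' by (auto simp: strip_def)
  have inj: "inj_on exp (strip \<sigma> X' k)" by (metis inj_onI log_branch_exp)
  have "log_branch k holomorphic_on punctured \<sigma> X' k"
  proof -
    have "(if k = 0 then t else - t) \<notin> \<real>\<^sub>\<le>\<^sub>0" if "t \<in> punctured \<sigma> X' k" for t
    proof -
      obtain x where x: "x \<in> strip \<sigma> X' k" "t = exp x" using \<open>t \<in> _\<close> unfolding punctured_def by blast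
      show ?thesis using Im_exp_strip_0[OF x(1)] unfolding complex_nonpos_Reals_iff x(2)
        by (cases "k = 0") auto
    qed
    then show ?thesis
      unfolding log_branch_def[abs_def] by (cases "k = 0") (auto intro!: holomorphic_intros)
  qed
  then have hol: "(\<lambda>t. u (\<sigma> * log_branch k t)) holomorphic_on punctured \<sigma> X' k"
    by (intro holomorphic_on_compose_gen[OF _ u, unfolded o_def] holomorphic_intros)
       (use H mem_punctured in auto)
  have smult: "diff_op (Polynomial.smult \<epsilon> r) u x = \<epsilon> * diff_op r u x" for r x
    using \<epsilon> by (simp add: diff_op_def sum_distrib_left mult.assoc)
  have "hyp_op p q (\<lambda>t. u (\<sigma> * log_branch k t)) (exp x) = 0" if x: "x \<in> strip \<sigma> X' k" for x
  proof -
    have pt: "poly_theta r (\<lambda>t. u (\<sigma> * log_branch k t)) (exp x) = diff_op (pcompose r [:0, \<sigma>:]) u (\<sigma> * x)" for r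
      by (rule poly_theta_exp[OF u op \<sigma>0 H x hol D])
    have e: "diff_op P u (\<sigma> * x) = exp (\<sigma> * x) * diff_op Q u (\<sigma> * x)" using H[OF x] by (intro eq) simp
    from PQ show ?thesis
    proof (elim disjE conjE)
      assume s: "\<sigma> = 1" "P = Polynomial.smult \<epsilon> (pcompose p [:0, \<sigma>:])" "Q = Polynomial.smult \<epsilon> (pcompose q [:0, \<sigma>:])"
      have "diff_op (pcompose p [:0, \<sigma>:]) u (\<sigma> * x) = exp (\<sigma> * x) * diff_op (pcompose q [:0, \<sigma>:]) u (\<sigma> * x)"
        using e \<epsilon> unfolding s(2,3) smult by (simp add: mult.left_commute)
      moreover have "exp (\<sigma> * x) = exp x" using s by simp
      ultimately show ?thesis unfolding hyp_op_def pt by (simp only: diff_self)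
    next
      assume s: "\<sigma> = -1" "P = Polynomial.smult \<epsilon> (pcompose q [:0, \<sigma>:])" "Q = Polynomial.smult \<epsilon> (pcompose p [:0, \<sigma>:])"
      have "diff_op (pcompose q [:0, \<sigma>:]) u (\<sigma> * x) = exp (\<sigma> * x) * diff_op (pcompose p [:0, \<sigma>:]) u (\<sigma> * x)"
        using e \<epsilon> unfolding s(2,3) smult by (simp add: mult.left_commute)
      moreover have "exp x * exp (\<sigma> * x) = 1" using s by (simp add: exp_minus)
      ultimately show ?thesis unfolding hyp_op_def pt by (simp only: mult.assoc[symmetric]) simp
    qed
  qed
  then show ?thesis unfolding sol_def using hol by (auto simp: punctured_def)
qed

end

context charts
begin

lemma fundamental_coordinates:
  assumes S: "open S" "S \<noteq> {}" "S \<subseteq> chart k" and eq: "\<And>z. z \<in> S \<Longrightarrow> lin_comb m c (\<Phi> k) z = lin_comb m c' (\<Phi> k) z"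
    and i: "i < m"
  shows "c i = c' i"
proof -
  have "\<forall>i<m. c i - c' i = 0"
  proof (rule fundamental_independent_on[OF region_chart fundamental_chart S(1,3,2)])
    fix z assume "z \<in> S"
    then show "lin_comb m (\<lambda>i. c i - c' i) (\<Phi> k) z = 0"
      using eq[of z] by (simp add: lin_comb_def left_diff_distrib sum_subtractf)
  qed
  then show ?thesis using i by simp
qed

lemma lin_comb_upper: "Im z > 0 \<Longrightarrow> lin_comb m c (\<Phi> k) z = lin_comb m c (\<Phi> k') z"
proof -
  assume "Im z > 0"
  then have "\<Phi> k i z = \<Phi> k' i z" if "i < m" for i using germ_eq_at[OF germ_upper] that by blast
  then show ?thesis by (simp add: lin_comb_def)
qed

lemma lin_comb_lower: "Im z < 0 \<Longrightarrow> lin_comb m c (\<Phi> k) z = lin_comb m (mat_apply m (Ti k' * T k) c) (\<Phi> k') z"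
proof -
  assume z: "Im z < 0"
  have "\<Phi> k i z = basis_change m (Ti k' * T k) (\<Phi> k') i z" if "i < m" for i using germ_eq_at[OF germ_lower[OF z that]] .
  then have "lin_comb m c (\<Phi> k) z = lin_comb m c (basis_change m (Ti k' * T k) (\<Phi> k')) z" by (simp add: lin_comb_def)
  then show ?thesis by (simp only: lin_comb_basis_change)
qed

text \<open>Solutions in two charts that agree above the real axis and are related by \<open>\<mu> j\<close> and a shift
  below it give a triangular basis for the transition matrix.\<close>

lemma transition_flag:
  assumes Sa: "region Sa" "Sa \<subseteq> chart ka" and Sb: "region Sb" "Sb \<subseteq> chart kb"
    and va: "\<And>j. sol Sa (va j)" and vb: "\<And>j. sol Sb (vb j)"
    and U: "open U" "U \<noteq> {}" "U \<subseteq> Sa \<inter> Sb" "\<And>z. z \<in> U \<Longrightarrow> Im z > 0" "\<And>j z. z \<in> U \<Longrightarrow> va j z = vb j z"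
    and L: "open L" "L \<noteq> {}" "L \<subseteq> Sa \<inter> Sb" "\<And>z. z \<in> L \<Longrightarrow> Im z < 0"
      "\<And>j z. z \<in> L \<Longrightarrow> vb j z = \<mu> j * va j z + va (Suc j) z"
    and vm: "\<And>z. z \<in> Sa \<Longrightarrow> va m z = 0"
    and indep: "\<And>d. (\<And>z. z \<in> Sa \<Longrightarrow> (\<Sum>j<m. d j * va j z) = 0) \<Longrightarrow> \<forall>j<m. d j = 0"
    and supp: "\<And>i. i \<ge> m \<Longrightarrow> x i = 0"
  shows "poly_mat_apply m (Ti ka * T kb) (\<Prod>j<m. [:- \<mu> j, 1:]) x = (\<lambda>_. 0)"
proof -
  have "\<exists>c. \<forall>z\<in>Sa. va j z = lin_comb m c (\<Phi> ka) z" for j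
    by (rule fundamental_spans[OF region_chart fundamental_chart Sa va])
  then obtain ca where ca: "\<And>j z. z \<in> Sa \<Longrightarrow> va j z = lin_comb m (ca j) (\<Phi> ka) z" by metis
  have "\<exists>c. \<forall>z\<in>Sb. vb j z = lin_comb m c (\<Phi> kb) z" for j
    by (rule fundamental_spans[OF region_chart fundamental_chart Sb vb])
  then obtain cb where cb: "\<And>j z. z \<in> Sb \<Longrightarrow> vb j z = lin_comb m (cb j) (\<Phi> kb) z" by metis
  define c where "c j i = (if i < m then ca j i else 0)" for j i
  have c: "va j z = lin_comb m (c j) (\<Phi> ka) z" if "z \<in> Sa" for j z
    using ca[OF that, of j] by (simp add: lin_comb_def c_def)
  have cab: "cb j i = c j i" if i: "i < m" for j i
  proof (rule fundamental_coordinates[of U kb _ _ i])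
    show "U \<subseteq> chart kb" using U(3) Sb(2) by blast
    fix z assume z: "z \<in> U"
    then have "z \<in> Sa" "z \<in> Sb" using U(3) by auto
    then show "lin_comb m (cb j) (\<Phi> kb) z = lin_comb m (c j) (\<Phi> kb) z"
      using U(5)[OF z, of j] c[of z j] cb[of z j] lin_comb_upper[OF U(4)[OF z], of "c j" ka kb] by simp
  qed (use U i in auto)
  have flag: "mat_apply m (Ti ka * T kb) (c j) = (\<lambda>i. \<mu> j * c j i + c (Suc j) i)" for j
  proof
    fix i
    show "mat_apply m (Ti ka * T kb) (c j) i = \<mu> j * c j i + c (Suc j) i"
    proof (cases "i < m")
      case True
      show ?thesis
      proof (rule fundamental_coordinates[of L ka _ _ i])
        show "L \<subseteq> chart ka" using L(3) Sa(2) by blast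
        fix z assume z: "z \<in> L"
        then have zS: "z \<in> Sa" "z \<in> Sb" using L(3) by auto
        have "lin_comb m (mat_apply m (Ti ka * T kb) (c j)) (\<Phi> ka) z = lin_comb m (c j) (\<Phi> kb) z"
          using lin_comb_lower[OF L(4)[OF z]] by simp
        also have "\<dots> = vb j z" using cb[OF zS(2), of j] cab by (simp add: lin_comb_def)
        also have "\<dots> = \<mu> j * lin_comb m (c j) (\<Phi> ka) z + lin_comb m (c (Suc j)) (\<Phi> ka) z"
          using L(5)[OF z] c[OF zS(1)] by simp
        also have "\<dots> = lin_comb m (\<lambda>i. \<mu> j * c j i + c (Suc j) i) (\<Phi> ka) z"
          by (simp add: lin_comb_def algebra_simps sum.distrib sum_distrib_left)
        finally show "lin_comb m (mat_apply m (Ti ka * T kb) (c j)) (\<Phi> ka) z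
          = lin_comb m (\<lambda>i. \<mu> j * c j i + c (Suc j) i) (\<Phi> ka) z" .
      qed (use L True in auto)
    qed (simp add: mat_apply_support c_def)
  qed
  have ne: "Sa \<noteq> {}" using U by blast
  have opSa: "open Sa" using Sa by (simp add: region_def)
  have cm: "c m = (\<lambda>_. 0)"
  proof
    fix i
    have "c m i = (\<lambda>_. 0) i" if "i < m"
      by (rule fundamental_coordinates[OF opSa ne Sa(2) _ that]) (use c[of _ m] vm in \<open>auto simp: lin_comb_def\<close>)
    then show "c m i = 0" by (cases "i < m") (auto simp: c_def)
  qed
  have inj: "\<forall>j<m. d j = 0" if d: "\<And>i. i < m \<Longrightarrow> (\<Sum>j<m. c j i * d j) = 0" for d
  proof (rule indep)
    fix z assume z: "z \<in> Sa"
    have "(\<Sum>j<m. d j * va j z) = (\<Sum>j<m. \<Sum>i<m. c j i * d j * \<Phi> ka i z)"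
      using c[OF z] by (simp add: lin_comb_def sum_distrib_left mult_ac)
    also have "\<dots> = (\<Sum>i<m. (\<Sum>j<m. c j i * d j) * \<Phi> ka i z)"
      by (subst sum.swap) (simp add: sum_distrib_right)
    also have "\<dots> = 0" using d by simp
    finally show "(\<Sum>j<m. d j * va j z) = 0" .
  qed
  obtain d where d: "\<And>i. i < m \<Longrightarrow> (\<Sum>j<m. c j i * d j) = x i"
    using solve_linear_system[of m "\<lambda>i j. c j i" x] inj by blast
  show ?thesis
    by (rule poly_mat_apply_flag_zero[where c=c and d=d, OF flag cm _ supp])
       (use d in \<open>auto simp: c_def mult.commute\<close>)
qed

lemma flag_regions:
  assumes "\<sigma> = 1 \<or> \<sigma> = -1"
  shows "open {z \<in> punctured \<sigma> X 0 \<inter> punctured \<sigma> X 1. Im z > 0}" "{z \<in> punctured \<sigma> X 0 \<inter> punctured \<sigma> X 1. Im z > 0} \<noteq> {}"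
    "open {z \<in> punctured \<sigma> X 0 \<inter> punctured \<sigma> X 1. Im z < 0}" "{z \<in> punctured \<sigma> X 0 \<inter> punctured \<sigma> X 1. Im z < 0} \<noteq> {}"
proof -
  have "inj_on exp (strip \<sigma> X k)" for k by (metis inj_onI log_branch_exp)
  then have op: "open (punctured \<sigma> X k)" for k
    unfolding punctured_def by (intro open_mapping_thm3[OF _ open_strip]) (auto intro: holomorphic_intros)
  have "{z \<in> punctured \<sigma> X 0 \<inter> punctured \<sigma> X 1. Im z > 0} = punctured \<sigma> X 0 \<inter> punctured \<sigma> X 1 \<inter> {z. Im z > 0}"
    "{z \<in> punctured \<sigma> X 0 \<inter> punctured \<sigma> X 1. Im z < 0} = punctured \<sigma> X 0 \<inter> punctured \<sigma> X 1 \<inter> {z. Im z < 0}" by auto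
  then show "open {z \<in> punctured \<sigma> X 0 \<inter> punctured \<sigma> X 1. Im z > 0}" "open {z \<in> punctured \<sigma> X 0 \<inter> punctured \<sigma> X 1. Im z < 0}"
    using op by (simp_all add: open_Int open_halfspace_Im_gt open_halfspace_Im_lt)
  define r where "r = - \<sigma> * of_real (\<bar>X\<bar> + 1)"
  have r: "Re (\<sigma> * r) < - X" "Im r = 0" "Re (\<sigma> * \<i>) = 0" using assms by (auto simp: r_def)
  have pp: "- pi < pi / 2" "pi / 2 < pi" "pi / 2 < 2 * pi" "- (pi / 2) < pi" "3 * pi / 2 < 2 * pi" "0 < 3 * pi / 2" "0 < pi / 2" "- pi < - (pi / 2)"
    using pi_gt_zero by linarith+
  define w0 w1 w2 where "w0 = r + \<i> * of_real (pi / 2)" and "w1 = r - \<i> * of_real (pi / 2)" and "w2 = r + \<i> * of_real (3 * pi / 2)"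
  have "Re (\<sigma> * w0) < - X" "Re (\<sigma> * w1) < - X" "Re (\<sigma> * w2) < - X"
    using r(1) assms by (auto simp: w0_def w1_def w2_def)
  moreover have im_w: "Im w0 = pi / 2" "Im w1 = - (pi / 2)" "Im w2 = 3 * pi / 2"
    using r(2) by (simp_all add: w0_def w1_def w2_def)
  ultimately have w: "w0 \<in> strip \<sigma> X 0" "w0 \<in> strip \<sigma> X 1" "w1 \<in> strip \<sigma> X 0" "w2 \<in> strip \<sigma> X 1"
    by (simp_all only: strip_def mem_Collect_eq refl if_True one_neq_zero if_False pp simp_thms)
  have im: "Im (exp w0) > 0" "Im (exp w1) < 0" unfolding Im_exp im_w by simp_all
  have "w2 = w1 + 2 * of_real pi * \<i>" by (simp add: w1_def w2_def field_simps)
  then have e: "exp w1 = exp w2" by (simp only: exp_add) simp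
  have "exp w0 \<in> punctured \<sigma> X 0" "exp w0 \<in> punctured \<sigma> X 1" "exp w1 \<in> punctured \<sigma> X 0"
    unfolding punctured_def using w by (auto intro: imageI)
  moreover have "exp w1 \<in> punctured \<sigma> X 1" unfolding e punctured_def using w(4) by (rule imageI)
  ultimately show "{z \<in> punctured \<sigma> X 0 \<inter> punctured \<sigma> X 1. Im z > 0} \<noteq> {}" "{z \<in> punctured \<sigma> X 0 \<inter> punctured \<sigma> X 1. Im z < 0} \<noteq> {}"
    using im by blast+
qed

lemma punctured_independent:
  assumes u: "\<And>j. u j holomorphic_on {x. Re x < - X}"
    and indep: "\<And>d. (\<And>x. Re x < - X \<Longrightarrow> (\<Sum>j<m. d j * u j x) = 0) \<Longrightarrow> \<forall>j<m. d j = 0"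
    and \<sigma>: "\<sigma> = 1 \<or> \<sigma> = -1" and X': "X \<le> X'" and z: "\<And>z. z \<in> punctured \<sigma> X' k \<Longrightarrow> (\<Sum>j<m. d j * u j (\<sigma> * log_branch k z)) = 0"
  shows "\<forall>j<m. d j = 0"
proof (rule indep)
  fix x assume x: "Re x < - X"
  have zero: "(\<Sum>j<m. d j * u j (\<sigma> * y)) = 0" if "y \<in> strip \<sigma> X' k" for y
    using z[of "exp y"] that by (simp add: punctured_def log_branch_exp)
  let ?S = "{x. Re x < - X}"
  let ?V = "(\<lambda>y. \<sigma> * y) ` strip \<sigma> X' k"
  have V: "y \<in> ?V \<longleftrightarrow> \<sigma> * y \<in> strip \<sigma> X' k" for y
  proof
    assume "\<sigma> * y \<in> strip \<sigma> X' k"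
    moreover have "y = \<sigma> * (\<sigma> * y)" using \<sigma> by auto
    ultimately show "y \<in> ?V" by (rule image_eqI[rotated])
  qed (use \<sigma> in auto)
  have op: "open ?V"
    using \<sigma> open_strip[of \<sigma> X' k] open_negations[of "strip \<sigma> X' k"] by auto
  show "(\<Sum>j<m. d j * u j x) = 0"
  proof (rule analytic_continuation_open[of ?V ?S "\<lambda>x. \<Sum>j<m. d j * u j x" "\<lambda>_. 0"])
    show "?V \<noteq> {}"
    proof -
      have "- \<sigma> * of_real (\<bar>X'\<bar> + 1) + \<i> * of_real (pi / 2) \<in> strip \<sigma> X' k"
        using \<sigma> by (auto simp: strip_def)
      then show ?thesis by blast
    qed
    show "?V \<subseteq> ?S" using X' by (auto simp: strip_def)
    show "connected ?S" by (intro convex_connected convex_halfspace_Re_lt)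
    show "(\<lambda>x. \<Sum>j<m. d j * u j x) holomorphic_on ?S" by (intro holomorphic_intros u)
  qed (use op zero x in \<open>auto simp: open_halfspace_Re_lt intro: holomorphic_intros\<close>)
qed

text \<open>On chart \<open>0\<close> and chart \<open>1\<close> near \<open>0\<close> the Frobenius solutions are composed with the two
  branches of the logarithm. Below the real axis these differ by \<open>2 \<pi> \<i>\<close>.\<close>

lemma monodromy_0_annihilated:
  assumes p: "p = (\<Prod>i<m. [:- \<rho> i, 1:])" and near: "\<And>i. i < m \<Longrightarrow> cmod (\<rho> i - z0) < 1/2"
    and supp: "\<And>i. i \<ge> m \<Longrightarrow> x i = 0"
  shows "poly_mat_apply m (Ti 0 * T 1) (\<Prod>j<m. [:- exp (2 * of_real pi * \<i> * \<rho> j), 1:]) x = (\<lambda>_. 0)"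
proof -
  interpret fr: frobenius m \<rho> q z0 by unfold_locales (use near deg in auto)
  have P: "fr.P = p" by (simp add: fr.P_def p)
  obtain u where u': "\<forall>j. u j holomorphic_on fr.H"
    "\<forall>j. \<forall>x\<in>fr.H. diff_op fr.P (u j) x = exp x * diff_op q (u j) x"
    "\<forall>j. \<forall>x\<in>fr.H. u j (x + 2 * of_real pi * \<i>) = exp (2 * of_real pi * \<i> * \<rho> j) * u j x + u (Suc j) x"
    "\<forall>x. u m x = 0" "\<forall>d. (\<forall>x\<in>fr.H. (\<Sum>j<m. d j * u j x) = 0) \<longrightarrow> (\<forall>j<m. d j = 0)"
    using fr.frobenius_solutions by blast
  have u: "\<And>j. u j holomorphic_on fr.H"
    "\<And>j x. x \<in> fr.H \<Longrightarrow> diff_op fr.P (u j) x = exp x * diff_op q (u j) x"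
    "\<And>j x. x \<in> fr.H \<Longrightarrow> u j (x + 2 * of_real pi * \<i>) = exp (2 * of_real pi * \<i> * \<rho> j) * u j x + u (Suc j) x"
    "\<And>x. u m x = 0" "\<And>d. (\<And>x. x \<in> fr.H \<Longrightarrow> (\<Sum>j<m. d j * u j x) = 0) \<Longrightarrow> \<forall>j<m. d j = 0"
    using u' by blast+
  define X where "X = max fr.X 0"
  have X: "fr.X \<le> X" "0 \<le> X" by (auto simp: X_def)
  have H: "x \<in> fr.H \<longleftrightarrow> Re x < - fr.X" for x by (simp add: fr.H_def)
  have sols: "sol (punctured 1 X k) (\<lambda>t. u j (1 * log_branch k t))" for j k
    by (rule sol_punctured[where \<epsilon>=1, OF u(1)[unfolded fr.H_def] u(2)[unfolded H P] _ _ X]) (auto simp: pcompose_idR)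
  let ?U = "{z \<in> punctured 1 X 0 \<inter> punctured 1 X 1. Im z > 0}" and ?L = "{z \<in> punctured 1 X 0 \<inter> punctured 1 X 1. Im z < 0}"
  note reg = flag_regions[of 1 X]
  show ?thesis
  proof (rule transition_flag[where Sa="punctured 1 X 0" and Sb="punctured 1 X 1" and va="\<lambda>j t. u j (1 * log_branch 0 t)"
        and vb="\<lambda>j t. u j (1 * log_branch 1 t)" and U="?U" and L="?L"])
    show "u j (1 * log_branch 1 z) = exp (2 * of_real pi * \<i> * \<rho> j) * u j (1 * log_branch 0 z) + u (Suc j) (1 * log_branch 0 z)" if "z \<in> ?L" for j z
    proof -
      have "log_branch 0 z \<in> fr.H" using that X by (auto simp: mem_punctured strip_def H)
      moreover have "log_branch 1 z = log_branch 0 z + 2 * of_real pi * \<i>" using log_branch_half_planes[of z] that by (auto split: if_splits)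
      ultimately show ?thesis using u(3) by simp
    qed
    show "u j (1 * log_branch 0 z) = u j (1 * log_branch 1 z)" if "z \<in> ?U" for j z using log_branch_half_planes[of z] that by (auto split: if_splits)
    show "\<forall>j<m. d j = 0" if "\<And>z. z \<in> punctured 1 X 0 \<Longrightarrow> (\<Sum>j<m. d j * u j (1 * log_branch 0 z)) = 0" for d
      by (rule punctured_independent[OF u(1)[unfolded fr.H_def] u(5)[unfolded H] _ X(1) that]) auto
  qed (use reg X sols u(4) supp region_punctured punctured_subset_chart in auto)
qed

text \<open>As at \<open>0\<close>, with \<open>x = - log t\<close>, which exchanges the roles of \<open>p\<close> and \<open>q\<close> and of the two
  branches of the logarithm.\<close>

lemma monodromy_inf_annihilated:
  assumes q: "q = (\<Prod>i<m. [:\<rho> i, 1:])" and near: "\<And>i. i < m \<Longrightarrow> cmod (\<rho> i - z0) < 1/2"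
    and supp: "\<And>i. i \<ge> m \<Longrightarrow> x i = 0"
  shows "poly_mat_apply m (Ti 1 * T 2) (\<Prod>j<m. [:- exp (2 * of_real pi * \<i> * \<rho> j), 1:]) x = (\<lambda>_. 0)"
proof -
  \<comment> \<open>The sign makes \<open>q(- X)\<close> monic, as the Frobenius construction demands of its leading operator.\<close>
  define Q where "Q = Polynomial.smult ((-1) ^ m) (pcompose p [:0, -1:])"
  have "degree (pcompose p [:0, -1:]) = m" using deg by (simp add: degree_pcompose)
  then have dQ: "degree Q \<le> m" by (simp add: Q_def)
  interpret fr: frobenius m \<rho> Q z0 by unfold_locales (use near dQ in auto)
  have P: "fr.P = Polynomial.smult ((-1) ^ m) (pcompose q [:0, -1:])"
  proof -
    have e: "pcompose [:\<rho> i, 1:] [:0, -1:] = Polynomial.smult (-1) [:- \<rho> i, 1:]" for i by (simp add: pcompose_pCons)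
    then have "pcompose q [:0, -1:] = Polynomial.smult ((-1) ^ m) fr.P"
      unfolding q pcompose_prod fr.P_def e prod_smult by simp
    then show ?thesis by (simp add: power_mult_distrib[symmetric] flip: power_add)
  qed
  obtain u where u': "\<forall>j. u j holomorphic_on fr.H"
    "\<forall>j. \<forall>x\<in>fr.H. diff_op fr.P (u j) x = exp x * diff_op Q (u j) x"
    "\<forall>j. \<forall>x\<in>fr.H. u j (x + 2 * of_real pi * \<i>) = exp (2 * of_real pi * \<i> * \<rho> j) * u j x + u (Suc j) x"
    "\<forall>x. u m x = 0" "\<forall>d. (\<forall>x\<in>fr.H. (\<Sum>j<m. d j * u j x) = 0) \<longrightarrow> (\<forall>j<m. d j = 0)"
    using fr.frobenius_solutions by blast
  have u: "\<And>j. u j holomorphic_on fr.H"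
    "\<And>j x. x \<in> fr.H \<Longrightarrow> diff_op fr.P (u j) x = exp x * diff_op Q (u j) x"
    "\<And>j x. x \<in> fr.H \<Longrightarrow> u j (x + 2 * of_real pi * \<i>) = exp (2 * of_real pi * \<i> * \<rho> j) * u j x + u (Suc j) x"
    "\<And>x. u m x = 0" "\<And>d. (\<And>x. x \<in> fr.H \<Longrightarrow> (\<Sum>j<m. d j * u j x) = 0) \<Longrightarrow> \<forall>j<m. d j = 0"
    using u' by blast+
  define X where "X = max fr.X 0"
  have X: "fr.X \<le> X" "0 \<le> X" by (auto simp: X_def)
  have H: "x \<in> fr.H \<longleftrightarrow> Re x < - fr.X" for x by (simp add: fr.H_def)
  have sols: "sol (punctured (-1) X k) (\<lambda>t. u j (-1 * log_branch k t))" for j k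
    by (rule sol_punctured[where \<epsilon>="(-1) ^ m", OF u(1)[unfolded fr.H_def] u(2)[unfolded H] _ _ X]) (auto simp: P Q_def)
  let ?U = "{z \<in> punctured (-1) X 0 \<inter> punctured (-1) X 1. Im z > 0}" and ?L = "{z \<in> punctured (-1) X 0 \<inter> punctured (-1) X 1. Im z < 0}"
  note reg = flag_regions[of "-1" X]
  show ?thesis
  proof (rule transition_flag[where Sa="punctured (-1) X 1" and Sb="punctured (-1) X 0" and va="\<lambda>j t. u j (-1 * log_branch 1 t)"
        and vb="\<lambda>j t. u j (-1 * log_branch 0 t)" and U="?U" and L="?L"])
    show "u j (-1 * log_branch 0 z) = exp (2 * of_real pi * \<i> * \<rho> j) * u j (-1 * log_branch 1 z) + u (Suc j) (-1 * log_branch 1 z)" if "z \<in> ?L" for j z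
    proof -
      have "- log_branch 1 z \<in> fr.H" using that X by (auto simp: mem_punctured strip_def H)
      moreover have "log_branch 1 z = log_branch 0 z + 2 * of_real pi * \<i>" using log_branch_half_planes[of z] that by (auto split: if_splits)
      then have "- log_branch 0 z = - log_branch 1 z + 2 * of_real pi * \<i>" by simp
      ultimately show ?thesis using u(3)[of "- log_branch 1 z" j] by simp
    qed
    show "u j (-1 * log_branch 1 z) = u j (-1 * log_branch 0 z)" if "z \<in> ?U" for j z using log_branch_half_planes[of z] that by (auto split: if_splits)
    show "\<forall>j<m. d j = 0" if "\<And>z. z \<in> punctured (-1) X 1 \<Longrightarrow> (\<Sum>j<m. d j * u j (-1 * log_branch 1 z)) = 0" for d
      by (rule punctured_independent[OF u(1)[unfolded fr.H_def] u(5)[unfolded H] _ X(1) that]) auto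
  qed (use reg X sols u(4) supp region_punctured punctured_subset_chart in auto)
qed

end

section \<open>The point 1\<close>

lemma hyperplane_span:
  fixes c :: "nat \<Rightarrow> nat \<Rightarrow> complex"
  assumes m: "m > 0" and indep: "\<And>d. (\<And>i. i < m \<Longrightarrow> (\<Sum>k<m-1. c k i * d k) = 0) \<Longrightarrow> \<forall>k<m-1. d k = 0"
    and l: "\<exists>i<m. l i \<noteq> 0" "\<And>k. k < m - 1 \<Longrightarrow> (\<Sum>i<m. c k i * l i) = 0"
    and x: "(\<Sum>i<m. l i * x i) = 0"
  shows "\<exists>d. \<forall>i<m. x i = (\<Sum>k<m-1. d k * c k i)"
proof -
  have split: "(\<Sum>k<m. F k) = (\<Sum>k<m-1. F k) + F (m - 1)" for F :: "nat \<Rightarrow> complex"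
    using m by (cases m) auto
  define M where "M i k = (if k < m - 1 then c k i else x i)" for i k
  have "\<exists>d. (\<forall>i<m. (\<Sum>k<m. M i k * d k) = 0) \<and> (\<exists>k<m. d k \<noteq> 0)"
  proof (rule ccontr)
    assume no: "\<not> ?thesis"
    obtain i0 where i0: "i0 < m" "l i0 \<noteq> 0" using l(1) by blast
    obtain d where d: "\<And>i. i < m \<Longrightarrow> (\<Sum>k<m. M i k * d k) = (if i = i0 then 1 else 0)"
      using solve_linear_system[of m M "\<lambda>i. if i = i0 then 1 else 0"] no by blast
    have orth: "(\<Sum>i<m. l i * M i k) = 0" if "k < m" for k
      using l(2)[of k] x by (cases "k < m - 1") (simp_all add: M_def mult.commute)
    have "l i0 = (\<Sum>i<m. l i * (\<Sum>k<m. M i k * d k))"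
      using i0 by (simp add: d if_distrib[of "\<lambda>y. _ * y"] cong: if_cong)
    also have "\<dots> = (\<Sum>k<m. (\<Sum>i<m. l i * M i k) * d k)"
      unfolding sum_distrib_left sum_distrib_right mult.assoc by (rule sum.swap)
    finally show False using orth i0 by simp
  qed
  then obtain d where d: "\<And>i. i < m \<Longrightarrow> (\<Sum>k<m. M i k * d k) = 0" "\<exists>k<m. d k \<noteq> 0" by blast
  have e: "(\<Sum>k<m-1. c k i * d k) + x i * d (m - 1) = 0" if "i < m" for i
    using d(1)[OF that] by (simp add: split M_def)
  have nz: "d (m - 1) \<noteq> 0"
  proof
    assume 0: "d (m - 1) = 0"
    then have "\<forall>k<m-1. d k = 0" using e by (intro indep) auto
    then have "d k = 0" if "k < m" for k using 0 that by (cases "k = m - 1") auto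
    then show False using d(2) by blast
  qed
  have "x i = (\<Sum>k<m-1. (- d k / d (m - 1)) * c k i)" if "i < m" for i
  proof -
    have "(\<Sum>k<m-1. (- d k / d (m - 1)) * c k i) = - (\<Sum>k<m-1. c k i * d k) / d (m - 1)"
      by (simp add: sum_negf sum_divide_distrib mult.commute)
    also have "- (\<Sum>k<m-1. c k i * d k) = x i * d (m - 1)" using e[OF that] unfolding add_eq_0_iff by simp
    finally show ?thesis using nz by simp
  qed
  then show ?thesis by (intro exI[of _ "\<lambda>k. - d k / d (m - 1)"]) simp
qed

lemma connected_chart_ball: "connected (ball 1 1 \<inter> chart k)" if "k = 0 \<or> k = 2"
proof (rule starlike_imp_connected)
  have c: "centre k \<in> ball 1 1 \<inter> chart k" using that by (auto simp: centre_def chart_def dist_norm)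
  have "closed_segment (centre k) z \<subseteq> ball 1 1 \<inter> chart k" if z: "z \<in> ball 1 1 \<inter> chart k" for z
  proof
    fix w assume w: "w \<in> closed_segment (centre k) z"
    have "w \<in> ball 1 1" using w z c convex_ball[of 1 1] closed_segment_subset by blast
    moreover obtain u where "0 \<le> u" "u \<le> 1" "w = (1 - u) *\<^sub>R centre k + u *\<^sub>R z" using w by (auto simp: closed_segment_def)
    then have "w = centre k + of_real u * (z - centre k)" by (simp add: scaleR_conv_of_real algebra_simps)
    then have "w \<in> chart k" using star_atD[OF star_at_chart, of z k u] z \<open>0 \<le> u\<close> \<open>u \<le> 1\<close> by simp
    ultimately show "w \<in> ball 1 1 \<inter> chart k" by blast
  qed
  then show "starlike (ball 1 1 \<inter> chart k)" unfolding starlike_def using c by blast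
qed

context charts
begin

lemma T_0: "T 0 = 1\<^sub>m m" "Ti 0 = 1\<^sub>m m"
proof -
  show T0: "T 0 = 1\<^sub>m m"
  proof (rule eq_matI)
    fix i j assume "i < dim_row (1\<^sub>m m :: complex mat)" "j < dim_col (1\<^sub>m m :: complex mat)"
    then have ij: "i < m" "j < m" by auto
    show "T 0 $$ (i, j) = 1\<^sub>m m $$ (i, j)"
    proof (rule fundamental_coordinates[of "{z. Im z < 0}" 0 "\<lambda>i. T 0 $$ (i, j)" "\<lambda>i. 1\<^sub>m m $$ (i, j)" i])
      show "{z::complex. Im z < 0} \<noteq> {}" by (auto intro: exI[of _ "- \<i>"])
      show "{z. Im z < 0} \<subseteq> chart 0" by (auto simp: chart_def)
      fix z :: complex assume "z \<in> {z. Im z < 0}"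
      then show "lin_comb m (\<lambda>i. T 0 $$ (i, j)) (\<Phi> 0) z = lin_comb m (\<lambda>i. 1\<^sub>m m $$ (i, j)) (\<Phi> 0) z"
        using lower[OF ij(2), of z 0] basis_change_one[OF ij(2), of "\<Phi> 0"] by (simp add: basis_change_def)
    qed (use ij in \<open>auto simp: open_halfspace_Im_lt\<close>)
  qed (use T(1)[of 0] in auto)
  show "Ti 0 = 1\<^sub>m m" using T_inv(1)[of 0] T(2)[of 0] unfolding T0 by simp
qed

text \<open>The \<open>m - 1\<close> solutions that are holomorphic at \<open>1\<close> have the same coordinates in the charts
  \<open>0\<close> and \<open>2\<close>, so the transition matrix fixes a hyperplane pointwise.\<close>

lemma monodromy_1_hyperplane:
  assumes N: "2 * \<kappa> = of_nat N" "N > 0"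
  obtains l where "\<And>x. (\<Sum>i<m. l i * x i) = 0 \<Longrightarrow> mat_apply m (T 2) x = mat_apply m (1\<^sub>m m) x"
proof -
  let ?B = "ball (1::complex) 1"
  have "\<exists>f. f holomorphic_on ?B \<and> sol (?B - {1}) f \<and> (\<forall>k<m-1. (theta ^^ k) f 1 = (if k = i then 1 else 0))" for i :: nat
    by (rule sol_exists_at_1[OF N, where c="\<lambda>k. if k = i then 1 else 0"]) blast
  then obtain f where f: "\<And>i. f i holomorphic_on ?B" "\<And>i. sol (?B - {1}) (f i)"
    "\<And>i k. k < m - 1 \<Longrightarrow> (theta ^^ k) (f i) 1 = (if k = i then 1 else 0)" by metis
  have region: "region (?B \<inter> chart k)" if "k = 0 \<or> k = 2" for k
    using connected_chart_ball[OF that] open_chart[of k] region_chart[of k] by (auto simp: region_def)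
  have fs: "sol (?B \<inter> chart k) (f i)" for i k
    by (rule sol_subset[OF f(2)]) (auto simp: chart_def)
  have "\<exists>c. \<forall>z\<in>?B \<inter> chart k. f i z = lin_comb m c (\<Phi> k) z" if "k = 0 \<or> k = 2" for i k
    by (rule fundamental_spans[OF region_chart fundamental_chart region[OF that] _ fs]) auto
  then have "\<exists>c c'. (\<forall>z\<in>?B \<inter> chart 0. f i z = lin_comb m c (\<Phi> 0) z) \<and> (\<forall>z\<in>?B \<inter> chart 2. f i z = lin_comb m c' (\<Phi> 2) z)" for i
    by (metis zero_neq_numeral)
  then obtain c0 c2 where c0: "\<And>i z. z \<in> ?B \<inter> chart 0 \<Longrightarrow> f i z = lin_comb m (c0 i) (\<Phi> 0) z"
    and c2: "\<And>i z. z \<in> ?B \<inter> chart 2 \<Longrightarrow> f i z = lin_comb m (c2 i) (\<Phi> 2) z" by metis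
  have up: "{z. Im z > 0} \<subseteq> chart k" "{z. Im z < 0} \<subseteq> chart k" for k by (auto simp: chart_def)
  let ?U = "?B \<inter> {z. Im z > 0}" and ?L = "?B \<inter> {z. Im z < 0}"
  have "1 + \<i> / 2 \<in> ?U" "1 - \<i> / 2 \<in> ?L" by (auto simp: dist_norm)
  then have ne: "?U \<noteq> {}" "?L \<noteq> {}" by blast+
  have op: "open ?U" "open ?L" by (auto simp: open_halfspace_Im_gt open_halfspace_Im_lt)
  have c02: "c2 i n = c0 i n" if "n < m" for i n
  proof (rule fundamental_coordinates[OF op(1) ne(1) _ _ that, of 2])
    fix z assume z: "z \<in> ?U"
    then have "z \<in> ?B \<inter> chart 0" "z \<in> ?B \<inter> chart 2" "Im z > 0" using up by auto
    then show "lin_comb m (c2 i) (\<Phi> 2) z = lin_comb m (c0 i) (\<Phi> 2) z"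
      using c0[of z i] c2[of z i] lin_comb_upper[of z "c0 i" 0 2] by simp
  qed (use up in auto)
  have fixed: "mat_apply m (T 2) (c0 i) n = c0 i n" if "n < m" for i n
  proof (rule fundamental_coordinates[OF op(2) ne(2) _ _ that, of 0])
    fix z assume z: "z \<in> ?L"
    have "lin_comb m (c0 i) (\<Phi> 2) z = lin_comb m (c2 i) (\<Phi> 2) z" using c02 by (simp add: lin_comb_def)
    moreover have "T 2 = Ti 0 * T 2" using T_0(2) T(1)[of 2] by simp
    moreover have "z \<in> ?B \<inter> chart 0" "z \<in> ?B \<inter> chart 2" "Im z < 0" using up z by auto
    ultimately show "lin_comb m (mat_apply m (T 2) (c0 i)) (\<Phi> 0) z = lin_comb m (c0 i) (\<Phi> 0) z"
      using c0[of z i] c2[of z i] lin_comb_lower[of z "c0 i" 2 0] by simp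
  qed (use up in auto)
  have indep: "\<forall>k<m-1. d k = 0" if d: "\<And>i. i < m \<Longrightarrow> (\<Sum>k<m-1. c0 k i * d k) = 0" for d
  proof (intro allI impI)
    fix k assume k: "k < m - 1"
    have z0: "(\<Sum>k<m-1. d k * f k z) = 0" if "z \<in> ?U" for z
    proof -
      have "z \<in> ?B \<inter> chart 0" using that up by auto
      then have "(\<Sum>k<m-1. d k * f k z) = (\<Sum>k<m-1. \<Sum>i<m. c0 k i * d k * \<Phi> 0 i z)"
        using c0 by (simp add: lin_comb_def sum_distrib_left mult_ac)
      also have "\<dots> = (\<Sum>i<m. (\<Sum>k<m-1. c0 k i * d k) * \<Phi> 0 i z)" by (subst sum.swap) (simp add: sum_distrib_right)
      finally show ?thesis using d by simp
    qed
    have "(\<Sum>k<m-1. d k * f k z) = 0" if "z \<in> ?B" for z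
      by (rule analytic_continuation_open[of ?U ?B "\<lambda>z. \<Sum>k<m-1. d k * f k z" "\<lambda>_. 0"])
         (use op ne z0 that f in \<open>auto intro!: holomorphic_intros\<close>)
    then have "(theta ^^ k) (\<lambda>z. \<Sum>k<m-1. d k * f k z) 1 = (theta ^^ k) (\<lambda>_. 0) 1"
      by (intro theta_cong[of ?B]) auto
    moreover have "(theta ^^ k) (\<lambda>z. \<Sum>k<m-1. d k * f k z) 1 = (\<Sum>j<m-1. d j * (theta ^^ k) (f j) 1)"
      by (rule theta_sum[of ?B]) (use f in auto)
    ultimately show "d k = 0" using k f(3)[OF k] theta_zero
      by (simp add: if_distrib[of "\<lambda>y. _ * y"] cong: if_cong)
  qed
  obtain l where l: "\<exists>i<m. l i \<noteq> 0" "\<And>k. k < m - 1 \<Longrightarrow> (\<Sum>i<m. c0 k i * l i) = 0"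
    using underdetermined_system[of "m - 1" m c0] m_pos by auto
  show ?thesis
  proof (rule that[of l])
    fix x assume x: "(\<Sum>i<m. l i * x i) = 0"
    have "\<exists>d. \<forall>i<m. x i = (\<Sum>k<m-1. d k * c0 k i)"
      by (rule hyperplane_span[OF m_pos indep l x])
    then obtain d where d': "\<forall>i<m. x i = (\<Sum>k<m-1. d k * c0 k i)" by blast
    then have d: "x i = (\<Sum>k<m-1. d k * c0 k i)" if "i < m" for i using that by blast
    have cong: "mat_apply m A x = mat_apply m A (\<lambda>i. \<Sum>k<m-1. d k * c0 k i)" for A
      unfolding mat_apply_def using d by (intro ext if_cong sum.cong) simp_all
    show "mat_apply m (T 2) x = mat_apply m (1\<^sub>m m) x"
    proof
      fix n
      show "mat_apply m (T 2) x n = mat_apply m (1\<^sub>m m) x n"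
      proof (cases "n < m")
        case True
        have "mat_apply m (1\<^sub>m m) x n = x n" using True by (simp add: mat_apply_def if_distrib[of "\<lambda>y. y * _"] cong: if_cong)
        then show ?thesis unfolding cong[of "T 2"] mat_apply_sum using fixed[OF True] d[OF True] by simp
      qed (simp add: mat_apply_def)
    qed
  qed
qed

section \<open>Base points and the monodromy group\<close>

text \<open>The basis \<open>\<Psi>\<close> at the base point is the continuation of \<open>\<Theta>\<close> backwards along \<open>\<tau>\<close>, so
  transporting a loop along \<open>\<tau>\<close> leaves its matrix unchanged.\<close>

lemma monodromy_conj:
  assumes \<tau>: "path \<tau>" "pathfinish \<tau> = pathstart l" and l: "path l" "pathfinish l = pathstart l"
    and \<Psi>: "\<And>j. j < m \<Longrightarrow> continuation_along \<tau> (\<Psi> j) (\<Theta> j)" and M: "is_monodromy_matrix m \<Theta> l M"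
  shows "is_monodromy_matrix m \<Psi> (conj_loop \<tau> l) M"
  unfolding is_monodromy_matrix_basis_change
proof (intro conjI allI impI)
  show "M \<in> carrier_mat m m" using M by (simp add: is_monodromy_matrix_def)
  fix j assume j: "j < m"
  have "continuation_along l (\<Theta> j) (basis_change m M \<Theta> j)" using M j by (simp add: is_monodromy_matrix_basis_change)
  moreover have "continuation_along (reversepath \<tau>) (basis_change m M \<Theta> j) (basis_change m M \<Psi> j)"
    by (rule continuation_along_basis_change) (use \<tau> continuation_along_reverse[OF \<Psi>] in auto)
  ultimately show "continuation_along (conj_loop \<tau> l) (\<Psi> j) (basis_change m M \<Psi> j)"
    unfolding conj_loop_def using \<Psi>[OF j] \<tau> l
    by (intro continuation_along_join[of \<tau> _ _ "\<Theta> j"] continuation_along_join[of l _ _ "basis_change m M \<Theta> j"]) auto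
qed

lemma germ_eq_zero_continuation:
  assumes "path l" "continuation_along l f g" "germ_eq (pathstart l) f (\<lambda>_. 0)"
  shows "germ_eq (pathfinish l) g (\<lambda>_. 0)"
proof -
  have "continuation_along l (\<lambda>_. 0) (\<lambda>_. 0)" by (rule continuation_const) simp
  from continuation_along_unique[OF assms(1,2) this assms(3)] show ?thesis .
qed

lemma transported_basis:
  assumes \<tau>: "path \<tau>" "path_image \<tau> \<subseteq> - {0, 1}" "pathstart \<tau> = t0" "pathfinish \<tau> = 1/2"
  obtains \<Psi> where "solution_basis (hyp_op p q) t0 m \<Psi>" "\<And>j. j < m \<Longrightarrow> continuation_along \<tau> (\<Psi> j) (\<Phi> 0 j)"
proof -
  have half: "1/2 \<in> chart 0" by (simp add: chart_def)
  have basis: "solution_basis (hyp_op p q) (1/2) m (\<Phi> 0)" by (rule fundamental_solution_basis[OF region_chart half fundamental_chart])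
  have "\<exists>g. continuation_along (reversepath \<tau>) (\<Phi> 0 j) g \<and> local_solution (hyp_op p q) t0 g" if "j < m" for j
  proof (rule continuation_exists[of "reversepath \<tau>" "\<Phi> 0 j"])
    show "local_solution (hyp_op p q) (pathstart (reversepath \<tau>)) (\<Phi> 0 j)"
      using basis that unfolding pathstart_reversepath \<tau>(4) solution_basis_def by blast
  qed (use \<tau> in auto)
  then obtain \<Psi> where \<Psi>: "\<And>j. j < m \<Longrightarrow> continuation_along (reversepath \<tau>) (\<Phi> 0 j) (\<Psi> j)"
    "\<And>j. j < m \<Longrightarrow> local_solution (hyp_op p q) t0 (\<Psi> j)" by metis
  have fwd: "continuation_along \<tau> (\<Psi> j) (\<Phi> 0 j)" if "j < m" for j
    using continuation_along_reverse[OF \<Psi>(1)[OF that]] by simp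
  have "solution_basis (hyp_op p q) t0 m \<Psi>"
    unfolding solution_basis_def
  proof (intro conjI allI impI)
    show "local_solution (hyp_op p q) t0 (\<Psi> i)" if "i < m" for i by (rule \<Psi>(2)[OF that])
    fix c i assume z: "germ_eq t0 (lin_comb m c \<Psi>) (\<lambda>_. 0)" and i: "i < m"
    have "continuation_along \<tau> (lin_comb m c \<Psi>) (lin_comb m c (\<Phi> 0))"
      by (rule continuation_along_lin_comb[OF \<tau>(1) fwd])
    then have "germ_eq (1/2) (lin_comb m c (\<Phi> 0)) (\<lambda>_. 0)"
      using germ_eq_zero_continuation[OF \<tau>(1)] z \<tau> by metis
    then show "c i = 0" using basis i unfolding solution_basis_def by blast
  next
    fix f assume f: "local_solution (hyp_op p q) t0 f"
    obtain g where g: "continuation_along \<tau> f g" "local_solution (hyp_op p q) (1/2) g"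
      using continuation_exists[OF \<tau>(1,2), of f] f \<tau> by auto
    then obtain c where c: "germ_eq (1/2) g (lin_comb m c (\<Phi> 0))" using basis unfolding solution_basis_def by blast
    have "continuation_along (reversepath \<tau>) (lin_comb m c (\<Phi> 0)) (lin_comb m c \<Psi>)"
      by (rule continuation_along_lin_comb) (use \<tau> \<Psi> in auto)
    from continuation_along_unique[OF _ continuation_along_reverse[OF g(1)] this] \<tau> c
    show "\<exists>c. germ_eq t0 f (lin_comb m c \<Psi>)" by auto
  qed
  then show ?thesis using fwd that by blast
qed

lemma monodromy_group_transport:
  assumes \<tau>: "path \<tau>" "path_image \<tau> \<subseteq> - {0, 1}" "pathstart \<tau> = t0" "pathfinish \<tau> = z"
    and \<Psi>: "\<And>j. j < m \<Longrightarrow> continuation_along \<tau> (\<Psi> j) (\<Theta> j)"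
  shows "monodromy_group t0 m \<Psi> = monodromy_group z m \<Theta>"
proof -
  have conj: "loop_at (pathstart \<sigma>) (conj_loop \<sigma> l)"
    if "path \<sigma>" "path_image \<sigma> \<subseteq> - {0, 1}" "loop_at (pathfinish \<sigma>) l" for \<sigma> l
    using that unfolding loop_at_def conj_loop_def by (auto simp: path_image_join)
  show ?thesis
  proof (intro equalityI subsetI)
    fix M assume "M \<in> monodromy_group t0 m \<Psi>"
    then obtain l where l: "loop_at t0 l" "is_monodromy_matrix m \<Psi> l M" by (auto simp: monodromy_group_def)
    have "is_monodromy_matrix m \<Theta> (conj_loop (reversepath \<tau>) l) M"
      by (rule monodromy_conj[OF _ _ _ _ continuation_along_reverse[OF \<Psi>] l(2)])
         (use \<tau> l(1) in \<open>auto simp: loop_at_def\<close>)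
    moreover have "loop_at z (conj_loop (reversepath \<tau>) l)"
      using conj[of "reversepath \<tau>" l] \<tau> l(1) by simp
    ultimately show "M \<in> monodromy_group z m \<Theta>" by (auto simp: monodromy_group_def)
  next
    fix M assume "M \<in> monodromy_group z m \<Theta>"
    then obtain l where l: "loop_at z l" "is_monodromy_matrix m \<Theta> l M" by (auto simp: monodromy_group_def)
    have "is_monodromy_matrix m \<Psi> (conj_loop \<tau> l) M"
      by (rule monodromy_conj[OF _ _ _ _ \<Psi> l(2)]) (use \<tau> l(1) in \<open>auto simp: loop_at_def\<close>)
    moreover have "loop_at t0 (conj_loop \<tau> l)" using conj[of \<tau> l] \<tau> l(1) by simp
    ultimately show "M \<in> monodromy_group t0 m \<Psi>" by (auto simp: monodromy_group_def)
  qed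
qed

lemma GL_group: "group (GL m)"
proof -
  interpret R: ring "ring_mat TYPE(complex) m ()" by (rule ring_mat)
  show ?thesis unfolding GL_def by (rule R.units_group)
qed

lemma GL_simps: "x \<otimes>\<^bsub>GL m\<^esub> y = x * y" "\<one>\<^bsub>GL m\<^esub> = 1\<^sub>m m"
  "carrier (GL m) = Units (ring_mat TYPE(complex) m ())"
  by (simp_all add: GL_def units_of_def ring_mat_def)

lemma GL_memI: "A \<in> carrier_mat m m \<Longrightarrow> B \<in> carrier_mat m m \<Longrightarrow> A * B = 1\<^sub>m m \<Longrightarrow> B * A = 1\<^sub>m m \<Longrightarrow> A \<in> carrier (GL m)"
  unfolding GL_simps by (auto simp: Units_def ring_mat_def)

lemma GL_inv: "A \<in> carrier_mat m m \<Longrightarrow> B \<in> carrier_mat m m \<Longrightarrow> A * B = 1\<^sub>m m \<Longrightarrow> B * A = 1\<^sub>m m \<Longrightarrow> inv\<^bsub>GL m\<^esub> A = B"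
  using group.inv_equality[OF GL_group, of B A] GL_memI[of A B] GL_memI[of B A] by (simp add: GL_simps)

lemma GL_carrier_mat: "A \<in> carrier (GL m) \<Longrightarrow> A \<in> carrier_mat m m"
  unfolding GL_simps by (auto simp: Units_def ring_mat_def)

lemma T_GL: "T k \<in> carrier (GL m)" "Ti k \<in> carrier (GL m)" "inv\<^bsub>GL m\<^esub> T k = Ti k" "inv\<^bsub>GL m\<^esub> Ti k = T k"
  by (intro GL_memI GL_inv; rule T T_inv)+

lemma loop_at_join: "loop_at z l \<Longrightarrow> loop_at z l' \<Longrightarrow> loop_at z (l +++ l')"
  by (auto simp: loop_at_def path_image_join)

lemma loop_at_reverse: "loop_at z l \<Longrightarrow> loop_at z (reversepath l)"
  by (auto simp: loop_at_def)

lemma monodromy_join: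
  assumes "loop_at z l" "loop_at z l'" "is_monodromy_matrix m \<Psi> l M" "is_monodromy_matrix m \<Psi> l' M'"
  shows "is_monodromy_matrix m \<Psi> (l +++ l') (M' * M)"
  unfolding is_monodromy_matrix_basis_change
proof (intro conjI allI impI)
  have c: "M' \<in> carrier_mat m m" "M \<in> carrier_mat m m" using assms by (auto simp: is_monodromy_matrix_def)
  then show "M' * M \<in> carrier_mat m m" by auto
  fix j assume j: "j < m"
  have "continuation_along l' (basis_change m M \<Psi> j) (basis_change m M (basis_change m M' \<Psi>) j)"
    by (rule continuation_along_basis_change) (use assms in \<open>auto simp: loop_at_def is_monodromy_matrix_basis_change\<close>)
  then show "continuation_along (l +++ l') (\<Psi> j) (basis_change m (M' * M) \<Psi> j)"
    unfolding basis_change_mult[OF c j] using assms j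
    by (intro continuation_along_join[of l l' _ "basis_change m M \<Psi> j"]) (auto simp: loop_at_def is_monodromy_matrix_basis_change)
qed

lemma monodromy_reverse:
  assumes "loop_at z l" "is_monodromy_matrix m \<Psi> l M" and N: "N \<in> carrier_mat m m" "M * N = 1\<^sub>m m"
  shows "is_monodromy_matrix m \<Psi> (reversepath l) N"
  unfolding is_monodromy_matrix_basis_change
proof (intro conjI allI impI N(1))
  have c: "M \<in> carrier_mat m m" using assms by (auto simp: is_monodromy_matrix_def)
  fix j assume j: "j < m"
  have "continuation_along (reversepath l) (basis_change m N (basis_change m M \<Psi>) j) (basis_change m N \<Psi> j)"
    by (rule continuation_along_basis_change)
       (use assms in \<open>auto simp: loop_at_def is_monodromy_matrix_basis_change intro: continuation_along_reverse\<close>)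
  moreover have "basis_change m N (basis_change m M \<Psi>) j = \<Psi> j"
    unfolding basis_change_mult[OF c N(1) j, symmetric] N(2) by (rule basis_change_one[OF j])
  ultimately show "continuation_along (reversepath l) (\<Psi> j) (basis_change m N \<Psi> j)" by simp
qed

text \<open>All transition matrices are words in \<open>T 1\<close> and \<open>Ti 1 * T 2\<close>, hence so is every monodromy
  matrix; conversely, words are realized by concatenated and reversed loops.\<close>

theorem monodromy_group_generated: "monodromy_group (1/2) m (\<Phi> 0) = generate (GL m) {T 1, Ti 1 * T 2}"
proof -
  interpret G: group "GL m" by (rule GL_group)
  let ?G = "generate (GL m) {T 1, Ti 1 * T 2}"
  have mem: "{T 1, Ti 1 * T 2} \<subseteq> carrier (GL m)"
    using T_GL G.m_closed[OF T_GL(2,1), of 1 2] by (auto simp: GL_simps)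
  have sub: "subgroup ?G (GL m)" by (rule G.generate_is_subgroup[OF mem])
  have mult: "A * B \<in> ?G" if "A \<in> ?G" "B \<in> ?G" for A B
    using subgroup.m_closed[OF sub that] by (simp add: GL_simps)
  have h: "T 1 \<in> ?G" "Ti 1 * T 2 \<in> ?G" by (auto intro: generate.incl)
  have "T 1 * (Ti 1 * T 2) = T 1 * Ti 1 * T 2" by (rule assoc_mult_mat[symmetric, OF T(1) T(2) T(1)])
  then have T2: "T 2 \<in> ?G" using mult[OF h] T_inv(1)[of 1] T(1)[of 2] by simp
  have "Ti 1 \<in> ?G" "Ti 2 \<in> ?G" using subgroup.m_inv_closed[OF sub h(1)] subgroup.m_inv_closed[OF sub T2] T_GL(3) by simp_all
  moreover have one: "1\<^sub>m m \<in> ?G" using subgroup.one_closed[OF sub] by (simp add: GL_simps)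
  ultimately have Tk: "T k \<in> ?G" "Ti k \<in> ?G" if "k < 3" for k
  proof -
    have "k = 0 \<or> k = 1 \<or> k = 2" using that by auto
    then show "T k \<in> ?G" "Ti k \<in> ?G" using T_0 h(1) T2 one \<open>Ti 1 \<in> ?G\<close> \<open>Ti 2 \<in> ?G\<close> by auto
  qed
  show ?thesis
  proof (intro equalityI subsetI)
    fix M assume "M \<in> monodromy_group (1/2) m (\<Phi> 0)"
    then obtain l where "loop_at (1/2) l" "is_monodromy_matrix m (\<Phi> 0) l M" by (auto simp: monodromy_group_def)
    then show "M \<in> ?G"
      by (intro monodromy_in_group[of ?G l M] mult Tk one)
         (use subgroup.subset[OF sub] GL_carrier_mat in auto)
  next
    fix M assume "M \<in> ?G"
    then show "M \<in> monodromy_group (1/2) m (\<Phi> 0)"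
    proof (induction rule: generate.induct)
      case one
      have "is_monodromy_matrix m (\<Phi> 0) (linepath (1/2) (1/2)) (1\<^sub>m m)"
        unfolding is_monodromy_matrix_basis_change
      proof (intro conjI allI impI)
        fix j assume j: "j < m"
        have "continuation_along (linepath (1/2) (1/2)) (\<Phi> 0 j) (\<Phi> 0 j)"
          by (rule continuation_const, rule sol_analytic[OF sol_\<Phi>[OF j] open_chart]) (simp add: linepath_def chart_def)
        then show "continuation_along (linepath (1/2) (1/2)) (\<Phi> 0 j) (basis_change m (1\<^sub>m m) (\<Phi> 0) j)" using basis_change_one[OF j] by simp
      qed simp
      moreover have "loop_at (1/2) (linepath (1/2) (1/2))" by (auto simp: loop_at_def)
      ultimately show ?case by (auto simp: monodromy_group_def GL_simps)
    next
      case (incl h)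
      then show ?case using monodromy_loop_0 loop_at_0 monodromy_loop_inf loop_at_inf by (auto simp: monodromy_group_def)
    next
      case (inv h)
      then have hG: "h \<in> carrier (GL m)" using mem by blast
      obtain l where l: "loop_at (1/2) l" "is_monodromy_matrix m (\<Phi> 0) l h"
        using inv monodromy_loop_0 loop_at_0 monodromy_loop_inf loop_at_inf by blast
      have "is_monodromy_matrix m (\<Phi> 0) (reversepath l) (inv\<^bsub>GL m\<^esub> h)"
        by (rule monodromy_reverse[OF l]) (use G.r_inv[OF hG] GL_carrier_mat[OF G.inv_closed[OF hG]] in \<open>simp_all add: GL_simps\<close>)
      moreover have "loop_at (1/2) (reversepath l)" by (rule loop_at_reverse[OF l(1)])
      ultimately show ?case by (auto simp: monodromy_group_def)
    next
      case (eng h1 h2)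
      then obtain l1 l2 where l: "loop_at (1/2) l1" "is_monodromy_matrix m (\<Phi> 0) l1 h1"
        "loop_at (1/2) l2" "is_monodromy_matrix m (\<Phi> 0) l2 h2" by (auto simp: monodromy_group_def)
      have "loop_at (1/2) (l2 +++ l1)" by (rule loop_at_join[OF l(3,1)])
      then show ?case using monodromy_join[OF l(3,1,4,2)] by (auto simp: monodromy_group_def GL_simps)
    qed
  qed
qed

end

section \<open>Monodromy of the hypergeometric equation\<close>

context hypergeometric
begin

text \<open>The bases are normalized by their initial values at the common point \<open>\<i>\<close> of all charts.\<close>

lemma charts_exist:
  assumes \<kappa>: "\<kappa> \<noteq> 0"
  obtains \<Phi> T Ti where "charts p q m \<Phi> T Ti"
proof -
  have "\<exists>\<Phi>. fundamental (chart k) \<Phi> \<and> (\<forall>i<m. \<forall>n<m. (theta ^^ n) (\<Phi> i) \<i> = (if n = i then 1 else 0))" for k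
  proof -
    have "\<i> \<in> chart k" by (simp add: chart_def)
    from fundamental_exists[OF region_chart star_at_chart \<kappa> this] show ?thesis by metis
  qed
  then obtain \<Phi> where \<Phi>: "\<And>k. fundamental (chart k) (\<Phi> k)"
    "\<And>k i n. i < m \<Longrightarrow> n < m \<Longrightarrow> (theta ^^ n) (\<Phi> k i) \<i> = (if n = i then 1 else 0)" by metis
  have sub: "{z. Im z > 0} \<subseteq> chart k" "{z. Im z < 0} \<subseteq> chart k" for k by (auto simp: chart_def)
  have region: "region {z. Im z > 0}" "region {z. Im z < 0}"
    by (auto simp: region_def open_halfspace_Im_gt open_halfspace_Im_lt
        intro!: convex_connected convex_halfspace_Im_gt convex_halfspace_Im_lt)
  have sols: "sol (chart k) (\<Phi> k j)" if "j < m" for j k using \<Phi>(1)[of k] that by (auto simp: fundamental_def)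
  have upper: "\<Phi> k j z = \<Phi> 0 j z" if "j < m" "Im z > 0" for k j z
  proof (rule sol_eq[OF region(1) sol_subset[OF sols[OF that(1)] sub(1)] sol_subset[OF sols[OF that(1)] sub(1)]])
    show "\<i> \<in> {z. Im z > 0}" "z \<in> {z. Im z > 0}" using that by auto
    fix n assume "n < m"
    from \<Phi>(2)[OF that(1) this] show "(theta ^^ n) (\<Phi> k j) \<i> = (theta ^^ n) (\<Phi> 0 j) \<i>" by simp
  qed
  have ex: "\<exists>c. \<forall>z\<in>{z. Im z < 0}. \<Phi> k j z = lin_comb m c (\<Phi> k') z" if "j < m" for j k k'
    by (rule fundamental_spans[OF region_chart \<Phi>(1) region(2) sub(2)]) (rule sol_subset[OF sols[OF that] sub(2)])
  define c where "c k k' j = (SOME c. \<forall>z\<in>{z. Im z < 0}. \<Phi> k j z = lin_comb m c (\<Phi> k') z)" for k k' j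
  have c: "\<Phi> k j z = lin_comb m (c k k' j) (\<Phi> k') z" if "j < m" "Im z < 0" for k k' j z
    using someI_ex[OF ex[OF that(1), of k k']] that(2) unfolding c_def by blast
  define T where "T k = mat m m (\<lambda>(i, j). c k 0 j i)" for k
  define Ti where "Ti k = mat m m (\<lambda>(i, j). c 0 k j i)" for k
  have carr: "T k \<in> carrier_mat m m" "Ti k \<in> carrier_mat m m" for k by (simp_all add: T_def Ti_def)
  have lower: "\<Phi> k j z = basis_change m (T k) (\<Phi> 0) j z" "\<Phi> 0 j z = basis_change m (Ti k) (\<Phi> k) j z" if "j < m" "Im z < 0" for k j z
    using c[OF that, of k 0] c[OF that, of 0 k] that(1) by (simp_all add: basis_change_def lin_comb_def T_def Ti_def)
  have inv: "T k * Ti k = 1\<^sub>m m" for k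
  proof (rule eq_matI)
    fix i j assume "i < dim_row (1\<^sub>m m :: complex mat)" "j < dim_col (1\<^sub>m m :: complex mat)"
    then have ij: "i < m" "j < m" by auto
    have "\<forall>i<m. (T k * Ti k) $$ (i, j) - 1\<^sub>m m $$ (i, j) = 0"
    proof (rule fundamental_independent_on[OF region_chart \<Phi>(1) _ sub(2)])
      show "{z. Im z < 0} \<noteq> {}" by (auto intro: exI[of _ "- \<i>"])
      fix z :: complex assume "z \<in> {z. Im z < 0}"
      then have z: "Im z < 0" by simp
      have "basis_change m (T k * Ti k) (\<Phi> 0) j z = basis_change m (Ti k) (basis_change m (T k) (\<Phi> 0)) j z"
        by (simp add: basis_change_mult[OF carr ij(2)])
      also have "\<dots> = basis_change m (Ti k) (\<Phi> k) j z"
        using lower(1)[OF _ z, of _ k] by (simp add: basis_change_def[of m "Ti k"] lin_comb_def)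
      also have "\<dots> = basis_change m (1\<^sub>m m) (\<Phi> 0) j z" using lower(2)[OF ij(2) z, of k] basis_change_one[OF ij(2), of "\<Phi> 0"] by simp
      finally show "lin_comb m (\<lambda>i. (T k * Ti k) $$ (i, j) - 1\<^sub>m m $$ (i, j)) (\<Phi> 0) z = 0"
        by (simp add: basis_change_def lin_comb_def left_diff_distrib sum_subtractf del: index_mult_mat)
    qed (simp add: open_halfspace_Im_lt)
    then show "(T k * Ti k) $$ (i, j) = 1\<^sub>m m $$ (i, j)" using ij by simp
  qed (auto simp: T_def Ti_def)
  have "charts p q m \<Phi> T Ti"
  proof unfold_locales
    show "fundamental (chart k) (\<Phi> k)" for k by (rule \<Phi>(1))
    show "\<Phi> k j z = \<Phi> 0 j z" if "j < m" "Im z > 0" for k j z by (rule upper[OF that])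
    show "\<Phi> k j z = basis_change m (T k) (\<Phi> 0) j z" if "j < m" "Im z < 0" for k j z by (rule lower(1)[OF that])
    show "T k \<in> carrier_mat m m" "Ti k \<in> carrier_mat m m" "T k * Ti k = 1\<^sub>m m" "Ti k * T k = 1\<^sub>m m" for k
      by (rule carr inv mat_mult_left_right_inverse[OF carr inv])+
  qed
  then show ?thesis by (rule that)
qed

end

lemma cancel_mat:
  fixes V :: "complex mat"
  assumes "V \<in> carrier_mat m m" "W \<in> carrier_mat m m" "X \<in> carrier_mat m m" "V * W = 1\<^sub>m m"
  shows "V * (W * X) = X"
  using assoc_mult_mat[OF assms(1-3)] left_mult_one_mat[OF assms(3)] assms(4) by simp

lemma conj_mat_mult:
  fixes V :: "complex mat"
  assumes V: "V \<in> carrier_mat m m" "W \<in> carrier_mat m m" and A: "A \<in> carrier_mat m m" and B: "B \<in> carrier_mat m m"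
    and VW: "V * W = 1\<^sub>m m"
  shows "(W * A * V) * (W * B * V) = W * (A * B) * V"
proof -
  have c: "W * A \<in> carrier_mat m m" "B * V \<in> carrier_mat m m" "W * B * V \<in> carrier_mat m m" "A * B \<in> carrier_mat m m"
    using V A B by auto
  have "(W * A * V) * (W * B * V) = W * A * (V * (W * B * V))" by (rule assoc_mult_mat[OF c(1) V(1) c(3)])
  also have "V * (W * B * V) = B * V"
    using assoc_mult_mat[OF V(2) B V(1)] cancel_mat[OF V c(2) VW] by simp
  also have "W * A * (B * V) = W * (A * (B * V))" by (rule assoc_mult_mat[OF V(2) A c(2)])
  also have "A * (B * V) = A * B * V" by (rule assoc_mult_mat[OF A B V(1), symmetric])
  also have "W * (A * B * V) = W * (A * B) * V" by (rule assoc_mult_mat[OF V(2) c(4) V(1), symmetric])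
  finally show ?thesis .
qed

text \<open>The same constant change of basis in all charts conjugates all transition matrices
  simultaneously.\<close>

lemma (in charts) charts_basis_change:
  assumes V: "V \<in> carrier_mat m m" "W \<in> carrier_mat m m" "V * W = 1\<^sub>m m" "W * V = 1\<^sub>m m"
  shows "charts p q m (\<lambda>k. basis_change m V (\<Phi> k)) (\<lambda>k. W * T k * V) (\<lambda>k. W * Ti k * V)"
proof -
  note cancel = conj_mat_mult[OF V(1,2) _ _ V(3)]
  show ?thesis
  proof unfold_locales
    fix k
    show "fundamental (chart k) (basis_change m V (\<Phi> k))"
      unfolding fundamental_def
    proof (intro conjI allI impI)
      show "sol (chart k) (basis_change m V (\<Phi> k) i)" for i by (rule sol_basis_change)
      fix c i assume z: "\<forall>z\<in>chart k. lin_comb m c (basis_change m V (\<Phi> k)) z = 0" and i: "i < m"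
      have "\<forall>i<m. mat_apply m V c i = 0" using fundamental_chart[of k] z unfolding lin_comb_basis_change fundamental_def by blast
      then have "mat_apply m V c = (\<lambda>_. 0)" by (auto simp: mat_apply_def)
      then have "mat_apply m (W * V) c = (\<lambda>_. 0)" using mat_apply_mult[OF V(2,1)] mat_apply_0 by simp
      then have "mat_apply m (1\<^sub>m m) c i = 0" using V(4) by simp
      then show "c i = 0" using i by (simp add: mat_apply_def if_distrib[of "\<lambda>y. y * _"] cong: if_cong)
    qed
    show "W * T k * V \<in> carrier_mat m m" "W * Ti k * V \<in> carrier_mat m m" using V T by auto
    show "(W * T k * V) * (W * Ti k * V) = 1\<^sub>m m" "(W * Ti k * V) * (W * T k * V) = 1\<^sub>m m"
      using cancel[OF T(1) T(2), of k k] cancel[OF T(2) T(1), of k k] T_inv V by simp_all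
    fix j z assume j: "j < m"
    show "basis_change m V (\<Phi> k) j z = basis_change m V (\<Phi> 0) j z" if "Im z > 0"
      using lin_comb_upper[OF that] by (simp add: basis_change_def)
    show "basis_change m V (\<Phi> k) j z = basis_change m (W * T k * V) (basis_change m V (\<Phi> 0)) j z" if z: "Im z < 0"
    proof -
      have "basis_change m V (\<Phi> k) j z = basis_change m V (basis_change m (T k) (\<Phi> 0)) j z"
        using lower[OF _ z, of _ k] by (simp add: basis_change_def[of m V] lin_comb_def)
      also have "\<dots> = basis_change m (T k * V) (\<Phi> 0) j z" by (simp add: basis_change_mult[OF T(1) V(1) j])
      also have "T k * V = V * (W * T k * V)"
        using cancel_mat[OF V(1,2) mult_carrier_mat[OF T(1) V(1)] V(3), of k] assoc_mult_mat[OF V(2) T(1) V(1), of k] by simp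
      also have "basis_change m (V * (W * T k * V)) (\<Phi> 0) j z = basis_change m (W * T k * V) (basis_change m V (\<Phi> 0)) j z"
        using V T by (subst basis_change_mult[OF _ _ j]) auto
      finally show ?thesis .
    qed
  qed
qed

text \<open>Beukers and Heckman: the monodromy at \<open>0\<close> and at \<open>\<infinity>\<close> have the prescribed eigenvalues, and
  their product, the inverse of the monodromy at \<open>1\<close>, fixes a hyperplane. By Levelt's theorem this
  determines both up to simultaneous conjugation.\<close>

theorem (in hypergeometric) hypergeometric_monodromy:
  assumes p: "p = (\<Prod>i<m. [:- \<rho> i, 1:])" and \<rho>: "\<And>i. i < m \<Longrightarrow> cmod (\<rho> i - z0) < 1/2"
    and q: "q = (\<Prod>i<m. [:\<sigma> i, 1:])" and \<sigma>: "\<And>i. i < m \<Longrightarrow> cmod (\<sigma> i - z1) < 1/2"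
    and N: "2 * \<kappa> = of_nat N" "N > 0"
    and no_common: "\<And>i j. i < m \<Longrightarrow> j < m \<Longrightarrow> inverse (exp (2 * of_real pi * \<i> * \<rho> i)) \<noteq> exp (2 * of_real pi * \<i> * \<sigma> j)"
  obtains \<Phi> T Ti where "charts p q m \<Phi> T Ti"
    "Ti 1 = companion m (\<Prod>j<m. [:- inverse (exp (2 * of_real pi * \<i> * \<rho> j)), 1:])"
    "Ti 1 * T 2 = companion m (\<Prod>j<m. [:- exp (2 * of_real pi * \<i> * \<sigma> j), 1:])"
proof -
  have "\<kappa> \<noteq> 0" using N by auto
  then obtain \<Phi> T Ti where ch: "charts p q m \<Phi> T Ti" using charts_exist by blast
  interpret C: charts p q m \<Phi> T Ti by (rule ch)
  let ?rB = "\<Prod>j<m. [:- inverse (exp (2 * of_real pi * \<i> * \<rho> j)), 1:]"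
  let ?rA = "\<Prod>j<m. [:- exp (2 * of_real pi * \<i> * \<sigma> j), 1:]"
  have T01: "Ti 0 * T 1 = T 1" using C.T_0(2) C.T(1)[of 1] by simp
  have monic: "degree (\<Prod>j<m. [:- f j, 1:]) = m" "Polynomial.coeff (\<Prod>j<m. [:- f j, 1:]) m = 1" for f :: "nat \<Rightarrow> complex"
  proof -
    show d: "degree (\<Prod>j<m. [:- f j, 1:]) = m" by (subst degree_prod_eq_sum_degree) auto
    have "lead_coeff (\<Prod>j<m. [:- f j, 1:]) = 1" by (simp add: lead_coeff_prod)
    then show "Polynomial.coeff (\<Prod>j<m. [:- f j, 1:]) m = 1" using d by simp
  qed
  obtain l where l: "\<And>x. (\<Sum>i<m. l i * x i) = 0 \<Longrightarrow> mat_apply m (T 2) x = mat_apply m (1\<^sub>m m) x"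
    using C.monodromy_1_hyperplane[OF N] by blast
  have cA: "Ti 1 * T 2 \<in> carrier_mat m m" by (rule mult_carrier_mat[OF C.T(2,1)])
  have zA: "poly_mat_apply m (Ti 1 * T 2) ?rA x = (\<lambda>_. 0)" if "\<And>i. i \<ge> m \<Longrightarrow> x i = 0" for x
    by (rule C.monodromy_inf_annihilated[OF q \<sigma> that])
  have zB: "poly_mat_apply m (Ti 1) ?rB x = (\<lambda>_. 0)" if "\<And>i. i \<ge> m \<Longrightarrow> x i = 0" for x
    by (rule poly_mat_apply_inverse_zero[OF C.T(1,2) C.T_inv(2) _ that C.monodromy_0_annihilated[OF p \<rho> that, unfolded T01]]) auto
  have nc: "poly ?rB z \<noteq> 0" if "poly ?rA z = 0" for z
  proof
    assume "poly ?rB z = 0"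
    then obtain i where i: "i < m" "z = inverse (exp (2 * of_real pi * \<i> * \<rho> i))" by (auto simp: poly_prod)
    obtain j where "j < m" "z = exp (2 * of_real pi * \<i> * \<sigma> j)" using \<open>poly ?rA z = 0\<close> by (auto simp: poly_prod)
    then show False using no_common i by metis
  qed
  have agree: "mat_apply m (Ti 1 * T 2) x = mat_apply m (Ti 1) x" if "(\<Sum>i<m. l i * x i) = 0" for x
  proof -
    have "mat_apply m (Ti 1) (mat_apply m (1\<^sub>m m) x) = mat_apply m (Ti 1) x"
      using mat_apply_mult[OF C.T(2) one_carrier_mat, of 1 x] C.T(2)[of 1] by simp
    then show ?thesis using mat_apply_mult[OF C.T(2,1), of 1 2 x] l[OF that] by simp
  qed
  obtain V W where VW: "V \<in> carrier_mat m m" "W \<in> carrier_mat m m" "V * W = 1\<^sub>m m" "W * V = 1\<^sub>m m"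
    and A: "(Ti 1 * T 2) * V = V * companion m ?rA" and B: "Ti 1 * V = V * companion m ?rB"
    by (rule simultaneous_companion[OF m_pos cA C.T(2) monic zA monic zB nc agree])
  interpret D: charts p q m "\<lambda>k. basis_change m V (\<Phi> k)" "\<lambda>k. W * T k * V" "\<lambda>k. W * Ti k * V"
    by (rule C.charts_basis_change[OF VW])
  have cc: "companion m r \<in> carrier_mat m m" for r by (simp add: companion_def)
  have WV: "W * M * V = companion m r" if "M * V = V * companion m r" "M \<in> carrier_mat m m" for M r
  proof -
    have "W * M * V = W * (M * V)" using VW that by (intro assoc_mult_mat) auto
    also have "\<dots> = (W * V) * companion m r" unfolding that(1) using VW cc by (intro assoc_mult_mat[symmetric]) auto
    finally show ?thesis unfolding VW(4) using left_mult_one_mat[OF cc] by simp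
  qed
  have "(W * Ti 1 * V) * (W * T 2 * V) = W * (Ti 1 * T 2) * V"
    by (rule conj_mat_mult[OF VW(1,2) C.T(2,1) VW(3)])
  then show ?thesis
    using that[OF D.charts_axioms] WV[OF B C.T(2)] WV[OF A cA] by simp
qed

section \<open>The exponents\<close>

abbreviation circle_exp :: "real \<Rightarrow> complex" where
  "circle_exp a \<equiv> exp (2 * of_real pi * \<i> * of_real a)"

definition char_poly_of :: "real multiset \<Rightarrow> complex poly" where
  "char_poly_of M = (\<Prod>a\<in>#M. [:- circle_exp a, 1:])"

text \<open>The fractions with denominator \<open>N\<close> in \<open>[0, 1)\<close>, described without numerators: in this form
  Bezout's identity yields their intersections.\<close>

definition fractions :: "nat \<Rightarrow> real set" where
  "fractions N = {x. 0 \<le> x \<and> x < 1 \<and> x * real N \<in> \<int>}"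

lemma fractions_image:
  assumes "N > 0"
  shows "fractions N = (\<lambda>j. real j / real N) ` {0..<N}"
proof (intro equalityI subsetI)
  fix x assume x: "x \<in> fractions N"
  then obtain k where k: "x * real N = of_int k" by (auto simp: fractions_def elim: Ints_cases)
  have "0 \<le> x * real N" "x * real N < real N" using x assms by (auto simp: fractions_def)
  then have "0 \<le> k" "k < int N" unfolding k by linarith+
  then have "x = real (nat k) / real N" "nat k < N" using k assms by (auto simp: field_simps)
  then show "x \<in> (\<lambda>j. real j / real N) ` {0..<N}" by auto
qed (use assms in \<open>auto simp: fractions_def\<close>)

lemma inj_fractions: "N > 0 \<Longrightarrow> inj_on (\<lambda>j. real j / real N) {0..<N}"
  by (auto simp: inj_on_def)

lemma finite_fractions: "N > 0 \<Longrightarrow> finite (fractions N)"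
  by (simp add: fractions_image)

lemma card_fractions: "N > 0 \<Longrightarrow> card (fractions N) = N"
  using card_image[OF inj_fractions] by (simp add: fractions_image)

lemma mset_fractions: "N > 0 \<Longrightarrow> image_mset (\<lambda>j. real j / real N) (mset_set {0..<N}) = mset_set (fractions N)"
  using image_mset_mset_set[OF inj_fractions] by (simp add: fractions_image)

lemma fractions_Int: "fractions a \<inter> fractions b = fractions (gcd a b)"
proof (intro equalityI subsetI)
  fix x assume x: "x \<in> fractions a \<inter> fractions b"
  obtain u v where uv: "u * int a + v * int b = gcd (int a) (int b)" using bezout_int by blast
  have "x * real (gcd a b) = of_int u * (x * real a) + of_int v * (x * real b)"
  proof -
    have "real (gcd a b) = of_int (gcd (int a) (int b))" by (simp only: gcd_int_int_eq of_int_of_nat_eq)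
    also have "\<dots> = of_int u * real a + of_int v * real b" by (simp only: uv[symmetric] of_int_add of_int_mult of_int_of_nat_eq)
    finally show ?thesis by (simp add: algebra_simps)
  qed
  moreover have "x * real a \<in> \<int>" "x * real b \<in> \<int>" using x by (auto simp: fractions_def)
  then have "of_int u * (x * real a) + of_int v * (x * real b) \<in> \<int>"
    by (intro Ints_add Ints_mult[OF Ints_of_int])
  ultimately show "x \<in> fractions (gcd a b)" using x by (simp add: fractions_def)
next
  fix x assume x: "x \<in> fractions (gcd a b)"
  have "x * real c \<in> \<int>" if "gcd a b dvd c" for c
  proof -
    obtain k where "c = gcd a b * k" using \<open>gcd a b dvd c\<close> by (elim dvdE)
    then have "x * real c = x * real (gcd a b) * real k" by simp
    moreover have "x * real (gcd a b) \<in> \<int>" using x by (simp add: fractions_def)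
    ultimately show ?thesis using Ints_mult[OF _ Ints_of_nat] by metis
  qed
  then show "x \<in> fractions a \<inter> fractions b" using x by (auto simp: fractions_def)
qed

lemma circle_exp_inj: "circle_exp x = circle_exp y \<Longrightarrow> \<bar>x - y\<bar> < 1 \<Longrightarrow> x = y"
proof -
  assume e: "circle_exp x = circle_exp y" and d: "\<bar>x - y\<bar> < 1"
  obtain k :: int where "2 * of_real pi * \<i> * of_real x = 2 * of_real pi * \<i> * of_real y + of_int (2 * k) * pi * \<i>"
    using e unfolding exp_eq by blast
  then have "2 * of_real pi * \<i> * (of_real x - of_real y - of_int k) = 0" by (simp add: algebra_simps)
  then have "complex_of_real (x - y) = of_real (of_int k)" by simp
  then have k: "x - y = of_int k" by (simp only: of_real_eq_iff)
  then have "k = 0" using d by linarith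
  then show ?thesis using k by simp
qed

definition int_coeffs :: "complex poly \<Rightarrow> bool" where
  "int_coeffs r \<longleftrightarrow> (\<forall>k. Polynomial.coeff r k \<in> \<int>)"

lemma int_coeffs_one: "int_coeffs 1"
  by (simp add: int_coeffs_def coeff_1)

lemma int_coeffs_mult: "int_coeffs r \<Longrightarrow> int_coeffs s \<Longrightarrow> int_coeffs (r * s)"
  unfolding int_coeffs_def coeff_mult by (auto intro!: Ints_sum Ints_mult)

lemma int_coeffs_prod: "(\<And>i. i \<in> I \<Longrightarrow> int_coeffs (f i)) \<Longrightarrow> int_coeffs (prod f I)"
  by (induction I rule: infinite_finite_induct) (auto simp: int_coeffs_mult int_coeffs_one)

text \<open>Comparing coefficients from the top: the highest non-integral coefficient of \<open>s\<close> would also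
  show up in \<open>r * s\<close>.\<close>

lemma int_coeffs_cancel:
  assumes r: "int_coeffs r" "lead_coeff r = 1" and rs: "int_coeffs (r * s)"
  shows "int_coeffs s"
proof (rule ccontr)
  assume "\<not> int_coeffs s"
  then have ne: "{k. Polynomial.coeff s k \<notin> \<int>} \<noteq> {}" by (auto simp: int_coeffs_def)
  have fin: "finite {k. Polynomial.coeff s k \<notin> \<int>}"
  proof (rule finite_subset)
    show "{k. Polynomial.coeff s k \<notin> \<int>} \<subseteq> {..degree s}"
    proof
      fix k assume "k \<in> {k. Polynomial.coeff s k \<notin> \<int>}"
      then have "Polynomial.coeff s k \<noteq> 0" by auto
      then show "k \<in> {..degree s}" using le_degree by blast
    qed
  qed simp
  define k where "k = Max {k. Polynomial.coeff s k \<notin> \<int>}"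
  have k: "Polynomial.coeff s k \<notin> \<int>" using Max_in[OF fin ne] by (simp add: k_def)
  have above: "Polynomial.coeff s i \<in> \<int>" if "i > k" for i
    using Max_ge[OF fin, of i] that by (fastforce simp: k_def)
  let ?d = "degree r"
  have "Polynomial.coeff (r * s) (?d + k) = (\<Sum>i\<le>?d + k. Polynomial.coeff r i * Polynomial.coeff s (?d + k - i))"
    by (rule coeff_mult)
  also have "\<dots> = Polynomial.coeff s k + (\<Sum>i\<in>{..?d + k} - {?d}. Polynomial.coeff r i * Polynomial.coeff s (?d + k - i))"
    using r(2) by (subst sum.remove[of _ ?d]) auto
  finally have "Polynomial.coeff s k = Polynomial.coeff (r * s) (?d + k)
      - (\<Sum>i\<in>{..?d + k} - {?d}. Polynomial.coeff r i * Polynomial.coeff s (?d + k - i))" by simp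
  moreover have "Polynomial.coeff r i * Polynomial.coeff s (?d + k - i) \<in> \<int>" if "i \<in> {..?d + k} - {?d}" for i
  proof (cases "i > ?d")
    case True then show ?thesis by (simp add: coeff_eq_0)
  next
    case False
    then show ?thesis using that r(1) by (intro Ints_mult above) (auto simp: int_coeffs_def)
  qed
  ultimately have "Polynomial.coeff s k \<in> \<int>" using rs by (simp only:) (intro Ints_diff Ints_sum, auto simp: int_coeffs_def)
  then show False using k by simp
qed

lemma prod_linear_factors:
  fixes f :: "'a \<Rightarrow> complex" and M :: "'a multiset"
  defines "r \<equiv> \<Prod>a\<in>#M. [:f a, 1:]"
  shows "degree r = size M" "Polynomial.coeff r (size M) = 1" "M \<noteq> {#} \<Longrightarrow> Polynomial.coeff r (size M - 1) = (\<Sum>a\<in>#M. f a)"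
proof -
  have "degree r = size M \<and> Polynomial.coeff r (size M) = 1
      \<and> (M \<noteq> {#} \<longrightarrow> Polynomial.coeff r (size M - 1) = (\<Sum>a\<in>#M. f a))"
    unfolding r_def
  proof (induction M)
    case (add x M)
    let ?R = "\<Prod>a\<in>#M. [:f a, 1:]"
    have e: "(\<Prod>a\<in>#add_mset x M. [:f a, 1:]) = Polynomial.smult (f x) ?R + pCons 0 ?R" by simp
    have c: "Polynomial.coeff (\<Prod>a\<in>#add_mset x M. [:f a, 1:]) k = f x * Polynomial.coeff ?R k
        + (case k of 0 \<Rightarrow> 0 | Suc i \<Rightarrow> Polynomial.coeff ?R i)" for k
      unfolding e by (simp add: coeff_pCons)
    have top: "Polynomial.coeff (\<Prod>a\<in>#add_mset x M. [:f a, 1:]) (Suc (size M)) = 1"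
      unfolding c using add by (simp add: coeff_eq_0)
    moreover have "Polynomial.coeff (\<Prod>a\<in>#add_mset x M. [:f a, 1:]) k = 0" if "k > Suc (size M)" for k
      unfolding c using add that by (auto simp: coeff_eq_0 split: nat.split)
    ultimately have "degree (\<Prod>a\<in>#add_mset x M. [:f a, 1:]) = Suc (size M)"
      by (intro antisym degree_le le_degree) auto
    moreover have "Polynomial.coeff (\<Prod>a\<in>#add_mset x M. [:f a, 1:]) (size M) = (\<Sum>a\<in>#add_mset x M. f a)"
      unfolding c using add by (cases "size M") auto
    ultimately show ?case using top by simp
  qed simp
  then show "degree r = size M" "Polynomial.coeff r (size M) = 1"
    "M \<noteq> {#} \<Longrightarrow> Polynomial.coeff r (size M - 1) = (\<Sum>a\<in>#M. f a)" by auto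
qed

lemma char_poly_of_monic: "degree (char_poly_of M) = size M" "lead_coeff (char_poly_of M) = 1"
  using prod_linear_factors[where f = "\<lambda>a. - circle_exp a" and M = M] by (simp_all add: char_poly_of_def)

lemma char_poly_of_add: "char_poly_of (M + N) = char_poly_of M * char_poly_of N"
  by (simp add: char_poly_of_def)

lemma char_poly_of_set: "char_poly_of (mset_set A) = (\<Prod>a\<in>A. [:- circle_exp a, 1:])"
  by (simp add: char_poly_of_def prod_unfold_prod_mset)

lemma char_poly_of_fractions:
  assumes N: "N > 0"
  shows "char_poly_of (mset_set (fractions N)) = monom 1 N - 1"
proof -
  let ?P = "char_poly_of (mset_set (fractions N))"
  let ?Q = "monom 1 N - 1 :: complex poly"
  have d: "degree ?P = N" using char_poly_of_monic(1) N by (simp add: finite_fractions card_fractions)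
  have cP: "Polynomial.coeff ?P N = 1" using char_poly_of_monic(2)[of "mset_set (fractions N)"] d by simp
  have cQ: "Polynomial.coeff ?Q N = 1" using N by (simp add: coeff_1)
  have dQ: "degree ?Q \<le> N" by (rule degree_diff_le) (auto simp: degree_monom_le)
  have "?P - ?Q = 0"
  proof (rule ccontr)
    assume nz: "?P - ?Q \<noteq> 0"
    have "degree (?P - ?Q) \<le> N" by (rule degree_diff_le[OF _ dQ]) (simp add: d)
    moreover have "Polynomial.coeff (?P - ?Q) N = 0" using cP cQ by simp
    ultimately have "degree (?P - ?Q) < N" using nz by (metis eq_zero_or_degree_less)
    moreover have "circle_exp ` fractions N \<subseteq> {z. poly (?P - ?Q) z = 0}"
    proof
      fix z assume "z \<in> circle_exp ` fractions N"
      then obtain x where x: "x \<in> fractions N" "z = circle_exp x" by blast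
      obtain k where k: "x * real N = of_int k" using x(1) by (auto simp: fractions_def elim: Ints_cases)
      have "z ^ N = exp (of_nat N * (2 * of_real pi * \<i> * of_real x))" by (simp only: x(2) exp_of_nat_mult)
      also have "of_nat N * (2 * of_real pi * \<i> * of_real x) = 2 * of_real pi * \<i> * of_real (x * real N)" by simp
      also have "\<dots> = 2 * of_int k * of_real pi * \<i>" unfolding k by simp
      also have "exp \<dots> = 1" by (auto simp: exp_eq_1)
      finally have "z ^ N = 1" .
      moreover have "poly ?P z = 0" unfolding char_poly_of_set poly_prod
        using finite_fractions[OF N] x by (auto intro!: prod_zero bexI[of _ x])
      ultimately show "z \<in> {z. poly (?P - ?Q) z = 0}" by (simp add: poly_monom)
    qed
    then have "card (circle_exp ` fractions N) \<le> card {z. poly (?P - ?Q) z = 0}"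
      using nz by (intro card_mono poly_roots_finite)
    moreover have "inj_on circle_exp (fractions N)"
    proof (rule inj_onI)
      fix x y assume "x \<in> fractions N" "y \<in> fractions N" "circle_exp x = circle_exp y"
      then show "x = y" by (intro circle_exp_inj) (auto simp: fractions_def)
    qed
    then have "card (circle_exp ` fractions N) = N" using card_image card_fractions[OF N] by metis
    ultimately show False using card_poly_roots_bound[OF nz] by simp
  qed
  then show ?thesis by simp
qed

lemma int_coeffs_fractions: "N > 0 \<Longrightarrow> int_coeffs (char_poly_of (mset_set (fractions N)))"
  by (simp add: char_poly_of_fractions int_coeffs_def coeff_1)

text \<open>Cancellation of common roots removes a union of sets \<open>fractions g\<close>. Its polynomial is
  integral by inclusion and exclusion, since intersections of such sets are again such sets.\<close>

lemma int_coeffs_UN_fractions: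
  assumes "\<And>g. g \<in> set gs \<Longrightarrow> g > 0"
  shows "int_coeffs (char_poly_of (mset_set (\<Union>g\<in>set gs. fractions g)))"
  using assms
proof (induction "length gs" arbitrary: gs)
  case 0 then show ?case by (simp add: char_poly_of_def int_coeffs_one)
next
  case (Suc k)
  then obtain g gs' where gs: "gs = g # gs'" "length gs' = k" by (cases gs) auto
  let ?A = "\<Union>g\<in>set gs'. fractions g"
  have fin: "finite ?A" "finite (fractions g)" using Suc.prems gs by (auto intro: finite_fractions)
  have "?A \<inter> fractions g = (\<Union>h\<in>set (map (gcd g) gs'). fractions h)"
    using fractions_Int[of g] by (auto simp: Int_commute)
  moreover have "int_coeffs (char_poly_of (mset_set (\<Union>h\<in>set (map (gcd g) gs'). fractions h)))"
    by (rule Suc.hyps(1)) (use gs Suc.prems in auto)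
  ultimately have i: "int_coeffs (char_poly_of (mset_set (?A \<inter> fractions g)))" by (simp only:)
  have "int_coeffs (char_poly_of (mset_set ?A) * char_poly_of (mset_set (fractions g)))"
    using Suc.hyps(1)[of gs'] gs Suc.prems by (intro int_coeffs_mult int_coeffs_fractions) auto
  moreover have "char_poly_of (mset_set ?A) * char_poly_of (mset_set (fractions g))
     = char_poly_of (mset_set (?A \<inter> fractions g)) * char_poly_of (mset_set (?A \<union> fractions g))"
    unfolding char_poly_of_set 
    by (rule trans[OF prod.union_inter[OF fin, symmetric] mult.commute])
  ultimately have "int_coeffs (char_poly_of (mset_set (?A \<union> fractions g)))"
    using int_coeffs_cancel[OF i char_poly_of_monic(2)] by simp
  then show ?case using gs by (simp add: Un_commute)
qed

lemma sum_fractions: "N > 0 \<Longrightarrow> (\<Sum>x\<in>fractions N. x) = (real N - 1) / 2"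
proof -
  assume N: "N > 0"
  have "(\<Sum>x\<in>fractions N. x) = (\<Sum>j\<in>{0..<N}. real j / real N)"
    unfolding fractions_image[OF N] by (rule sum.reindex[OF inj_fractions[OF N], unfolded o_def])
  also have "\<dots> = (\<Sum>j\<in>{0..<N}. real j) / real N" by (simp add: sum_divide_distrib)
  also have "(\<Sum>j\<in>{0..<N}. real j) = real N * (real N - 1) / 2"
    by (induction N) (auto simp: field_simps)
  finally show ?thesis using N by simp
qed

lemma fractions_reflect: "x \<in> fractions N \<Longrightarrow> x \<noteq> 0 \<Longrightarrow> 1 - x \<in> fractions N"
  by (auto simp: fractions_def left_diff_distrib)

text \<open>The consequences of the geometric hypotheses on which the arithmetic of the exponents rests.\<close>

locale exponent_data =
  fixes \<gamma> n :: nat and B :: "nat \<Rightarrow> nat"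
  assumes n: "n > 0" and B: "\<And>q. q \<in> {1..n+1} \<Longrightarrow> B q > 0" and sum_B: "(\<Sum>q\<in>{1..n+1}. B q) = \<gamma>"
begin

lemma \<gamma>: "\<gamma> > 0"
proof -
  have "B 1 \<le> (\<Sum>q\<in>{1..n+1}. B q)" by (rule member_le_sum) auto
  then show ?thesis using B[of 1] sum_B by simp
qed

abbreviation U :: "real set" where "U \<equiv> (\<Union>q\<in>{1..n+1}. fractions (B q))"

lemma C_plus_eq: "C_plus \<gamma> = mset_set (fractions \<gamma>)"
  unfolding C_plus_def by (rule mset_fractions[OF \<gamma>])

lemma C_minus_eq: "C_minus n B = (\<Sum>q\<in>{1..n+1}. mset_set (fractions (B q)))"
  unfolding C_minus_def by (rule sum.cong) (use B mset_fractions in auto)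

lemma count_C_minus: "count (C_minus n B) x = (\<Sum>q\<in>{1..n+1}. if x \<in> fractions (B q) then 1 else 0)"
  unfolding C_minus_eq count_sum
  by (rule sum.cong) (use B finite_fractions in \<open>auto simp: count_mset_set'\<close>)

lemma mem_C_minus: "x \<in># C_minus n B \<longleftrightarrow> x \<in> U"
proof -
  have "count (C_minus n B) x > 0 \<longleftrightarrow> (\<exists>q\<in>{1..n+1}. x \<in> fractions (B q))"
    unfolding count_C_minus neq0_conv[symmetric] by (subst sum_eq_0_iff) auto
  then show ?thesis by (auto simp: count_greater_zero_iff)
qed

lemma C_zero_eq: "C_zero \<gamma> n B = mset_set (fractions \<gamma> \<inter> U)"
proof (rule multiset_eqI)
  fix x
  have "x \<in> U \<longleftrightarrow> count (C_minus n B) x > 0" using mem_C_minus by (simp add: count_greater_zero_iff)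
  then show "count (C_zero \<gamma> n B) x = count (mset_set (fractions \<gamma> \<inter> U)) x"
    unfolding C_zero_def C_plus_eq using finite_fractions[OF \<gamma>] by (auto simp: count_mset_set')
qed

lemma C_plus_red_eq: "C_plus_red \<gamma> n B = mset_set (fractions \<gamma> - U)"
  unfolding C_plus_red_def C_zero_eq C_plus_eq
  by (rule multiset_eqI) (use finite_fractions[OF \<gamma>] in \<open>auto simp: count_mset_set'\<close>)

lemma C_plus_split: "C_plus \<gamma> = C_plus_red \<gamma> n B + C_zero \<gamma> n B"
  and C_minus_split: "C_minus n B = C_minus_red \<gamma> n B + C_zero \<gamma> n B"
  by (rule multiset_eqI; simp add: C_plus_red_def C_minus_red_def C_zero_def)+

lemma size_eq: "size (C_minus_red \<gamma> n B) = gamma_bar \<gamma> n B"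
proof -
  have "size (C_minus n B) = (\<Sum>q\<in>{1..n+1}. size (mset_set (fractions (B q))))"
    unfolding C_minus_eq by (rule size_multiset_sum)
  also have "\<dots> = (\<Sum>q\<in>{1..n+1}. B q)" by (rule sum.cong) (use B in \<open>auto simp: card_fractions\<close>)
  finally have "size (C_minus n B) = size (C_plus \<gamma>)" using sum_B \<gamma> by (simp add: C_plus_eq card_fractions)
  then show ?thesis unfolding gamma_bar_def C_plus_split C_minus_split by simp
qed

lemma zero_fractions: "0 \<in> fractions N"
  by (simp add: fractions_def)

lemma plus_range: "x \<in># C_plus_red \<gamma> n B \<Longrightarrow> 0 < x \<and> x < 1"
proof -
  assume "x \<in># C_plus_red \<gamma> n B"
  then have x: "x \<in> fractions \<gamma>" "x \<notin> U" unfolding C_plus_red_eq using finite_fractions[OF \<gamma>] by auto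
  have "0 \<in> U" using zero_fractions by (auto intro!: bexI[of _ 1])
  then have "x \<noteq> 0" using x(2) by auto
  then show ?thesis using x(1) by (auto simp: fractions_def)
qed

lemma minus_range: "x \<in># C_minus_red \<gamma> n B \<Longrightarrow> 0 \<le> x \<and> x < 1"
proof -
  assume "x \<in># C_minus_red \<gamma> n B"
  then have "x \<in># C_minus n B" unfolding C_minus_red_def by (rule in_diffD)
  then show ?thesis unfolding mem_C_minus by (auto simp: fractions_def)
qed

lemma disjoint: "x \<in># C_plus_red \<gamma> n B \<Longrightarrow> x \<notin># C_minus_red \<gamma> n B"
proof
  assume "x \<in># C_plus_red \<gamma> n B" "x \<in># C_minus_red \<gamma> n B"
  then have "x \<notin> U" "x \<in># C_minus n B"
    unfolding C_plus_red_eq C_minus_red_def using finite_fractions[OF \<gamma>] by (auto dest: in_diffD)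
  then show False using mem_C_minus by blast
qed

lemma n_le: "n \<le> gamma_bar \<gamma> n B"
proof -
  have "count (C_minus n B) 0 = n + 1" unfolding count_C_minus by (simp add: zero_fractions)
  moreover have "count (C_zero \<gamma> n B) 0 \<le> 1" unfolding C_zero_eq by (simp add: count_mset_set')
  ultimately have "n \<le> count (C_minus_red \<gamma> n B) 0" by (simp add: C_minus_red_def)
  also have "\<dots> \<le> size (C_minus_red \<gamma> n B)" by (rule count_le_size)
  finally show ?thesis using size_eq by simp
qed

text \<open>This difference is the number \<open>n / 2\<close> that makes the exponent at \<open>1\<close> half an integer and the
  constant term of the characteristic polynomial at infinity \<open>(-1) ^ n\<close>.\<close>

lemma sum_diff: "sum_mset (C_plus_red \<gamma> n B) - sum_mset (C_minus_red \<gamma> n B) = real n / 2"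
proof -
  have sm: "sum_mset (\<Sum>q\<in>Q. f q) = (\<Sum>q\<in>Q. sum_mset (f q))" for Q :: "nat set" and f :: "nat \<Rightarrow> real multiset"
    by (induction Q rule: infinite_finite_induct) auto
  have "sum_mset (C_minus n B) = (\<Sum>q\<in>{1..n+1}. \<Sum>x\<in>fractions (B q). x)"
    unfolding C_minus_eq sm by (simp add: sum_unfold_sum_mset)
  also have "\<dots> = (\<Sum>q\<in>{1..n+1}. (real (B q) - 1) / 2)" by (rule sum.cong) (use B sum_fractions in auto)
  also have "\<dots> = (real \<gamma> - real (n + 1)) / 2"
    by (simp add: sum_B[symmetric] sum_divide_distrib[symmetric] sum_subtractf)
  finally have "sum_mset (C_minus n B) = (real \<gamma> - real (n + 1)) / 2" .
  moreover have "sum_mset (C_plus \<gamma>) = (real \<gamma> - 1) / 2"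
    using sum_fractions[OF \<gamma>] by (simp add: C_plus_eq sum_unfold_sum_mset)
  ultimately show ?thesis unfolding C_plus_split C_minus_split by (simp add: field_simps)
qed

text \<open>Half the cardinality, because the set is invariant under the reflection that sends \<open>x\<close> to
  \<open>1 - x\<close>.\<close>

lemma sum_plus: "sum_mset (C_plus_red \<gamma> n B) = real (gamma_bar \<gamma> n B) / 2"
proof -
  let ?A = "fractions \<gamma> - U"
  have nz: "x \<noteq> 0" if "x \<in> ?A" for x
    using that zero_fractions n by (auto intro!: bexI[of _ 1])
  have refl: "1 - x \<in> ?A" if "x \<in> ?A" for x
  proof -
    have "1 - x \<notin> fractions (B q)" if q: "q \<in> {1..n+1}" for q
    proof
      assume "1 - x \<in> fractions (B q)"
      moreover have "1 - x \<noteq> 0" using \<open>x \<in> ?A\<close> by (auto simp: fractions_def)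
      ultimately have "1 - (1 - x) \<in> fractions (B q)" by (rule fractions_reflect)
      then show False using \<open>x \<in> ?A\<close> q by auto
    qed
    then show ?thesis using that fractions_reflect[of x \<gamma>] nz[OF that] by auto
  qed
  have "(\<Sum>x\<in>?A. x) = (\<Sum>x\<in>?A. 1 - x)"
    by (rule sum.reindex_bij_witness[of _ "\<lambda>x. 1 - x" "\<lambda>x. 1 - x"]) (use refl in auto)
  then have "2 * (\<Sum>x\<in>?A. x) = real (card ?A)" by (simp add: sum_subtractf)
  moreover have "sum_mset (mset_set ?A) = (\<Sum>x\<in>?A. x)" by (simp add: sum_unfold_sum_mset)
  ultimately show ?thesis unfolding gamma_bar_def C_plus_red_eq by simp
qed

lemma int_coeffs_plus: "int_coeffs (char_poly_of (C_plus_red \<gamma> n B))"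
  and int_coeffs_minus: "int_coeffs (char_poly_of (C_minus_red \<gamma> n B))"
proof -
  let ?gs = "map (\<lambda>q. gcd \<gamma> (B q)) [1..<n+2]"
  have "set [1..<n + 2] = {1..n+1}" by auto
  then have "fractions \<gamma> \<inter> U = (\<Union>g\<in>set ?gs. fractions g)"
    unfolding set_map image_image fractions_Int[symmetric] by blast
  moreover have "int_coeffs (char_poly_of (mset_set (\<Union>g\<in>set ?gs. fractions g)))"
    by (rule int_coeffs_UN_fractions) (use \<gamma> in auto)
  ultimately have z: "int_coeffs (char_poly_of (C_zero \<gamma> n B))" unfolding C_zero_eq by (simp only:)
  have "int_coeffs (char_poly_of (C_plus \<gamma>))" unfolding C_plus_eq by (rule int_coeffs_fractions[OF \<gamma>])
  then show "int_coeffs (char_poly_of (C_plus_red \<gamma> n B))"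
    unfolding C_plus_split char_poly_of_add mult.commute[of "char_poly_of (C_plus_red \<gamma> n B)"]
    by (rule int_coeffs_cancel[OF z char_poly_of_monic(2)])
  have pm: "char_poly_of (\<Sum>q\<in>Q. f q) = (\<Prod>q\<in>Q. char_poly_of (f q))" for Q :: "nat set" and f
    by (induction Q rule: infinite_finite_induct) (auto simp: char_poly_of_add, auto simp: char_poly_of_def)
  have "int_coeffs (char_poly_of (C_minus n B))" unfolding C_minus_eq pm
    by (intro int_coeffs_prod int_coeffs_fractions) (use B in auto)
  then show "int_coeffs (char_poly_of (C_minus_red \<gamma> n B))"
    unfolding C_minus_split char_poly_of_add mult.commute[of "char_poly_of (C_minus_red \<gamma> n B)"]
    by (rule int_coeffs_cancel[OF z char_poly_of_monic(2)])
qed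

lemma coeff_0_char_poly_of: "Polynomial.coeff (char_poly_of M) 0 = (-1) ^ size M * circle_exp (sum_mset M)"
  unfolding char_poly_of_def
proof (induction M)
  case (add x M)
  then show ?case by (simp add: distrib_left exp_add mult_ac)
qed simp

lemma minus_one_power: "(-1 :: complex) ^ k = circle_exp (real k / 2)"
proof -
  have "circle_exp (real k / 2) = exp (of_nat k * (of_real pi * \<i>))" by (simp add: mult_ac)
  then show ?thesis by (simp only: exp_of_nat_mult exp_pi_i)
qed

lemma coeff_0_plus: "Polynomial.coeff (char_poly_of (C_plus_red \<gamma> n B)) 0 = 1"
  unfolding coeff_0_char_poly_of sum_plus gamma_bar_def[symmetric] minus_one_power[symmetric]
  by (simp flip: power_mult_distrib)

lemma coeff_0_minus: "Polynomial.coeff (char_poly_of (C_minus_red \<gamma> n B)) 0 = (-1) ^ n"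
proof -
  let ?m = "gamma_bar \<gamma> n B"
  have "circle_exp (sum_mset (C_minus_red \<gamma> n B)) * (-1) ^ n = circle_exp (sum_mset (C_minus_red \<gamma> n B) + real n / 2)"
    unfolding minus_one_power by (simp add: distrib_left exp_add)
  also have "sum_mset (C_minus_red \<gamma> n B) + real n / 2 = real ?m / 2" using sum_diff sum_plus by simp
  finally have "circle_exp (sum_mset (C_minus_red \<gamma> n B)) * (-1) ^ n = (-1) ^ ?m" unfolding minus_one_power .
  then have "(-1) ^ ?m * circle_exp (sum_mset (C_minus_red \<gamma> n B)) * (-1) ^ n = 1"
    by (simp add: mult.assoc flip: power_mult_distrib)
  then have "(-1) ^ ?m * circle_exp (sum_mset (C_minus_red \<gamma> n B)) * ((-1) ^ n * (-1) ^ n) = (-1) ^ n"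
    by (simp only: mult.assoc[symmetric]) simp
  then show ?thesis unfolding coeff_0_char_poly_of size_eq by (simp flip: power_mult_distrib)
qed

end

section \<open>The volumes\<close>

lemma measure_pos_of_affine_independent:
  fixes S :: "'a::euclidean_space set"
  assumes S: "\<not> affine_dependent S" "card S = Suc DIM('a)"
  shows "measure lebesgue (convex hull S) > 0"
proof -
  have "compact (convex hull S)" using aff_independent_finite[OF S(1)] by (simp add: finite_imp_compact compact_convex_hull)
  then have "convex hull S \<in> lmeasurable" by (rule lmeasurable_compact)
  moreover have "interior (convex hull S) \<noteq> {}" using interior_convex_hull_eq_empty[OF S(2)] S(1) by simp
  then have "\<not> negligible (convex hull S)" by (simp add: negligible_convex_interior)
  ultimately have "measure lebesgue (convex hull S) \<noteq> 0" by (simp add: negligible_iff_measure0)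
  then show ?thesis using measure_nonneg[of lebesgue "convex hull S"] by linarith
qed

text \<open>The cones from \<open>b\<close> over the facets cover the simplex and overlap in hulls of at most
  \<open>DIM('a)\<close> points, which are null sets. No cone is degenerate because \<open>b\<close> is not in the affine
  hull of a facet.\<close>

lemma simplex_subdivision:
  fixes A :: "'a::euclidean_space set"
  assumes A: "\<not> affine_dependent A" "card A = Suc DIM('a)" and b: "b \<in> interior (convex hull A)"
  shows "a \<in> A \<Longrightarrow> measure lebesgue (convex hull (insert b (A - {a}))) > 0"
    and "(\<Sum>a\<in>A. measure lebesgue (convex hull (insert b (A - {a})))) = measure lebesgue (convex hull A)"
proof -
  let ?H = "\<lambda>a. convex hull (insert b (A - {a}))"
  have fin: "finite A" using A(1) by (rule aff_independent_finite)
  have bA: "b \<notin> A" using not_in_interior_convex_hull[OF fin, of b] A(2) b by auto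
  have b': "b \<in> convex hull A" using b interior_subset by blast
  have card: "card (insert b (A - {a})) = Suc DIM('a)" if "a \<in> A" for a
    using that fin bA A(2) by (simp add: card_Diff_singleton)
  show "measure lebesgue (?H a) > 0" if a: "a \<in> A"
  proof (rule measure_pos_of_affine_independent[OF _ card[OF a]])
    let ?F = "convex hull (A - {a})"
    have "?F face_of convex hull A" using face_of_convex_hull_affine_independent[OF A(1)] by blast
    moreover have "?F \<noteq> convex hull A"
    proof
      assume "?F = convex hull A"
      then have "a \<in> affine hull (A - {a})" using a hull_inc[of a A convex] convex_hull_subset_affine_hull by blast
      then show False using A(1) a by (auto simp: affine_dependent_def)
    qed
    ultimately have "affine hull ?F \<inter> rel_interior (convex hull A) = {}"
      by (intro affine_hull_face_of_disjoint_rel_interior) auto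
    then have "b \<notin> affine hull (A - {a})" using b interior_subset_rel_interior by fastforce
    then show "\<not> affine_dependent (insert b (A - {a}))"
      using affine_independent_insert affine_independent_Diff[OF A(1)] by blast
  qed
  have "measure lebesgue (\<Union>(?H ` A)) = (\<Sum>a\<in>A. measure lebesgue (?H a))"
  proof (rule measure_negligible_finite_Union_image[OF fin])
    show "?H a \<in> lmeasurable" if "a \<in> A" for a
      using fin by (intro lmeasurable_compact compact_convex_hull finite_imp_compact) auto
    show "pairwise (\<lambda>x y. negligible (?H x \<inter> ?H y)) A"
    proof (rule pairwiseI)
      fix x y assume xy: "x \<in> A" "y \<in> A" "x \<noteq> y"
      have eq: "?H x \<inter> ?H y = convex hull (insert b ((A - {x}) \<inter> (A - {y})))"
        by (rule convex_hull_exchange_Int[OF A(1) b']) auto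
      have "(A - {x}) \<inter> (A - {y}) = A - {x} - {y}" by blast
      then have "card (insert b ((A - {x}) \<inter> (A - {y}))) \<le> DIM('a)"
        using xy fin bA A(2) by (simp add: card_Diff_singleton)
      then have "interior (?H x \<inter> ?H y) = {}" unfolding eq using fin by (intro empty_interior_convex_hull) auto
      then show "negligible (?H x \<inter> ?H y)" by (subst negligible_convex_interior) (auto intro: convex_Int)
    qed
  qed
  then show "(\<Sum>a\<in>A. measure lebesgue (?H a)) = measure lebesgue (convex hull A)"
    using convex_hull_exchange_Union[OF b'] by simp
qed

lemma exponent_data_of_simplex:
  fixes \<alpha> :: "nat \<Rightarrow> real ^ 'n::finite"
  assumes n: "n = CARD('n)"
    and simplex: "int n simplex (convex hull (\<alpha> ` {1..n+1}))"
    and inner: "\<alpha> (n + 2) \<in> interior (convex hull (\<alpha> ` {1..n+1}))"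
    and \<gamma>: "real \<gamma> = normalized_volume (convex hull (\<alpha> ` {1..n+1}))"
    and B: "\<And>q. q \<in> {1..n+1} \<Longrightarrow>
              real (B q) = normalized_volume (convex hull (\<alpha> ` {1..n+2} - {\<alpha> q}))"
  shows "exponent_data \<gamma> n B"
proof
  let ?A = "\<alpha> ` {1..n+1}" and ?b = "\<alpha> (n + 2)"
  let ?H = "\<lambda>a. convex hull (insert ?b (?A - {a}))"
  \<comment> \<open>The vertices of the simplex are its extreme points, so they are among the \<open>\<alpha> i\<close>; by counting,
    the \<open>\<alpha> i\<close> are distinct and affinely independent.\<close>
  obtain C where C: "\<not> affine_dependent C" "int (card C) = int n + 1" "convex hull ?A = convex hull C"
    using simplex unfolding simplex_def by blast
  have "C \<subseteq> ?A"
  proof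
    fix x assume "x \<in> C"
    then have "x extreme_point_of (convex hull C)" using extreme_point_of_convex_hull_affine_independent[OF C(1)] by blast
    then show "x \<in> ?A" using extreme_point_of_convex_hull[of x ?A] C(3) by simp
  qed
  moreover have "card ?A \<le> card C" using card_image_le[of "{1..n+1}" \<alpha>] C(2) by simp
  ultimately have CA: "C = ?A" by (intro card_seteq) auto
  have A: "\<not> affine_dependent ?A" using C(1) CA by simp
  have cA: "card ?A = Suc n" using C(2) CA by simp
  then have cA': "card ?A = Suc DIM(real ^ 'n)" using n by simp
  have "card ?A = card {1..n+1}" using cA by simp
  then have inj: "inj_on \<alpha> {1..n+1}" by (intro eq_card_imp_inj_on) auto
  have bA: "?b \<notin> ?A" using not_in_interior_convex_hull[of ?A ?b] cA' inner by auto
  have B': "real (B q) = fact n * measure lebesgue (?H (\<alpha> q))" if q: "q \<in> {1..n+1}" for q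
  proof -
    have "{1..n+2} = insert (n+2) {1..n+1}" by auto
    then have "\<alpha> ` {1..n+2} - {\<alpha> q} = insert ?b (?A - {\<alpha> q})" using bA q by auto
    then show ?thesis using B[OF q] unfolding normalized_volume_def n by simp
  qed
  show "n > 0" using n by simp
  show "B q > 0" if "q \<in> {1..n+1}" for q
  proof -
    have "real (B q) > 0" unfolding B'[OF that]
      using simplex_subdivision(1)[OF A cA' inner, of "\<alpha> q"] that by (intro mult_pos_pos) auto
    then show ?thesis by simp
  qed
  have "real (\<Sum>q\<in>{1..n+1}. B q) = (\<Sum>q\<in>{1..n+1}. fact n * measure lebesgue (?H (\<alpha> q)))"
    unfolding of_nat_sum by (rule sum.cong[OF refl B'])
  also have "\<dots> = fact n * (\<Sum>a\<in>?A. measure lebesgue (?H a))"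
    unfolding sum.reindex[OF inj] sum_distrib_left[symmetric] o_def ..
  also have "\<dots> = real \<gamma>"
    unfolding \<gamma> normalized_volume_def by (simp only: simplex_subdivision(2)[OF A cA' inner] n[symmetric])
  finally show "(\<Sum>q\<in>{1..n+1}. B q) = \<gamma>" by (simp only: of_nat_eq_iff)
qed

section \<open>The monodromy of the reduced operator\<close>

text \<open>The inverse of the companion matrix is integral if the constant term is a unit; it is
  written down explicitly as \<open>D\<close>.\<close>

lemma companion_GL_int:
  assumes m: "m > 0" and r: "int_coeffs r" "Polynomial.coeff r m = 1"
    and unit: "Polynomial.coeff r 0 = 1 \<or> Polynomial.coeff r 0 = -1"
    and M: "M \<in> carrier_mat m m" "M * companion m r = 1\<^sub>m m"
  shows "companion m r \<in> GL_int m" "M \<in> GL_int m"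
proof -
  have "\<exists>c. \<forall>i. Polynomial.coeff r i = of_int (c i)"
    using r(1) unfolding int_coeffs_def by (intro choice) (auto elim: Ints_cases)
  then obtain c where c: "\<And>i. Polynomial.coeff r i = complex_of_int (c i)" by blast
  have "complex_of_int (c m) = of_int 1" using r(2) c by simp
  then have cm: "c m = 1" by (simp only: of_int_eq_iff)
  have "complex_of_int (c 0 * c 0) = of_int 1" using unit c[of 0] by auto
  then have c0: "c 0 * c 0 = 1" by (simp only: of_int_eq_iff)
  define K where "K = mat m m (\<lambda>(i, j). if j = m - 1 then - c i else if i = j + 1 then 1 else 0)"
  define D where "D = mat m m (\<lambda>(i, j). if j = 0 then - c 0 * c (i + 1) else if j = i + 1 then 1 else 0)"
  obtain m' where m': "m = Suc m'" using m by (cases m) auto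
  have K_sum: "(\<Sum>k<m. K $$ (i, k) * x k) = (if i = 0 then 0 else x (i - 1)) - c i * x (m - 1)" if i: "i < m" for i x
  proof -
    have "(\<Sum>k<m'. K $$ (i, k) * x k) = (\<Sum>k<m'. if k = i - 1 then (if i = 0 then 0 else x k) else 0)"
      using i by (intro sum.cong) (auto simp: K_def m')
    also have "\<dots> = (if i = 0 then 0 else x (i - 1))" using i by (auto simp: m')
    finally show ?thesis using i by (simp add: m' K_def)
  qed
  have D_sum: "(\<Sum>k<m. D $$ (i, k) * x k) = - c 0 * c (i + 1) * x 0 + (if i + 1 < m then x (i + 1) else 0)" if i: "i < m" for i x
  proof -
    have "(\<Sum>k<m'. D $$ (i, Suc k) * x (Suc k)) = (\<Sum>k<m'. if k = i then x (Suc k) else 0)"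
      using i by (intro sum.cong) (auto simp: D_def m')
    also have "\<dots> = (if i + 1 < m then x (i + 1) else 0)" by (auto simp: m')
    finally show ?thesis using i unfolding m' sum.lessThan_Suc_shift by (simp add: D_def m')
  qed
  have car: "K \<in> carrier_mat m m" "D \<in> carrier_mat m m" by (auto simp: K_def D_def)
  have KD: "K * D = 1\<^sub>m m"
  proof (rule eq_matI)
    fix i j assume "i < dim_row (1\<^sub>m m :: int mat)" "j < dim_col (1\<^sub>m m :: int mat)"
    then have ij: "i < m" "j < m" by auto
    have "(K * D) $$ (i, j) = (\<Sum>k<m. K $$ (i, k) * D $$ (k, j))"
      using ij car by (auto simp: scalar_prod_def atLeast0LessThan)
    also have "\<dots> = (if i = 0 then 0 else D $$ (i - 1, j)) - c i * D $$ (m - 1, j)" by (rule K_sum[OF ij(1)])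
    also have "\<dots> = (if i = j then 1 else 0)" using ij m c0 cm by (auto simp: D_def)
    finally show "(K * D) $$ (i, j) = 1\<^sub>m m $$ (i, j)" using ij by simp
  qed (auto simp: K_def D_def)
  have DK: "D * K = 1\<^sub>m m"
  proof (rule eq_matI)
    fix i j assume "i < dim_row (1\<^sub>m m :: int mat)" "j < dim_col (1\<^sub>m m :: int mat)"
    then have ij: "i < m" "j < m" by auto
    have "(D * K) $$ (i, j) = (\<Sum>k<m. D $$ (i, k) * K $$ (k, j))"
      using ij car by (auto simp: scalar_prod_def atLeast0LessThan)
    also have "\<dots> = - c 0 * c (i + 1) * K $$ (0, j) + (if i + 1 < m then K $$ (i + 1, j) else 0)" by (rule D_sum[OF ij(1)])
    also have "\<dots> = (if i = j then 1 else 0)"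
    proof (cases "j = m - 1")
      case True
      have "- c 0 * c (i + 1) * K $$ (0, j) = c 0 * c 0 * c (i + 1)" using True ij by (simp add: K_def mult_ac)
      also have "\<dots> = c (i + 1)" by (simp only: c0 mult_1)
      finally have z: "- c 0 * c (i + 1) * K $$ (0, j) = c (i + 1)" .
      show ?thesis
      proof (cases "i = m - 1")
        case i: True
        then have "i + 1 = m" using m by simp
        then show ?thesis using z cm i True by simp
      next
        case False
        then show ?thesis unfolding z using True ij by (auto simp: K_def)
      qed
    next
      case False
      then show ?thesis using ij by (auto simp: K_def)
    qed
    finally show "(D * K) $$ (i, j) = 1\<^sub>m m $$ (i, j)" using ij by simp
  qed (auto simp: K_def D_def)
  have U: "K \<in> Units (ring_mat TYPE(int) m ())" "D \<in> Units (ring_mat TYPE(int) m ())"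
    using KD DK car by (auto simp: Units_def ring_mat_def)
  have cK: "companion m r = map_mat complex_of_int K"
    by (rule eq_matI) (auto simp: companion_def K_def c)
  then show "companion m r \<in> GL_int m" using U by (simp add: GL_int_def)
  have "companion m r * map_mat of_int D = 1\<^sub>m m"
    unfolding cK of_int_hom.mat_hom_mult[OF car, symmetric] KD by (rule of_int_hom.mat_hom_one)
  then have "M = M * (companion m r * map_mat of_int D)" using M(1) by simp
  also have "\<dots> = M * companion m r * map_mat of_int D"
    using M(1) car by (subst assoc_mult_mat[of _ m m _ m _ m]) (auto simp: companion_def)
  also have "\<dots> = map_mat of_int D" using M(2) car by simp
  finally show "M \<in> GL_int m" using U by (simp add: GL_int_def)
qed

lemma prod_mset_nth:
  assumes "mset xs = M"
  shows "(\<Prod>a\<in>#M. f a) = (\<Prod>i<length xs. f (xs ! i))"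
proof -
  have "(\<Prod>a\<in>#M. f a) = prod_list (map f xs)" unfolding assms[symmetric] by (simp flip: prod_mset_prod_list)
  then show ?thesis by (simp add: prod.list_conv_set_nth atLeast0LessThan)
qed

context exponent_data
begin

definition p :: "complex poly" where "p = (\<Prod>a\<in>#C_plus_red \<gamma> n B. [:complex_of_real a, 1:])"
definition q :: "complex poly" where "q = (\<Prod>a\<in>#C_minus_red \<gamma> n B. [:complex_of_real a + 1, 1:])"

abbreviation "m \<equiv> gamma_bar \<gamma> n B"

lemma R_bar_hyp_op: "R_bar \<gamma> n B = hyp_op p q"
  by (intro ext) (simp add: R_bar_def hyp_op_def p_def q_def)

sublocale H: hypergeometric p q m
proof
  show "m > 0" using n_le n by simp
  show "degree p = m" "Polynomial.coeff p m = 1"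
    unfolding p_def gamma_bar_def by (rule prod_linear_factors)+
  show "degree q = m" "Polynomial.coeff q m = 1"
    unfolding q_def size_eq[symmetric] by (rule prod_linear_factors)+
qed

lemma H_\<kappa>: "2 * H.\<kappa> = of_nat (2 * m - n)" "2 * m - n > 0"
proof -
  have ne: "C_plus_red \<gamma> n B \<noteq> {#}" "C_minus_red \<gamma> n B \<noteq> {#}"
    using H.m_pos size_eq unfolding gamma_bar_def by auto
  have of_real_sum: "(\<Sum>a\<in>#M. complex_of_real a) = of_real (sum_mset M)" for M by (induction M) auto
  have add_one: "(\<Sum>a\<in>#M. complex_of_real a + 1) = of_real (sum_mset M) + of_nat (size M)" for M
    by (induction M) auto
  have "Polynomial.coeff p (m - 1) = of_real (sum_mset (C_plus_red \<gamma> n B))"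
    unfolding p_def gamma_bar_def using prod_linear_factors(3)[OF ne(1)] of_real_sum by metis
  moreover have "Polynomial.coeff q (m - 1) = of_real (sum_mset (C_minus_red \<gamma> n B)) + of_nat m"
    unfolding q_def using prod_linear_factors(3)[OF ne(2), of "\<lambda>a. of_real a + 1"] add_one size_eq by metis
  moreover have "sum_mset (C_plus_red \<gamma> n B) = sum_mset (C_minus_red \<gamma> n B) + real n / 2" using sum_diff by simp
  ultimately have "H.\<kappa> = of_nat m - of_nat n / 2" unfolding H.\<kappa>_def by simp
  then show "2 * H.\<kappa> = of_nat (2 * m - n)" using n_le by (simp add: of_nat_diff)
  show "2 * m - n > 0" using n_le n by simp
qed

lemma companion_char_poly_plus:
  "companion m (char_poly_of (C_plus_red \<gamma> n B)) = last_column_mat m (-1) (B_coeff \<gamma> n B)"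
  using coeff_0_plus by (intro eq_matI) (auto simp: companion_def last_column_mat_def B_coeff_def char_poly_of_def)

lemma companion_char_poly_minus:
  "companion m (char_poly_of (C_minus_red \<gamma> n B)) = last_column_mat m ((-1) ^ (n + 1)) (A_coeff \<gamma> n B)"
  using coeff_0_minus by (intro eq_matI) (auto simp: companion_def last_column_mat_def A_coeff_def char_poly_of_def)

text \<open>The exponents at \<open>0\<close> are \<open>- a\<close> with \<open>0 < a < 1\<close>, those at \<open>\<infinity>\<close> are \<open>a + 1\<close> with \<open>0 \<le> a < 1\<close>;
  each family lies in an open disc of radius \<open>1/2\<close>. For the second family the centre depends on
  the largest \<open>a\<close>, as \<open>a = 0\<close> does occur.\<close>

theorem monodromy_matrices:
  obtains \<Phi> T Ti where "charts p q m \<Phi> T Ti" "Ti 1 = last_column_mat m (-1) (B_coeff \<gamma> n B)"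
    "Ti 1 * T 2 = last_column_mat m ((-1) ^ (n + 1)) (A_coeff \<gamma> n B)"
proof -
  obtain xs ys where xs: "mset xs = C_plus_red \<gamma> n B" and ys: "mset ys = C_minus_red \<gamma> n B" by (metis ex_mset)
  have len: "length xs = m" "length ys = m"
    using arg_cong[OF xs, of size] arg_cong[OF ys, of size] by (simp_all add: gamma_bar_def[symmetric] size_eq)
  have xs_mem: "xs ! i \<in># C_plus_red \<gamma> n B" if "i < m" for i using that len unfolding xs[symmetric] by simp
  have ys_mem: "ys ! i \<in># C_minus_red \<gamma> n B" if "i < m" for i using that len unfolding ys[symmetric] by simp
  define \<rho> where "\<rho> i = - complex_of_real (xs ! i)" for i
  define \<sigma> where "\<sigma> i = complex_of_real (ys ! i) + 1" for i
  define M where "M = Max (set ys)"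
  have ne: "set ys \<noteq> {}" using len H.m_pos by auto
  have "M \<in> set ys" unfolding M_def using ne by (intro Max_in) auto
  then have M1: "M < 1" using minus_range[of M] ys by (metis set_mset_mset)
  have p: "p = (\<Prod>i<m. [:- \<rho> i, 1:])" unfolding p_def prod_mset_nth[OF xs] len \<rho>_def by simp
  have q: "q = (\<Prod>i<m. [:\<sigma> i, 1:])" unfolding q_def prod_mset_nth[OF ys] len \<sigma>_def by simp
  have \<rho>: "cmod (\<rho> i - (- 1/2)) < 1/2" if "i < m" for i
  proof -
    have "\<rho> i - (- 1/2) = of_real (1/2 - xs ! i)" by (simp add: \<rho>_def)
    moreover have "\<bar>1/2 - xs ! i\<bar> < 1/2" using plus_range[OF xs_mem[OF that]] by linarith
    ultimately show ?thesis by (simp only: norm_of_real)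
  qed
  have \<sigma>: "cmod (\<sigma> i - of_real (1 + M / 2)) < 1/2" if i: "i < m" for i
  proof -
    have "\<sigma> i - of_real (1 + M / 2) = of_real (ys ! i - M / 2)" by (simp add: \<sigma>_def)
    moreover have "ys ! i \<le> M" unfolding M_def using i len by (intro Max_ge) auto
    then have "\<bar>ys ! i - M / 2\<bar> < 1/2" using minus_range[OF ys_mem[OF i]] M1 by linarith
    ultimately show ?thesis by (simp only: norm_of_real)
  qed
  have e\<rho>: "inverse (exp (2 * of_real pi * \<i> * \<rho> i)) = circle_exp (xs ! i)" for i by (simp add: \<rho>_def exp_minus)
  have e\<sigma>: "exp (2 * of_real pi * \<i> * \<sigma> i) = circle_exp (ys ! i)" for i
    by (simp add: \<sigma>_def distrib_left exp_add)
  have no_common: "inverse (exp (2 * of_real pi * \<i> * \<rho> i)) \<noteq> exp (2 * of_real pi * \<i> * \<sigma> j)" if "i < m" "j < m" for i j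
  proof
    assume "inverse (exp (2 * of_real pi * \<i> * \<rho> i)) = exp (2 * of_real pi * \<i> * \<sigma> j)"
    then have "circle_exp (xs ! i) = circle_exp (ys ! j)" unfolding e\<rho> e\<sigma> .
    moreover have "\<bar>xs ! i - ys ! j\<bar> < 1"
      using plus_range[OF xs_mem[OF that(1)]] minus_range[OF ys_mem[OF that(2)]] by auto
    ultimately have "xs ! i = ys ! j" by (rule circle_exp_inj)
    then show False using disjoint[OF xs_mem[OF that(1)]] ys_mem[OF that(2)] by simp
  qed
  have P: "(\<Prod>j<m. [:- inverse (exp (2 * of_real pi * \<i> * \<rho> j)), 1:]) = char_poly_of (C_plus_red \<gamma> n B)"
    unfolding e\<rho> char_poly_of_def prod_mset_nth[OF xs] len ..
  have Q: "(\<Prod>j<m. [:- exp (2 * of_real pi * \<i> * \<sigma> j), 1:]) = char_poly_of (C_minus_red \<gamma> n B)"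
    unfolding e\<sigma> char_poly_of_def prod_mset_nth[OF ys] len ..
  show ?thesis
    using H.hypergeometric_monodromy[OF p \<rho> q \<sigma> H_\<kappa> no_common] that
    unfolding P Q companion_char_poly_plus companion_char_poly_minus by blast
qed

lemma matrices_GL_int:
  defines "h0_inv \<equiv> last_column_mat m (-1) (B_coeff \<gamma> n B)"
    and "h \<equiv> last_column_mat m ((-1) ^ (n + 1)) (A_coeff \<gamma> n B)"
  assumes M: "M \<in> carrier_mat m m"
  shows "M * h0_inv = 1\<^sub>m m \<Longrightarrow> M \<in> GL_int m" "M * h = 1\<^sub>m m \<Longrightarrow> h \<in> GL_int m"
proof -
  let ?P = "char_poly_of (C_plus_red \<gamma> n B)" and ?Q = "char_poly_of (C_minus_red \<gamma> n B)"
  have P: "Polynomial.coeff ?P m = 1" "Polynomial.coeff ?P 0 = 1 \<or> Polynomial.coeff ?P 0 = -1"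
    using coeff_0_plus char_poly_of_monic[of "C_plus_red \<gamma> n B"] by (simp_all add: gamma_bar_def)
  have Q: "Polynomial.coeff ?Q m = 1" "Polynomial.coeff ?Q 0 = 1 \<or> Polynomial.coeff ?Q 0 = -1"
    using coeff_0_minus char_poly_of_monic[of "C_minus_red \<gamma> n B"] by (simp_all add: size_eq) (cases "even n"; simp)
  show "M \<in> GL_int m" if "M * h0_inv = 1\<^sub>m m"
    using companion_GL_int(2)[OF H.m_pos int_coeffs_plus P M] that unfolding companion_char_poly_plus h0_inv_def .
  show "h \<in> GL_int m" if "M * h = 1\<^sub>m m"
    using companion_GL_int(1)[OF H.m_pos int_coeffs_minus Q M] that unfolding companion_char_poly_minus h_def .
qed

end

theorem lemma7p13:
  fixes \<alpha> :: "nat \<Rightarrow> real ^ 'n::finite"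
    and n \<gamma> :: nat and B :: "nat \<Rightarrow> nat"
    and t0 :: complex and \<tau> :: "real \<Rightarrow> complex"
  assumes n: "n = CARD('n)"
    and lattice: "\<And>i k. i \<in> {1..n+2} \<Longrightarrow> \<alpha> i $ k \<in> \<int>"
    and origin: "\<alpha> (n + 1) = 0"
    and simplex: "int n simplex (convex hull (\<alpha> ` {1..n+1}))"
    and inner: "\<alpha> (n + 2) \<in> interior (convex hull (\<alpha> ` {1..n+1}))"
    and \<gamma>: "real \<gamma> = normalized_volume (convex hull (\<alpha> ` {1..n+1}))"
    and B: "\<And>q. q \<in> {1..n+1} \<Longrightarrow>
              real (B q) = normalized_volume (convex hull (\<alpha> ` {1..n+2} - {\<alpha> q}))"
    and gcd: "Gcd (B ` {1..n+1}) = 1"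
    and \<tau>: "path \<tau>" "path_image \<tau> \<subseteq> - {0, 1}" "pathstart \<tau> = t0" "pathfinish \<tau> = 1/2"
  defines "m \<equiv> gamma_bar \<gamma> n B"
  defines "h_inf \<equiv> last_column_mat m ((-1) ^ (n + 1)) (A_coeff \<gamma> n B)"
  defines "h_0 \<equiv> inv\<^bsub>GL m\<^esub> (last_column_mat m (-1) (B_coeff \<gamma> n B))"
  defines "h_1 \<equiv> inv\<^bsub>GL m\<^esub> (h_0 * h_inf)"
  shows "last_column_mat m (-1) (B_coeff \<gamma> n B) \<in> carrier (GL m) \<and>
    h_0 \<in> GL_int m \<and> h_inf \<in> GL_int m \<and>
    (\<exists>\<Phi>. solution_basis (R_bar \<gamma> n B) t0 m \<Phi> \<and>
         monodromy_group t0 m \<Phi> = generate (GL m) {h_0, h_inf} \<and>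
         is_monodromy_matrix m \<Phi> (conj_loop \<tau> loop_0) h_0 \<and>
         is_monodromy_matrix m \<Phi> (conj_loop \<tau> loop_inf) h_inf \<and>
         is_monodromy_matrix m \<Phi> (conj_loop \<tau> loop_1) h_1)"
proof -
  interpret exponent_data \<gamma> n B
    by (rule exponent_data_of_simplex[OF n simplex inner \<gamma> B])
  obtain \<Phi> T Ti where ch: "charts p q m \<Phi> T Ti" and K: "Ti 1 = last_column_mat m (-1) (B_coeff \<gamma> n B)"
    "Ti 1 * T 2 = h_inf"
    using monodromy_matrices unfolding m_def h_inf_def by blast
  interpret C: charts p q m \<Phi> T Ti by (rule ch)
  have h0: "h_0 = T 1" unfolding h_0_def K(1)[symmetric] by (rule C.T_GL)
  \<comment> \<open>\<open>h_0 * h_inf\<close> is \<open>T 2\<close>, the matrix of the loop around \<open>1\<close> run backwards.\<close>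
  have "T 1 * (Ti 1 * T 2) = T 2" using C.T[of 1] C.T(1)[of 2] C.T_inv(1)[of 1] by (rule cancel_mat)
  then have h1: "h_1 = Ti 2" unfolding h_1_def h0 K(2)[symmetric] by (simp add: C.T_GL)
  have "(Ti 2 * T 1) * (Ti 1 * T 2) = Ti 2 * (T 1 * (Ti 1 * T 2))"
    using mult_carrier_mat[OF C.T(2)[of 1] C.T(1)[of 2]] C.T by (intro assoc_mult_mat[of _ m m _ m _ m]) auto
  also have "\<dots> = 1\<^sub>m m" using \<open>T 1 * (Ti 1 * T 2) = T 2\<close> C.T_inv by simp
  finally have "(Ti 2 * T 1) * h_inf = 1\<^sub>m m" unfolding K(2) .
  then have int_inf: "h_inf \<in> GL_int m"
    unfolding h_inf_def m_def by (intro matrices_GL_int(2)[of "Ti 2 * T 1"]) (use mult_carrier_mat[OF C.T(2)[of 2] C.T(1)[of 1]] in \<open>auto simp: m_def\<close>)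
  have int_0: "h_0 \<in> GL_int m"
    unfolding h0 m_def by (rule matrices_GL_int(1)) (use C.T C.T_inv(1)[of 1] K(1) in \<open>auto simp: m_def\<close>)
  obtain \<Psi> where \<Psi>: "solution_basis (hyp_op p q) t0 m \<Psi>" "\<And>j. j < m \<Longrightarrow> continuation_along \<tau> (\<Psi> j) (\<Phi> 0 j)"
    using C.transported_basis[OF \<tau>] by blast
  have conj: "is_monodromy_matrix m \<Psi> (conj_loop \<tau> l) M"
    if "loop_at (1/2) l" "is_monodromy_matrix m (\<Phi> 0) l M" for l M
  proof (rule C.monodromy_conj[OF \<tau>(1) _ _ _ \<Psi>(2) that(2)])
    show "pathfinish \<tau> = pathstart l" "path l" "pathfinish l = pathstart l"
      using \<tau>(4) that(1) unfolding loop_at_def by metis+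
  qed
  have "monodromy_group t0 m \<Psi> = generate (GL m) {h_0, h_inf}"
    using C.monodromy_group_transport[OF \<tau> \<Psi>(2)] C.monodromy_group_generated unfolding h0 K(2) by simp
  then have "solution_basis (R_bar \<gamma> n B) t0 m \<Psi> \<and> monodromy_group t0 m \<Psi> = generate (GL m) {h_0, h_inf} \<and>
      is_monodromy_matrix m \<Psi> (conj_loop \<tau> loop_0) h_0 \<and>
      is_monodromy_matrix m \<Psi> (conj_loop \<tau> loop_inf) h_inf \<and>
      is_monodromy_matrix m \<Psi> (conj_loop \<tau> loop_1) h_1"
    unfolding R_bar_hyp_op h0 h1 K(2)[symmetric]
    using \<Psi>(1) conj[OF C.loop_at_0 C.monodromy_loop_0] conj[OF C.loop_at_inf C.monodromy_loop_inf]
      conj[OF C.loop_at_1 C.monodromy_loop_1] by simp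
  moreover have "last_column_mat m (-1) (B_coeff \<gamma> n B) \<in> carrier (GL m)" unfolding K(1)[symmetric] by (rule C.T_GL)
  ultimately show ?thesis using int_0 int_inf by blast
qed

end
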